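(* Consider the diffusion model with constant coefficients $\mu(x)\equiv\mu>0$, $\sigma(x)\equiv\sigma>0$, and exponential ambiguity aggregation $\phi(x)=-\frac1\alpha e^{-\alpha x}$ with $\alpha>0$ satisfying $\alpha<\dfrac{\mu+\sqrt{\mu^2+2\sigma^2\underline r}}{\sigma^2}$. Let $k^*\in(0,\infty)$ be the unique root of $$G(k)=\int_0^\infty e^{-\alpha h(k,r)}\big(\mu-r\,h(k,r)\big)\,\mathrm dF_\rho(r)=0 .$$ Then the barrier-type law $\hat{\mathcal D}$ with barrier point $k^*$, i.e. $\mathcal{NT}=(0,k^* )$ and $\mathcal P=[k^*,\infty)$, is an equilibrium singular dividend law.
   Context: Notation: $\mathbb R_+=(0,\infty)$. For $r>0$, $\lambda_\pm(r)=\dfrac{-\mu\pm\sqrt{\mu^2+2\sigma^2r}}{\sigma^2}$ and $h(k,r)=\dfrac{e^{\lambda_+(r)k}-e^{\lambda_-(r)k}}{\lambda_+(r)e^{\lambda_+(r)k}-\lambda_-(r)e^{\lambda_-(r)k}}$. Under the stated condition on $\alpha$, $G$ has a unique root in $(0,\infty)$. $(\Omega,\mathcal F,\mathbb F,\mathbb P)$ is a filtered probability space satisfying the usual conditions and supporting a one-dimensional standard Brownian motion $W$. Model: a dividend strategy $D$ (cumulative dividends) started at time $t$ from surplus $x>0$ gives the surplus $\mathrm dX_s^D=\mu\,\mathrm ds+\sigma\,\mathrm dW_s-\mathrm dD_s$, $X^D_{t-}=x$, with ruin time $\tau^D=\inf\{s\ge t:X_s^D\le0\}$. $\mathbb E_{t,x}$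 is expectation conditional on $X_{t-}=x$. The discount rate is random, independent of the surplus, with distribution function $F_\rho$ on $[0,\infty)$, and (standing assumption) $\operatorname{Supp}(F_\rho)\subset[\underline r,\bar r]$ with $0<\underline r\le\bar r<\infty$. Set $Y^D(t;r)=\int_t^{\tau^D}e^{-r(s-t)}\mathrm dD_s$ (including a possible jump of $D$ at $t$; $Y^D(t;r)=0$ for $t\ge\tau^D$) and $J(t,x;D)=\int_0^\infty\phi(\mathbb E_{t,x}[Y^D(t;r)])\,\mathrm dF_\rho(r)$. Admissible strategies $\mathcal A(t,x)$: strategies $D=\{D_s\}_{s\ge t}$ that are $\mathbb F$-adapted, right-continuous, nondecreasing with $D_{t-}=0$; such that $X^D$ is well defined on $[t,\tau^D)$; $\Delta D_s=D_s-D_{s-}\le X^D_{s-}$ for $s\ge t$; $D_s=D_{\tau^D}$ for $s\ge\tau^D$; $\mathbb E_{t,x}[Y^D(t;r)]<\infty$ a.s. for $F_\rho$-a.e. $r>0$; and $J(t,x;D)<\infty$ a.s. Admissible singular dividend law: a partition $\mathcal D=(\mathcal{NT},\mathcal P)$ of $\mathbb R_+$ into an open no-transaction region $\mathcal{NT}$ and a closed pay region $\mathcal P$ such that for all $t\ge0$, $x>0$: (i) the Skorokhod reflection problem $\mathrm dX_s=\mu\,\mathrm ds+\sigma\,\mathrm dW_s-\mathrm dD_s$, $X_s\in\overline{\mathcal{NT}}$ for $s\in[t,\tau^D)$, $D_s=\int_t^{s\wedge\tau^D}\mathbf 1_{\{X_u\in\mathcal P\}}\mathrm dD_u$ for $s\ge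 t$, $D_{t-}=0$, $X_{t-}=x$, has a unique strong $\mathbb F$-adapted right-continuous solution $(X^{t,x,\mathcal D},D^{t,x,\mathcal D})$ ($D^{t,x,\mathcal D}$ is the strategy generated by $\mathcal D$); and (ii) $D^{t,x,\mathcal D}$ satisfies the two finiteness conditions in the definition of $\mathcal A(t,x)$. Write $J(t,x;\mathcal D)=J(t,x;D^{t,x,\mathcal D})$. Perturbations: for $(t,x)$ with $x>0$ and ruin not yet occurred by $t$, a perturbation process is $\delta\in\mathcal A(t,x)$, nondecreasing and right-continuous on $[t,\infty)$, for which there are a sufficiently small $\tilde\varepsilon>0$ and a constant $M>0$ independent of $\varepsilon$ with $\delta(t-)=0$, $\delta(t)\in[0,x]$, $\delta(t+\varepsilon)-\delta(t)\le M\varepsilon$ for all $\varepsilon\le\tilde\varepsilon$. Given a law $\mathcal D$ and the initial value $D_{t-}$, the perturbed strategy is $D_s^\varepsilon=D_{t-}+\int_t^{s\wedge\tau^\varepsilon}\mathrm d\delta(u)$ for $t\le s<(t+\varepsilon)\wedge\tau^\varepsilon$ (including the jump of $\delta$ at $t$), and $D_s^\varepsilon=D^\varepsilon_{(t+\varepsilon)-}+D_s^{t+\varepsilon,\,X_{((t+\varepsilon)-)\wedge\tau^\varepsilon},\,\mathcal D}$ for $s\ge(t+\varepsilon)\wedge\tau^\varepsilon$, where $\tau^\varepsilon=\tau^{D^\varepsilon}$. Equilibrium: an admissible singular dividend law $\hat{\mathcal D}$ is an equilibrium (singular) dividend law if for every $(t,x)$ with $x>0$ and ruin not yet occurred by $t$,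 and every perturbation process $\delta$ with corresponding perturbed strategies $D^\varepsilon$ (built from $\hat{\mathcal D}$), $\liminf_{\varepsilon\downarrow0}\frac{J(t,x;\hat{\mathcal D})-J(t,x;D^\varepsilon)}{\varepsilon}\ge0$. *)

theory Defs
  imports "HOL-Probability.Probability"
begin

definition left_limit :: "(real \<Rightarrow> real) \<Rightarrow> real \<Rightarrow> real" where
  "left_limit f s = Lim (at_left s) f"

definition right_continuous :: "(real \<Rightarrow> real) \<Rightarrow> bool" where
  "right_continuous f \<longleftrightarrow> (\<forall>s. continuous (at_right s) f)"

definition measure_support :: "real measure \<Rightarrow> real set" where
  "measure_support R = {r. \<forall>e>0. 0 < measure R {r - e<..<r + e}}"

definition lambda_plus :: "real \<Rightarrow> real \<Rightarrow> real \<Rightarrow> real" where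
  "lambda_plus \<mu> \<sigma> r = (- \<mu> + sqrt (\<mu>\<^sup>2 + 2 * \<sigma>\<^sup>2 * r)) / \<sigma>\<^sup>2"

definition lambda_minus :: "real \<Rightarrow> real \<Rightarrow> real \<Rightarrow> real" where
  "lambda_minus \<mu> \<sigma> r = (- \<mu> - sqrt (\<mu>\<^sup>2 + 2 * \<sigma>\<^sup>2 * r)) / \<sigma>\<^sup>2"

definition h_fun :: "real \<Rightarrow> real \<Rightarrow> real \<Rightarrow> real \<Rightarrow> real" where
  "h_fun \<mu> \<sigma> k r =
    (exp (lambda_plus \<mu> \<sigma> r * k) - exp (lambda_minus \<mu> \<sigma> r * k)) /
    (lambda_plus \<mu> \<sigma> r * exp (lambda_plus \<mu> \<sigma> r * k)
      - lambda_minus \<mu> \<sigma> r * exp (lambda_minus \<mu> \<sigma> r * k))"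

definition G_fun :: "real \<Rightarrow> real \<Rightarrow> real \<Rightarrow> real measure \<Rightarrow> real \<Rightarrow> real" where
  "G_fun \<mu> \<sigma> \<alpha> R k =
    (LINT r:{0..}|R. exp (- \<alpha> * h_fun \<mu> \<sigma> k r) * (\<mu> - r * h_fun \<mu> \<sigma> k r))"

text \<open>
  A filtered probability space satisfying the usual conditions, with a standard Brownian motion.
  The time index is \<^typ>\<open>real\<close>, but only times \<open>t \<ge> 0\<close> are constrained: a filtration
  on \<open>[0, \<infinity>)\<close> is extended to negative times by, for example, \<open>F t = F 0\<close>.
\<close>

locale brownian_space =
  prob_space M + complete_measure M + filtration "space M" F
  for M :: "'a measure" and F :: "real \<Rightarrow> 'a measure" +
  fixes W :: "real \<Rightarrow> 'a \<Rightarrow> real"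
  assumes subalgebra_F: "\<And>t. 0 \<le> t \<Longrightarrow> subalgebra M (F t)"
    and null_sets_F: "null_sets M \<subseteq> sets (F 0)"
    and right_continuous_F: "\<And>t. 0 \<le> t \<Longrightarrow> sets (F t) = (\<Inter>u\<in>{t<..}. sets (F u))"
    and W_adapted: "\<And>t. 0 \<le> t \<Longrightarrow> W t \<in> borel_measurable (F t)"
    and W_zero: "AE \<omega> in M. W 0 \<omega> = 0"
    and W_continuous: "AE \<omega> in M. continuous_on {0..} (\<lambda>t. W t \<omega>)"
    and W_normal: "\<And>s t. 0 \<le> s \<Longrightarrow> s < t \<Longrightarrow>
      distributed M lborel (\<lambda>\<omega>. W t \<omega> - W s \<omega>) (normal_density 0 (sqrt (t - s)))"
    and W_indep: "\<And>s t. 0 \<le> s \<Longrightarrow> s < t \<Longrightarrow>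
      indep_set (sets (F s)) {(\<lambda>\<omega>. W t \<omega> - W s \<omega>) -` B \<inter> space M | B. B \<in> sets borel}"

text \<open>
  The law of the discount rate is the measure \<open>R\<close>; its distribution function is
  \<open>cdf R\<close>, so that integrals against \<open>dF\<^sub>\<rho>\<close> are integrals with respect to \<open>R\<close>.
\<close>

locale dividend_model =
  brownian_space M F W + rate: real_distribution R
  for M :: "'a measure" and F :: "real \<Rightarrow> 'a measure" and W :: "real \<Rightarrow> 'a \<Rightarrow> real"
    and R :: "real measure" +
  fixes \<mu> \<sigma> :: real and \<phi> :: "real \<Rightarrow> real"
begin

text \<open>
  Processes started at time \<open>t\<close> are functions of all real times; their values strictly before
  \<open>t\<close> are constant and only serve to encode the left limit at \<open>t\<close>.  Thus a strategy \<open>D\<close>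
  has \<open>D s = D\<^bsub>t-\<^esub>\<close> for \<open>s < t\<close>, and the surplus, which solves
  \<open>dX = \<mu> ds + \<sigma> dW - dD\<close>, has \<open>X s = X\<^bsub>t-\<^esub> = \<xi>\<close> for \<open>s < t\<close>.
  The initial surplus \<open>\<xi>\<close> may be random, since strategies are restarted from a random state.
\<close>

definition surplus :: "real \<Rightarrow> ('a \<Rightarrow> real) \<Rightarrow> (real \<Rightarrow> 'a \<Rightarrow> real) \<Rightarrow> real \<Rightarrow> 'a \<Rightarrow> real" where
  "surplus t \<xi> D s \<omega> =
    (if s < t then \<xi> \<omega>
     else \<xi> \<omega> + \<mu> * (s - t) + \<sigma> * (W s \<omega> - W t \<omega>) - (D s \<omega> - left_limit (\<lambda>u. D u \<omega>) t))"

definition ruin_time :: "real \<Rightarrow> (real \<Rightarrow> 'a \<Rightarrow> real) \<Rightarrow> 'a \<Rightarrow> ereal" where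
  "ruin_time t X \<omega> = Inf (ereal ` {s. t \<le> s \<and> X s \<omega> \<le> 0})"

definition stieltjes :: "(real \<Rightarrow> 'a \<Rightarrow> real) \<Rightarrow> 'a \<Rightarrow> real measure" where
  "stieltjes D \<omega> = interval_measure (\<lambda>s. D s \<omega>)"

text \<open>
  Discounted dividends up to and including ruin.  Both end points count: the atom of \<open>dD\<close> at
  \<open>t\<close> is the initial lump sum, and a lump sum may itself cause ruin.
\<close>

definition payoff :: "real \<Rightarrow> real \<Rightarrow> (real \<Rightarrow> 'a \<Rightarrow> real) \<Rightarrow> real \<Rightarrow> 'a \<Rightarrow> ennreal" where
  "payoff t x D r \<omega> =
    (\<integral>\<^sup>+ s \<in> {s. t \<le> s \<and> ereal s \<le> ruin_time t (surplus t (\<lambda>_. x) D) \<omega>}.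
       ennreal (exp (- r * (s - t))) \<partial>stieltjes D \<omega>)"

definition expected_payoff :: "real \<Rightarrow> real \<Rightarrow> (real \<Rightarrow> 'a \<Rightarrow> real) \<Rightarrow> real \<Rightarrow> ennreal" where
  "expected_payoff t x D r = (\<integral>\<^sup>+ \<omega>. payoff t x D r \<omega> \<partial>M)"

definition J :: "real \<Rightarrow> real \<Rightarrow> (real \<Rightarrow> 'a \<Rightarrow> real) \<Rightarrow> real" where
  "J t x D = (LINT r:{0..}|R. \<phi> (enn2real (expected_payoff t x D r)))"

text \<open>The second condition says that the integral defining \<open>J\<close> is finite.\<close>

definition finite_reward :: "real \<Rightarrow> real \<Rightarrow> (real \<Rightarrow> 'a \<Rightarrow> real) \<Rightarrow> bool" where
  "finite_reward t x D \<longleftrightarrow>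
    (AE r in R. 0 < r \<longrightarrow> expected_payoff t x D r < \<infinity>) \<and>
    set_integrable R {0..} (\<lambda>r. \<phi> (enn2real (expected_payoff t x D r)))"

definition dividend_process :: "real \<Rightarrow> (real \<Rightarrow> 'a \<Rightarrow> real) \<Rightarrow> bool" where
  "dividend_process t D \<longleftrightarrow>
    (\<forall>s\<ge>t. D s \<in> borel_measurable (F s)) \<and>
    (AE \<omega> in M. (\<forall>s<t. D s \<omega> = 0) \<and> mono (\<lambda>s. D s \<omega>) \<and> right_continuous (\<lambda>s. D s \<omega>))"

text \<open>
  The bound on the jumps is imposed up to ruin, where the controlled surplus lives; afterwards
  \<open>D\<close> is constant.  Well-posedness of the surplus equation is automatic, because the
  coefficients are constant.
\<close>

definition admissible :: "real \<Rightarrow> real \<Rightarrow> (real \<Rightarrow> 'a \<Rightarrow> real) \<Rightarrow> bool" where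
  "admissible t x D \<longleftrightarrow>
    dividend_process t D \<and>
    (AE \<omega> in M.
      let X = surplus t (\<lambda>_. x) D; \<tau> = ruin_time t X \<omega> in
        (\<forall>s\<ge>t. ereal s \<le> \<tau> \<longrightarrow>
          D s \<omega> - left_limit (\<lambda>u. D u \<omega>) s \<le> left_limit (\<lambda>u. X u \<omega>) s) \<and>
        (\<forall>s. \<tau> \<le> ereal s \<longrightarrow> D s \<omega> = D (real_of_ereal \<tau>) \<omega>)) \<and>
    finite_reward t x D"

text \<open>
  Strong solutions of the Skorokhod reflection problem.  Starting points \<open>\<xi> \<omega> \<le> 0\<close>
  (ruined states) are harmless: there ruin occurs at \<open>t\<close>, and the last condition forces
  \<open>D = 0\<close> because \<open>P\<close> consists of positive numbers.
\<close>

definition skorokhod_solution ::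
  "real \<Rightarrow> ('a \<Rightarrow> real) \<Rightarrow> real set \<Rightarrow> real set \<Rightarrow>
    (real \<Rightarrow> 'a \<Rightarrow> real) \<Rightarrow> (real \<Rightarrow> 'a \<Rightarrow> real) \<Rightarrow> bool" where
  "skorokhod_solution t \<xi> NT P X D \<longleftrightarrow>
    dividend_process t D \<and>
    (\<forall>s\<ge>t. X s \<in> borel_measurable (F s)) \<and>
    (AE \<omega> in M. right_continuous (\<lambda>s. X s \<omega>) \<and>
      (\<forall>s. X s \<omega> = surplus t \<xi> D s \<omega>) \<and>
      (\<forall>s\<ge>t. ereal s < ruin_time t X \<omega> \<longrightarrow> X s \<omega> \<in> closure NT) \<and>
      (\<forall>s\<ge>t. ennreal (D s \<omega>) =
        (\<integral>\<^sup>+ u \<in> {u. t \<le> u \<and> u \<le> s \<and> ereal u \<le> ruin_time t X \<omega>}.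
           indicator P (X u \<omega>) \<partial>stieltjes D \<omega>)))"

definition uniquely_solvable :: "real \<Rightarrow> real \<Rightarrow> real set \<Rightarrow> real set \<Rightarrow> bool" where
  "uniquely_solvable t x NT P \<longleftrightarrow>
    (\<exists>X D. skorokhod_solution t (\<lambda>_. x) NT P X D) \<and>
    (\<forall>X D X' D'. skorokhod_solution t (\<lambda>_. x) NT P X D \<longrightarrow>
       skorokhod_solution t (\<lambda>_. x) NT P X' D' \<longrightarrow>
       (AE \<omega> in M. \<forall>s\<ge>t. X s \<omega> = X' s \<omega> \<and> D s \<omega> = D' s \<omega>))"

text \<open>The strategy generated by a law; it is determined up to indistinguishability.\<close>

definition law_strategy :: "real \<Rightarrow> real \<Rightarrow> real set \<Rightarrow> real set \<Rightarrow> real \<Rightarrow> 'a \<Rightarrow> real" where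
  "law_strategy t x NT P = (SOME D. \<exists>X. skorokhod_solution t (\<lambda>_. x) NT P X D)"

definition admissible_law :: "real set \<Rightarrow> real set \<Rightarrow> bool" where
  "admissible_law NT P \<longleftrightarrow>
    NT \<union> P = {0<..} \<and> NT \<inter> P = {} \<and>
    openin (top_of_set {0<..}) NT \<and> closedin (top_of_set {0<..}) P \<and>
    (\<forall>t\<ge>0. \<forall>x>0. uniquely_solvable t x NT P \<and> finite_reward t x (law_strategy t x NT P))"

definition perturbation :: "real \<Rightarrow> real \<Rightarrow> (real \<Rightarrow> 'a \<Rightarrow> real) \<Rightarrow> bool" where
  "perturbation t x \<delta> \<longleftrightarrow>
    admissible t x \<delta> \<and>
    (\<exists>\<epsilon>\<^sub>0>0. \<exists>K>0. AE \<omega> in M.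
      0 \<le> \<delta> t \<omega> \<and> \<delta> t \<omega> \<le> x \<and> (\<forall>\<epsilon>. 0 < \<epsilon> \<and> \<epsilon> \<le> \<epsilon>\<^sub>0 \<longrightarrow> \<delta> (t + \<epsilon>) \<omega> - \<delta> t \<omega> \<le> K * \<epsilon>))"

text \<open>
  \<open>D\<close> follows \<open>\<delta>\<close>, stopped at the ruin time of \<open>D\<close>, on \<open>[t, t + \<epsilon>)\<close>; from
  \<open>t + \<epsilon>\<close> on it adds the strategy generated by the law from the surplus reached just before
  \<open>t + \<epsilon>\<close> (or from the surplus at ruin, in which case that strategy is \<open>0\<close>).  Generated
  strategies are only unique up to null sets depending on the deterministic starting point, so the
  restart from a random state is expressed through the reflection problem with random initial
  value.  As \<open>\<delta>\<close> vanishes before \<open>t\<close>, \<open>\<delta> v\<close> is the integral of \<open>d\<delta>\<close>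
  over \<open>[t, v]\<close>.  The argument \<open>d\<close> is the initial value \<open>D\<^bsub>t-\<^esub>\<close>.
\<close>

definition perturbed_strategy ::
  "real \<Rightarrow> real \<Rightarrow> ('a \<Rightarrow> real) \<Rightarrow> real set \<Rightarrow> real set \<Rightarrow> (real \<Rightarrow> 'a \<Rightarrow> real) \<Rightarrow>
    real \<Rightarrow> (real \<Rightarrow> 'a \<Rightarrow> real) \<Rightarrow> bool" where
  "perturbed_strategy t x d NT P \<delta> \<epsilon> D \<longleftrightarrow>
    (let X = surplus t (\<lambda>_. x) D;
         \<tau> = ruin_time t X;
         \<xi> = (\<lambda>\<omega>. if \<tau> \<omega> < ereal (t + \<epsilon>) then X (real_of_ereal (\<tau> \<omega>)) \<omega>
                   else left_limit (\<lambda>u. X u \<omega>) (t + \<epsilon>))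
     in \<exists>X' D'. skorokhod_solution (t + \<epsilon>) \<xi> NT P X' D' \<and>
       (AE \<omega> in M.
         (\<forall>s<t. D s \<omega> = d \<omega>) \<and>
         (\<forall>s. t \<le> s \<and> s < t + \<epsilon> \<longrightarrow>
           D s \<omega> = d \<omega> + \<delta> (real_of_ereal (min (ereal s) (\<tau> \<omega>))) \<omega>) \<and>
         (\<forall>s\<ge>t + \<epsilon>. D s \<omega> = left_limit (\<lambda>u. D u \<omega>) (t + \<epsilon>) + D' s \<omega>)))"

definition equilibrium_law :: "real set \<Rightarrow> real set \<Rightarrow> bool" where
  "equilibrium_law NT P \<longleftrightarrow>
    admissible_law NT P \<and>
    (\<forall>t\<ge>0. \<forall>x>0. \<forall>\<delta> d D\<epsilon>.
      perturbation t x \<delta> \<longrightarrow> d \<in> borel_measurable (F t) \<longrightarrow>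
      (\<forall>\<epsilon>>0. perturbed_strategy t x d NT P \<delta> \<epsilon> (D\<epsilon> \<epsilon>)) \<longrightarrow>
      Liminf (at_right 0)
        (\<lambda>\<epsilon>. ereal ((J t x (law_strategy t x NT P) - J t x (D\<epsilon> \<epsilon>)) / \<epsilon>)) \<ge> 0)"

end

end

theory Submission
  imports Defs
begin

text \<open>
  Let \<open>V r z\<close> be the expected payoff, at discount rate \<open>r\<close>, of the barrier strategy from surplus
  \<open>z\<close>.  It is \<open>0\<close> for \<open>z \<le> 0\<close>; on \<open>[0, k]\<close> it is the solution of
  \<open>\<sigma>\<^sup>2/2 v'' + \<mu> v' = r v\<close> with \<open>v(0) = 0\<close> and \<open>v'(k) = 1\<close>; above \<open>k\<close> it has slope \<open>1\<close>, since the
  excess is paid out at once.  In particular \<open>V r k\<close> is the function \<open>h(k, r)\<close>, and the equation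
  gives \<open>\<sigma>\<^sup>2/2 v''(k) = r h(k, r) - \<mu>\<close>.  So \<open>G(k) = 0\<close> says that the curvature \<open>v''(k)\<close> of the value
  functions at the barrier has mean zero over the rates, when each rate is weighted by its marginal
  utility \<open>exp (- \<alpha> h(k, r))\<close>.

  A deviation pays a lump sum \<open>a\<close> and then at most \<open>K \<epsilon>\<close> until \<open>t + \<epsilon>\<close>.  By concavity of \<open>\<phi>\<close> its
  gain is at most the average of its linear gains \<open>U r - V r x\<close> with weights
  \<open>w r = exp (- \<alpha> V r x)\<close>, where \<open>U r\<close> is its expected payoff at rate \<open>r\<close>.  Up to a mean zero
  increment and an error of expectation \<open>O(\<epsilon>\<^bsup>3/2\<^esup>)\<close>, the gain on each path is at most
  \<open>c v''(k)\<close>, with a coefficient \<open>c\<close> that may depend on the path but not on the rate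
  (\<open>one_step_estimate\<close>).  This is where the shape of \<open>v\<close> enters: \<open>v' - 1\<close> lies above its tangent
  \<open>v''(k) (z - k)\<close> at the barrier, because \<open>v''' > 0\<close>; hence the
  gains from paying too early, from paying too late and from waiting are all bounded by multiples of
  \<open>v''(k)\<close> to leading order.

  It remains to control the sign of the weighted mean \<open>S x\<close> of \<open>v''(k)\<close> with weights \<open>w r\<close>.  For
  \<open>x \<ge> k\<close> the weights are proportional to those at the barrier, so \<open>S x = 0\<close>.  For \<open>x < k\<close> one has
  \<open>c \<ge> 0\<close>, and \<open>S x \<le> 0\<close>: a Wronskian argument shows that \<open>v''(k)\<close> increases with the rate while
  \<open>V r k - V r x\<close> decreases, so passing from the weights at \<open>k\<close> to those at \<open>x\<close> moves mass to the rates
  at which \<open>v''(k)\<close> is small (\<open>integral_association_nonpos\<close>).  Every deviation thus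
  gains at most \<open>O(\<epsilon>\<^bsup>3/2\<^esup>)\<close>, which is \<open>o(\<epsilon>)\<close>.

  The probabilistic half identifies \<open>V\<close> with the payoff of the law.  Pathwise, a solution of the
  reflection problem is a continuous path that is pushed down only at \<open>k\<close> and stops at ruin; this
  yields existence and uniqueness through the running maximum.  For the payoff, no stochastic
  integral is needed: \<open>exp (- r s) v (X s)\<close> is telescoped along a grid.  The free increments have
  mean zero, because \<open>exp (l (\<mu> s + \<sigma> W s) - r s)\<close> is a martingale for both roots \<open>l\<close> of the characteristic
  equation, and the reflection contributes \<open>- exp (- r s) v'(k) dD\<close> in the limit, with \<open>v'(k) = 1\<close>.
  Dominated convergence, with an exponential moment of the running maximum of \<open>W\<close>, gives
  \<open>expected_reflection_dividends\<close>.
\<close>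

section \<open>Value functions of a barrier strategy\<close>

lemma exI_deriv:
  assumes "(f has_real_derivative d) (at (y::real))" "P d"
  shows "\<exists>d. (f has_real_derivative d) (at y) \<and> P d"
  using assms by blast

lemma second_order_coeff:
  fixes s a m b d :: real
  assumes "0 < s" "s / 2 * a + m * b = d"
  shows "a = 2 / s * d - 2 * m / s * b"
proof -
  have "2 / s * d - 2 * m / s * b = 2 / s * (s / 2 * a)"
    unfolding assms(2)[symmetric] by (simp add: distrib_left)
  then show ?thesis using assms(1) by simp
qed

lemma nonneg_of_deriv_sign:
  fixes f f' :: "real \<Rightarrow> real"
  assumes "\<And>z. (f has_real_derivative f' z) (at z)" "0 \<le> f k"
    and "\<And>z. z \<le> k \<Longrightarrow> f' z \<le> 0" "\<And>z. k \<le> z \<Longrightarrow> 0 \<le> f' z"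
  shows "0 \<le> f z"
proof (cases "z \<le> k")
  case True
  have "f k \<le> f z"
    by (rule DERIV_nonpos_imp_nonincreasing[OF True]) (use assms in blast)
  then show ?thesis using assms(2) by linarith
next
  case False
  have "f k \<le> f z"
    by (rule DERIV_nonneg_imp_nondecreasing[of k z f]) (use assms False in auto)
  then show ?thesis using assms(2) by linarith
qed

locale barrier =
  fixes \<mu> \<sigma> k :: real
  assumes mu_pos: "0 < \<mu>" and sigma_pos: "0 < \<sigma>" and k_pos: "0 < k"
begin

abbreviation lp :: "real \<Rightarrow> real" where "lp \<equiv> lambda_plus \<mu> \<sigma>"
abbreviation lm :: "real \<Rightarrow> real" where "lm \<equiv> lambda_minus \<mu> \<sigma>"

definition den :: "real \<Rightarrow> real" where
  "den r = lp r * exp (lp r * k) - lm r * exp (lm r * k)"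

text \<open>
  The function \<open>v 0 r\<close> solves \<open>\<sigma>\<^sup>2/2 v'' + \<mu> v' = r v\<close> with \<open>v(0) = 0\<close> and \<open>v'(k) = 1\<close>; \<open>v n r\<close> is
  its \<open>n\<close>-th derivative.  It is defined on all of \<open>\<real>\<close>, so that it can be compared with the payoff of
  the strategy beyond the barrier and below ruin.
\<close>

definition v :: "nat \<Rightarrow> real \<Rightarrow> real \<Rightarrow> real" where
  "v n r z = (lp r ^ n * exp (lp r * z) - lm r ^ n * exp (lm r * z)) / den r"

lemma sqrt_gt: assumes "0 < r" shows "\<mu> < sqrt (\<mu>\<^sup>2 + 2 * \<sigma>\<^sup>2 * r)"
proof -
  have "\<mu>\<^sup>2 < \<mu>\<^sup>2 + 2 * \<sigma>\<^sup>2 * r" using assms sigma_pos by simp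
  then have "sqrt (\<mu>\<^sup>2) < sqrt (\<mu>\<^sup>2 + 2 * \<sigma>\<^sup>2 * r)" by (rule real_sqrt_less_mono)
  then show ?thesis using mu_pos by simp
qed

lemma lp_pos: "0 < r \<Longrightarrow> 0 < lp r"
  using sqrt_gt[of r] sigma_pos by (simp add: lambda_plus_def)

lemma lm_le: "0 < r \<Longrightarrow> lm r \<le> - 2 * \<mu> / \<sigma>\<^sup>2"
  using sqrt_gt[of r] sigma_pos by (simp add: lambda_minus_def divide_simps)

lemma lm_neg: assumes "0 < r" shows "lm r < 0"
proof -
  have "0 < 2 * \<mu> / \<sigma>\<^sup>2" using mu_pos sigma_pos by simp
  then show ?thesis using lm_le[OF assms] by linarith
qed

lemma root_char:
  assumes "0 < r"
  shows "\<sigma>\<^sup>2 / 2 * (lp r)\<^sup>2 + \<mu> * lp r = r" "\<sigma>\<^sup>2 / 2 * (lm r)\<^sup>2 + \<mu> * lm r = r"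
proof -
  define q where "q = sqrt (\<mu>\<^sup>2 + 2 * \<sigma>\<^sup>2 * r)"
  have q: "q\<^sup>2 = \<mu>\<^sup>2 + 2 * \<sigma>\<^sup>2 * r"
    unfolding q_def using assms by (intro real_sqrt_pow2) simp
  have s: "\<sigma> \<noteq> 0" using sigma_pos by simp
  have l: "lp r = (- \<mu> + q) / \<sigma>\<^sup>2" "lm r = (- \<mu> - q) / \<sigma>\<^sup>2"
    by (simp_all add: lambda_plus_def lambda_minus_def q_def)
  have "\<sigma>\<^sup>2 / 2 * (lp r)\<^sup>2 + \<mu> * lp r = (q\<^sup>2 - \<mu>\<^sup>2) / (2 * \<sigma>\<^sup>2)"
    unfolding l using s by (simp add: field_simps power2_eq_square)
  then show "\<sigma>\<^sup>2 / 2 * (lp r)\<^sup>2 + \<mu> * lp r = r" using s by (simp add: q)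
  have "\<sigma>\<^sup>2 / 2 * (lm r)\<^sup>2 + \<mu> * lm r = (q\<^sup>2 - \<mu>\<^sup>2) / (2 * \<sigma>\<^sup>2)"
    unfolding l using s by (simp add: field_simps power2_eq_square)
  then show "\<sigma>\<^sup>2 / 2 * (lm r)\<^sup>2 + \<mu> * lm r = r" using s by (simp add: q)
qed

lemma den_pos: "0 < r \<Longrightarrow> 0 < den r"
  unfolding den_def using lp_pos[of r] lm_neg[of r]
  by (smt (verit) exp_gt_zero mult_pos_pos mult_neg_pos)

lemma v_deriv: "(v n r has_real_derivative v (Suc n) r z) (at z)"
  unfolding v_def[abs_def] divide_inverse
  by (auto intro!: derivative_eq_intros simp: algebra_simps)

lemma v_deriv_numerals:
  "(v 0 r has_real_derivative v (Suc 0) r z) (at z)"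
  "(v (Suc 0) r has_real_derivative v 2 r z) (at z)"
  "(v 2 r has_real_derivative v 3 r z) (at z)"
  using v_deriv[of 0 r z] v_deriv[of "Suc 0" r z] v_deriv[of 2 r z]
  by (simp_all only: Suc_1 [symmetric] One_nat_def numeral_3_eq_3 numeral_2_eq_2)

lemma v_ode:
  assumes "0 < r" shows "\<sigma>\<^sup>2 / 2 * v (Suc (Suc n)) r z + \<mu> * v (Suc n) r z = r * v n r z"
proof -
  have "\<sigma>\<^sup>2 / 2 * v (Suc (Suc n)) r z + \<mu> * v (Suc n) r z =
     ((\<sigma>\<^sup>2 / 2 * (lp r)\<^sup>2 + \<mu> * lp r) * (lp r ^ n * exp (lp r * z))
     - (\<sigma>\<^sup>2 / 2 * (lm r)\<^sup>2 + \<mu> * lm r) * (lm r ^ n * exp (lm r * z))) / den r"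
    unfolding v_def by (simp add: add_divide_distrib diff_divide_distrib algebra_simps power2_eq_square)
  also have "\<dots> = r * v n r z"
    unfolding root_char[OF assms] v_def by (simp add: algebra_simps diff_divide_distrib)
  finally show ?thesis .
qed

lemma v_0_0: "v 0 r 0 = 0" by (simp add: v_def)

lemma v_0_k: "v 0 r k = h_fun \<mu> \<sigma> k r" by (simp add: v_def h_fun_def den_def)

text \<open>
  Smooth fit: at the barrier a unit of surplus is worth a unit of dividends.
\<close>

lemma v_1_k: "0 < r \<Longrightarrow> v (Suc 0) r k = 1"
  using den_pos[of r] by (simp add: v_def den_def)

lemma v_1_pos: assumes "0 < r" shows "0 < v (Suc 0) r z"
proof -
  have "0 < lp r * exp (lp r * z)" "lm r * exp (lm r * z) < 0"
    using lp_pos[OF assms] lm_neg[OF assms] by (simp_all add: mult_neg_pos)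
  then show ?thesis unfolding v_def using den_pos[OF assms] by (intro divide_pos_pos) auto
qed

text \<open>
  The coefficients of \<open>v'''\<close> in both exponentials are positive, because \<open>lm r < 0\<close>.  The term kept
  here has a lower bound that is uniform over bounded ranges of \<open>r\<close> and \<open>z\<close>.
\<close>

lemma v_3_ge: assumes "0 < r" shows "(- lm r) ^ 3 * exp (lm r * z) / den r \<le> v 3 r z"
  unfolding v_def using den_pos[OF assms] lp_pos[OF assms]
  by (intro divide_right_mono) auto

lemma v_3_pos: assumes "0 < r" shows "0 < v 3 r z"
proof -
  have "0 < (- lm r) ^ 3 * exp (lm r * z) / den r"
    using den_pos[OF assms] lm_neg[OF assms] by (intro divide_pos_pos mult_pos_pos zero_less_power) auto
  then show ?thesis using v_3_ge[OF assms, of z] by linarith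
qed

text \<open>
  The link with \<open>G\<close>: its integrand is a negative multiple of the curvature at the barrier.
\<close>

lemma v_2_k: assumes "0 < r" shows "\<sigma>\<^sup>2 / 2 * v 2 r k = r * h_fun \<mu> \<sigma> k r - \<mu>"
proof -
  have "\<sigma>\<^sup>2 / 2 * v (Suc (Suc 0)) r k + \<mu> * v (Suc 0) r k = r * v 0 r k"
    by (rule v_ode[OF assms])
  then show ?thesis unfolding v_1_k[OF assms] v_0_k numeral_2_eq_2[symmetric] by linarith
qed

lemma v_2_mono: assumes "0 < r" "y \<le> z" shows "v 2 r y \<le> v 2 r z"
  by (rule DERIV_nonneg_imp_nondecreasing[OF assms(2)])
     (use v_deriv_numerals v_3_pos[OF assms(1)] in \<open>blast intro: less_imp_le\<close>)

lemma v_0_mono: assumes "0 < r" "y \<le> z" shows "v 0 r y \<le> v 0 r z"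
  by (rule DERIV_nonneg_imp_nondecreasing[OF assms(2)])
     (use v_deriv_numerals v_1_pos[OF assms(1)] in \<open>blast intro: less_imp_le\<close>)

lemma v_0_nonneg: "0 < r \<Longrightarrow> 0 \<le> z \<Longrightarrow> 0 \<le> v 0 r z"
  using v_0_mono[of r 0 z] by (simp add: v_0_0)

text \<open>
  Since \<open>v''' > 0\<close>, the slope \<open>v'\<close> is convex and lies above its tangent at \<open>k\<close>.
\<close>

lemma v_1_tangent:
  assumes "0 < r" shows "1 + v 2 r k * (z - k) \<le> v (Suc 0) r z"
proof -
  let ?f = "\<lambda>z. v (Suc 0) r z - (1 + v 2 r k * (z - k))"
  have "0 \<le> ?f z"
  proof (rule nonneg_of_deriv_sign[where f = ?f and k = k and f' = "\<lambda>z. v 2 r z - v 2 r k"])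
    show "(?f has_real_derivative v 2 r z - v 2 r k) (at z)" for z
      by (auto intro!: derivative_eq_intros v_deriv_numerals[THEN DERIV_cong] simp: field_simps)
  qed (use v_1_k v_2_mono assms in auto)
  then show ?thesis by linarith
qed

text \<open>
  The tangent bound for \<open>v'\<close>, integrated from \<open>k\<close> to \<open>z\<close>.
\<close>

lemma v_0_above:
  assumes "0 < r" "k \<le> z"
  shows "v 0 r k + (z - k) + v 2 r k / 2 * (z - k)\<^sup>2 \<le> v 0 r z"
proof -
  let ?f = "\<lambda>z. v 0 r z - (v 0 r k + (z - k) + v 2 r k / 2 * (z - k)\<^sup>2)"
  have "?f k \<le> ?f z"
  proof (rule DERIV_nonneg_imp_nondecreasing[OF assms(2)])
    fix y assume "k \<le> y"
    have d: "(?f has_real_derivative v (Suc 0) r y - (1 + v 2 r k * (y - k))) (at y)"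
      by (auto intro!: derivative_eq_intros v_deriv_numerals[THEN DERIV_cong] simp: field_simps)
    show "\<exists>d. (?f has_real_derivative d) (at y) \<and> 0 \<le> d"
      by (rule exI_deriv[OF d]) (use v_1_tangent[OF assms(1), of y] in linarith)
  qed
  then show ?thesis by simp
qed

text \<open>
  Taylor expansion at the barrier.  The quadratic term is a multiple of \<open>v 2 r k\<close>, and the cubic
  remainder has a sign; it will make large lump sums strictly unprofitable.
\<close>

lemma v_0_gap:
  assumes r: "0 < r" and yx: "y \<le> x" "x \<le> k" and m: "0 \<le> m" "\<And>z. y \<le> z \<Longrightarrow> z \<le> k \<Longrightarrow> m \<le> v 3 r z"
  shows "(x - y) - v 2 r k / 2 * ((k - y)\<^sup>2 - (k - x)\<^sup>2) + m / 6 * ((k - y) ^ 3 - (k - x) ^ 3)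
    \<le> v 0 r x - v 0 r y"
proof -
  have v2: "v 2 r z \<le> v 2 r k - m * (k - z)" if "y \<le> z" "z \<le> k" for z
  proof -
    have "v 2 r z - m * z \<le> v 2 r k - m * k"
    proof (rule DERIV_nonneg_imp_nondecreasing[OF that(2)])
      fix w assume w: "z \<le> w" "w \<le> k"
      have d: "((\<lambda>z. v 2 r z - m * z) has_real_derivative v 3 r w - m) (at w)"
        by (auto intro!: derivative_eq_intros v_deriv_numerals[THEN DERIV_cong] simp: field_simps)
      show "\<exists>d. ((\<lambda>z. v 2 r z - m * z) has_real_derivative d) (at w) \<and> 0 \<le> d"
        by (rule exI_deriv[OF d]) (use m(2)[of w] w that  in auto)
    qed
    then show ?thesis by (simp add: algebra_simps)
  qed
  have v1: "1 + v 2 r k * (z - k) + m / 2 * (k - z)\<^sup>2 \<le> v (Suc 0) r z" if "y \<le> z" "z \<le> k" for z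
  proof -
    let ?g = "\<lambda>z. v (Suc 0) r z - (1 + v 2 r k * (z - k) + m / 2 * (k - z)\<^sup>2)"
    have "?g k \<le> ?g z"
    proof (rule DERIV_nonpos_imp_nonincreasing[OF that(2)])
      fix w assume w: "z \<le> w" "w \<le> k"
      have d: "(?g has_real_derivative v 2 r w - (v 2 r k - m * (k - w))) (at w)"
        by (auto intro!: derivative_eq_intros v_deriv_numerals[THEN DERIV_cong] simp: field_simps)
      show "\<exists>d. (?g has_real_derivative d) (at w) \<and> d \<le> 0"
        by (rule exI_deriv[OF d]) (use v2[of w] w that  in auto)
    qed
    then show ?thesis using v_1_k[OF r] by simp
  qed
  let ?f = "\<lambda>z. v 0 r z - z - v 2 r k / 2 * (k - z)\<^sup>2 + m / 6 * (k - z) ^ 3"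
  have "?f y \<le> ?f x"
  proof (rule DERIV_nonneg_imp_nondecreasing[OF yx(1)])
    fix w assume w: "y \<le> w" "w \<le> x"
    have d: "(?f has_real_derivative v (Suc 0) r w - (1 + v 2 r k * (w - k) + m / 2 * (k - w)\<^sup>2)) (at w)"
      by (auto intro!: derivative_eq_intros v_deriv_numerals[THEN DERIV_cong] simp: field_simps)
    show "\<exists>d. (?f has_real_derivative d) (at w) \<and> 0 \<le> d"
      by (rule exI_deriv[OF d]) (use v1[of w] w yx in auto)
  qed
  then show ?thesis by (simp add: algebra_simps)
qed

text \<open>
  Write \<open>\<Delta>\<close> for the left side minus the right side and \<open>\<kappa> = 2 \<mu> / \<sigma>\<^sup>2\<close>.  The differentiated equation
  gives \<open>(exp (\<kappa> z) \<Delta>)' = 2 / \<sigma>\<^sup>2 (r1 - r2) exp (\<kappa> z) v1' v2' \<le> 0\<close>, and \<open>\<Delta>\<close> vanishes at \<open>0\<close>, where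
  \<open>v'' = - \<kappa> v'\<close> for both rates because \<open>v(0) = 0\<close>.
\<close>

lemma wronskian:
  assumes r: "0 < r1" "r1 \<le> r2" and z: "0 \<le> z"
  shows "v 2 r1 z * v (Suc 0) r2 z \<le> v (Suc 0) r1 z * v 2 r2 z"
proof -
  define \<kappa> where "\<kappa> = 2 * \<mu> / \<sigma>\<^sup>2"
  let ?f = "\<lambda>z. exp (\<kappa> * z) * (v 2 r1 z * v (Suc 0) r2 z - v (Suc 0) r1 z * v 2 r2 z)"
  have r2: "0 < r2" using r by linarith
  have eq3: "v 3 r y = 2 / \<sigma>\<^sup>2 * r * v (Suc 0) r y - \<kappa> * v 2 r y" if "0 < r" for r y
  proof -
    have "\<sigma>\<^sup>2 / 2 * v 3 r y + \<mu> * v 2 r y = r * v (Suc 0) r y"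
      using v_ode[OF that, of "Suc 0" y] by (simp only: numeral_3_eq_3 numeral_2_eq_2)
    from second_order_coeff[OF _ this] show ?thesis
      using sigma_pos by (simp add: \<kappa>_def)
  qed
  have eq0: "v 2 r 0 = - \<kappa> * v (Suc 0) r 0" if "0 < r" for r
  proof -
    have "\<sigma>\<^sup>2 / 2 * v 2 r 0 + \<mu> * v (Suc 0) r 0 = 0"
      using v_ode[OF that, of 0 0] unfolding v_0_0 by (simp only: numeral_2_eq_2)
    from second_order_coeff[OF _ this] show ?thesis
      using sigma_pos by (simp add: \<kappa>_def)
  qed
  have "?f z \<le> ?f 0"
  proof (rule DERIV_nonpos_imp_nonincreasing[OF z])
    fix y
    define w where "w = \<kappa> * (v 2 r1 y * v (Suc 0) r2 y - v (Suc 0) r1 y * v 2 r2 y)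
       + v 3 r1 y * v (Suc 0) r2 y - v (Suc 0) r1 y * v 3 r2 y"
    have d: "(?f has_real_derivative exp (\<kappa> * y) * w) (at y)"
    proof (rule DERIV_cong[OF DERIV_mult[OF _ DERIV_diff[OF
            DERIV_mult[OF v_deriv_numerals(3) v_deriv_numerals(2)]
            DERIV_mult[OF v_deriv_numerals(2) v_deriv_numerals(3)]]]])
      show "((\<lambda>z. exp (\<kappa> * z)) has_real_derivative \<kappa> * exp (\<kappa> * y)) (at y)"
        by (auto intro!: derivative_eq_intros)
    qed (simp only: w_def algebra_simps)
    have w: "w = 2 / \<sigma>\<^sup>2 * (v (Suc 0) r1 y * v (Suc 0) r2 y) * (r1 - r2)"
      unfolding w_def eq3[OF r(1), of y] eq3[OF r2, of y] by (simp only: algebra_simps)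
    show "\<exists>d. (?f has_real_derivative d) (at y) \<and> d \<le> 0"
    proof (rule exI_deriv[OF d], unfold w, intro mult_nonneg_nonpos mult_nonneg_nonneg)
      show "0 \<le> v (Suc 0) r1 y" "0 \<le> v (Suc 0) r2 y"
        using v_1_pos[OF r(1), of y] v_1_pos[OF r2, of y] by linarith+
    qed (use r in simp_all)
  qed
  also have "?f 0 = 0" using eq0[OF r(1)] eq0[OF r2] by simp
  finally show ?thesis by (simp add: mult_le_0_iff)
qed

lemma v_2_k_mono: "0 < r1 \<Longrightarrow> r1 \<le> r2 \<Longrightarrow> v 2 r1 k \<le> v 2 r2 k"
  using wronskian[of r1 r2 k] k_pos v_1_k[of r1] v_1_k[of r2] by simp

text \<open>
  The Wronskian inequality says that the quotient of the slopes is monotone, and the slopes agree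
  at \<open>k\<close>.
\<close>

lemma v_1_antimono:
  assumes r: "0 < r1" "r1 \<le> r2" and z: "0 \<le> z" "z \<le> k"
  shows "v (Suc 0) r2 z \<le> v (Suc 0) r1 z"
proof -
  have r2: "0 < r2" using r by linarith
  let ?q = "\<lambda>z. v (Suc 0) r1 z / v (Suc 0) r2 z"
  have "?q k \<le> ?q z"
  proof (rule DERIV_nonpos_imp_nonincreasing[OF z(2)])
    fix y assume y: "z \<le> y" "y \<le> k"
    have p: "0 < v (Suc 0) r2 y" by (rule v_1_pos[OF r2])
    have "(?q has_real_derivative (v 2 r1 y * v (Suc 0) r2 y - v (Suc 0) r1 y * v 2 r2 y) /
        (v (Suc 0) r2 y * v (Suc 0) r2 y)) (at y)"
      using p by (intro DERIV_divide[OF v_deriv_numerals(2) v_deriv_numerals(2)]) simp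
    moreover have "(v 2 r1 y * v (Suc 0) r2 y - v (Suc 0) r1 y * v 2 r2 y) /
        (v (Suc 0) r2 y * v (Suc 0) r2 y) \<le> 0"
      using wronskian[OF r, of y] y z p by (intro divide_nonpos_pos) auto
    ultimately show "\<exists>d. (?q has_real_derivative d) (at y) \<and> d \<le> 0" by blast
  qed
  then show ?thesis
    using v_1_k[OF r(1)] v_1_k[OF r2] v_1_pos[OF r2, of z] by (simp add: field_simps)
qed

lemma v_0_increment_antimono:
  assumes r: "0 < r1" "r1 \<le> r2" and x: "0 \<le> x" "x \<le> k"
  shows "v 0 r2 k - v 0 r2 x \<le> v 0 r1 k - v 0 r1 x"
proof -
  let ?f = "\<lambda>z. v 0 r1 z - v 0 r2 z"
  have "?f x \<le> ?f k"
  proof (rule DERIV_nonneg_imp_nondecreasing[OF x(2)])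
    fix y assume xy: "x \<le> y" "y \<le> k"
    have d: "(?f has_real_derivative v (Suc 0) r1 y - v (Suc 0) r2 y) (at y)"
      by (rule DERIV_diff[OF v_deriv_numerals(1) v_deriv_numerals(1)])
    show "\<exists>d. (?f has_real_derivative d) (at y) \<and> 0 \<le> d"
      by (rule exI_deriv[OF d]) (use v_1_antimono[OF r, of y] x xy in auto)
  qed
  then show ?thesis by simp
qed

text \<open>
  The expected payoff of the barrier strategy started from surplus \<open>z\<close>.
\<close>

definition V :: "real \<Rightarrow> real \<Rightarrow> real" where
  "V r z = (if z \<le> 0 then 0 else if z \<le> k then v 0 r z else v 0 r k + (z - k))"

text \<open>
  Both characteristic roots are at most \<open>L\<close> in modulus for all rates up to \<open>rh\<close>, and \<open>den\<close> is
  bounded away from \<open>0\<close>.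
\<close>

lemma v_bound:
  assumes r: "0 < rl" "rl \<le> r" "r \<le> rh"
  defines "L \<equiv> (\<mu> + sqrt (\<mu>\<^sup>2 + 2 * \<sigma>\<^sup>2 * rh)) / \<sigma>\<^sup>2"
  shows "\<bar>v n r z\<bar> \<le> 2 * L ^ n * exp (L * \<bar>z\<bar>) / lp rl"
    and "lp r \<le> L" "- lm r \<le> L" "lp rl \<le> den r" "den r \<le> 2 * L * exp (L * k)"
proof -
  have r0: "0 < r" using r by linarith
  have s: "sqrt (\<mu>\<^sup>2 + 2 * \<sigma>\<^sup>2 * rl) \<le> sqrt (\<mu>\<^sup>2 + 2 * \<sigma>\<^sup>2 * r)"
      "sqrt (\<mu>\<^sup>2 + 2 * \<sigma>\<^sup>2 * r) \<le> sqrt (\<mu>\<^sup>2 + 2 * \<sigma>\<^sup>2 * rh)"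
    using r by (auto intro!: mult_left_mono)
  show lpL: "lp r \<le> L" and lmL: "- lm r \<le> L"
  proof -
    have m: "(- \<mu> + sqrt (\<mu>\<^sup>2 + 2 * \<sigma>\<^sup>2 * r)) \<le> \<mu> + sqrt (\<mu>\<^sup>2 + 2 * \<sigma>\<^sup>2 * rh)"
      "- (- \<mu> - sqrt (\<mu>\<^sup>2 + 2 * \<sigma>\<^sup>2 * r)) \<le> \<mu> + sqrt (\<mu>\<^sup>2 + 2 * \<sigma>\<^sup>2 * rh)"
      using s(2) mu_pos by linarith+
    show "lp r \<le> L" unfolding lambda_plus_def L_def by (rule divide_right_mono[OF m(1)]) simp
    show "- lm r \<le> L" unfolding lambda_minus_def L_def minus_divide_left
      by (rule divide_right_mono[OF m(2)]) simp
  qed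
  have L0: "0 < L" using lp_pos[OF r0] lpL by linarith
  have lprl: "0 < lp rl" "lp rl \<le> lp r"
  proof -
    show "0 < lp rl" by (rule lp_pos[OF r(1)])
    show "lp rl \<le> lp r" unfolding lambda_plus_def using s(1) by (intro divide_right_mono) simp_all
  qed
  have "lp rl * 1 \<le> lp r * exp (lp r * k)"
    using lprl lp_pos[OF r0] k_pos by (intro mult_mono lprl) simp_all
  moreover have "lm r * exp (lm r * k) \<le> 0" using lm_neg[OF r0] by (intro mult_nonpos_nonneg) simp_all
  ultimately show d: "lp rl \<le> den r" by (simp add: den_def)
  have e: "\<bar>l ^ n * exp (l * z)\<bar> \<le> L ^ n * exp (L * \<bar>z\<bar>)" if "\<bar>l\<bar> \<le> L" for l n z
  proof -
    have "l * z \<le> L * \<bar>z\<bar>"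
      using mult_right_mono[OF that abs_ge_zero, of z] abs_ge_self[of "l * z"] by (simp add: abs_mult)
    then have "exp (l * z) \<le> exp (L * \<bar>z\<bar>)" by simp
    moreover have "\<bar>l\<bar> ^ n \<le> L ^ n" using that by (intro power_mono) auto
    ultimately have "\<bar>l\<bar> ^ n * exp (l * z) \<le> L ^ n * exp (L * \<bar>z\<bar>)"
      using that by (intro mult_mono) auto
    then show ?thesis by (simp add: abs_mult power_abs)
  qed
  have ll: "\<bar>lp r\<bar> \<le> L" "\<bar>lm r\<bar> \<le> L" unfolding abs_le_iff using lpL lmL lp_pos[OF r0] lm_neg[OF r0] by linarith+
  have "\<bar>v n r z\<bar> \<le> (2 * L ^ n * exp (L * \<bar>z\<bar>)) / den r"
    unfolding v_def abs_divide abs_of_pos[OF den_pos[OF r0]]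
    using e[OF ll(1), of n z] e[OF ll(2), of n z] den_pos[OF r0]
    by (intro divide_right_mono) linarith+
  also have "\<dots> \<le> (2 * L ^ n * exp (L * \<bar>z\<bar>)) / lp rl"
    using d lprl(1) L0 den_pos[OF r0]
    by (intro divide_left_mono mult_nonneg_nonneg zero_le_power mult_pos_pos) simp_all
  finally show "\<bar>v n r z\<bar> \<le> 2 * L ^ n * exp (L * \<bar>z\<bar>) / lp rl" .
  show "den r \<le> 2 * L * exp (L * k)"
    proof -
    have "\<bar>lp r * exp (lp r * k)\<bar> \<le> L * exp (L * k)" "\<bar>lm r * exp (lm r * k)\<bar> \<le> L * exp (L * k)"
      using e[OF ll(1), of 1 k] e[OF ll(2), of 1 k] unfolding power_one_right abs_of_pos[OF k_pos] by blast+
    then show ?thesis unfolding den_def by linarith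
  qed
qed

lemma uniform_bounds:
  assumes rl: "0 < rl" "rl \<le> rh"
  obtains C m where "1 \<le> C" "0 < m" "rh \<le> C"
    "\<And>r z. rl \<le> r \<Longrightarrow> r \<le> rh \<Longrightarrow> \<bar>v 0 r z\<bar> \<le> C * exp (C * \<bar>z\<bar>)"
    "\<And>r z. rl \<le> r \<Longrightarrow> r \<le> rh \<Longrightarrow> 0 \<le> z \<Longrightarrow> z \<le> k \<Longrightarrow> v (Suc 0) r z \<le> C"
    "\<And>r. rl \<le> r \<Longrightarrow> r \<le> rh \<Longrightarrow> \<bar>v 2 r k\<bar> \<le> C"
    "\<And>r. rl \<le> r \<Longrightarrow> r \<le> rh \<Longrightarrow> v 0 r k \<le> C"
    "\<And>r z. rl \<le> r \<Longrightarrow> r \<le> rh \<Longrightarrow> 0 \<le> z \<Longrightarrow> z \<le> k \<Longrightarrow> m \<le> v 3 r z"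
proof -
  define L where "L = (\<mu> + sqrt (\<mu>\<^sup>2 + 2 * \<sigma>\<^sup>2 * rh)) / \<sigma>\<^sup>2"
  define B where "B n = 2 * L ^ n * exp (L * k) / lp rl" for n
  define C where "C = 1 + \<bar>rh\<bar> + L + 2 / lp rl + B 0 + B 1 + B 2"
  define \<kappa> where "\<kappa> = 2 * \<mu> / \<sigma>\<^sup>2"
  define m where "m = \<kappa> ^ 3 * exp (- (L * k)) / (2 * L * exp (L * k))"
  note vb = v_bound[OF rl(1), where rh = rh, folded L_def]
  have lprl: "0 < lp rl" by (rule lp_pos[OF rl(1)])
  have lprl2: "0 \<le> 2 / lp rl" using lprl by simp
  have L0: "0 < L" using vb(2)[OF order_refl rl(2)] lprl by linarith
  have \<kappa>0: "0 < \<kappa>" using mu_pos sigma_pos by (simp add: \<kappa>_def)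
  have B0: "0 \<le> B n" for n unfolding B_def using L0 lprl by (intro divide_nonneg_nonneg mult_nonneg_nonneg zero_le_power) auto
  have LC: "L \<le> C" "2 / lp rl \<le> C" "B 0 \<le> C" "B 1 \<le> C" "B 2 \<le> C"
    unfolding C_def using B0[of 0] B0[of 1] B0[of 2] L0 lprl2 by linarith+
  show thesis
  proof (rule that[of C m])
    show "1 \<le> C" "rh \<le> C" unfolding C_def using B0[of 0] B0[of 1] B0[of 2] L0 lprl2 by linarith+
    show "0 < m" unfolding m_def using \<kappa>0 L0 by (intro divide_pos_pos mult_pos_pos zero_less_power) auto
    fix r assume r: "rl \<le> r" "r \<le> rh"
    have r0: "0 < r" using r rl by linarith
    have Bk: "\<bar>v n r z\<bar> \<le> B n" if "0 \<le> z" "z \<le> k" for n z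
    proof -
      have "2 * L ^ n * exp (L * \<bar>z\<bar>) / lp rl \<le> B n"
        unfolding B_def using that L0 lprl by (intro divide_right_mono mult_left_mono) auto
      then show ?thesis using vb(1)[OF r, of n z] by linarith
    qed
    show "\<bar>v 0 r z\<bar> \<le> C * exp (C * \<bar>z\<bar>)" for z
    proof -
      have "\<bar>v 0 r z\<bar> \<le> (2 / lp rl) * exp (L * \<bar>z\<bar>)" using vb(1)[OF r, of 0 z] by (simp only: power_0 mult_1_right times_divide_eq_left)
      also have "\<dots> \<le> C * exp (C * \<bar>z\<bar>)"
      proof (rule mult_mono)
        show "exp (L * \<bar>z\<bar>) \<le> exp (C * \<bar>z\<bar>)" using LC(1) by (simp add: mult_right_mono)
      qed (use LC(1,2) L0 in simp_all)
      finally show ?thesis .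
    qed
    show "v (Suc 0) r z \<le> C" if "0 \<le> z" "z \<le> k" for z
      using Bk[OF that, of "Suc 0"] LC(4) unfolding One_nat_def by linarith
    show "\<bar>v 2 r k\<bar> \<le> C" using Bk[of k 2] LC(5) k_pos by linarith
    show "v 0 r k \<le> C" using Bk[of k 0] LC(3) k_pos by linarith
    show "m \<le> v 3 r z" if "0 \<le> z" "z \<le> k" for z
    proof -
      define b where "b = - lm r"
      have b: "\<kappa> \<le> b" "b \<le> L" using lm_le[OF r0] vb(3)[OF r] by (simp_all add: \<kappa>_def b_def)
      have p: "\<kappa> ^ 3 \<le> b ^ 3" by (rule power_mono[OF b(1) less_imp_le[OF \<kappa>0]])
      have b0: "0 \<le> b" using b(1) \<kappa>0 by linarith
      have "b * z \<le> L * k" using b b0 that(2) L0 by (intro mult_mono) (auto intro: that)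
      then have q: "exp (- (L * k)) \<le> exp (lm r * z)" unfolding b_def exp_le_cancel_iff by linarith
      have b3: "0 \<le> b ^ 3" by (rule zero_le_power[OF b0])
      have "m \<le> b ^ 3 * exp (lm r * z) / den r"
        unfolding m_def
      proof (rule frac_le)
        show "\<kappa> ^ 3 * exp (- (L * k)) \<le> b ^ 3 * exp (lm r * z)"
          by (rule mult_mono[OF p q b3]) simp
              show "0 \<le> b ^ 3 * exp (lm r * z)" using b3 by simp
        show "0 < den r" by (rule den_pos[OF r0])
        show "den r \<le> 2 * L * exp (L * k)" by (rule vb(5)[OF r])
      qed
      then have "m \<le> (- lm r) ^ 3 * exp (lm r * z) / den r" by (simp only: b_def)
      also have "\<dots> \<le> v 3 r z" using v_3_ge[OF r0, of z] by simp
      finally show ?thesis .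
    qed
  qed
qed

end

section \<open>Association, and elementary bounds for the payoff\<close>

text \<open>
  Where \<open>f > 0\<close> the arguments are larger than where \<open>f < 0\<close>, hence \<open>g\<close> is smaller there; a constant
  \<open>c\<close> separates the two ranges of \<open>g\<close>, and \<open>g f \<le> c f\<close> everywhere.
\<close>

lemma integral_association_nonpos:
  fixes f g w :: "real \<Rightarrow> real"
  assumes I: "AE r in R. r \<in> I"
    and f: "\<And>r s. r \<in> I \<Longrightarrow> s \<in> I \<Longrightarrow> r \<le> s \<Longrightarrow> f r \<le> f s"
    and g: "\<And>r s. r \<in> I \<Longrightarrow> s \<in> I \<Longrightarrow> r \<le> s \<Longrightarrow> g s \<le> g r"
    and g0: "\<And>r. r \<in> I \<Longrightarrow> 0 \<le> g r \<and> g r \<le> B"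
    and w: "\<And>r. r \<in> I \<Longrightarrow> 0 \<le> w r"
    and int: "integrable R (\<lambda>r. w r * f r)" "integrable R (\<lambda>r. w r * g r * f r)"
    and le: "(\<integral>r. w r * f r \<partial>R) \<le> 0"
  shows "(\<integral>r. w r * g r * f r \<partial>R) \<le> 0"
proof -
  define P where "P = {r \<in> I. 0 < f r}"
  \<comment> \<open>If \<open>f\<close> is nowhere positive, \<open>c = 0\<close> separates because \<open>g \<ge> 0\<close>.\<close>
  define c where "c = (if P = {} then 0 else Sup (g ` P))"
  have bdd: "bdd_above (g ` P)" using g0 by (intro bdd_aboveI[of _ B]) (auto simp: P_def)
  have c1: "g r \<le> c" if "r \<in> I" "0 < f r" for r
    using that bdd by (auto simp: c_def P_def intro!: cSup_upper)
  have c2: "c \<le> g r" if r: "r \<in> I" "f r < 0" for r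
  proof (cases "P = {}")
    case True then show ?thesis using g0[OF r(1)] by (simp add: c_def)
  next
    case False
    have "g s \<le> g r" if "s \<in> P" for s
      using that r f[of s r] g[of r s] by (cases "r \<le> s") (auto simp: P_def)
    then show ?thesis using False by (auto simp: c_def intro!: cSup_least)
  qed
  have c0: "0 \<le> c"
  proof (cases "P = {}")
    case False
    then obtain r where "r \<in> I" "0 < f r" by (auto simp: P_def)
    then show ?thesis using c1[of r] g0[of r] by linarith
  qed (simp add: c_def)
  have "(\<integral>r. w r * g r * f r \<partial>R) \<le> (\<integral>r. c * (w r * f r) \<partial>R)"
  proof (rule integral_mono_AE)
    show "AE r in R. w r * g r * f r \<le> c * (w r * f r)"
      using I
    proof eventually_elim
      case (elim r)
      have "g r * f r \<le> c * f r"
      proof (cases "f r" "0::real" rule: linorder_cases)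
        case less show ?thesis using c2[OF elim less] less by (intro mult_right_mono_neg) auto
      next
        case greater show ?thesis using c1[OF elim greater] greater by (intro mult_right_mono) auto
      qed simp
      from mult_left_mono[OF this w[OF elim]] show ?case by (simp add: mult_ac)
    qed
  qed (use int in auto)
  also have "\<dots> \<le> 0" using le c0 by (simp add: mult_nonneg_nonpos)
  finally show ?thesis .
qed

text \<open>
  Events on which an increment exceeds a fixed threshold only cost a fourth moment, which is of
  order \<open>\<epsilon>\<^sup>2\<close> for a Brownian increment.
\<close>

lemma power_le_fourth:
  fixes g t :: real
  assumes "0 < t" "t \<le> \<bar>g\<bar>"
  shows "1 \<le> g ^ 4 / t ^ 4" "\<bar>g\<bar> \<le> g ^ 4 / t ^ 3" "g\<^sup>2 \<le> g ^ 4 / t\<^sup>2"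
proof -
  have g: "g ^ 4 = \<bar>g\<bar> ^ 4" "g\<^sup>2 = \<bar>g\<bar>\<^sup>2" by (simp_all add: power_even_abs)
  have "t ^ n \<le> \<bar>g\<bar> ^ n" for n using assms by (intro power_mono) auto
  note p = this
  show "1 \<le> g ^ 4 / t ^ 4" using p[of 4] assms by (simp only: g pos_le_divide_eq zero_less_power mult_1)
  have "\<bar>g\<bar> * t ^ 3 \<le> \<bar>g\<bar> * \<bar>g\<bar> ^ 3" by (intro mult_left_mono p) simp
  also have "\<dots> = \<bar>g\<bar> ^ 4" by (simp add: eval_nat_numeral)
  finally show "\<bar>g\<bar> \<le> g ^ 4 / t ^ 3" using assms by (simp only: g pos_le_divide_eq zero_less_power)
  have "\<bar>g\<bar>\<^sup>2 * t\<^sup>2 \<le> \<bar>g\<bar>\<^sup>2 * \<bar>g\<bar>\<^sup>2" by (intro mult_left_mono p) simp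
  also have "\<dots> = \<bar>g\<bar> ^ 4" by (simp add: eval_nat_numeral)
  finally show "g\<^sup>2 \<le> g ^ 4 / t\<^sup>2" using assms by (simp only: g pos_le_divide_eq zero_less_power)
qed

lemma exp_neg_bounds:
  fixes s :: real
  assumes "0 \<le> s"
  shows "exp (- s) \<le> 1" "1 - exp (- s) \<le> s" "s - s\<^sup>2 / 2 \<le> 1 - exp (- s)"
proof -
  show "exp (- s) \<le> 1" using assms by simp
  show "1 - exp (- s) \<le> s" using exp_ge_add_one_self[of "- s"] by linarith
  let ?f = "\<lambda>s::real. 1 - exp (- s) - s + s\<^sup>2 / 2"
  have "?f 0 \<le> ?f s"
  proof (rule DERIV_nonneg_imp_nondecreasing[OF assms])
    fix x :: real assume "0 \<le> x"
    have d: "(?f has_real_derivative exp (- x) - 1 + x) (at x)"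
      by (auto intro!: derivative_eq_intros)
    show "\<exists>d. (?f has_real_derivative d) (at x) \<and> 0 \<le> d"
      by (rule exI_deriv[OF d]) (use exp_ge_add_one_self[of "- x"] in linarith)
  qed
  then show "s - s\<^sup>2 / 2 \<le> 1 - exp (- s)" by simp
qed

text \<open>
  All estimates have to be uniform over the support of the rate; these are the constants that they
  use.
\<close>

locale barrier_bounds = barrier +
  fixes rl rh B m :: real
  assumes rl_pos: "0 < rl" and rl_le: "rl \<le> rh" and B_ge: "1 \<le> B" and m_pos: "0 < m" and rh_le: "rh \<le> B"
    and v_0_exp: "\<And>r z. rl \<le> r \<Longrightarrow> r \<le> rh \<Longrightarrow> \<bar>v 0 r z\<bar> \<le> B * exp (B * \<bar>z\<bar>)"
    and v_1_le: "\<And>r z. rl \<le> r \<Longrightarrow> r \<le> rh \<Longrightarrow> 0 \<le> z \<Longrightarrow> z \<le> k \<Longrightarrow> v (Suc 0) r z \<le> B"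
    and v_2_abs: "\<And>r. rl \<le> r \<Longrightarrow> r \<le> rh \<Longrightarrow> \<bar>v 2 r k\<bar> \<le> B"
    and v_0_k_le: "\<And>r. rl \<le> r \<Longrightarrow> r \<le> rh \<Longrightarrow> v 0 r k \<le> B"
    and v_3_ge_m: "\<And>r z. rl \<le> r \<Longrightarrow> r \<le> rh \<Longrightarrow> 0 \<le> z \<Longrightarrow> z \<le> k \<Longrightarrow> m \<le> v 3 r z"

lemma (in barrier) barrier_bounds_exist:
  assumes "0 < rl" "rl \<le> rh"
  shows "\<exists>B m. barrier_bounds \<mu> \<sigma> k rl rh B m"
proof (rule uniform_bounds[OF assms])
  fix C n
  assume "1 \<le> C" "0 < n" "rh \<le> C"
    "\<And>r z. rl \<le> r \<Longrightarrow> r \<le> rh \<Longrightarrow> \<bar>v 0 r z\<bar> \<le> C * exp (C * \<bar>z\<bar>)"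
    "\<And>r z. rl \<le> r \<Longrightarrow> r \<le> rh \<Longrightarrow> 0 \<le> z \<Longrightarrow> z \<le> k \<Longrightarrow> v (Suc 0) r z \<le> C"
    "\<And>r. rl \<le> r \<Longrightarrow> r \<le> rh \<Longrightarrow> \<bar>v 2 r k\<bar> \<le> C"
    "\<And>r. rl \<le> r \<Longrightarrow> r \<le> rh \<Longrightarrow> v 0 r k \<le> C"
    "\<And>r z. rl \<le> r \<Longrightarrow> r \<le> rh \<Longrightarrow> 0 \<le> z \<Longrightarrow> z \<le> k \<Longrightarrow> n \<le> v 3 r z"
  then have "barrier_bounds \<mu> \<sigma> k rl rh C n"
    by (intro barrier_bounds.intro barrier_axioms barrier_bounds_axioms.intro assms)
  then show ?thesis by blast
qed

context barrier begin

lemma V_cont_pieces: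
  assumes "0 < r"
  shows "0 \<le> z \<Longrightarrow> z \<le> k \<Longrightarrow> V r z = v 0 r z" "k \<le> z \<Longrightarrow> V r z = v 0 r k + (z - k)" "z \<le> 0 \<Longrightarrow> V r z = 0"
  using k_pos v_0_0[of r] by (auto simp: V_def)

lemma V_nonneg: "0 < r \<Longrightarrow> 0 \<le> V r z"
  using v_0_nonneg[of r z] v_0_nonneg[of r k] k_pos by (auto simp: V_def)

lemma V_mono:
  assumes "0 < r" "y \<le> z" shows "V r y \<le> V r z"
proof -
  note c = V_cont_pieces[OF assms(1)]
  consider "y \<le> 0" | "0 \<le> y" "z \<le> k" | "0 \<le> y" "y \<le> k" "k \<le> z" | "k \<le> y" by linarith
  then show ?thesis
  proof cases
    case 1 then show ?thesis using c(3)[of y] V_nonneg[OF assms(1), of z] by linarith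
  next
    case 2 then show ?thesis using c(1)[of y] c(1)[of z] v_0_mono[OF assms] assms by linarith
  next
    case 3 then show ?thesis using c(1)[of y] c(2)[of z] v_0_mono[OF assms(1), of y k] by linarith
  next
    case 4 then show ?thesis using c(2)[of y] c(2)[of z] assms by linarith
  qed
qed

lemma V_measurable[measurable]:
  assumes [measurable]: "f \<in> borel_measurable N" "g \<in> borel_measurable N"
  shows "(\<lambda>x. v n (f x) (g x)) \<in> borel_measurable N" "(\<lambda>x. V (f x) (g x)) \<in> borel_measurable N"
  unfolding V_def v_def den_def lambda_plus_def lambda_minus_def by measurable

text \<open>
  The part of the gain of a deviation that has mean zero.  Here \<open>x\<close> is the surplus, \<open>y\<close> what is left
  of it after the initial lump sum, and \<open>g\<close> the uncontrolled increment over a time \<open>\<epsilon>\<close>.  Below the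
  barrier it is the increment of the discounted harmonic function, above it the linear part of the
  increment.  If the lump sum leaves less than \<open>min x k / 2\<close>, its loss is so large that nothing
  needs to be compensated.
\<close>

definition one_step_martingale :: "real \<Rightarrow> real \<Rightarrow> real \<Rightarrow> real \<Rightarrow> real \<Rightarrow> real" where
  "one_step_martingale x r \<epsilon> y g =
    (if y < min x k / 2 then 0
     else if y < k then exp (- (r * \<epsilon>)) * v 0 r (y + g) - v 0 r y
     else exp (- (r * \<epsilon>)) * (g - \<mu> * \<epsilon>))"

end

section \<open>The gain of a deviation along a path\<close>

context barrier_bounds begin

lemma V_lipschitz:
  assumes r: "rl \<le> r" "r \<le> rh" and yz: "0 \<le> y" "y \<le> z"
  shows "V r z \<le> V r y + B * (z - y)"
proof -
  have r0: "0 < r" using r rl_pos by linarith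
  note c = V_cont_pieces[OF r0]
  have low: "v 0 r z' \<le> v 0 r y' + B * (z' - y')" if "0 \<le> y'" "y' \<le> z'" "z' \<le> k" for y' z'
  proof -
    have "v 0 r z' - B * z' \<le> v 0 r y' - B * y'"
    proof (rule DERIV_nonpos_imp_nonincreasing[OF that(2)])
      fix w assume w: "y' \<le> w" "w \<le> z'"
      have d: "((\<lambda>z. v 0 r z - B * z) has_real_derivative v (Suc 0) r w - B) (at w)"
        by (auto intro!: derivative_eq_intros v_deriv_numerals[THEN DERIV_cong])
      show "\<exists>d. ((\<lambda>z. v 0 r z - B * z) has_real_derivative d) (at w) \<and> d \<le> 0"
        by (rule exI_deriv[OF d]) (use v_1_le[OF r, of w] w that in auto)
    qed
    then show ?thesis by (simp add: algebra_simps)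
  qed
  have up: "z' - y' \<le> B * (z' - y')" if "y' \<le> z'" for y' z'
    using mult_right_mono[OF B_ge, of "z' - y'"] that by simp
  consider "z \<le> k" | "y \<le> k" "k \<le> z" | "k \<le> y" by linarith
  then show ?thesis
  proof cases
    case 1 then show ?thesis using c(1)[of y] c(1)[of z] low[of y z] yz by linarith
  next
    case 2
    have "B * (z - y) = B * (z - k) + B * (k - y)" by (simp add: algebra_simps)
    then show ?thesis using c(1)[of y] c(2)[of z] low[of y k] up[of k z] 2 yz by linarith
  next
    case 3 then show ?thesis using c(2)[of y] c(2)[of z] up[of y z] yz by linarith
  qed
qed

text \<open>
  The gain from an immediate payment of \<open>x - y\<close>, by the expansion at the barrier.  For \<open>x > k\<close> the excess over the
  barrier is paid by the barrier strategy as well.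
\<close>

lemma lump_sum_gap:
  assumes r: "rl \<le> r" "r \<le> rh" and y: "0 \<le> y" "y \<le> min x k"
  shows "(x - y) + v 0 r y - V r x \<le> v 2 r k / 2 * ((k - y)\<^sup>2 - (k - min x k)\<^sup>2)
      - m / 6 * ((k - y) ^ 3 - (k - min x k) ^ 3)"
proof -
  have r0: "0 < r" using r rl_pos by linarith
  have "V r x = v 0 r (min x k) + (x - min x k)"
    using V_cont_pieces(1,2)[OF r0, of x] y by (cases "x \<le> k") (auto simp: min_def)
  moreover have "(min x k - y) - v 2 r k / 2 * ((k - y)\<^sup>2 - (k - min x k)\<^sup>2)
      + m / 6 * ((k - y) ^ 3 - (k - min x k) ^ 3) \<le> v 0 r (min x k) - v 0 r y"
    by (rule v_0_gap[OF r0 y(2)]) (use y m_pos v_3_ge_m[OF r] in auto)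
  ultimately show ?thesis by linarith
qed

lemma gap_pos:
  assumes "0 < x" shows "0 < m / 6 * ((k - min x k / 2) ^ 3 - (k - min x k) ^ 3)"
proof -
  have "(k - min x k) ^ 3 < (k - min x k / 2) ^ 3" using assms k_pos by (intro power_strict_mono) auto
  then show ?thesis using m_pos by simp
qed

text \<open>
  A large lump sum loses at least the fixed amount \<open>c0\<close> beyond the multiple of \<open>v 2 r k\<close>, by the
  cubic term.  This pays for the dividends \<open>\<Delta>\<close> and for every increment with \<open>B \<bar>g\<bar> \<le> c0 / 2\<close>;
  larger increments are charged to \<open>g\<^sup>4\<close>.
\<close>

lemma step_from_low:
  fixes x K
  defines "c0 \<equiv> m / 6 * ((k - min x k / 2) ^ 3 - (k - min x k) ^ 3)"
  assumes r: "rl \<le> r" "r \<le> rh" and x: "0 < x" and y: "0 \<le> y" "y < min x k / 2"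
    and \<epsilon>: "0 < \<epsilon>" "K * \<epsilon> \<le> c0 / 2" and \<Delta>: "0 \<le> \<Delta>" "\<Delta> \<le> K * \<epsilon>"
  shows "(x - y) + \<Delta> + exp (- (r * \<epsilon>)) * V r (y + g - \<Delta>) - V r x
    \<le> ((k - y)\<^sup>2 - (k - min x k)\<^sup>2) / 2 * v 2 r k + B * (g ^ 4 / (c0 / (2 * B)) ^ 3)"
proof -
  have r0: "0 < r" using r rl_pos by linarith
  have x': "0 < min x k" "min x k \<le> k" using x k_pos by auto
  have c0: "0 < c0" unfolding c0_def by (rule gap_pos[OF x])
  have "exp (- (r * \<epsilon>)) * V r (y + g - \<Delta>) \<le> 1 * V r (y + g - \<Delta>)"
    using r0 \<epsilon> by (intro mult_right_mono V_nonneg) auto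
  also have "\<dots> \<le> V r (y + \<bar>g\<bar>)" using V_mono[OF r0, of "y + g - \<Delta>" "y + \<bar>g\<bar>"] \<Delta> by simp
  also have "\<dots> \<le> V r y + B * \<bar>g\<bar>" using V_lipschitz[OF r, of y "y + \<bar>g\<bar>"] y by simp
  also have "V r y = v 0 r y" using V_cont_pieces(1)[OF r0, of y] y x' by auto
  finally have 1: "exp (- (r * \<epsilon>)) * V r (y + g - \<Delta>) \<le> v 0 r y + B * \<bar>g\<bar>" .
  have 2: "c0 \<le> m / 6 * ((k - y) ^ 3 - (k - min x k) ^ 3)"
    unfolding c0_def using m_pos x' y by (intro mult_left_mono diff_right_mono power_mono) auto
  have 3: "B * \<bar>g\<bar> - c0 / 2 \<le> B * (g ^ 4 / (c0 / (2 * B)) ^ 3)"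
  proof (cases "c0 / (2 * B) \<le> \<bar>g\<bar>")
    case True
    have "0 < c0 / (2 * B)" using c0 B_ge by simp
    from mult_left_mono[OF power_le_fourth(2)[OF this True], of B] show ?thesis using c0 B_ge by linarith
  next
    case False
    have "0 \<le> B * (g ^ 4 / (c0 / (2 * B)) ^ 3)" using c0 B_ge by (intro mult_nonneg_nonneg divide_nonneg_nonneg) auto
    moreover have "\<bar>g\<bar> * (2 * B) \<le> c0" using False B_ge pos_less_divide_eq[of "2 * B" "\<bar>g\<bar>" c0] pos_le_divide_eq[of "2 * B" "\<bar>g\<bar>" c0] by linarith
    moreover have "\<bar>g\<bar> * (2 * B) = 2 * (B * \<bar>g\<bar>)" by simp
    ultimately show ?thesis by linarith
  qed
  have "v 2 r k / 2 * ((k - y)\<^sup>2 - (k - min x k)\<^sup>2) = ((k - y)\<^sup>2 - (k - min x k)\<^sup>2) / 2 * v 2 r k" by simp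
  then show "(x - y) + \<Delta> + exp (- (r * \<epsilon>)) * V r (y + g - \<Delta>) - V r x
    \<le> ((k - y)\<^sup>2 - (k - min x k)\<^sup>2) / 2 * v 2 r k + B * (g ^ 4 / (c0 / (2 * B)) ^ 3)"
    using lump_sum_gap[OF r, of y x] y x' 1 2 3 \<epsilon>(2) \<Delta>(2) by linarith
qed

text \<open>
  A unit paid at a surplus near \<open>y\<close> costs the slope of the value function, which is at least its
  tangent at \<open>k\<close>.
\<close>

lemma small_dividend:
  assumes r: "rl \<le> r" "r \<le> rh" and \<Delta>: "0 \<le> \<Delta>"
  shows "v 0 r (y + g - \<Delta>) - v 0 r (y + g) \<le> - \<Delta> + \<Delta> * (k - y) * v 2 r k + B * \<Delta> * (\<bar>g\<bar> + \<Delta>)"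
proof (cases "\<Delta> = 0")
  case False
  have r0: "0 < r" using r rl_pos by linarith
  obtain \<zeta> where z: "y + g - \<Delta> < \<zeta>" "\<zeta> < y + g"
    and e: "v 0 r (y + g) - v 0 r (y + g - \<Delta>) = (y + g - (y + g - \<Delta>)) * v (Suc 0) r \<zeta>"
    using MVT2[of "y + g - \<Delta>" "y + g" "v 0 r" "v (Suc 0) r"] \<Delta> False v_deriv_numerals(1) by auto
  have "\<bar>v 2 r k * (\<zeta> - y)\<bar> \<le> B * (\<bar>g\<bar> + \<Delta>)"
    unfolding abs_mult using z v_2_abs[OF r] \<Delta> B_ge by (intro mult_mono) auto
  moreover have "v 2 r k * (\<zeta> - k) = v 2 r k * (\<zeta> - y) - (k - y) * v 2 r k" by (simp add: algebra_simps)
  ultimately have "1 - (k - y) * v 2 r k - B * (\<bar>g\<bar> + \<Delta>) \<le> v (Suc 0) r \<zeta>"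
    using v_1_tangent[OF r0, of \<zeta>] by linarith
  from mult_left_mono[OF this \<Delta>] show ?thesis using e by (simp add: algebra_simps)
qed simp

text \<open>
  Below the barrier the gain splits into the lump sum, the dividends paid before \<open>\<epsilon>\<close>, and the
  difference between the payoff and its harmonic extension at the end point \<open>z\<close>.  The last one is
  nonzero only beyond ruin, which needs a large increment, or beyond \<open>k\<close>.  There it is quadratic
  with coefficient \<open>v 2 r k\<close> if \<open>x \<ge> k\<close>, while for \<open>x < k\<close> it again needs a large increment and is
  moved to the error, so that the coefficient of \<open>v 2 r k\<close> stays nonnegative.
\<close>

lemma step_from_middle:
  fixes x K g :: real
  defines "\<eta> \<equiv> min x k / 2"
  assumes r: "rl \<le> r" "r \<le> rh" and x: "0 < x" and y: "\<eta> \<le> y" "y < k" "y \<le> x"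
    and \<epsilon>: "0 < \<epsilon>" "\<epsilon> \<le> 1" "K * \<epsilon> \<le> \<eta> / 2" and \<Delta>: "0 \<le> \<Delta>" "\<Delta> \<le> K * \<epsilon>" and K: "0 < K"
  defines "z \<equiv> y + g - \<Delta>"
  shows "(x - y) + \<Delta> + exp (- (r * \<epsilon>)) * V r z - V r x - (exp (- (r * \<epsilon>)) * v 0 r (y + g) - v 0 r y)
    \<le> (((k - y)\<^sup>2 - (k - min x k)\<^sup>2) / 2 + \<Delta> * (k - y) - (if k \<le> x \<and> k < z then (z - k)\<^sup>2 / 2 else 0)) * v 2 r k
      + (K * B + B\<^sup>2 * K * k + B * K\<^sup>2) * \<epsilon>\<^sup>2 + B * K * (\<epsilon> * \<bar>g\<bar>) + B\<^sup>2 * (\<epsilon> * g\<^sup>2)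
      + (B / (\<eta> / 2) ^ 4 * exp (B * \<bar>g\<bar>) + (if x < k then B / (k - x)\<^sup>2 else 0)) * g ^ 4"
proof -
  have r0: "0 < r" "r \<le> B" using r rl_pos rh_le by linarith+
  have \<eta>0: "0 < \<eta>" using x k_pos by (simp add: \<eta>_def)
  have y0: "0 \<le> y" using y(1) \<eta>0 by linarith
  have B0: "0 \<le> B" "0 < B" using B_ge by linarith+
  define e where "e = exp (- (r * \<epsilon>))"
  define A where "A = v 2 r k"
  have A: "\<bar>A\<bar> \<le> B" unfolding A_def by (rule v_2_abs[OF r])
  have "0 \<le> r * \<epsilon>" using r0 \<epsilon> by simp
  note eb = exp_neg_bounds[OF this, folded e_def]
  have re: "r * \<epsilon> \<le> B * \<epsilon>" using r0 \<epsilon> by (intro mult_right_mono) auto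
  have e: "0 < e" "e \<le> 1" "1 - e \<le> B * \<epsilon>" "0 \<le> 1 - e" using eb re by (auto simp: e_def)
  have gap: "(x - y) + v 0 r y - V r x \<le> ((k - y)\<^sup>2 - (k - min x k)\<^sup>2) / 2 * A"
  proof -
    have "0 \<le> m / 6 * ((k - y) ^ 3 - (k - min x k) ^ 3)"
      using m_pos y by (intro mult_nonneg_nonneg) (auto intro!: power_mono)
    moreover have "v 2 r k / 2 * ((k - y)\<^sup>2 - (k - min x k)\<^sup>2) = ((k - y)\<^sup>2 - (k - min x k)\<^sup>2) / 2 * A"
      by (simp add: A_def)
    ultimately show ?thesis using lump_sum_gap[OF r y0, of x] y by linarith
  qed
  have div: "\<Delta> + e * (v 0 r z - v 0 r (y + g))
      \<le> \<Delta> * (k - y) * A + (K * B + B\<^sup>2 * K * k + B * K\<^sup>2) * \<epsilon>\<^sup>2 + B * K * (\<epsilon> * \<bar>g\<bar>)"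
  proof -
    have "e * (v 0 r z - v 0 r (y + g)) \<le> e * (- \<Delta> + \<Delta> * (k - y) * A + B * \<Delta> * (\<bar>g\<bar> + \<Delta>))"
      using small_dividend[OF r \<Delta>(1), of y g] e unfolding z_def A_def by (intro mult_left_mono) auto
    also have "\<dots> = - \<Delta> + \<Delta> * (k - y) * A + (1 - e) * \<Delta> + (1 - e) * (\<Delta> * (k - y) * (- A)) + e * (B * \<Delta> * (\<bar>g\<bar> + \<Delta>))"
      by (simp add: algebra_simps)
    finally have 1: "\<Delta> + e * (v 0 r z - v 0 r (y + g)) \<le> \<Delta> * (k - y) * A
       + (1 - e) * \<Delta> + (1 - e) * (\<Delta> * (k - y) * (- A)) + e * (B * \<Delta> * (\<bar>g\<bar> + \<Delta>))" by linarith
    have 2: "(1 - e) * \<Delta> \<le> (B * \<epsilon>) * (K * \<epsilon>)" using e \<Delta> B0 \<epsilon> by (intro mult_mono) auto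
    have 3: "(1 - e) * (\<Delta> * (k - y) * (- A)) \<le> (B * \<epsilon>) * (K * \<epsilon> * k * B)"
    proof -
      have "(1 - e) * (\<Delta> * (k - y) * (- A)) \<le> (1 - e) * (\<Delta> * (k - y) * B)"
        using e \<Delta> y A by (intro mult_left_mono mult_nonneg_nonneg) auto
      also have "\<dots> \<le> (B * \<epsilon>) * (K * \<epsilon> * k * B)"
        using e \<Delta> y y0 B0 \<epsilon> K by (intro mult_mono mult_nonneg_nonneg) auto
      finally show ?thesis .
    qed
    have 4: "e * (B * \<Delta> * (\<bar>g\<bar> + \<Delta>)) \<le> 1 * (B * (K * \<epsilon>) * (\<bar>g\<bar> + K * \<epsilon>))"
      using e \<Delta> B0 \<epsilon> K by (intro mult_mono mult_nonneg_nonneg add_mono) auto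
    have 5: "(B * \<epsilon>) * (K * \<epsilon>) + (B * \<epsilon>) * (K * \<epsilon> * k * B) + 1 * (B * (K * \<epsilon>) * (\<bar>g\<bar> + K * \<epsilon>))
       = (K * B + B\<^sup>2 * K * k + B * K\<^sup>2) * \<epsilon>\<^sup>2 + B * K * (\<epsilon> * \<bar>g\<bar>)"
      by (simp add: power2_eq_square algebra_simps)
    show ?thesis using 1 2 3 4 5 by linarith
  qed
  have g4: "0 \<le> g ^ 4" by simp
  have nn: "0 \<le> B\<^sup>2 * (\<epsilon> * g\<^sup>2)" "0 \<le> B / (\<eta> / 2) ^ 4 * exp (B * \<bar>g\<bar>)" "0 \<le> (if x < k then B / (k - x)\<^sup>2 else 0)"
    using B0 \<epsilon> \<eta>0 by auto
  have over: "e * (V r z - v 0 r z) \<le> - (if k \<le> x \<and> k < z then (z - k)\<^sup>2 / 2 else 0) * A + B\<^sup>2 * (\<epsilon> * g\<^sup>2)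
      + (B / (\<eta> / 2) ^ 4 * exp (B * \<bar>g\<bar>) + (if x < k then B / (k - x)\<^sup>2 else 0)) * g ^ 4"
    (is "?L \<le> - ?q * A + _ + (?a + ?b) * _")
  proof -
    have ab: "(?a + ?b) * g ^ 4 = ?a * g ^ 4 + ?b * g ^ 4" "0 \<le> ?a * g ^ 4" "0 \<le> ?b * g ^ 4"
      using nn g4 by (auto simp only: distrib_right intro!: mult_nonneg_nonneg)
    consider "z \<le> 0" | "0 \<le> z" "z \<le> k" | "k < z" by linarith
    then show ?thesis
    proof cases
      case 1
      have g: "\<eta> / 2 \<le> \<bar>g\<bar>" "\<bar>z\<bar> \<le> \<bar>g\<bar>"
        using 1 y \<Delta> \<epsilon>(3) \<eta>0 unfolding z_def by linarith+
      have "B * exp (B * \<bar>z\<bar>) \<le> B * exp (B * \<bar>g\<bar>)" using g(2) B0 by (intro mult_left_mono) auto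
      then have "V r z - v 0 r z \<le> B * exp (B * \<bar>g\<bar>)"
        using V_cont_pieces(3)[OF r0(1) 1] v_0_exp[OF r, of z] by linarith
      then have "?L \<le> e * (B * exp (B * \<bar>g\<bar>))" using e by (intro mult_left_mono) auto
      also have "\<dots> \<le> 1 * (B * exp (B * \<bar>g\<bar>))" using e B0 by (intro mult_right_mono) auto
      also have "\<dots> \<le> (g ^ 4 / (\<eta> / 2) ^ 4) * (B * exp (B * \<bar>g\<bar>))"
        using power_le_fourth(1)[OF _ g(1)] \<eta>0 B0 by (intro mult_right_mono) auto
      also have "\<dots> = ?a * g ^ 4" by simp
      finally have "?L \<le> ?a * g ^ 4" .
      moreover have "?q = 0" using 1 k_pos by simp
      ultimately show ?thesis using ab nn(1) by simp
    next
      case 2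
      then have "V r z - v 0 r z = 0" using V_cont_pieces(1)[OF r0(1), of z] by simp
      moreover have "?q = 0" using 2 by simp
      ultimately show ?thesis using ab nn(1) by simp
    next
      case 3
      have zg: "0 \<le> z - k" "z - k \<le> \<bar>g\<bar>" using 3 y \<Delta> unfolding z_def by linarith+
      have q: "(z - k)\<^sup>2 \<le> g\<^sup>2" using power_mono[OF zg(2,1), of 2] by simp
      have "V r z - v 0 r z \<le> - A / 2 * (z - k)\<^sup>2"
        using V_cont_pieces(2)[OF r0(1), of z] v_0_above[OF r0(1), of z] 3 by (simp add: A_def)
      then have 1: "?L \<le> e * (- A / 2 * (z - k)\<^sup>2)" using e by (intro mult_left_mono) auto
      show ?thesis
      proof (cases "k \<le> x")
        case True
        have "e * (- A / 2 * (z - k)\<^sup>2) = - ((z - k)\<^sup>2 / 2) * A + (1 - e) * (A / 2 * (z - k)\<^sup>2)"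
          by (simp add: algebra_simps)
        moreover have "(1 - e) * (A / 2 * (z - k)\<^sup>2) \<le> (B * \<epsilon>) * (B * g\<^sup>2)"
        proof -
          have "A / 2 * (z - k)\<^sup>2 \<le> \<bar>A / 2\<bar> * (z - k)\<^sup>2" by (intro mult_right_mono) auto
          also have "\<dots> \<le> B * g\<^sup>2" using A B0 q by (intro mult_mono) auto
          finally have "(1 - e) * (A / 2 * (z - k)\<^sup>2) \<le> (1 - e) * (B * g\<^sup>2)"
            using e by (intro mult_left_mono) auto
          also have "\<dots> \<le> (B * \<epsilon>) * (B * g\<^sup>2)" using e B0 by (intro mult_right_mono) auto
          finally show ?thesis .
        qed
        moreover have "(B * \<epsilon>) * (B * g\<^sup>2) = B\<^sup>2 * (\<epsilon> * g\<^sup>2)" by (simp add: power2_eq_square)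
        moreover have "- ?q * A = - ((z - k)\<^sup>2 / 2) * A" using True 3 by simp
        ultimately show ?thesis using 1 ab by linarith
      next
        case False
        have d: "0 < k - x" "k - x \<le> \<bar>g\<bar>" using False zg 3 y \<Delta> unfolding z_def by linarith+
        have "e * (- A / 2 * (z - k)\<^sup>2) \<le> 1 * (B * g\<^sup>2)"
        proof -
          have "e * (- A / 2 * (z - k)\<^sup>2) \<le> e * (B * g\<^sup>2)"
          proof (intro mult_left_mono)
            have "- A / 2 * (z - k)\<^sup>2 \<le> \<bar>A / 2\<bar> * (z - k)\<^sup>2" by (intro mult_right_mono) auto
            also have "\<dots> \<le> B * g\<^sup>2" using A B0 q by (intro mult_mono) auto
            finally show "- A / 2 * (z - k)\<^sup>2 \<le> B * g\<^sup>2" .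
          qed (use e in auto)
          also have "\<dots> \<le> 1 * (B * g\<^sup>2)" using e B0 by (intro mult_right_mono) auto
          finally show ?thesis .
        qed
        also have "\<dots> \<le> B * (g ^ 4 / (k - x)\<^sup>2)" using power_le_fourth(3)[OF d] B0
          unfolding mult_1 by (intro mult_left_mono)
        also have "\<dots> = ?b * g ^ 4" using False by simp
        finally have "?L \<le> ?b * g ^ 4" using 1 by linarith
        moreover have "?q = 0" using False by simp
        ultimately show ?thesis using ab nn(1) by simp
      qed
    qed
  qed
  have "(x - y) + \<Delta> + e * V r z - V r x - (e * v 0 r (y + g) - v 0 r y)
     = ((x - y) + v 0 r y - V r x) + (\<Delta> + e * (v 0 r z - v 0 r (y + g))) + e * (V r z - v 0 r z)"
    by (simp add: algebra_simps)
  moreover have "(((k - y)\<^sup>2 - (k - min x k)\<^sup>2) / 2 + \<Delta> * (k - y) - (if k \<le> x \<and> k < z then (z - k)\<^sup>2 / 2 else 0)) * A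
    = ((k - y)\<^sup>2 - (k - min x k)\<^sup>2) / 2 * A + \<Delta> * (k - y) * A + - (if k \<le> x \<and> k < z then (z - k)\<^sup>2 / 2 else 0) * A"
    by (simp only: algebra_simps)
  ultimately show ?thesis unfolding e_def[symmetric] A_def[symmetric] using gap div over by linarith
qed

text \<open>
  Above the barrier, waiting for a time \<open>\<epsilon>\<close> earns the drift \<open>\<mu> \<epsilon>\<close> and loses the interest
  \<open>r \<epsilon> h\<close> on the value at the barrier (and on the excess, which only lowers the gain); the balance
  \<open>\<mu> - r h\<close> is a multiple of \<open>v 2 r k\<close>.  If the path falls below the barrier, the loss of value there
  is quadratic in \<open>k - z\<close>, again with coefficient \<open>v 2 r k\<close>.
\<close>

lemma step_from_high:
  fixes x K g :: real
  assumes r: "rl \<le> r" "r \<le> rh" and y: "k \<le> y" "y \<le> x"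
    and \<epsilon>: "0 < \<epsilon>" "\<epsilon> \<le> 1" "K * \<epsilon> \<le> k / 2" and \<Delta>: "0 \<le> \<Delta>" "\<Delta> \<le> K * \<epsilon>" and K: "0 < K"
  defines "z \<equiv> y + g - \<Delta>"
  shows "(x - y) + \<Delta> + exp (- (r * \<epsilon>)) * V r z - V r x - exp (- (r * \<epsilon>)) * (g - \<mu> * \<epsilon>)
    \<le> ((if 0 \<le> z \<and> z < k then (k - z)\<^sup>2 / 2 else 0) - \<epsilon> * \<sigma>\<^sup>2 / 2) * v 2 r k
      + (K * B + B\<^sup>2 * (B + x) + 2 * B\<^sup>2 * K\<^sup>2) * \<epsilon>\<^sup>2 + 2 * B\<^sup>2 * (\<epsilon> * g\<^sup>2)
      + 2 / (k / 2) ^ 3 * g ^ 4"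
proof -
  have r0: "0 < r" "r \<le> B" using r rl_pos rh_le by linarith+
  have B0: "0 \<le> B" "0 < B" using B_ge by linarith+
  define e where "e = exp (- (r * \<epsilon>))"
  define A where "A = v 2 r k"
  define h where "h = v 0 r k"
  have A: "\<bar>A\<bar> \<le> B" unfolding A_def by (rule v_2_abs[OF r])
  have h: "0 \<le> h" "h \<le> B" unfolding h_def using v_0_nonneg[OF r0(1), of k] k_pos v_0_k_le[OF r] by auto
  have re0: "0 \<le> r * \<epsilon>" using r0 \<epsilon> by simp
  note eb = exp_neg_bounds[OF re0, folded e_def]
  have re: "r * \<epsilon> \<le> B * \<epsilon>" using r0 \<epsilon> by (intro mult_right_mono) auto
  have e: "0 < e" "e \<le> 1" "1 - e \<le> B * \<epsilon>" "0 \<le> 1 - e" using eb re by (auto simp: e_def)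
  define q where "q = (if 0 \<le> z \<and> z < k then k - z else 0)"
  define X where "X = 2 * (g ^ 4 / (k / 2) ^ 3)"
  have X0: "0 \<le> X" using k_pos by (simp add: X_def)
  have Vx: "V r x = h + (x - k)" using V_cont_pieces(2)[OF r0(1), of x] y by (simp add: h_def)
  have q2: "q\<^sup>2 \<le> 2 * g\<^sup>2 + 2 * (K * \<epsilon>)\<^sup>2"
  proof -
    have "0 \<le> q" "q \<le> \<bar>g\<bar> + K * \<epsilon>" using y \<Delta> K \<epsilon> by (auto simp: q_def z_def)
    then have "q\<^sup>2 \<le> (\<bar>g\<bar> + K * \<epsilon>)\<^sup>2" by (intro power_mono) auto
    also have "\<dots> \<le> 2 * g\<^sup>2 + 2 * (K * \<epsilon>)\<^sup>2"
      using zero_le_power2[of "\<bar>g\<bar> - K * \<epsilon>"] by (simp add: power2_eq_square algebra_simps)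
    finally show ?thesis .
  qed
  have Vz: "V r z \<le> h + (y + g - \<Delta> - k) + A / 2 * q\<^sup>2 + X"
  proof -
    consider "z < 0" | "0 \<le> z" "z < k" | "k \<le> z" by linarith
    then show ?thesis
    proof cases
      case 1
      have g: "k / 2 \<le> \<bar>g\<bar>" "k - z \<le> 2 * \<bar>g\<bar>" using 1 y \<Delta> \<epsilon>(3) unfolding z_def by linarith+
      have "2 * \<bar>g\<bar> \<le> X" unfolding X_def using power_le_fourth(2)[OF _ g(1)] k_pos by simp
      moreover have "q = 0" using 1 by (simp add: q_def)
      ultimately show ?thesis using V_cont_pieces(3)[OF r0(1), of z] 1 g h by (simp add: z_def)
    next
      case 2
      have "V r z = v 0 r z" using V_cont_pieces(1)[OF r0(1), of z] 2 by simp
      moreover have "(k - z) - v 2 r k / 2 * ((k - z)\<^sup>2 - (k - k)\<^sup>2) + 0 / 6 * ((k - z) ^ 3 - (k - k) ^ 3) \<le> v 0 r k - v 0 r z"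
        by (rule v_0_gap[OF r0(1)]) (use 2 v_3_pos[OF r0(1)] in \<open>auto intro: less_imp_le\<close>)
      moreover have "q = k - z" using 2 by (simp add: q_def)
      ultimately show ?thesis using X0 by (simp add: z_def h_def A_def)
    next
      case 3
      have "q = 0" using 3 by (simp add: q_def)
      then show ?thesis using V_cont_pieces(2)[OF r0(1), of z] 3 X0 by (simp add: z_def h_def)
    qed
  qed
  define P where "P = h + (y - k)"
  have P: "h \<le> P" "0 \<le> P" "P \<le> B + x" using h y k_pos by (auto simp: P_def)
  have "e * V r z \<le> e * (P + g - \<Delta> + A / 2 * q\<^sup>2 + X)"
    using Vz e by (intro mult_left_mono) (auto simp: P_def)
  then have 1: "(x - y) + \<Delta> + e * V r z - V r x - e * (g - \<mu> * \<epsilon>)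
     \<le> (1 - e) * \<Delta> - (1 - e) * P + e * (\<mu> * \<epsilon>) + e * (A / 2 * q\<^sup>2) + e * X"
    using Vx by (simp add: algebra_simps P_def)
  have 2: "(1 - e) * \<Delta> \<le> (B * \<epsilon>) * (K * \<epsilon>)" using e \<Delta> B0 \<epsilon> by (intro mult_mono) auto
  have 3: "- ((1 - e) * P) \<le> - (r * \<epsilon> * h) + (B * \<epsilon>)\<^sup>2 * (B + x)"
  proof -
    have "(r * \<epsilon> - (r * \<epsilon>)\<^sup>2 / 2) * P \<le> (1 - e) * P" using eb(3) P by (intro mult_right_mono) auto
    moreover have "(r * \<epsilon>)\<^sup>2 / 2 * P \<le> (B * \<epsilon>)\<^sup>2 * (B + x)"
    proof (rule mult_mono)
      show "(r * \<epsilon>)\<^sup>2 / 2 \<le> (B * \<epsilon>)\<^sup>2"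
        using power_mono[OF re re0, of 2] zero_le_power2[of "B * \<epsilon>"] by linarith
    qed (use P in auto)
    moreover have "r * \<epsilon> * h \<le> r * \<epsilon> * P" using re0 P by (intro mult_left_mono) auto
    ultimately show ?thesis by (simp add: left_diff_distrib)
  qed
  have 4: "e * (\<mu> * \<epsilon>) \<le> \<mu> * \<epsilon>" using e mu_pos \<epsilon> by (simp add: mult_left_le_one_le)
  have 5: "e * (A / 2 * q\<^sup>2) \<le> q\<^sup>2 / 2 * A + (B * \<epsilon>) * (B * (2 * g\<^sup>2 + 2 * (K * \<epsilon>)\<^sup>2))"
  proof -
    have "e * (A / 2 * q\<^sup>2) = q\<^sup>2 / 2 * A + (1 - e) * (- A / 2 * q\<^sup>2)" by (simp add: field_simps)
    moreover have "(1 - e) * (- A / 2 * q\<^sup>2) \<le> (1 - e) * (B * (2 * g\<^sup>2 + 2 * (K * \<epsilon>)\<^sup>2))"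
    proof (intro mult_left_mono)
      have "- A / 2 * q\<^sup>2 \<le> \<bar>A / 2\<bar> * q\<^sup>2" by (intro mult_right_mono) auto
      also have "\<dots> \<le> B * (2 * g\<^sup>2 + 2 * (K * \<epsilon>)\<^sup>2)" using A B0 q2 by (intro mult_mono) auto
      finally show "- A / 2 * q\<^sup>2 \<le> B * (2 * g\<^sup>2 + 2 * (K * \<epsilon>)\<^sup>2)" .
    qed (use e in auto)
    moreover have "(1 - e) * (B * (2 * g\<^sup>2 + 2 * (K * \<epsilon>)\<^sup>2)) \<le> (B * \<epsilon>) * (B * (2 * g\<^sup>2 + 2 * (K * \<epsilon>)\<^sup>2))"
      using e B0 by (intro mult_right_mono) auto
    ultimately show ?thesis by linarith
  qed
  have 6: "e * X \<le> X" using e X0 by (simp add: mult_left_le_one_le)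
  have 7: "\<mu> * \<epsilon> - r * \<epsilon> * h = - (\<epsilon> * \<sigma>\<^sup>2 / 2) * A"
    using arg_cong[OF v_2_k[OF r0(1)], of "\<lambda>u. \<epsilon> * u"] by (simp add: A_def h_def v_0_k algebra_simps)
  have 8: "(B * \<epsilon>) * (K * \<epsilon>) + (B * \<epsilon>)\<^sup>2 * (B + x) + (B * \<epsilon>) * (B * (2 * g\<^sup>2 + 2 * (K * \<epsilon>)\<^sup>2)) + X
     \<le> (K * B + B\<^sup>2 * (B + x) + 2 * B\<^sup>2 * K\<^sup>2) * \<epsilon>\<^sup>2 + 2 * B\<^sup>2 * (\<epsilon> * g\<^sup>2) + 2 / (k / 2) ^ 3 * g ^ 4"
  proof -
    have "(2 * B\<^sup>2 * K\<^sup>2 * \<epsilon>\<^sup>2) * \<epsilon> \<le> (2 * B\<^sup>2 * K\<^sup>2 * \<epsilon>\<^sup>2) * 1" using \<epsilon> by (intro mult_left_mono) auto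
    then show ?thesis by (simp add: X_def power2_eq_square algebra_simps)
  qed
  have 9: "((if 0 \<le> z \<and> z < k then (k - z)\<^sup>2 / 2 else 0) - \<epsilon> * \<sigma>\<^sup>2 / 2) * A = q\<^sup>2 / 2 * A + - (\<epsilon> * \<sigma>\<^sup>2 / 2) * A"
    by (simp add: q_def algebra_simps)
  show ?thesis unfolding e_def[symmetric] A_def[symmetric] 9 using 1 2 3 4 5 6 7 8 by linarith
qed

text \<open>
  The three cases combined.  The coefficient \<open>c\<close> does not depend on \<open>r\<close>, so that integration over
  the rates leaves \<open>c\<close> times the weighted mean of \<open>v 2 r k\<close>.  That mean vanishes for \<open>x \<ge> k\<close> and is
  nonpositive for \<open>x < k\<close>; hence the sign of \<open>c\<close> matters only in the second case.
\<close>

lemma one_step_estimate: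
  assumes x: "0 < x" and K: "0 < K"
  obtains C \<epsilon>1 where "0 < C" "0 < \<epsilon>1" "\<epsilon>1 \<le> 1"
    "\<And>\<epsilon> a \<Delta> g. 0 < \<epsilon> \<Longrightarrow> \<epsilon> \<le> \<epsilon>1 \<Longrightarrow> 0 \<le> a \<Longrightarrow> a \<le> x \<Longrightarrow> 0 \<le> \<Delta> \<Longrightarrow> \<Delta> \<le> K * \<epsilon> \<Longrightarrow>
      \<exists>c. (x < k \<longrightarrow> 0 \<le> c) \<and> (\<forall>r\<in>{rl..rh}.
        a + \<Delta> + exp (- (r * \<epsilon>)) * V r (x - a + g - \<Delta>) - V r x - one_step_martingale x r \<epsilon> (x - a) g
          \<le> c * v 2 r k + C * (\<epsilon>\<^sup>2 + \<epsilon> * \<bar>g\<bar> + \<epsilon> * g\<^sup>2 + g ^ 4) * exp (C * \<bar>g\<bar>))"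
proof -
  define \<eta> where "\<eta> = min x k / 2"
  define c0 where "c0 = m / 6 * ((k - min x k / 2) ^ 3 - (k - min x k) ^ 3)"
  have \<eta>0: "0 < \<eta>" using x k_pos by (simp add: \<eta>_def)
  have c00: "0 < c0"
    unfolding c0_def by (rule gap_pos[OF x])
  have B0: "0 \<le> B" using B_ge by linarith
  \<comment> \<open>For such \<open>\<epsilon>\<close> the dividends \<open>K \<epsilon>\<close> are covered by half of the fixed loss \<open>c0\<close> and cannot ruin the surplus from \<open>\<eta>\<close>.\<close>
  define \<epsilon>1 where "\<epsilon>1 = min 1 (min (c0 / (2 * K)) (\<eta> / (2 * K)))"
  define C1 where "C1 = B * (1 / (c0 / (2 * B)) ^ 3)"
  define C2 where "C2 = K * B + B\<^sup>2 * K * k + B * K\<^sup>2"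
  define C3 where "C3 = B * K + 2 * B\<^sup>2"
  define C4 where "C4 = B / (\<eta> / 2) ^ 4 + (if x < k then B / (k - x)\<^sup>2 else 0)"
  define C5 where "C5 = K * B + B\<^sup>2 * (B + x) + 2 * B\<^sup>2 * K\<^sup>2"
  define C6 where "C6 = 2 / (k / 2) ^ 3"
  have Cs: "0 \<le> C1" "0 \<le> C2" "0 \<le> C3" "0 \<le> C4" "0 \<le> C5" "0 \<le> C6"
    unfolding C1_def C2_def C3_def C4_def C5_def C6_def using B0 K x k_pos \<eta>0 c00 by auto
  define C where "C = 1 + B + C1 + C2 + C3 + C4 + C5 + C6"
  have C: "1 \<le> C" "B \<le> C" "C1 \<le> C" "C2 \<le> C" "C3 \<le> C" "C4 \<le> C" "C5 \<le> C" "C6 \<le> C"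
    unfolding C_def using Cs B0 by linarith+
  have \<epsilon>1: "0 < \<epsilon>1" "\<epsilon>1 \<le> 1" "K * \<epsilon>1 \<le> c0 / 2" "K * \<epsilon>1 \<le> \<eta> / 2"
  proof -
    show "0 < \<epsilon>1" "\<epsilon>1 \<le> 1" using c00 \<eta>0 K by (auto simp: \<epsilon>1_def)
    have "\<epsilon>1 \<le> c0 / (2 * K)" "\<epsilon>1 \<le> \<eta> / (2 * K)" by (auto simp: \<epsilon>1_def)
    from this[THEN mult_left_mono, of K] show "K * \<epsilon>1 \<le> c0 / 2" "K * \<epsilon>1 \<le> \<eta> / 2" using K by simp_all
  qed
  show thesis
  proof (rule that[of C \<epsilon>1])
    show "0 < C" using C by linarith
    show "0 < \<epsilon>1" "\<epsilon>1 \<le> 1" by fact+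
    fix \<epsilon> a \<Delta> g :: real
    assume \<epsilon>: "0 < \<epsilon>" "\<epsilon> \<le> \<epsilon>1" and a: "0 \<le> a" "a \<le> x" and \<Delta>: "0 \<le> \<Delta>" "\<Delta> \<le> K * \<epsilon>"
    define y where "y = x - a"
    define z where "z = y + g - \<Delta>"
    define E where "E = \<epsilon>\<^sup>2 + \<epsilon> * \<bar>g\<bar> + \<epsilon> * g\<^sup>2 + g ^ 4"
    have y: "0 \<le> y" "y \<le> x" using a by (auto simp: y_def)
    have K\<epsilon>: "K * \<epsilon> \<le> K * \<epsilon>1" using \<epsilon> K by (intro mult_left_mono) auto
    have terms: "0 \<le> \<epsilon>\<^sup>2" "0 \<le> \<epsilon> * \<bar>g\<bar>" "0 \<le> \<epsilon> * g\<^sup>2" "0 \<le> g ^ 4" using \<epsilon> by auto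
    have E: "0 \<le> E" unfolding E_def using terms by linarith
    have ex: "1 \<le> exp (C * \<bar>g\<bar>)" using C by simp
    have fin: "u \<le> C * E * exp (C * \<bar>g\<bar>)" if "u \<le> C * E" for u
    proof -
      have "C * E * 1 \<le> C * E * exp (C * \<bar>g\<bar>)" using E C ex by (intro mult_left_mono) auto
      then show ?thesis using that by linarith
    qed
    have CE: "C * E = C * \<epsilon>\<^sup>2 + C * (\<epsilon> * \<bar>g\<bar>) + C * (\<epsilon> * g\<^sup>2) + C * g ^ 4"
      by (simp only: E_def distrib_left)
    have mono: "c * t \<le> C * t" if "c \<le> C" "0 \<le> t" for c t using that by (rule mult_right_mono)
    have C0t: "0 \<le> C * t" if "0 \<le> t" for t using that C by simp
    consider "y < \<eta>" | "\<eta> \<le> y" "y < k" | "\<eta> \<le> y" "k \<le> y" by linarith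
    then have "\<exists>c. (x < k \<longrightarrow> 0 \<le> c) \<and> (\<forall>r\<in>{rl..rh}.
        a + \<Delta> + exp (- (r * \<epsilon>)) * V r z - V r x - one_step_martingale x r \<epsilon> y g
          \<le> c * v 2 r k + C * E * exp (C * \<bar>g\<bar>))"
    proof cases
      case 1
      let ?c = "((k - y)\<^sup>2 - (k - min x k)\<^sup>2) / 2"
      have "0 \<le> ?c"
        using power_mono[of "k - min x k" "k - y" 2] 1 \<eta>0 x k_pos by (auto simp: \<eta>_def)
      moreover have "a + \<Delta> + exp (- (r * \<epsilon>)) * V r z - V r x - one_step_martingale x r \<epsilon> y g
          \<le> ?c * v 2 r k + C * E * exp (C * \<bar>g\<bar>)" if r: "r \<in> {rl..rh}" for r
      proof -
        have "(x - y) + \<Delta> + exp (- (r * \<epsilon>)) * V r z - V r x \<le> ?c * v 2 r k + B * (g ^ 4 / (c0 / (2 * B)) ^ 3)"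
          unfolding z_def c0_def
        proof (rule step_from_low[where K = K])
          show "K * \<epsilon> \<le> m / 6 * ((k - min x k / 2) ^ 3 - (k - min x k) ^ 3) / 2"
            unfolding c0_def[symmetric] using \<epsilon>1(3) K\<epsilon> by linarith
          show "y < min x k / 2" using 1 by (simp only: \<eta>_def)
        qed (use r x y \<epsilon> \<Delta> in auto)
        moreover have "B * (g ^ 4 / (c0 / (2 * B)) ^ 3) = C1 * g ^ 4" by (simp add: C1_def)
        moreover have "one_step_martingale x r \<epsilon> y g = 0" using 1 by (simp add: one_step_martingale_def \<eta>_def)
        moreover have "C1 * g ^ 4 \<le> C * E * exp (C * \<bar>g\<bar>)"
          by (rule fin) (use CE mono[OF C(3) terms(4)] C0t[OF terms(1)] C0t[OF terms(2)] C0t[OF terms(3)] in linarith)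
        ultimately show ?thesis by (simp add: y_def)
      qed
      ultimately show ?thesis by blast
    next
      case 2
      let ?c = "((k - y)\<^sup>2 - (k - min x k)\<^sup>2) / 2 + \<Delta> * (k - y) - (if k \<le> x \<and> k < z then (z - k)\<^sup>2 / 2 else 0)"
      have "0 \<le> ?c" if "x < k"
      proof -
        have "(k - min x k)\<^sup>2 \<le> (k - y)\<^sup>2" using that y by (intro power_mono) auto
        moreover have "0 \<le> \<Delta> * (k - y)" using \<Delta> 2 by simp
        ultimately show ?thesis using that by simp
      qed
      moreover have "a + \<Delta> + exp (- (r * \<epsilon>)) * V r z - V r x - one_step_martingale x r \<epsilon> y g
          \<le> ?c * v 2 r k + C * E * exp (C * \<bar>g\<bar>)" if r: "r \<in> {rl..rh}" for r
      proof -
        let ?b = "if x < k then B / (k - x)\<^sup>2 else 0"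
        have "(x - y) + \<Delta> + exp (- (r * \<epsilon>)) * V r z - V r x - (exp (- (r * \<epsilon>)) * v 0 r (y + g) - v 0 r y)
          \<le> ?c * v 2 r k + C2 * \<epsilon>\<^sup>2 + B * K * (\<epsilon> * \<bar>g\<bar>) + B\<^sup>2 * (\<epsilon> * g\<^sup>2)
            + (B / (\<eta> / 2) ^ 4 * exp (B * \<bar>g\<bar>) + ?b) * g ^ 4"
          unfolding z_def C2_def \<eta>_def
        proof (rule step_from_middle)
          show "min x k / 2 \<le> y" "K * \<epsilon> \<le> min x k / 2 / 2"
            using 2(1) K\<epsilon> \<epsilon>1(4) unfolding \<eta>_def by linarith+
        qed (use r x y 2 \<epsilon> \<Delta> \<epsilon>1(2) K in auto)
        moreover have "one_step_martingale x r \<epsilon> y g = exp (- (r * \<epsilon>)) * v 0 r (y + g) - v 0 r y"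
          using 2 unfolding one_step_martingale_def \<eta>_def by (simp only: not_less[symmetric] if_False if_True)
        moreover have "C2 * \<epsilon>\<^sup>2 + B * K * (\<epsilon> * \<bar>g\<bar>) + B\<^sup>2 * (\<epsilon> * g\<^sup>2)
            + (B / (\<eta> / 2) ^ 4 * exp (B * \<bar>g\<bar>) + ?b) * g ^ 4 \<le> C * E * exp (C * \<bar>g\<bar>)"
        proof -
          have b: "0 \<le> ?b" "0 \<le> B / (\<eta> / 2) ^ 4" using B0 \<eta>0 by auto
          have "exp (B * \<bar>g\<bar>) \<le> exp (C * \<bar>g\<bar>)" using C by (simp add: mult_right_mono)
          from mult_left_mono[OF this b(2)] mult_left_mono[OF ex b(1)]
          have "B / (\<eta> / 2) ^ 4 * exp (B * \<bar>g\<bar>) + ?b \<le> C4 * exp (C * \<bar>g\<bar>)"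
            unfolding C4_def distrib_right by linarith
          also have "\<dots> \<le> C * exp (C * \<bar>g\<bar>)" using C by (intro mult_right_mono) auto
          finally have 4: "(B / (\<eta> / 2) ^ 4 * exp (B * \<bar>g\<bar>) + ?b) * g ^ 4 \<le> C * exp (C * \<bar>g\<bar>) * g ^ 4"
            using terms by (intro mult_right_mono) auto
          have lift: "c * t \<le> C * exp (C * \<bar>g\<bar>) * t" if "c \<le> C" "0 \<le> t" for c t
          proof -
            have "C * 1 \<le> C * exp (C * \<bar>g\<bar>)" using C ex by (intro mult_left_mono) auto
            then show ?thesis using that by (intro mult_right_mono) auto
          qed
          have "0 \<le> B * K" "0 \<le> B\<^sup>2" using B0 K by auto
          then have cc: "B * K \<le> C" "B\<^sup>2 \<le> C" using C(5) unfolding C3_def by linarith+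
          have "C * E * exp (C * \<bar>g\<bar>) = C * exp (C * \<bar>g\<bar>) * \<epsilon>\<^sup>2 + C * exp (C * \<bar>g\<bar>) * (\<epsilon> * \<bar>g\<bar>)
             + C * exp (C * \<bar>g\<bar>) * (\<epsilon> * g\<^sup>2) + C * exp (C * \<bar>g\<bar>) * g ^ 4"
            unfolding E_def by (simp add: algebra_simps)
          then show ?thesis using 4 lift[OF C(4) terms(1)] lift[OF cc(1) terms(2)] lift[OF cc(2) terms(3)]
            by linarith
        qed
        ultimately show ?thesis by (simp add: y_def)
      qed
      ultimately show ?thesis by blast
    next
      case 3
      let ?c = "(if 0 \<le> z \<and> z < k then (k - z)\<^sup>2 / 2 else 0) - \<epsilon> * \<sigma>\<^sup>2 / 2"
      have "a + \<Delta> + exp (- (r * \<epsilon>)) * V r z - V r x - one_step_martingale x r \<epsilon> y g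
          \<le> ?c * v 2 r k + C * E * exp (C * \<bar>g\<bar>)" if r: "r \<in> {rl..rh}" for r
      proof -
        have "\<eta> / 2 \<le> k / 2" using k_pos x by (auto simp: \<eta>_def)
        then have "(x - y) + \<Delta> + exp (- (r * \<epsilon>)) * V r z - V r x - exp (- (r * \<epsilon>)) * (g - \<mu> * \<epsilon>)
          \<le> ?c * v 2 r k + C5 * \<epsilon>\<^sup>2 + 2 * B\<^sup>2 * (\<epsilon> * g\<^sup>2) + C6 * g ^ 4"
          unfolding z_def C5_def C6_def
        proof (intro step_from_high)
          assume "\<eta> / 2 \<le> k / 2"
          then show "K * \<epsilon> \<le> k / 2" using K\<epsilon> \<epsilon>1(4) by linarith
        qed (use r x y 3 \<epsilon> \<Delta> \<epsilon>1(2) K in auto)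
        moreover have "one_step_martingale x r \<epsilon> y g = exp (- (r * \<epsilon>)) * (g - \<mu> * \<epsilon>)"
          using 3 unfolding one_step_martingale_def \<eta>_def by (simp only: not_less[symmetric] if_False)
        moreover have "C5 * \<epsilon>\<^sup>2 + 2 * B\<^sup>2 * (\<epsilon> * g\<^sup>2) + C6 * g ^ 4 \<le> C * E * exp (C * \<bar>g\<bar>)"
        proof (rule fin)
          have "2 * B\<^sup>2 \<le> C" using C(5) mult_nonneg_nonneg[OF B0 less_imp_le[OF K]] unfolding C3_def by linarith
          from mono[OF this terms(3)] mono[OF C(7) terms(1)] mono[OF C(8) terms(4)] C0t[OF terms(2)]
          show "C5 * \<epsilon>\<^sup>2 + 2 * B\<^sup>2 * (\<epsilon> * g\<^sup>2) + C6 * g ^ 4 \<le> C * E" unfolding CE by linarith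
        qed
        ultimately show ?thesis by (simp add: y_def)
      qed
      then show ?thesis using 3 y by (intro exI[of _ ?c]) auto
    qed
    then show "\<exists>c. (x < k \<longrightarrow> 0 \<le> c) \<and> (\<forall>r\<in>{rl..rh}.
        a + \<Delta> + exp (- (r * \<epsilon>)) * V r (x - a + g - \<Delta>) - V r x - one_step_martingale x r \<epsilon> (x - a) g
          \<le> c * v 2 r k + C * (\<epsilon>\<^sup>2 + \<epsilon> * \<bar>g\<bar> + \<epsilon> * g\<^sup>2 + g ^ 4) * exp (C * \<bar>g\<bar>))"
      unfolding E_def y_def z_def .
  qed
qed

end

section \<open>Exponential moments of Brownian motion\<close>

lemma normal_density_exp:
  assumes h: "0 < h"
  shows "normal_density 0 (sqrt h) x * exp (c * x) = exp (c\<^sup>2 * h / 2) * normal_density (c * h) (sqrt h) x"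
proof -
  have "- (x - 0)\<^sup>2 / (2 * (sqrt h)\<^sup>2) + c * x = c\<^sup>2 * h / 2 + - (x - c * h)\<^sup>2 / (2 * (sqrt h)\<^sup>2)"
    using h by (simp add: field_simps power2_eq_square)
  then have "exp (- (x - 0)\<^sup>2 / (2 * (sqrt h)\<^sup>2)) * exp (c * x)
      = exp (c\<^sup>2 * h / 2) * exp (- (x - c * h)\<^sup>2 / (2 * (sqrt h)\<^sup>2))"
    by (simp only: exp_add[symmetric])
  from arg_cong[OF this, of "\<lambda>u. 1 / sqrt (2 * pi * (sqrt h)\<^sup>2) * u"]
  show ?thesis unfolding normal_density_def by (simp only: mult.assoc mult.left_commute)
qed

primrec running_max :: "(nat \<Rightarrow> real) \<Rightarrow> nat \<Rightarrow> real" where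
  "running_max s 0 = s 0"
| "running_max s (Suc n) = max (running_max s n) (s (Suc n))"

lemma running_max_ge: "i \<le> n \<Longrightarrow> s i \<le> running_max s n"
  by (induction n) (auto simp: le_Suc_eq le_max_iff_disj)

lemma running_max_le_sum: "(\<And>i. 0 \<le> s i) \<Longrightarrow> running_max s n \<le> (\<Sum>i\<le>n. s i)"
  by (induction n) (auto simp: add_increasing add_increasing2 sum_nonneg)

lemma running_max_nonneg: "(\<And>i. 0 \<le> s i) \<Longrightarrow> 0 \<le> running_max s n"
  using running_max_ge[of 0 n s] by (auto intro: order_trans)

text \<open>
  Doob's \<open>L\<^sup>2\<close> inequality holds path by path: the correction is a discrete stochastic integral, which
  has nonnegative expectation when \<open>s\<close> is a nonnegative submartingale.
\<close>

lemma pathwise_doob: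
  "(running_max s n)\<^sup>2 \<le> 4 * (s n)\<^sup>2 - 4 * (\<Sum>i<n. running_max s i * (s (Suc i) - s i))"
proof -
  have "2 * (\<Sum>i<n. running_max s i * (s (Suc i) - s i)) \<le> 2 * (running_max s n * s n) - (running_max s n)\<^sup>2"
  proof (induction n)
    case (Suc n)
    define M M' s' where "M = running_max s n" and "M' = running_max s (Suc n)" and "s' = s (Suc n)"
    have "0 \<le> (M' - M) * (2 * s' - M' - M)"
    proof (cases "s' \<le> M")
      case True then show ?thesis by (simp add: M_def M'_def s'_def)
    next
      case False
      then have "M' = s'" by (simp add: M_def M'_def s'_def)
      then have "(M' - M) * (2 * s' - M' - M) = (s' - M)\<^sup>2" by (simp add: power2_eq_square)
      then show ?thesis by simp
    qed
    then have "2 * (M * (s' - s n)) \<le> 2 * (M' * s') - M'\<^sup>2 - (2 * (M * s n) - M\<^sup>2)"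
      by (simp add: power2_eq_square algebra_simps)
    with Suc show ?case unfolding M_def M'_def s'_def sum.lessThan_Suc distrib_left by linarith
  qed (simp add: power2_eq_square)
  moreover have "running_max s n * s n * 2 \<le> (running_max s n)\<^sup>2 / 2 + 2 * (s n)\<^sup>2"
    using zero_le_power2[of "running_max s n - 2 * s n"] by (simp add: power2_eq_square algebra_simps)
  ultimately show ?thesis by linarith
qed

context brownian_space begin

lemma sets_F_M: "0 \<le> t \<Longrightarrow> A \<in> sets (F t) \<Longrightarrow> A \<in> sets M"
  using subalgebra_F[of t] by (auto simp: subalgebra_def)

lemma measurable_F_M: "0 \<le> t \<Longrightarrow> f \<in> borel_measurable (F t) \<Longrightarrow> f \<in> borel_measurable M"
  using measurable_from_subalg[OF subalgebra_F] by blast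

lemma measurable_F_mono: "s \<le> t \<Longrightarrow> f \<in> borel_measurable (F s) \<Longrightarrow> f \<in> borel_measurable (F t)"
  using measurable_from_subalg[of "F t" "F s"] sets_F_mono[of s t] space_F by (auto simp: subalgebra_def)

lemma null_sets_sets_F: "0 \<le> t \<Longrightarrow> N \<in> null_sets M \<Longrightarrow> N \<in> sets (F t)"
  using null_sets_F sets_F_mono[of 0 t] by blast

lemma W_measurable[measurable]: "0 \<le> t \<Longrightarrow> W t \<in> borel_measurable M"
  by (rule measurable_F_M[OF _ W_adapted])

lemma increment_exp:
  assumes "0 \<le> s" "s \<le> u"
  shows "integrable M (\<lambda>\<omega>. exp (c * (W u \<omega> - W s \<omega>)))"
    and "expectation (\<lambda>\<omega>. exp (c * (W u \<omega> - W s \<omega>))) = exp (c\<^sup>2 * (u - s) / 2)"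
proof -
  have "integrable M (\<lambda>\<omega>. exp (c * (W u \<omega> - W s \<omega>))) \<and>
     expectation (\<lambda>\<omega>. exp (c * (W u \<omega> - W s \<omega>))) = exp (c\<^sup>2 * (u - s) / 2)"
  proof (cases "s = u")
    case True then show ?thesis by (simp add: prob_space)
  next
    case False
    then have su: "s < u" "0 < u - s" using assms by auto
    note D = W_normal[OF assms(1) su(1)]
    have m: "(\<lambda>x. exp (c * x)) \<in> borel_measurable lborel" for c :: real by measurable
    have "integrable lborel (\<lambda>x. normal_density 0 (sqrt (u - s)) x * exp (c * x))"
      unfolding normal_density_exp[OF su(2)] using su by simp
    then have "integrable M (\<lambda>\<omega>. exp (c * (W u \<omega> - W s \<omega>)))"
      by (subst (asm) distributed_integrable[OF D m]) simp_all
    moreover have "expectation (\<lambda>\<omega>. exp (c * (W u \<omega> - W s \<omega>))) = (\<integral>x. normal_density 0 (sqrt (u - s)) x * exp (c * x) \<partial>lborel)"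
      by (rule distributed_integral[OF D m, symmetric]) simp
    moreover have "\<dots> = exp (c\<^sup>2 * (u - s) / 2)"
      unfolding normal_density_exp[OF su(2)] using su by simp
    ultimately show ?thesis by simp
  qed
  then show "integrable M (\<lambda>\<omega>. exp (c * (W u \<omega> - W s \<omega>)))"
    and "expectation (\<lambda>\<omega>. exp (c * (W u \<omega> - W s \<omega>))) = exp (c\<^sup>2 * (u - s) / 2)" by auto
qed

text \<open>
  The integrand \<open>f\<close> is known at time \<open>s\<close>, so this plays the role of conditioning on \<open>F s\<close>.
\<close>

lemma increment_independent:
  fixes f :: "'a \<Rightarrow> real" and g :: "real \<Rightarrow> real"
  assumes su: "0 \<le> s" "s < u" and f: "f \<in> borel_measurable (F s)" "integrable M f"
    and g: "g \<in> borel_measurable borel" "integrable M (\<lambda>\<omega>. g (W u \<omega> - W s \<omega>))"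
  shows "integrable M (\<lambda>\<omega>. f \<omega> * g (W u \<omega> - W s \<omega>))"
    and "expectation (\<lambda>\<omega>. f \<omega> * g (W u \<omega> - W s \<omega>)) = expectation f * expectation (\<lambda>\<omega>. g (W u \<omega> - W s \<omega>))"
proof -
  let ?X = "\<lambda>\<omega>. W u \<omega> - W s \<omega>"
  have u: "0 \<le> u" using su by linarith
  note [measurable] = measurable_F_M[OF su(1) f(1)] g(1) W_measurable[OF su(1)] W_measurable[OF u]
  have [measurable]: "?X \<in> borel_measurable M" by measurable
  have "indep_var borel f borel ?X"
    unfolding indep_var_eq
  proof (intro conjI)
    have "indep_set (sets (F s)) {?X -` B \<inter> space M | B. B \<in> sets borel}" by (rule W_indep[OF su])
    note ind = this[unfolded indep_sets2_eq]
    have "{f -` A \<inter> space M | A. A \<in> sets borel} \<subseteq> sets (F s)"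
      using measurable_sets[OF f(1)] unfolding space_F by blast
    from sets.sigma_sets_subset[OF this]
    have sub: "sigma_sets (space M) {f -` A \<inter> space M | A. A \<in> sets borel} \<subseteq> sets (F s)"
      unfolding space_F .
    have eq: "sigma_sets (space M) {?X -` A \<inter> space M | A. A \<in> sets borel}
        = {?X -` B \<inter> space M | B. B \<in> sets borel}"
      unfolding sets_vimage_algebra[symmetric] by (rule sets_vimage_algebra2) simp
    show "indep_set (sigma_sets (space M) {f -` A \<inter> space M | A. A \<in> sets borel})
      (sigma_sets (space M) {?X -` A \<inter> space M | A. A \<in> sets borel})"
      unfolding indep_sets2_eq eq
    proof (intro conjI ballI)
      show "sigma_sets (space M) {f -` A \<inter> space M | A. A \<in> sets borel} \<subseteq> events"
        by (rule order_trans[OF sub conjunct1[OF ind]])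
      show "{?X -` B \<inter> space M | B. B \<in> sets borel} \<subseteq> events"
        by (rule conjunct1[OF conjunct2[OF ind]])
      fix a b
      assume a: "a \<in> sigma_sets (space M) {f -` A \<inter> space M | A. A \<in> sets borel}"
        and b: "b \<in> {?X -` B \<inter> space M | B. B \<in> sets borel}"
      show "prob (a \<inter> b) = prob a * prob b"
        by (rule bspec[OF bspec[OF conjunct2[OF conjunct2[OF ind]] subsetD[OF sub a]] b])
    qed
  qed measurable
  from indep_var_compose[OF this measurable_ident g(1)]
  have i: "indep_var borel f borel (\<lambda>\<omega>. g (?X \<omega>))" by (simp add: comp_def id_def)
  show "integrable M (\<lambda>\<omega>. f \<omega> * g (?X \<omega>))" by (rule indep_var_integrable[OF i f(2) g(2)])
  show "expectation (\<lambda>\<omega>. f \<omega> * g (?X \<omega>)) = expectation f * expectation (\<lambda>\<omega>. g (?X \<omega>))"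
    by (rule indep_var_lebesgue_integral[OF i f(2) g(2)])
qed

end

lemma running_max_measurable:
  assumes "\<And>j. j \<le> i \<Longrightarrow> (\<lambda>\<omega>. s j \<omega>) \<in> borel_measurable N"
  shows "(\<lambda>\<omega>. running_max (\<lambda>j. s j \<omega>) i) \<in> borel_measurable N"
  using assms by (induction i) (auto intro!: borel_measurable_max)

lemma grid_approximation:
  fixes T S u :: real
  assumes S: "0 < S" and u: "u \<in> {T..T + S}"
  obtains i where "\<And>n. i n \<le> Suc n" "\<And>n. T + real (i n) * (S / real (Suc n)) \<in> {T..T + S}"
    "(\<lambda>n. T + real (i n) * (S / real (Suc n))) \<longlonglongrightarrow> u"
proof -
  define h where "h n = S / real (Suc n)" for n
  have h: "0 < h n" for n using S by (simp add: h_def)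
  have hS: "real (Suc n) * h n = S" for n by (simp add: h_def)
  define i where "i n = nat \<lfloor>(u - T) / h n\<rfloor>" for n
  define t where "t n = T + real (i n) * h n" for n
  have i: "real (i n) \<le> (u - T) / h n" "(u - T) / h n < real (i n) + 1" for n
    unfolding i_def using u h[of n] by (auto simp: of_nat_nat)
  have iS: "i n \<le> Suc n" for n
  proof -
    have "(u - T) / h n \<le> S / h n" using u h[of n] by (intro divide_right_mono) auto
    also have "S / h n = real (Suc n)" using h[of n] hS[of n] by (simp add: field_simps)
    finally show ?thesis using i(1)[of n] by linarith
  qed
  have t: "t n \<le> u" "u - h n \<le> t n" "T \<le> t n" for n
    using i[of n] h[of n] by (auto simp: t_def field_simps)
  have h0: "h \<longlonglongrightarrow> 0" unfolding h_def[abs_def] by (rule LIMSEQ_Suc[OF lim_const_over_n])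
  have "t \<longlonglongrightarrow> u"
  proof (rule tendsto_sandwich)
    show "(\<lambda>n. u - h n) \<longlonglongrightarrow> u" using tendsto_diff[OF tendsto_const h0, of u] by simp
  qed (use t in auto)
  moreover have "t n \<in> {T..T + S}" for n using t[of n] u by auto
  ultimately show thesis using that[OF iS] unfolding t_def[abs_def] h_def by blast
qed

context brownian_space begin

lemma grid_maximal_inequality:
  fixes c T h :: real
  assumes T: "0 \<le> T" and h: "0 < h"
  defines "s \<equiv> \<lambda>i \<omega>. exp (c * (W (T + real i * h) \<omega> - W T \<omega>))"
  shows "(\<integral>\<^sup>+ \<omega>. ennreal ((running_max (\<lambda>i. s i \<omega>) n)\<^sup>2) \<partial>M) \<le> ennreal (4 * exp (2 * c\<^sup>2 * (real n * h)))"
proof -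
  define t where "t i = T + real i * h" for i
  have t: "T \<le> t i" "0 \<le> t i" "t i < t (Suc i)" for i using T h by (simp_all add: t_def algebra_simps)
  have tmono: "j \<le> i \<Longrightarrow> t j \<le> t i" for i j using h by (simp add: t_def mult_right_mono)
  have s: "s i \<omega> = exp (c * (W (t i) \<omega> - W T \<omega>))" for i \<omega> by (simp add: s_def t_def)
  have sF: "s i \<in> borel_measurable (F (t j))" if "i \<le> j" for i j
  proof -
    have [measurable]: "W (t i) \<in> borel_measurable (F (t j))" "W T \<in> borel_measurable (F (t j))"
      using measurable_F_mono[OF tmono[OF that] W_adapted[OF t(2)]] measurable_F_mono[OF t(1) W_adapted[OF T]] by auto
    show ?thesis unfolding s[abs_def] by measurable
  qed
  have sM[measurable]: "s i \<in> borel_measurable M" for i by (rule measurable_F_M[OF t(2) sF[OF order_refl]])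
  define m where "m i \<omega> = running_max (\<lambda>i. s i \<omega>) i" for i \<omega>
  have mF: "m i \<in> borel_measurable (F (t i))" for i
    unfolding m_def[abs_def] by (intro running_max_measurable sF)
  have mM[measurable]: "m i \<in> borel_measurable M" for i by (rule measurable_F_M[OF t(2) mF])
  have s0: "0 \<le> s i \<omega>" for i \<omega> by (simp add: s)
  have m0: "0 \<le> m i \<omega>" for i \<omega> unfolding m_def by (rule running_max_nonneg) (rule s0)
  have sq: "(s i \<omega>)\<^sup>2 = exp ((2 * c) * (W (t i) \<omega> - W T \<omega>))" for i \<omega>
    by (simp add: s power2_eq_square exp_add[symmetric])
  have int2: "integrable M (\<lambda>\<omega>. (s i \<omega>)\<^sup>2)" for i
    unfolding sq by (rule increment_exp[OF T t(1)])
  have int11: "integrable M (\<lambda>\<omega>. s j \<omega> * s i \<omega>)" for i j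
  proof (rule Bochner_Integration.integrable_bound)
    show "integrable M (\<lambda>\<omega>. (s j \<omega>)\<^sup>2 + (s i \<omega>)\<^sup>2)" by (intro Bochner_Integration.integrable_add int2)
    have "s j \<omega> * s i \<omega> \<le> (s j \<omega>)\<^sup>2 + (s i \<omega>)\<^sup>2" for \<omega>
      using sum_squares_bound[of "s j \<omega>" "s i \<omega>"] mult_nonneg_nonneg[OF s0[of j \<omega>] s0[of i \<omega>]] by linarith
    then show "AE \<omega> in M. norm (s j \<omega> * s i \<omega>) \<le> norm ((s j \<omega>)\<^sup>2 + (s i \<omega>)\<^sup>2)"
      using s0 by (intro AE_I2) (simp add: abs_mult)
  qed measurable
  have intm: "integrable M (\<lambda>\<omega>. m i \<omega> * s i \<omega>)" for i
  proof (rule Bochner_Integration.integrable_bound)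
    show "integrable M (\<lambda>\<omega>. \<Sum>j\<le>i. s j \<omega> * s i \<omega>)" by (intro Bochner_Integration.integrable_sum int11)
    have "m i \<omega> * s i \<omega> \<le> (\<Sum>j\<le>i. s j \<omega> * s i \<omega>)" for \<omega>
      unfolding sum_distrib_right[symmetric] m_def by (intro mult_right_mono running_max_le_sum s0)
    moreover have "0 \<le> m i \<omega> * s i \<omega>" for \<omega> using m0 s0 by simp
    ultimately show "AE \<omega> in M. norm (m i \<omega> * s i \<omega>) \<le> norm (\<Sum>j\<le>i. s j \<omega> * s i \<omega>)"
      by (intro AE_I2) (smt (verit) real_norm_def)
  qed measurable
  define g where "g x = exp (c * x) - 1" for x :: real
  have gm: "g \<in> borel_measurable borel" unfolding g_def[abs_def] by measurable
  \<comment> \<open>The increments of the submartingale are its value times an independent factor of nonnegative mean.\<close>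
  have dec: "m i \<omega> * (s (Suc i) \<omega> - s i \<omega>) = (m i \<omega> * s i \<omega>) * g (W (t (Suc i)) \<omega> - W (t i) \<omega>)" for i \<omega>
  proof -
    have "s (Suc i) \<omega> = s i \<omega> * exp (c * (W (t (Suc i)) \<omega> - W (t i) \<omega>))"
      unfolding s exp_add[symmetric] by (simp add: algebra_simps)
    then show ?thesis by (simp add: g_def algebra_simps)
  qed
  have gi: "integrable M (\<lambda>\<omega>. g (W (t (Suc i)) \<omega> - W (t i) \<omega>))"
     and ge: "0 \<le> expectation (\<lambda>\<omega>. g (W (t (Suc i)) \<omega> - W (t i) \<omega>))" for i
  proof -
    note e = increment_exp[OF t(2) less_imp_le[OF t(3)], of c i]
    show "integrable M (\<lambda>\<omega>. g (W (t (Suc i)) \<omega> - W (t i) \<omega>))" unfolding g_def using e(1) by simp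
    have "expectation (\<lambda>\<omega>. g (W (t (Suc i)) \<omega> - W (t i) \<omega>)) = exp (c\<^sup>2 * (t (Suc i) - t i) / 2) - 1"
      unfolding g_def using e by (subst Bochner_Integration.integral_diff) (auto simp: prob_space)
    then show "0 \<le> expectation (\<lambda>\<omega>. g (W (t (Suc i)) \<omega> - W (t i) \<omega>))" using t(3)[of i] by simp
  qed
  note ii = increment_independent[OF t(2) t(3) borel_measurable_times[OF mF sF[OF order_refl]] intm gm gi]
  have mi: "integrable M (\<lambda>\<omega>. m i \<omega> * (s (Suc i) \<omega> - s i \<omega>))" for i
    unfolding dec by (rule ii(1))
  have mpos: "0 \<le> expectation (\<lambda>\<omega>. m i \<omega> * (s (Suc i) \<omega> - s i \<omega>))" for i
    unfolding dec ii(2) by (rule mult_nonneg_nonneg[OF Bochner_Integration.integral_nonneg ge]) (simp add: m0 s0)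
  let ?R = "\<lambda>\<omega>. 4 * (s n \<omega>)\<^sup>2 - 4 * (\<Sum>i<n. m i \<omega> * (s (Suc i) \<omega> - s i \<omega>))"
  have R: "(m n \<omega>)\<^sup>2 \<le> ?R \<omega>" for \<omega> unfolding m_def by (rule pathwise_doob)
  have Ri: "integrable M ?R"
    by (intro Bochner_Integration.integrable_diff integrable_mult_right Bochner_Integration.integrable_sum int2 mi)
  have "(\<integral>\<^sup>+ \<omega>. ennreal ((m n \<omega>)\<^sup>2) \<partial>M) \<le> (\<integral>\<^sup>+ \<omega>. ennreal (?R \<omega>) \<partial>M)"
    using R by (intro nn_integral_mono ennreal_leI)
  also have "\<dots> = ennreal (expectation ?R)"
    using R by (intro nn_integral_eq_integral Ri AE_I2) (meson order_trans zero_le_power2)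
  also have "expectation ?R = 4 * expectation (\<lambda>\<omega>. (s n \<omega>)\<^sup>2) - 4 * (\<Sum>i<n. expectation (\<lambda>\<omega>. m i \<omega> * (s (Suc i) \<omega> - s i \<omega>)))"
    using int2 mi by (simp add: Bochner_Integration.integral_diff Bochner_Integration.integral_sum Bochner_Integration.integrable_sum)
  also have "ennreal \<dots> \<le> ennreal (4 * expectation (\<lambda>\<omega>. (s n \<omega>)\<^sup>2))"
    using sum_nonneg[of "{..<n}" "\<lambda>i. expectation (\<lambda>\<omega>. m i \<omega> * (s (Suc i) \<omega> - s i \<omega>))"] mpos
    by (intro ennreal_leI) simp
  also have "expectation (\<lambda>\<omega>. (s n \<omega>)\<^sup>2) = exp (2 * c\<^sup>2 * (real n * h))"
    unfolding sq increment_exp(2)[OF T t(1)] by (simp add: t_def power2_eq_square)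
  finally show ?thesis unfolding m_def .
qed

text \<open>
  Maximal inequalities on finer and finer grids pass to the supremum by Fatou's lemma and
  continuity of the paths.  The maximal inequality bounds a square, which is why it is used with the
  exponent \<open>c / 2\<close>.
\<close>

lemma sup_increment_exp_one_sided:
  assumes T: "0 \<le> T" and S: "0 < S"
  shows "\<exists>H. H \<in> borel_measurable M \<and> (\<integral>\<^sup>+ \<omega>. H \<omega> \<partial>M) < \<infinity> \<and>
    (AE \<omega> in M. \<forall>u\<in>{T..T + S}. ennreal (exp (c * (W u \<omega> - W T \<omega>))) \<le> H \<omega>)"
proof -
  define h where "h n = S / real (Suc n)" for n
  have h: "0 < h n" for n using S by (simp add: h_def)
  have hS: "real (Suc n) * h n = S" for n by (simp add: h_def)
  define s where "s n i \<omega> = exp (c / 2 * (W (T + real i * h n) \<omega> - W T \<omega>))" for n i \<omega>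
  have sm[measurable]: "s n i \<in> borel_measurable M" for n i
  proof -
    have "0 \<le> T + real i * h n" using T h[of n] by simp
    note [measurable] = W_measurable[OF this] W_measurable[OF T]
    show ?thesis unfolding s_def[abs_def] by measurable
  qed
  define G where "G n \<omega> = ennreal ((running_max (\<lambda>i. s n i \<omega>) (Suc n))\<^sup>2)" for n \<omega>
  have Gm[measurable]: "G n \<in> borel_measurable M" for n
  proof -
    have [measurable]: "(\<lambda>\<omega>. running_max (\<lambda>i. s n i \<omega>) (Suc n)) \<in> borel_measurable M"
      by (rule running_max_measurable) measurable
    show ?thesis unfolding G_def[abs_def] by measurable
  qed
  have GI: "(\<integral>\<^sup>+ \<omega>. G n \<omega> \<partial>M) \<le> ennreal (4 * exp (2 * (c / 2)\<^sup>2 * S))" for n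
    using grid_maximal_inequality[OF T h[of n], where n = "Suc n" and c = "c / 2"] unfolding G_def s_def hS .
  define H where "H \<omega> = liminf (\<lambda>n. G n \<omega>)" for \<omega>
  have Hm: "H \<in> borel_measurable M" unfolding H_def[abs_def] by measurable
  have "(\<integral>\<^sup>+ \<omega>. H \<omega> \<partial>M) \<le> liminf (\<lambda>n. \<integral>\<^sup>+ \<omega>. G n \<omega> \<partial>M)"
    unfolding H_def by (rule nn_integral_liminf) measurable
  also have "\<dots> \<le> ennreal (4 * exp (2 * (c / 2)\<^sup>2 * S))"
    using GI by (intro Liminf_le) simp_all
  finally have HI: "(\<integral>\<^sup>+ \<omega>. H \<omega> \<partial>M) < \<infinity>" by (simp add: le_less_trans)
  have "AE \<omega> in M. \<forall>u\<in>{T..T + S}. ennreal (exp (c * (W u \<omega> - W T \<omega>))) \<le> H \<omega>"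
    using W_continuous
  proof eventually_elim
    case (elim \<omega>)
    show ?case
    proof
      fix u assume u: "u \<in> {T..T + S}"
      obtain i where iS: "\<And>n. i n \<le> Suc n" and tS: "\<And>n. T + real (i n) * h n \<in> {T..T + S}"
        and tu: "(\<lambda>n. T + real (i n) * h n) \<longlonglongrightarrow> u"
        using grid_approximation[OF S u] unfolding h_def by blast
      define t where "t n = T + real (i n) * h n" for n
      have t: "t \<longlonglongrightarrow> u" "\<And>n. 0 \<le> t n" using tu tS T by (auto simp: t_def[abs_def])
      then have "(\<lambda>n. W (t n) \<omega>) \<longlonglongrightarrow> W u \<omega>"
        using u T t by (intro continuous_on_tendsto_compose[OF elim]) auto
      then have "(\<lambda>n. ennreal (exp (c * (W (t n) \<omega> - W T \<omega>)))) \<longlonglongrightarrow> ennreal (exp (c * (W u \<omega> - W T \<omega>)))"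
        by (intro tendsto_intros)
      then have "ennreal (exp (c * (W u \<omega> - W T \<omega>))) = liminf (\<lambda>n. ennreal (exp (c * (W (t n) \<omega> - W T \<omega>))))"
        by (intro lim_imp_Liminf[symmetric]) simp_all
      also have "\<dots> \<le> H \<omega>"
        unfolding H_def
      proof (rule Liminf_mono, rule always_eventually, rule allI)
        fix n
        have "0 \<le> s n (i n) \<omega>" by (simp add: s_def)
        moreover have "s n (i n) \<omega> \<le> running_max (\<lambda>i. s n i \<omega>) (Suc n)"
          by (rule running_max_ge[where s = "\<lambda>i. s n i \<omega>", OF iS])
        ultimately have "(s n (i n) \<omega>)\<^sup>2 \<le> (running_max (\<lambda>i. s n i \<omega>) (Suc n))\<^sup>2" by (intro power_mono)
        moreover have "(s n (i n) \<omega>)\<^sup>2 = exp (c * (W (t n) \<omega> - W T \<omega>))"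
          by (simp add: s_def t_def power2_eq_square exp_add[symmetric])
        ultimately show "ennreal (exp (c * (W (t n) \<omega> - W T \<omega>))) \<le> G n \<omega>" by (simp add: G_def ennreal_leI)
      qed
      finally show "ennreal (exp (c * (W u \<omega> - W T \<omega>))) \<le> H \<omega>" .
    qed
  qed
  then show ?thesis using Hm HI by blast
qed

lemma sup_increment_exp:
  assumes T: "0 \<le> T" and S: "0 < S"
  obtains H where "integrable M H" "AE \<omega> in M. \<forall>u\<in>{T..T + S}. exp (c * \<bar>W u \<omega> - W T \<omega>\<bar>) \<le> H \<omega>"
proof -
  obtain H1 where H1[measurable]: "H1 \<in> borel_measurable M" and f1: "(\<integral>\<^sup>+ \<omega>. H1 \<omega> \<partial>M) < \<infinity>"
    and b1: "AE \<omega> in M. \<forall>u\<in>{T..T + S}. ennreal (exp (c * (W u \<omega> - W T \<omega>))) \<le> H1 \<omega>"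
    using sup_increment_exp_one_sided[OF T S] by blast
  obtain H2 where H2[measurable]: "H2 \<in> borel_measurable M" and f2: "(\<integral>\<^sup>+ \<omega>. H2 \<omega> \<partial>M) < \<infinity>"
    and b2: "AE \<omega> in M. \<forall>u\<in>{T..T + S}. ennreal (exp ((- c) * (W u \<omega> - W T \<omega>))) \<le> H2 \<omega>"
    using sup_increment_exp_one_sided[OF T S] by blast
  define H where "H \<omega> = enn2real (H1 \<omega> + H2 \<omega>)" for \<omega>
  have f: "(\<integral>\<^sup>+ \<omega>. H1 \<omega> + H2 \<omega> \<partial>M) < \<infinity>" using f1 f2 by (simp add: nn_integral_add)
  then have fin: "AE \<omega> in M. H1 \<omega> + H2 \<omega> \<noteq> \<infinity>" by (intro nn_integral_PInf_AE) auto
  have "integrable M H"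
  proof (rule integrableI_nonneg)
    have "(\<integral>\<^sup>+ \<omega>. ennreal (H \<omega>) \<partial>M) = (\<integral>\<^sup>+ \<omega>. H1 \<omega> + H2 \<omega> \<partial>M)"
      using fin unfolding H_def by (intro nn_integral_cong_AE) (auto simp: less_top)
    then show "(\<integral>\<^sup>+ \<omega>. ennreal (H \<omega>) \<partial>M) < \<infinity>" using f by simp
  qed (auto simp: H_def[abs_def])
  moreover have "AE \<omega> in M. \<forall>u\<in>{T..T + S}. exp (c * \<bar>W u \<omega> - W T \<omega>\<bar>) \<le> H \<omega>"
    using fin b1 b2
  proof eventually_elim
    case (elim \<omega>)
    show ?case
    proof
      fix u assume u: "u \<in> {T..T + S}"
      have "ennreal (exp (c * \<bar>W u \<omega> - W T \<omega>\<bar>)) \<le> H1 \<omega> + H2 \<omega>"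
      proof (cases "0 \<le> W u \<omega> - W T \<omega>")
        case True
        then show ?thesis using bspec[OF elim(2) u] by (simp add: add_increasing2)
      next
        case False
        then have "c * \<bar>W u \<omega> - W T \<omega>\<bar> = (- c) * (W u \<omega> - W T \<omega>)" by (simp add: algebra_simps)
        then show ?thesis using bspec[OF elim(3) u] by (simp add: add_increasing)
      qed
      also have "\<dots> = ennreal (H \<omega>)" unfolding H_def using elim(1) by (simp add: less_top)
      finally show "exp (c * \<bar>W u \<omega> - W T \<omega>\<bar>) \<le> H \<omega>" by (simp add: H_def)
    qed
  qed
  ultimately show thesis by (rule that)
qed

lemma increment_moments:
  assumes "0 \<le> s" "s < u"
  shows "integrable M (\<lambda>\<omega>. W u \<omega> - W s \<omega>)" "expectation (\<lambda>\<omega>. W u \<omega> - W s \<omega>) = 0"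
proof -
  note D = W_normal[OF assms]
  have pos: "0 < sqrt (u - s)" using assms by simp
  show "expectation (\<lambda>\<omega>. W u \<omega> - W s \<omega>) = 0" by (rule normal_distributed_expectation[OF pos D])
  have "integrable lborel (\<lambda>x. normal_density 0 (sqrt (u - s)) x * x)"
    by (rule integrable_normal_moment_nz_1[OF pos])
  then show "integrable M (\<lambda>\<omega>. W u \<omega> - W s \<omega>)"
    by (intro distributed_integrable_var[OF D]) simp_all
qed

text \<open>
  By Brownian scaling, \<open>\<bar>g\<bar> \<le> q b\<close> with \<open>q = sqrt \<epsilon>\<close> and a variable \<open>b\<close> whose exponential moments
  do not depend on \<open>\<epsilon>\<close>, so each summand of the error is of order \<open>q\<^sup>3\<close>.
\<close>

lemma small_increment_error:
  fixes \<mu> \<sigma> C :: real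
  assumes pos: "0 < \<mu>" "0 < \<sigma>" "0 < C"
  obtains C' where "0 < C'"
    "\<And>t \<epsilon>. 0 \<le> t \<Longrightarrow> 0 < \<epsilon> \<Longrightarrow> \<epsilon> \<le> 1 \<Longrightarrow> \<exists>Z. integrable M Z \<and> expectation Z \<le> C' * (\<epsilon> * sqrt \<epsilon>) \<and>
      (\<forall>\<omega> g. g = \<mu> * \<epsilon> + \<sigma> * (W (t + \<epsilon>) \<omega> - W t \<omega>) \<longrightarrow>
        (\<epsilon>\<^sup>2 + \<epsilon> * \<bar>g\<bar> + \<epsilon> * g\<^sup>2 + g ^ 4) * exp (C * \<bar>g\<bar>) \<le> Z \<omega>)"
proof
  define d where "d = (C + 2) * \<sigma>"
  define C' where "C' = 16 * exp ((C + 2) * \<mu>) * exp (d\<^sup>2 / 2)"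
  show "0 < C'" by (simp add: C'_def)
  fix t \<epsilon> :: real assume t: "0 \<le> t" and \<epsilon>: "0 < \<epsilon>" "\<epsilon> \<le> 1"
  define q where "q = sqrt \<epsilon>"
  have q: "0 < q" "q \<le> 1" "\<epsilon> = q\<^sup>2" using \<epsilon> by (auto simp: q_def)
  \<comment> \<open>The variance of \<open>e X\<close> is \<open>d\<^sup>2\<close>, independently of \<open>\<epsilon>\<close>.\<close>
  define e where "e = d / q"
  define X where "X \<omega> = W (t + \<epsilon>) \<omega> - W t \<omega>" for \<omega>
  define Z where "Z \<omega> = 8 * q ^ 3 * exp ((C + 2) * \<mu>) * (exp (e * X \<omega>) + exp ((- e) * X \<omega>))" for \<omega>
  have te: "t \<le> t + \<epsilon>" using \<epsilon> by simp
  note I = increment_exp[OF t te, folded X_def]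
  have "integrable M Z" unfolding Z_def[abs_def] using I(1) by (intro integrable_mult_right Bochner_Integration.integrable_add)
  moreover have "expectation Z \<le> C' * (\<epsilon> * sqrt \<epsilon>)"
  proof -
    have "e\<^sup>2 * \<epsilon> / 2 = d\<^sup>2 / 2" using q by (simp add: e_def power_divide)
    then have "expectation Z = 8 * q ^ 3 * exp ((C + 2) * \<mu>) * (exp (d\<^sup>2 / 2) + exp (d\<^sup>2 / 2))"
      unfolding Z_def[abs_def] using I(1)[of e] I(1)[of "- e"] I(2)[of e] I(2)[of "- e"]
      by (simp add: Bochner_Integration.integral_add)
    also have "\<dots> = C' * q ^ 3" by (simp add: C'_def)
    also have "q ^ 3 = \<epsilon> * sqrt \<epsilon>" unfolding q_def[symmetric] q(3) using q(1) by (simp add: eval_nat_numeral)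
    finally show ?thesis by simp
  qed
  moreover have "(\<epsilon>\<^sup>2 + \<epsilon> * \<bar>g\<bar> + \<epsilon> * g\<^sup>2 + g ^ 4) * exp (C * \<bar>g\<bar>) \<le> Z \<omega>" if g: "g = \<mu> * \<epsilon> + \<sigma> * X \<omega>" for \<omega> g
  proof -
    define b where "b = \<mu> + \<sigma> * (\<bar>X \<omega>\<bar> / q)"
    have b0: "0 \<le> b" using pos q by (simp add: b_def)
    have "\<bar>g\<bar> \<le> \<mu> * \<epsilon> + \<sigma> * \<bar>X \<omega>\<bar>"
      unfolding g using pos \<epsilon> by (intro order_trans[OF abs_triangle_ineq]) (simp add: abs_mult)
    also have "\<mu> * \<epsilon> \<le> \<mu> * q" using pos q by (simp add: power2_eq_square mult_left_le)
    also have "\<mu> * q + \<sigma> * \<bar>X \<omega>\<bar> = q * b" using q by (simp add: b_def field_simps)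
    finally have gb: "\<bar>g\<bar> \<le> q * b" by simp
    have gb1: "\<bar>g\<bar> \<le> b" using gb mult_right_mono[OF q(2) b0] by linarith
    have qq: "q ^ 4 \<le> q ^ 3" using q by (intro power_decreasing) auto
    have 1: "\<epsilon>\<^sup>2 \<le> q ^ 3 * 1" using qq unfolding q(3) by (simp only: power_mult[symmetric]) simp
    have 2: "\<epsilon> * \<bar>g\<bar> \<le> q ^ 3 * b"
    proof -
      have "q\<^sup>2 * \<bar>g\<bar> \<le> q\<^sup>2 * (q * b)" using gb by (intro mult_left_mono) auto
      then show ?thesis unfolding q(3) by (simp add: eval_nat_numeral mult_ac)
    qed
    have g2: "g\<^sup>2 \<le> q\<^sup>2 * b\<^sup>2" using power_mono[OF gb abs_ge_zero, of 2] by (simp add: power_mult_distrib)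
    have 3: "\<epsilon> * g\<^sup>2 \<le> q ^ 3 * b\<^sup>2"
    proof -
      have "q\<^sup>2 * g\<^sup>2 \<le> q\<^sup>2 * (q\<^sup>2 * b\<^sup>2)" using g2 by (intro mult_left_mono) auto
      also have "\<dots> = q ^ 4 * b\<^sup>2" by (simp add: eval_nat_numeral mult_ac)
      also have "\<dots> \<le> q ^ 3 * b\<^sup>2" using qq by (intro mult_right_mono) auto
      finally show ?thesis unfolding q(3) .
    qed
    have 4: "g ^ 4 \<le> q ^ 3 * b ^ 4"
    proof -
      have "g ^ 4 = \<bar>g\<bar> ^ 4" by (simp add: power_even_abs)
      also have "\<dots> \<le> (q * b) ^ 4" by (intro power_mono gb) simp
      also have "\<dots> = q ^ 4 * b ^ 4" by (rule power_mult_distrib)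
      also have "\<dots> \<le> q ^ 3 * b ^ 4" using qq b0 by (intro mult_right_mono) auto
      finally show ?thesis .
    qed
    have E: "1 + b + b\<^sup>2 / 2 \<le> exp b" by (rule exp_lower_Taylor_quadratic[OF b0])
    have E1: "1 \<le> exp b" "exp b \<le> exp (2 * b)" using b0 by auto
    have b2: "b\<^sup>2 \<le> 2 * exp b" "b \<le> exp b" using E b0 zero_le_power2[of b] by linarith+
    have "b ^ 4 = b\<^sup>2 * b\<^sup>2" by (simp only: power_add[symmetric]) simp
    also have "\<dots> \<le> (2 * exp b) * (2 * exp b)" using b2 by (intro mult_mono) auto
    also have "\<dots> = 4 * exp (2 * b)" by (simp add: mult_exp_exp)
    finally have b4: "b ^ 4 \<le> 4 * exp (2 * b)" .
    have "\<epsilon>\<^sup>2 + \<epsilon> * \<bar>g\<bar> + \<epsilon> * g\<^sup>2 + g ^ 4 \<le> q ^ 3 * (1 + b + b\<^sup>2 + b ^ 4)"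
      unfolding distrib_left using 1 2 3 4 by linarith
    also have "\<dots> \<le> q ^ 3 * (8 * exp (2 * b))"
    proof (rule mult_left_mono)
      show "1 + b + b\<^sup>2 + b ^ 4 \<le> 8 * exp (2 * b)" using b4 b2 E1 by linarith
    qed (use q in simp)
    finally have 5: "\<epsilon>\<^sup>2 + \<epsilon> * \<bar>g\<bar> + \<epsilon> * g\<^sup>2 + g ^ 4 \<le> q ^ 3 * (8 * exp (2 * b))" .
    have 6: "exp (C * \<bar>g\<bar>) \<le> exp (C * b)" using gb1 pos by simp
    have "(\<epsilon>\<^sup>2 + \<epsilon> * \<bar>g\<bar> + \<epsilon> * g\<^sup>2 + g ^ 4) * exp (C * \<bar>g\<bar>) \<le> (q ^ 3 * (8 * exp (2 * b))) * exp (C * b)"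
      using 5 6 q by (intro mult_mono) auto
    also have "\<dots> = 8 * q ^ 3 * exp ((C + 2) * b)" by (simp add: mult_exp_exp algebra_simps)
    also have "(C + 2) * b = (C + 2) * \<mu> + \<bar>e * X \<omega>\<bar>"
    proof -
      have "0 \<le> e" using q pos by (simp add: e_def d_def)
      then have "\<bar>e * X \<omega>\<bar> = e * \<bar>X \<omega>\<bar>" by (simp add: abs_mult)
      then have "\<bar>e * X \<omega>\<bar> = (C + 2) * \<sigma> * (\<bar>X \<omega>\<bar> / q)" by (simp only: e_def d_def times_divide_eq_left times_divide_eq_right)
      then show ?thesis by (simp only: b_def distrib_left mult.assoc)
    qed
    also have "exp ((C + 2) * \<mu> + \<bar>e * X \<omega>\<bar>) \<le> exp ((C + 2) * \<mu>) * (exp (e * X \<omega>) + exp ((- e) * X \<omega>))"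
      unfolding exp_add by (intro mult_left_mono) (auto simp: abs_if add_increasing add_increasing2)
    finally show ?thesis using q by (simp add: Z_def mult_ac mult_left_mono)
  qed
  ultimately show "\<exists>Z. integrable M Z \<and> expectation Z \<le> C' * (\<epsilon> * sqrt \<epsilon>) \<and>
      (\<forall>\<omega> g. g = \<mu> * \<epsilon> + \<sigma> * (W (t + \<epsilon>) \<omega> - W t \<omega>) \<longrightarrow>
        (\<epsilon>\<^sup>2 + \<epsilon> * \<bar>g\<bar> + \<epsilon> * g\<^sup>2 + g ^ 4) * exp (C * \<bar>g\<bar>) \<le> Z \<omega>)"
    unfolding X_def by blast
qed

end

section \<open>Mean zero increments\<close>

locale brownian_barrier = brownian_space M F W + barrier \<mu> \<sigma> k
  for M :: "'a measure" and F :: "real \<Rightarrow> 'a measure" and W :: "real \<Rightarrow> 'a \<Rightarrow> real" and \<mu> \<sigma> k :: real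
begin

text \<open>
  The condition on \<open>l\<close> is the characteristic equation, which makes \<open>exp (l (\<mu> s + \<sigma> W s) - r s)\<close> a
  martingale.  The event \<open>I\<close> and the bound on \<open>f\<close> allow starting points that are bounded only while
  the surplus is alive.
\<close>

lemma exponential_martingale_increment:
  assumes su: "0 \<le> s" "s < u" and l: "\<sigma>\<^sup>2 / 2 * l\<^sup>2 + \<mu> * l = r"
    and I: "I \<in> sets (F s)" and f: "f \<in> borel_measurable (F s)" and C: "\<And>\<omega>. \<omega> \<in> I \<Longrightarrow> \<bar>f \<omega>\<bar> \<le> C"
  defines "X \<equiv> \<lambda>\<omega>. indicator I \<omega> *
    (exp (- (r * (u - s))) * exp (l * (f \<omega> + \<mu> * (u - s) + \<sigma> * (W u \<omega> - W s \<omega>))) - exp (l * f \<omega>))"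
  shows "integrable M X" "expectation X = 0"
proof -
  define e where "e \<omega> = (indicator I \<omega> :: real) * exp (l * f \<omega>)" for \<omega>
  define g where "g x = exp (l * \<mu> * (u - s) - r * (u - s)) * exp (l * \<sigma> * x) - 1" for x
  have eF: "e \<in> borel_measurable (F s)" unfolding e_def[abs_def] using I f by measurable
  have ei: "integrable M e"
  proof (rule integrable_const_bound)
    have "norm (e \<omega>) \<le> exp (\<bar>l\<bar> * \<bar>C\<bar>)" for \<omega>
    proof (cases "\<omega> \<in> I")
      case True
      have "l * f \<omega> \<le> \<bar>l\<bar> * \<bar>f \<omega>\<bar>" using abs_ge_self[of "l * f \<omega>"] by (simp add: abs_mult)
      also have "\<dots> \<le> \<bar>l\<bar> * \<bar>C\<bar>" using C[OF True] by (intro mult_left_mono) auto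
      finally show ?thesis using True by (simp add: e_def)
    qed (simp add: e_def)
    then show "AE \<omega> in M. norm (e \<omega>) \<le> exp (\<bar>l\<bar> * \<bar>C\<bar>)" by simp
    show "e \<in> borel_measurable M" by (rule measurable_F_M[OF su(1) eF])
  qed
  have gm: "g \<in> borel_measurable borel" unfolding g_def[abs_def] by measurable
  note inc = increment_exp[OF su(1) less_imp_le[OF su(2)], of "l * \<sigma>"]
  have gi: "integrable M (\<lambda>\<omega>. g (W u \<omega> - W s \<omega>))" unfolding g_def using inc(1) by simp
  have "expectation (\<lambda>\<omega>. g (W u \<omega> - W s \<omega>)) = exp (l * \<mu> * (u - s) - r * (u - s)) * exp ((l * \<sigma>)\<^sup>2 * (u - s) / 2) - 1"
    unfolding g_def using inc by (simp add: Bochner_Integration.integral_diff prob_space)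
  also have "l * \<mu> * (u - s) - r * (u - s) = - ((l * \<sigma>)\<^sup>2 * (u - s) / 2)"
    unfolding l[symmetric] by (simp add: field_simps power_mult_distrib)
  finally have ge: "expectation (\<lambda>\<omega>. g (W u \<omega> - W s \<omega>)) = 0" by (simp add: mult_exp_exp)
  have X: "X = (\<lambda>\<omega>. e \<omega> * g (W u \<omega> - W s \<omega>))"
  proof
    fix \<omega>
    have "exp (- (r * (u - s))) * exp (l * (f \<omega> + \<mu> * (u - s) + \<sigma> * (W u \<omega> - W s \<omega>)))
       = exp (l * f \<omega>) * (exp (l * \<mu> * (u - s) - r * (u - s)) * exp (l * \<sigma> * (W u \<omega> - W s \<omega>)))"
      unfolding mult_exp_exp by (simp add: algebra_simps)
    then show "X \<omega> = e \<omega> * g (W u \<omega> - W s \<omega>)" by (simp add: X_def e_def g_def algebra_simps)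
  qed
  show "integrable M X" "expectation X = 0"
    using increment_independent[OF su eF ei gm gi] ge unfolding X by simp_all
qed

lemma harmonic_increment:
  assumes su: "0 \<le> s" "s < u" and r: "0 < r"
    and I: "I \<in> sets (F s)" and f: "f \<in> borel_measurable (F s)" and C: "\<And>\<omega>. \<omega> \<in> I \<Longrightarrow> \<bar>f \<omega>\<bar> \<le> C"
  defines "X \<equiv> \<lambda>\<omega>. indicator I \<omega> *
    (exp (- (r * (u - s))) * v 0 r (f \<omega> + \<mu> * (u - s) + \<sigma> * (W u \<omega> - W s \<omega>)) - v 0 r (f \<omega>))"
  shows "integrable M X" "expectation X = 0"
proof -
  define Y where "Y l \<omega> = indicator I \<omega> *
    (exp (- (r * (u - s))) * exp (l * (f \<omega> + \<mu> * (u - s) + \<sigma> * (W u \<omega> - W s \<omega>))) - exp (l * f \<omega>))" for l \<omega>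
  note p = exponential_martingale_increment[OF su root_char(1)[OF r] I f C, folded Y_def]
  note m = exponential_martingale_increment[OF su root_char(2)[OF r] I f C, folded Y_def]
  have X: "X = (\<lambda>\<omega>. (Y (lp r) \<omega> - Y (lm r) \<omega>) / den r)"
  proof
    fix \<omega>
    have "i * (E * ((a - b) / D) - (c - d) / D) = (i * (E * a - c) - i * (E * b - d)) / D" for i E a b c d D :: real
      by (cases "D = 0") (auto simp: field_simps)
    then show "X \<omega> = (Y (lp r) \<omega> - Y (lm r) \<omega>) / den r" by (simp only: X_def Y_def v_def power_0 mult_1)
  qed
  show "integrable M X" unfolding X by (intro integrable_divide Bochner_Integration.integrable_diff p(1) m(1))
  show "expectation X = 0" unfolding X using p m by (simp add: Bochner_Integration.integral_diff)
qed

lemma one_step_martingale_expectation: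
  assumes t: "0 \<le> t" and \<epsilon>: "0 < \<epsilon>" and r: "0 < r" and x: "0 < x"
    and y: "y \<in> borel_measurable (F t)" "AE \<omega> in M. 0 \<le> y \<omega> \<and> y \<omega> \<le> x"
  defines "X \<equiv> \<lambda>\<omega>. one_step_martingale x r \<epsilon> (y \<omega>) (\<mu> * \<epsilon> + \<sigma> * (W (t + \<epsilon>) \<omega> - W t \<omega>))"
  shows "integrable M X" "expectation X = 0"
proof -
  define y' where "y' \<omega> = max 0 (min x (y \<omega>))" for \<omega>
  have y'm: "y' \<in> borel_measurable (F t)" unfolding y'_def[abs_def] using y(1) by measurable
  have te: "t < t + \<epsilon>" "t + \<epsilon> - t = \<epsilon>" using \<epsilon> by auto
  define I where "I = {\<omega> \<in> space (F t). min x k / 2 \<le> y' \<omega> \<and> y' \<omega> < k}"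
  define J where "J = {\<omega> \<in> space (F t). k \<le> y' \<omega>}"
  have I: "I \<in> sets (F t)" unfolding I_def using y'm by measurable
  have J: "J \<in> sets (F t)" unfolding J_def using y'm by measurable
  define X1 where "X1 \<omega> = indicator I \<omega> *
    (exp (- (r * \<epsilon>)) * v 0 r (y' \<omega> + \<mu> * \<epsilon> + \<sigma> * (W (t + \<epsilon>) \<omega> - W t \<omega>)) - v 0 r (y' \<omega>))" for \<omega>
  have "\<bar>y' \<omega>\<bar> \<le> x" for \<omega> using x by (auto simp: y'_def)
  note h = harmonic_increment[OF t te(1) r I y'm this, unfolded te(2), folded X1_def]
  define X2 where "X2 \<omega> = (exp (- (r * \<epsilon>)) * \<sigma> * indicator J \<omega>) * (W (t + \<epsilon>) \<omega> - W t \<omega>)" for \<omega>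
  have fm: "(\<lambda>\<omega>. exp (- (r * \<epsilon>)) * \<sigma> * indicator J \<omega>) \<in> borel_measurable (F t)" using J by measurable
  have fi: "integrable M (\<lambda>\<omega>. exp (- (r * \<epsilon>)) * \<sigma> * indicator J \<omega>)"
    by (intro integrable_mult_right integrable_real_indicator) (auto simp: sets_F_M[OF t J] emeasure_eq_measure)
  have "integrable M X2 \<and> expectation X2 = 0"
    using increment_independent[OF t te(1) fm fi, of "\<lambda>x. x"] increment_moments[OF t te(1)]
    unfolding X2_def[abs_def] by simp
  moreover have sum: "X1 \<omega> + X2 \<omega> = one_step_martingale x r \<epsilon> (y' \<omega>) (\<mu> * \<epsilon> + \<sigma> * (W (t + \<epsilon>) \<omega> - W t \<omega>))"
    if "\<omega> \<in> space M" for \<omega>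
    using that x k_pos unfolding X1_def X2_def one_step_martingale_def I_def J_def space_F
    by (auto simp: algebra_simps indicator_def)
  ultimately have Y: "integrable M (\<lambda>\<omega>. X1 \<omega> + X2 \<omega>)" "expectation (\<lambda>\<omega>. X1 \<omega> + X2 \<omega>) = 0"
    using h by simp_all
  have ae: "AE \<omega> in M. X1 \<omega> + X2 \<omega> = X \<omega>"
    using y(2) AE_space
  proof eventually_elim
    case (elim \<omega>)
    then have "y' \<omega> = y \<omega>" by (simp add: y'_def)
    then show ?case using sum[OF elim(2)] by (simp add: X_def)
  qed
  have Xm: "X \<in> borel_measurable M"
  proof -
    have "0 \<le> t + \<epsilon>" using t \<epsilon> by simp
    note [measurable] = W_measurable[OF this] W_measurable[OF t] measurable_F_M[OF t y(1)]
    show ?thesis unfolding X_def one_step_martingale_def by measurable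
  qed
  show "integrable M X" using Y(1) by (rule integrable_cong_AE_imp[OF _ Xm]) (use ae in auto)
  have "expectation X = expectation (\<lambda>\<omega>. X1 \<omega> + X2 \<omega>)"
    using ae Y(1) by (intro integral_cong_AE Xm) auto
  then show "expectation X = 0" using Y(2) by simp
qed

end

section \<open>Reflected paths\<close>

text \<open>
  This describes survival up to time \<open>s\<close> by countably many values of the path, which makes it an
  event of \<open>F s\<close>.
\<close>

lemma positive_on_grid_iff:
  fixes f :: "real \<Rightarrow> real"
  assumes s: "T < s" and f: "continuous_on {T..s} f"
  shows "(\<forall>u\<in>{T..s}. 0 < f u) \<longleftrightarrow>
    (\<exists>m. \<forall>n. \<forall>i\<le>Suc n. 1 / real (Suc m) \<le> f (T + real i * ((s - T) / real (Suc n))))"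
    (is "_ \<longleftrightarrow> ?R")
proof
  have sub: "T + real i * ((s - T) / real (Suc n)) \<in> {T..s}" if "i \<le> Suc n" for i n
  proof -
    have "real i * ((s - T) / real (Suc n)) \<le> real (Suc n) * ((s - T) / real (Suc n))"
      using that s by (intro mult_right_mono) auto
    then show ?thesis using s by simp
  qed
  assume a: "\<forall>u\<in>{T..s}. 0 < f u"
  obtain w where w: "w \<in> {T..s}" "\<And>u. u \<in> {T..s} \<Longrightarrow> f w \<le> f u"
    using continuous_attains_inf[of "{T..s}" f] s f by auto
  have "0 < f w" using w(1) a by blast
  then obtain m where m: "1 / real (Suc m) < f w" by (rule nat_approx_posE)
  show ?R using w(2)[OF sub] m by (intro exI[of _ m]) (auto intro: order_trans[OF less_imp_le])
next
  assume ?R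
  then obtain m where m: "\<And>n i. i \<le> Suc n \<Longrightarrow> 1 / real (Suc m) \<le> f (T + real i * ((s - T) / real (Suc n)))" by blast
  show "\<forall>u\<in>{T..s}. 0 < f u"
  proof
    fix u assume u: "u \<in> {T..s}"
    have su: "u \<in> {T..T + (s - T)}" "0 < s - T" using u s by auto
    obtain i where i: "\<And>n. i n \<le> Suc n" and t: "\<And>n. T + real (i n) * ((s - T) / real (Suc n)) \<in> {T..T + (s - T)}"
      and l: "(\<lambda>n. T + real (i n) * ((s - T) / real (Suc n))) \<longlonglongrightarrow> u"
      using grid_approximation[OF su(2) su(1)] by blast
    have "(\<lambda>n. f (T + real (i n) * ((s - T) / real (Suc n)))) \<longlonglongrightarrow> f u"
      using t u by (intro continuous_on_tendsto_compose[OF f l]) auto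
    then have "1 / real (Suc m) \<le> f u"
      by (rule LIMSEQ_le_const) (use m[OF i] in blast)
    moreover have "0 < 1 / real (Suc m)" by simp
    ultimately show "0 < f u" by linarith
  qed
qed

text \<open>
  The path \<open>b - D\<close> of a surplus with uncontrolled path \<open>b\<close> that the dividends \<open>D\<close> keep from exceeding
  \<open>k\<close> and that is only controlled until its ruin time \<open>\<tau>\<close>.  The last assumption is the minimality of \<open>D\<close>: it increases
  over an interval only if the surplus visits the barrier there.
\<close>

locale reflected_path =
  fixes k T :: real and b D :: "real \<Rightarrow> real" and \<tau> :: ereal
  assumes k_pos: "0 < k"
    and b_cont: "continuous_on {T..} b"
    and D_mono: "mono D"
    and D_right_cont: "\<And>s. continuous (at_right s) D"
    and D_cont: "continuous_on {T..} D"
    and start: "0 \<le> b T - D T" "b T - D T \<le> k"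
    and T_le: "ereal T \<le> \<tau>"
    and above_zero: "\<And>s. T \<le> s \<Longrightarrow> ereal s < \<tau> \<Longrightarrow> 0 < b s - D s"
    and below_barrier: "\<And>s. T \<le> s \<Longrightarrow> ereal s < \<tau> \<Longrightarrow> b s - D s \<le> k"
    and ruin: "\<And>u. \<tau> = ereal u \<Longrightarrow> b u - D u = 0"
    and frozen: "\<And>s u. T \<le> s \<Longrightarrow> \<tau> \<le> ereal s \<Longrightarrow> s \<le> u \<Longrightarrow> D u = D s"
    and growth: "\<And>s u. T \<le> s \<Longrightarrow> s < u \<Longrightarrow> D s < D u \<Longrightarrow> \<exists>v. s < v \<and> v \<le> u \<and> b v - D v = k"
begin

abbreviation X :: "real \<Rightarrow> real" where "X s \<equiv> b s - D s"

lemma X_cont: "continuous_on {T..} X"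
  by (intro continuous_on_diff b_cont D_cont)

text \<open>
  If \<open>D\<close> has increased at all, take the last time at which the surplus was at the barrier; \<open>D\<close> has been
  constant since.
\<close>

lemma last_barrier_time:
  assumes u: "T \<le> u"
  shows "D u = D T \<or> (\<exists>v\<in>{T..u}. D u = b v - k)"
proof (cases "D u = D T")
  case False
  then have Tu: "T < u" "D T < D u" using u monoD[OF D_mono u] by (auto simp: less_le)
  define A where "A = {T..u} \<inter> X -` {k}"
  obtain v0 where "T < v0" "v0 \<le> u" "X v0 = k" using growth[OF order_refl Tu] by blast
  then have "v0 \<in> A" by (simp add: A_def)
  then have "A \<noteq> {}" by blast
  moreover have "closed A" unfolding A_def
    by (rule continuous_closed_preimage) (use continuous_on_subset[OF X_cont] in auto)
  moreover have "bounded A" unfolding A_def by (rule bounded_subset[of "{T..u}"]) auto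
  ultimately have "compact A" "A \<noteq> {}" by (auto simp: compact_eq_bounded_closed)
  then obtain v where v: "v \<in> A" "\<And>w. w \<in> A \<Longrightarrow> w \<le> v"
    using compact_attains_sup[of A] by blast
  have "D v = D u"
  proof (rule ccontr)
    assume "D v \<noteq> D u"
    then have "D v < D u" "v < u" using v(1) monoD[OF D_mono, of v u] by (auto simp: A_def less_le)
    then obtain w where "v < w" "w \<le> u" "X w = k" using growth[of v u] v(1) by (auto simp: A_def)
    then show False using v(2)[of w] v(1) by (auto simp: A_def)
  qed
  then show ?thesis using v(1) by (auto simp: A_def intro!: bexI[of _ v])
qed simp

text \<open>
  Skorokhod's formula: up to ruin and from their initial value on, the dividends are the running
  maximum of the excess of the free path over the barrier.
\<close>

lemma explicit_formula:
  assumes u: "T \<le> u" "ereal u \<le> \<tau>"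
  shows "D u = max (D T) (Sup ((\<lambda>v. b v - k) ` {T..u}))"
proof -
  have le: "b v - k \<le> D u" if v: "v \<in> {T..u}" for v
  proof -
    have "X v \<le> k"
    proof (cases "ereal v < \<tau>")
      case True then show ?thesis using below_barrier v by auto
    next
      case False
      then have "\<tau> = ereal v" using u v by (metis antisym atLeastAtMost_iff ereal_less_eq(3) not_less order_trans)
      then show ?thesis using ruin k_pos by simp
    qed
    moreover have "D v \<le> D u" using v by (intro monoD[OF D_mono]) auto
    ultimately show ?thesis by linarith
  qed
  have bdd: "bdd_above ((\<lambda>v. b v - k) ` {T..u})" using le by (intro bdd_aboveI[of _ "D u"]) auto
  have "Sup ((\<lambda>v. b v - k) ` {T..u}) \<le> D u" using le u by (intro cSup_least) auto
  moreover have "D T \<le> D u" using u by (intro monoD[OF D_mono])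
  moreover have "D u \<le> max (D T) (Sup ((\<lambda>v. b v - k) ` {T..u}))"
    using last_barrier_time[OF u(1)]
  proof
    assume "\<exists>v\<in>{T..u}. D u = b v - k"
    then obtain v where "v \<in> {T..u}" "D u = b v - k" by blast
    then have "D u \<le> Sup ((\<lambda>v. b v - k) ` {T..u})" using bdd by (auto intro!: cSup_upper)
    then show ?thesis by simp
  qed simp
  ultimately show ?thesis by linarith
qed

lemma increment_bounds:
  assumes Z: "\<And>s. s \<in> {T..T + S} \<Longrightarrow> \<bar>b s - b T\<bar> \<le> Z" and u: "u \<in> {T..T + S}"
  shows "0 \<le> D u - D T" "D u - D T \<le> Z" "\<bar>X u\<bar> \<le> k + 2 * Z"
proof -
  have Z0: "0 \<le> Z" using Z[OF u] by linarith
  show 1: "0 \<le> D u - D T" using monoD[OF D_mono, of T u] u by simp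
  show 2: "D u - D T \<le> Z"
    using last_barrier_time[of u]
  proof
    assume "\<exists>v\<in>{T..u}. D u = b v - k"
    then obtain v where v: "v \<in> {T..u}" "D u = b v - k" by blast
    have "\<bar>b v - b T\<bar> \<le> Z" using v u by (intro Z) auto
    then show ?thesis using v start by linarith
  qed (use u Z0 in auto)
  show "\<bar>X u\<bar> \<le> k + 2 * Z" using 1 2 Z[OF u] start k_pos by linarith
qed

lemma alive_iff:
  assumes s: "T \<le> s"
  shows "ereal s < \<tau> \<longleftrightarrow> (\<forall>u\<in>{T..s}. 0 < X u)"
proof
  assume a: "ereal s < \<tau>"
  show "\<forall>u\<in>{T..s}. 0 < X u"
  proof
    fix u assume u: "u \<in> {T..s}"
    then have "ereal u < \<tau>" using a by (auto intro: le_less_trans[of _ "ereal s"])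
    then show "0 < X u" using u by (intro above_zero) auto
  qed
next
  assume a: "\<forall>u\<in>{T..s}. 0 < X u"
  show "ereal s < \<tau>"
  proof (rule ccontr)
    assume "\<not> ereal s < \<tau>"
    then obtain u where u: "\<tau> = ereal u" "T \<le> u" "u \<le> s" using T_le by (cases \<tau>) auto
    then show False using bspec[OF a, of u] ruin[OF u(1)] by simp
  qed
qed

end

text \<open>
  The formula determines both paths up to the earlier of the two ruin times, and both are then
  ruined at the same time.
\<close>

lemma reflected_path_unique:
  assumes "reflected_path k T b D \<tau>" "reflected_path k T b D' \<tau>'" "D T = D' T" and s: "T \<le> s"
  shows "D s = D' s"
proof -
  have main: "D s = D' s"
    if "reflected_path k T b D \<tau>" "reflected_path k T b D' \<tau>'" "D T = D' T" and le: "\<tau> \<le> \<tau>'" for D D' \<tau> \<tau>'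
  proof -
    interpret P: reflected_path k T b D \<tau> by fact
    interpret Q: reflected_path k T b D' \<tau>' by fact
    have eq: "D u = D' u" if "T \<le> u" "ereal u \<le> \<tau>" for u
      using P.explicit_formula[OF that] Q.explicit_formula[of u] that le \<open>D T = D' T\<close> by (auto intro: order_trans)
    show ?thesis
    proof (cases "ereal s \<le> \<tau>")
      case True then show ?thesis using eq s by simp
    next
      case False
      then obtain u where u: "\<tau> = ereal u" "T \<le> u" "u < s" using P.T_le by (cases \<tau>) auto
      have "b u - D' u = 0" using eq[of u] u P.ruin[OF u(1)] by simp
      then have "\<tau>' \<le> ereal u" using Q.above_zero[of u] u by (auto simp: not_less[symmetric])
      then show ?thesis using P.frozen[of u s] Q.frozen[of u s] eq[of u] u by simp
    qed
  qed
  show ?thesis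
    using main[OF assms(1-3)] main[OF assms(2,1) assms(3)[symmetric]] by (cases "\<tau> \<le> \<tau>'") auto
qed

text \<open>
  The discount factor is monotone, so the integral lies between its lower and upper Riemann-Stieltjes
  sums.
\<close>

lemma stieltjes_exp_bounds:
  fixes D :: "real \<Rightarrow> real" and T h r :: real
  assumes D: "mono D" "\<And>s. continuous (at_right s) D" and h: "0 < h" and r: "0 < r"
  defines "t \<equiv> \<lambda>i. T + real i * h"
  defines "P \<equiv> \<lambda>N. \<integral>\<^sup>+ s \<in> {T<..t N}. ennreal (exp (- r * (s - T))) \<partial>interval_measure D"
  shows "ennreal (\<Sum>i<N. exp (- r * (t (Suc i) - T)) * (D (t (Suc i)) - D (t i))) \<le> P N"
    and "P N \<le> ennreal (\<Sum>i<N. exp (- r * (t i - T)) * (D (t (Suc i)) - D (t i)))"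
proof -
  have tt: "t i \<le> t (Suc i)" "T \<le> t i" for i using h by (simp_all add: t_def algebra_simps)
  have inc: "0 \<le> D (t (Suc i)) - D (t i)" for i using monoD[OF D(1) tt(1)[of i]] by simp
  have em: "emeasure (interval_measure D) {t i<..t (Suc i)} = ennreal (D (t (Suc i)) - D (t i))" for i
    using D tt(1) by (intro emeasure_interval_measure_Ioc) (auto dest: monoD)
  let ?f = "\<lambda>s. ennreal (exp (- r * (s - T)))"
  let ?M = "interval_measure D"
  have [measurable]: "?f \<in> borel_measurable borel" by measurable
  have piece: "(\<integral>\<^sup>+ s \<in> {t i<..t (Suc i)}. ?f s \<partial>?M) \<le> ennreal (exp (- r * (t i - T)) * (D (t (Suc i)) - D (t i)))"
    "ennreal (exp (- r * (t (Suc i) - T)) * (D (t (Suc i)) - D (t i))) \<le> (\<integral>\<^sup>+ s \<in> {t i<..t (Suc i)}. ?f s \<partial>?M)" for i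
  proof -
    have "(\<integral>\<^sup>+ s \<in> {t i<..t (Suc i)}. ?f s \<partial>?M) \<le> (\<integral>\<^sup>+ s \<in> {t i<..t (Suc i)}. ?f (t i) \<partial>?M)"
      using r by (intro nn_integral_mono) (auto simp: indicator_def intro!: ennreal_leI)
    also have "\<dots> = ?f (t i) * ennreal (D (t (Suc i)) - D (t i))"
      by (subst nn_integral_cmult_indicator) (auto simp: em)
    finally show "(\<integral>\<^sup>+ s \<in> {t i<..t (Suc i)}. ?f s \<partial>?M) \<le> ennreal (exp (- r * (t i - T)) * (D (t (Suc i)) - D (t i)))"
      using inc[of i] by (simp add: ennreal_mult)
    have "?f (t (Suc i)) * ennreal (D (t (Suc i)) - D (t i)) = (\<integral>\<^sup>+ s \<in> {t i<..t (Suc i)}. ?f (t (Suc i)) \<partial>?M)"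
      by (subst nn_integral_cmult_indicator) (auto simp: em)
    also have "\<dots> \<le> (\<integral>\<^sup>+ s \<in> {t i<..t (Suc i)}. ?f s \<partial>?M)"
      using r by (intro nn_integral_mono) (auto simp: indicator_def intro!: ennreal_leI)
    finally show "ennreal (exp (- r * (t (Suc i) - T)) * (D (t (Suc i)) - D (t i))) \<le> (\<integral>\<^sup>+ s \<in> {t i<..t (Suc i)}. ?f s \<partial>?M)"
      using inc[of i] by (simp add: ennreal_mult)
  qed
  have step: "P (Suc N) = P N + (\<integral>\<^sup>+ s \<in> {t N<..t (Suc N)}. ?f s \<partial>?M)" for N
  proof -
    have "{T<..t (Suc N)} = {T<..t N} \<union> {t N<..t (Suc N)}" using tt[of N] by auto
    then show ?thesis unfolding P_def
      by (subst nn_integral_disjoint_pair[symmetric]) auto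
  qed
  have P0: "P 0 = 0" by (simp add: P_def t_def)
  show "ennreal (\<Sum>i<N. exp (- r * (t (Suc i) - T)) * (D (t (Suc i)) - D (t i))) \<le> P N"
  proof (induction N)
    case (Suc N)
    have "0 \<le> (\<Sum>i<N. exp (- r * (t (Suc i) - T)) * (D (t (Suc i)) - D (t i)))" using inc by (intro sum_nonneg) simp
    then show ?case using Suc piece(2)[of N] inc[of N] unfolding step by (simp add: add_mono)
  qed (simp add: P0)
  show "P N \<le> ennreal (\<Sum>i<N. exp (- r * (t i - T)) * (D (t (Suc i)) - D (t i)))"
  proof (induction N)
    case (Suc N)
    have "0 \<le> (\<Sum>i<N. exp (- r * (t i - T)) * (D (t (Suc i)) - D (t i)))" using inc by (intro sum_nonneg) simp
    then show ?case using Suc piece(1)[of N] inc[of N] unfolding step by (simp add: add_mono)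
  qed (simp add: P0)
qed

section \<open>A discrete change of variables along reflected paths\<close>

lemma stopped_telescope:
  fixes q :: "nat \<Rightarrow> real" and p :: "nat \<Rightarrow> bool"
  assumes p: "\<And>i. p (Suc i) \<Longrightarrow> p i"
  shows "\<exists>j\<le>N. q 0 + (\<Sum>i<N. if p i then q (Suc i) - q i else 0) = q j \<and> (\<forall>i<j. p i) \<and> (j < N \<longrightarrow> \<not> p j)"
proof (induction N)
  case (Suc N)
  have down: "p i" if "i \<le> j" "p j" for i j using that by (induction rule: inc_induct) (auto intro: p)
  obtain j where j: "j \<le> N" "q 0 + (\<Sum>i<N. if p i then q (Suc i) - q i else 0) = q j" "\<forall>i<j. p i" "j < N \<longrightarrow> \<not> p j"
    using Suc by blast
  show ?case
  proof (cases "p N")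
    case True
    then have "j = N" using j(1,4) down[of j N] by (cases "j < N") auto
    then show ?thesis using j True by (intro exI[of _ "Suc N"]) (auto simp: less_Suc_eq)
  next
    case False
    then have "j < Suc N \<longrightarrow> \<not> p j" using j(1,4) by (cases "j < N") auto
    then show ?thesis using j False by (intro exI[of _ j]) auto
  qed
qed simp

context barrier begin

lemma value_growth:
  assumes "0 < r"
  obtains c where "1 \<le> c" "\<And>z. \<bar>v 0 r z\<bar> \<le> c * exp (c * \<bar>z\<bar>)" "\<And>z. \<bar>v (Suc 0) r z\<bar> \<le> c * exp (c * \<bar>z\<bar>)"
proof -
  define L where "L = (\<mu> + sqrt (\<mu>\<^sup>2 + 2 * \<sigma>\<^sup>2 * r)) / \<sigma>\<^sup>2"
  note vb = v_bound[OF assms order_refl order_refl, folded L_def]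
  have l: "0 < lp r" by (rule lp_pos[OF assms])
  have L: "0 < L" using vb(2) l by linarith
  define c where "c = 1 + L + 2 / lp r + 2 * L / lp r"
  have "0 \<le> 2 / lp r" "0 \<le> 2 * L / lp r" using l L by auto
  then have c: "1 \<le> c" "L \<le> c" "2 / lp r \<le> c" "2 * L / lp r \<le> c" using L by (auto simp: c_def)
  have e: "exp (L * \<bar>z\<bar>) \<le> exp (c * \<bar>z\<bar>)" for z using c(2) by (simp add: mult_right_mono)
  show thesis
  proof (rule that[OF c(1)])
    fix z
    have "\<bar>v 0 r z\<bar> \<le> (2 / lp r) * exp (L * \<bar>z\<bar>)"
      using vb(1)[of 0 z] by (simp only: power_0 mult_1_right times_divide_eq_left)
    also have "\<dots> \<le> c * exp (c * \<bar>z\<bar>)" using c by (intro mult_mono e) auto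
    finally show "\<bar>v 0 r z\<bar> \<le> c * exp (c * \<bar>z\<bar>)" .
    have "\<bar>v (Suc 0) r z\<bar> \<le> (2 * L / lp r) * exp (L * \<bar>z\<bar>)"
      using vb(1)[of "Suc 0" z] by (simp only: power_Suc power_0 mult_1_right times_divide_eq_left)
    also have "\<dots> \<le> c * exp (c * \<bar>z\<bar>)" using c by (intro mult_mono e) auto
    finally show "\<bar>v (Suc 0) r z\<bar> \<le> c * exp (c * \<bar>z\<bar>)" .
  qed
qed

text \<open>
  The initial value plus the increments of the discounted harmonic function along the free path,
  over the grid intervals on which the surplus is alive at the left end point.  With a Brownian free
  path each summand has mean zero.
\<close>

definition grid_martingale ::
  "real \<Rightarrow> real \<Rightarrow> real \<Rightarrow> (real \<Rightarrow> real) \<Rightarrow> (real \<Rightarrow> real) \<Rightarrow> ereal \<Rightarrow> nat \<Rightarrow> real" where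
  "grid_martingale r T S b D \<tau> n = (let t = (\<lambda>i. T + real i * (S / real (Suc n))) in
     v 0 r (b T - D T) + (\<Sum>i<Suc n. if ereal (t i) < \<tau> then
       exp (- (r * (t (Suc i) - T))) * v 0 r (b (t i) - D (t i) + (b (t (Suc i)) - b (t i)))
       - exp (- (r * (t i - T))) * v 0 r (b (t i) - D (t i)) else 0))"

text \<open>
  The increments of the discounted harmonic function that the reflection undoes.
\<close>

definition grid_reflection ::
  "real \<Rightarrow> real \<Rightarrow> real \<Rightarrow> (real \<Rightarrow> real) \<Rightarrow> (real \<Rightarrow> real) \<Rightarrow> nat \<Rightarrow> real" where
  "grid_reflection r T S b D n = (let t = (\<lambda>i. T + real i * (S / real (Suc n))) in
     \<Sum>i<Suc n. exp (- (r * (t (Suc i) - T))) *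
       (v 0 r (b (t (Suc i)) - D (t (Suc i)) + (D (t (Suc i)) - D (t i))) - v 0 r (b (t (Suc i)) - D (t (Suc i)))))"

lemma grid_points:
  fixes T S :: real
  assumes S: "0 < S"
  defines "t \<equiv> \<lambda>n i. T + real i * (S / real (Suc n))"
  shows "t n 0 = T" "t n (Suc n) = T + S" "t n i < t n (Suc i)" "t n (Suc i) - t n i = S / real (Suc n)"
    "i \<le> Suc n \<Longrightarrow> t n i \<in> {T..T + S}" "T \<le> t n i"
proof -
  have h: "0 < S / real (Suc n)" using S by simp
  show "t n 0 = T" "t n (Suc n) = T + S" by (simp_all add: t_def)
  show d: "t n (Suc i) - t n i = S / real (Suc n)" by (simp add: t_def distrib_right add_divide_distrib)
  then show "t n i < t n (Suc i)" using h by linarith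
  have i0: "0 \<le> real i * (S / real (Suc n))" using h by (intro mult_nonneg_nonneg) simp_all
  then show "T \<le> t n i" unfolding t_def by linarith
  assume "i \<le> Suc n"
  then have "real i * (S / real (Suc n)) \<le> real (Suc n) * (S / real (Suc n))"
    using h by (intro mult_right_mono) auto
  also have "\<dots> = S" by simp
  finally show "t n i \<in> {T..T + S}" using i0 unfolding t_def atLeastAtMost_iff by linarith
qed

text \<open>
  Telescoping.  The index \<open>j\<close> is the first grid point at or after ruin, or the end of the grid.
\<close>

lemma grid_decomposition:
  assumes path: "reflected_path k T b D \<tau>" and S: "0 < S"
  defines "t \<equiv> \<lambda>n i. T + real i * (S / real (Suc n))"
  obtains j where "j \<le> Suc n" "\<And>i. i < j \<Longrightarrow> ereal (t n i) < \<tau>" "j < Suc n \<Longrightarrow> \<tau> \<le> ereal (t n j)"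
    "grid_martingale r T S b D \<tau> n
      = exp (- (r * (t n j - T))) * v 0 r (b (t n j) - D (t n j)) + grid_reflection r T S b D n"
proof -
  interpret P: reflected_path k T b D \<tau> by fact
  have tn: "t n i = T + real i * (S / real (Suc n))" for n i by (simp only: t_def)
  note g = grid_points[OF S, where T = T and n = n, folded tn]
  define q where "q i = exp (- (r * (t n i - T))) * v 0 r (b (t n i) - D (t n i))" for i
  define p where "p i \<longleftrightarrow> ereal (t n i) < \<tau>" for i
  have "p (Suc i) \<Longrightarrow> p i" for i
    unfolding p_def using g(3)[of i] by (intro less_trans[of "ereal (t n i)" "ereal (t n (Suc i))" \<tau>]) simp_all
  then obtain j where j: "j \<le> Suc n" "q 0 + (\<Sum>i<Suc n. if p i then q (Suc i) - q i else 0) = q j"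
      "\<forall>i<j. p i" "j < Suc n \<longrightarrow> \<not> p j"
    using stopped_telescope[where p = p and q = q and N = "Suc n"] by blast
  define R where "R i = exp (- (r * (t n (Suc i) - T))) *
       (v 0 r (P.X (t n (Suc i)) + (D (t n (Suc i)) - D (t n i))) - v 0 r (P.X (t n (Suc i))))" for i
  define m where "m i = exp (- (r * (t n (Suc i) - T))) * v 0 r (P.X (t n i) + (b (t n (Suc i)) - b (t n i)))
       - exp (- (r * (t n i - T))) * v 0 r (P.X (t n i))" for i
  have summand: "(if p i then m i else 0) = (if p i then q (Suc i) - q i else 0) + R i" for i
  proof (cases "p i")
    case True
    have "P.X (t n (Suc i)) + (D (t n (Suc i)) - D (t n i)) = P.X (t n i) + (b (t n (Suc i)) - b (t n i))" by simp
    then show ?thesis using True by (simp add: m_def q_def R_def algebra_simps)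
  next
    case False
    then have "D (t n (Suc i)) = D (t n i)"
      using P.frozen[of "t n i" "t n (Suc i)"] g(3)[of i] g(6)[of i] by (simp add: p_def)
    then show ?thesis using False by (simp add: R_def)
  qed
  have "grid_martingale r T S b D \<tau> n = q 0 + (\<Sum>i<Suc n. if p i then m i else 0)"
    unfolding grid_martingale_def Let_def m_def p_def q_def t_def
    by (simp only: of_nat_0 mult_zero_left mult_zero_right add_0_right diff_self minus_zero exp_zero mult_1)
  also have "\<dots> = q j + grid_reflection r T S b D n"
    unfolding summand sum.distrib j(2)[symmetric] by (simp only: grid_reflection_def R_def t_def Let_def)
  finally show thesis using that[of j] j by (auto simp: p_def q_def not_less)
qed

lemma value_increment:
  assumes "0 \<le> d"
  obtains \<zeta> where "x \<le> \<zeta>" "\<zeta> \<le> x + d" "v 0 r (x + d) - v 0 r x = d * v (Suc 0) r \<zeta>"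
proof (cases "d = 0")
  case False
  then obtain \<zeta> where "x < \<zeta>" "\<zeta> < x + d" "v 0 r (x + d) - v 0 r x = (x + d - x) * v (Suc 0) r \<zeta>"
    using MVT2[of x "x + d" "v 0 r" "v (Suc 0) r"] assms v_deriv_numerals(1) by auto
  then show thesis using that[of \<zeta>] by auto
qed (use that[of x] in auto)

text \<open>
  By the decomposition, the discrete martingale is bounded by the value function along the path
  and by the total dividends, and both are controlled by the oscillation \<open>Z\<close> of the free path.
\<close>

lemma grid_martingale_bound:
  assumes r: "0 < r"
  obtains c where "1 \<le> c" "\<And>T S b D \<tau> Z n. reflected_path k T b D \<tau> \<Longrightarrow> 0 < S \<Longrightarrow>
     (\<And>s. s \<in> {T..T + S} \<Longrightarrow> \<bar>b s - b T\<bar> \<le> Z) \<Longrightarrow> \<bar>grid_martingale r T S b D \<tau> n\<bar> \<le> c * exp (c * Z)"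
proof -
  obtain a where a: "1 \<le> a" "\<And>z. \<bar>v 0 r z\<bar> \<le> a * exp (a * \<bar>z\<bar>)" "\<And>z. \<bar>v (Suc 0) r z\<bar> \<le> a * exp (a * \<bar>z\<bar>)"
    using value_growth[OF r] by blast
  define c where "c = 2 * a * exp (a * k) + 3 * a + 1"
  have c: "2 * a * exp (a * k) \<le> c" "3 * a + 1 \<le> c" using a(1) by (simp_all add: c_def)
  show thesis
  proof (rule that[of c])
    show "1 \<le> c" using c(2) a(1) by linarith
    fix T S b D \<tau> Z n
    assume path: "reflected_path k T b D \<tau>" and S: "0 < S"
      and Z: "\<And>s. s \<in> {T..T + S} \<Longrightarrow> \<bar>b s - b T\<bar> \<le> Z"
    interpret P: reflected_path k T b D \<tau> by fact
    define t where "t i = T + real i * (S / real (Suc n))" for i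
    note g = grid_points[OF S, where T = T and n = n, folded t_def]
    have ib: "0 \<le> D u - D T" "D u - D T \<le> Z" "\<bar>P.X u\<bar> \<le> k + 2 * Z" if "u \<in> {T..T + S}" for u
      using P.increment_bounds[of S Z u] Z that by blast+
    have amono: "a * exp (a * \<bar>x\<bar>) \<le> a * exp (a * y)" if "\<bar>x\<bar> \<le> y" for x y
      using that a(1) by (intro mult_left_mono) (auto intro: mult_left_mono)
    have Z0: "0 \<le> Z" using Z[of T] S by simp
    obtain j where "j \<le> Suc n" "grid_martingale r T S b D \<tau> n
        = exp (- (r * (T + real j * (S / real (Suc n)) - T))) *
          v 0 r (P.X (T + real j * (S / real (Suc n)))) + grid_reflection r T S b D n"
      by (rule grid_decomposition[OF path S, of n r])
    note j = this[folded t_def]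
    have e1: "exp (- (r * (t i - T))) \<le> 1" for i using r g(6)[of i] by simp
    have "\<bar>exp (- (r * (t j - T))) * v 0 r (P.X (t j))\<bar> \<le> 1 * \<bar>v 0 r (P.X (t j))\<bar>"
      unfolding abs_mult using e1 by (intro mult_right_mono) auto
    also have "\<dots> \<le> a * exp (a * (k + 2 * Z))"
      using a(2)[of "P.X (t j)"] amono[OF ib(3)[OF g(5)[OF j(1)]]] by linarith
    also have "\<dots> \<le> a * exp (a * k) * exp ((3 * a + 1) * Z)"
    proof -
      have "a * (k + 2 * Z) \<le> a * k + (3 * a + 1) * Z" using a(1) Z0 by (simp add: algebra_simps)
      then show ?thesis using a(1) by (simp add: mult.assoc exp_add[symmetric])
    qed
    finally have 1: "\<bar>exp (- (r * (t j - T))) * v 0 r (P.X (t j))\<bar> \<le> a * exp (a * k) * exp ((3 * a + 1) * Z)" .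
    have dD: "0 \<le> D (t (Suc i)) - D (t i)" for i using monoD[OF P.D_mono, of "t i" "t (Suc i)"] g(3)[of i] by simp
    have "\<bar>grid_reflection r T S b D n\<bar> \<le> (\<Sum>i<Suc n. (D (t (Suc i)) - D (t i)) * (a * exp (a * (k + 3 * Z))))"
      unfolding grid_reflection_def Let_def t_def[symmetric]
    proof (intro order_trans[OF sum_abs] sum_mono)
      fix i assume "i \<in> {..<Suc n}"
      then have i: "t (Suc i) \<in> {T..T + S}" "t i \<in> {T..T + S}" by (intro g(5); simp)+
      obtain \<zeta> where z: "P.X (t (Suc i)) \<le> \<zeta>" "\<zeta> \<le> P.X (t (Suc i)) + (D (t (Suc i)) - D (t i))"
        "v 0 r (P.X (t (Suc i)) + (D (t (Suc i)) - D (t i))) - v 0 r (P.X (t (Suc i))) = (D (t (Suc i)) - D (t i)) * v (Suc 0) r \<zeta>"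
        using value_increment[OF dD] by blast
      have "\<bar>\<zeta>\<bar> \<le> k + 3 * Z" using z(1,2) ib(3)[OF i(1)] ib(2)[OF i(1)] ib(1)[OF i(2)] by linarith
      then have "\<bar>v (Suc 0) r \<zeta>\<bar> \<le> a * exp (a * (k + 3 * Z))"
        using a(3)[of \<zeta>] amono[of \<zeta> "k + 3 * Z"] by linarith
      then have "\<bar>(D (t (Suc i)) - D (t i)) * v (Suc 0) r \<zeta>\<bar> \<le> (D (t (Suc i)) - D (t i)) * (a * exp (a * (k + 3 * Z)))"
        using dD[of i] by (simp add: abs_mult mult_left_mono)
      moreover have "\<bar>exp (- (r * (t (Suc i) - T))) * ((D (t (Suc i)) - D (t i)) * v (Suc 0) r \<zeta>)\<bar>
          \<le> 1 * \<bar>(D (t (Suc i)) - D (t i)) * v (Suc 0) r \<zeta>\<bar>"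
        unfolding abs_mult[of "exp (- (r * (t (Suc i) - T)))"] using e1[of "Suc i"] by (intro mult_right_mono) auto
      ultimately show "\<bar>exp (- (r * (t (Suc i) - T))) *
           (v 0 r (P.X (t (Suc i)) + (D (t (Suc i)) - D (t i))) - v 0 r (P.X (t (Suc i))))\<bar>
         \<le> (D (t (Suc i)) - D (t i)) * (a * exp (a * (k + 3 * Z)))" unfolding z(3) by linarith
    qed
    also have "\<dots> = (D (T + S) - D T) * (a * exp (a * (k + 3 * Z)))"
      unfolding sum_distrib_right[symmetric] sum_lessThan_telescope[of "\<lambda>i. D (t i)"] g(1,2) ..
    also have "\<dots> \<le> exp Z * (a * exp (a * (k + 3 * Z)))"
    proof (intro mult_right_mono)
      have "D (T + S) - D T \<le> Z" using S by (intro ib(2)) auto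
      also have "Z \<le> exp Z" using exp_ge_add_one_self[of Z] by linarith
      finally show "D (T + S) - D T \<le> exp Z" .
    qed (use a(1) in simp)
    also have "\<dots> = a * exp (a * k) * exp ((3 * a + 1) * Z)"
      by (simp add: mult_exp_exp algebra_simps)
    finally have "\<bar>grid_martingale r T S b D \<tau> n\<bar> \<le> 2 * a * exp (a * k) * exp ((3 * a + 1) * Z)"
      unfolding j(2) using 1 by linarith
    also have "\<dots> \<le> c * exp (c * Z)"
      using c a(1) Z0 by (intro mult_mono) (auto intro: mult_right_mono)
    finally show "\<bar>grid_martingale r T S b D \<tau> n\<bar> \<le> c * exp (c * Z)" .
  qed
qed

text \<open>
  Dividends are paid only while the surplus is near \<open>k\<close>, where the slope of the value function is
  near \<open>1\<close> by smooth fit.  So the sum is close to the Riemann-Stieltjes sum of the discounted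
  dividends.
\<close>

lemma grid_reflection_limit:
  assumes r: "0 < r" and path: "reflected_path k T b D \<tau>" and S: "0 < S"
  defines "P \<equiv> \<integral>\<^sup>+ s \<in> {T<..T + S}. ennreal (exp (- r * (s - T))) \<partial>interval_measure D"
  shows "grid_reflection r T S b D \<longlonglongrightarrow> enn2real P" "P < \<infinity>"
proof -
  interpret P: reflected_path k T b D \<tau> by fact
  define t where "t n i = T + real i * (S / real (Suc n))" for n i
  note g = grid_points[OF S, where T = T, folded t_def]
  have dD: "0 \<le> D (t n (Suc i)) - D (t n i)" for n i
    using monoD[OF P.D_mono less_imp_le[OF g(3)], of n i] by simp
  define \<rho> where "\<rho> n = (\<Sum>i<Suc n. exp (- r * (t n (Suc i) - T)) * (D (t n (Suc i)) - D (t n i)))" for n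
  define Dt where "Dt = D (T + S) - D T"
  have Dt0: "0 \<le> Dt" using monoD[OF P.D_mono, of T "T + S"] S by (simp add: Dt_def)
  have Dsum: "(\<Sum>i<Suc n. D (t n (Suc i)) - D (t n i)) = Dt" for n
    unfolding sum_lessThan_telescope[of "\<lambda>i. D (t n i)"] g(1,2) Dt_def ..
  have h: "0 < S / real (Suc n)" for n using S by simp
  have lower: "ennreal (\<rho> n) \<le> P" for n
    using stieltjes_exp_bounds(1)[OF P.D_mono P.D_right_cont h[of n] r, where T = T and N = "Suc n", folded t_def] unfolding \<rho>_def P_def g(2) .
  have upper: "P \<le> ennreal (\<rho> n + r * (S / real (Suc n)) * Dt)" for n
  proof -
    have "P \<le> ennreal (\<Sum>i<Suc n. exp (- r * (t n i - T)) * (D (t n (Suc i)) - D (t n i)))"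
      using stieltjes_exp_bounds(2)[OF P.D_mono P.D_right_cont h[of n] r, where T = T and N = "Suc n", folded t_def] unfolding P_def g(2) .
    also have "\<dots> \<le> ennreal (\<rho> n + r * (S / real (Suc n)) * Dt)"
    proof (rule ennreal_leI)
      have "exp (- r * (t n i - T)) \<le> exp (- r * (t n (Suc i) - T)) + r * (S / real (Suc n))" for i
      proof -
        define h where "h = S / real (Suc n)"
        have h: "0 \<le> r * h" using r S by (simp add: h_def)
        have "t n (Suc i) = t n i + h" using g(4)[of n i] by (simp add: h_def)
        then have "exp (- r * (t n (Suc i) - T)) = exp (- r * (t n i - T)) * exp (- (r * h))"
          unfolding mult_exp_exp by (simp add: algebra_simps)
        then have "exp (- r * (t n i - T)) - exp (- r * (t n (Suc i) - T)) = exp (- r * (t n i - T)) * (1 - exp (- (r * h)))"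
          by (simp only: right_diff_distrib mult_1_right)
        also have "\<dots> \<le> 1 * (r * h)"
          using exp_neg_bounds[OF h] r g(6)[of n i] h by (intro mult_mono) auto
        finally show ?thesis unfolding h_def by linarith
      qed
      then have "(\<Sum>i<Suc n. exp (- r * (t n i - T)) * (D (t n (Suc i)) - D (t n i)))
        \<le> (\<Sum>i<Suc n. (exp (- r * (t n (Suc i) - T)) + r * (S / real (Suc n))) * (D (t n (Suc i)) - D (t n i)))"
        using dD by (intro sum_mono mult_right_mono)
      also have "\<dots> = \<rho> n + r * (S / real (Suc n)) * Dt"
        unfolding distrib_right sum.distrib sum_distrib_left[symmetric] Dsum \<rho>_def ..
      finally show "(\<Sum>i<Suc n. exp (- r * (t n i - T)) * (D (t n (Suc i)) - D (t n i))) \<le> \<rho> n + r * (S / real (Suc n)) * Dt" .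
    qed
    finally show ?thesis .
  qed
  show fin: "P < \<infinity>" using upper[of 0] by (simp add: le_less_trans)
  have \<rho>0: "0 \<le> \<rho> n" for n unfolding \<rho>_def by (intro sum_nonneg mult_nonneg_nonneg dD) simp
  have l: "\<rho> n \<le> enn2real P" for n
    using enn2real_mono[OF lower[of n] fin[unfolded infinity_ennreal_def]] unfolding enn2real_ennreal[OF \<rho>0] .
  have u: "enn2real P \<le> \<rho> n + r * (S / real (Suc n)) * Dt" for n
  proof -
    have x0: "0 \<le> \<rho> n + r * (S / real (Suc n)) * Dt"
      using \<rho>0[of n] r S Dt0 by (intro add_nonneg_nonneg mult_nonneg_nonneg) auto
    show ?thesis using enn2real_mono[OF upper[of n] ennreal_less_top] unfolding enn2real_ennreal[OF x0] .
  qed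
  have h0: "(\<lambda>n. S / real (Suc n)) \<longlonglongrightarrow> 0" by (rule LIMSEQ_Suc[OF lim_const_over_n])
  then have "(\<lambda>n. enn2real P - r * (S / real (Suc n)) * Dt) \<longlonglongrightarrow> enn2real P - r * 0 * Dt" by (intro tendsto_intros)
  then have "(\<lambda>n. enn2real P - r * (S / real (Suc n)) * Dt) \<longlonglongrightarrow> enn2real P" by simp
  then have \<rho>lim: "\<rho> \<longlonglongrightarrow> enn2real P"
    by (rule tendsto_sandwich[rotated 2, OF _ tendsto_const]) (use l u in \<open>auto simp: algebra_simps\<close>)
  have "(\<lambda>n. grid_reflection r T S b D n - \<rho> n) \<longlonglongrightarrow> 0"
  proof (rule LIMSEQ_I)
    fix e :: real assume e: "0 < e"
    define \<eta> where "\<eta> = e / (Dt + 1)"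
    have \<eta>: "0 < \<eta>" "\<eta> * Dt < e" using e Dt0 by (auto simp: \<eta>_def field_simps)
    have "isCont (v (Suc 0) r) k" using v_deriv_numerals(2) by (rule DERIV_isCont)
    then obtain \<theta> where \<theta>': "0 < \<theta>" "\<forall>\<zeta>. dist \<zeta> k < \<theta> \<longrightarrow> dist (v (Suc 0) r \<zeta>) (v (Suc 0) r k) < \<eta>"
      using \<eta>(1) unfolding continuous_at_eps_delta by blast
    then have \<theta>: "0 < \<theta>" "\<And>\<zeta>. \<bar>\<zeta> - k\<bar> < \<theta> \<Longrightarrow> \<bar>v (Suc 0) r \<zeta> - 1\<bar> < \<eta>"
      unfolding dist_real_def v_1_k[OF r] by blast+
    have uc: "uniformly_continuous_on {T..T + S} P.X" "uniformly_continuous_on {T..T + S} D"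
      by (rule compact_uniformly_continuous[OF continuous_on_subset[OF P.X_cont]]; auto)
         (rule compact_uniformly_continuous[OF continuous_on_subset[OF P.D_cont]]; auto)
    have \<theta>2: "0 < \<theta> / 2" using \<theta>(1) by simp
    obtain d1 where d1: "0 < d1" "\<forall>s\<in>{T..T + S}. \<forall>s'\<in>{T..T + S}. dist s' s < d1 \<longrightarrow> dist (P.X s') (P.X s) < \<theta> / 2"
      using uc(1) \<theta>2 unfolding uniformly_continuous_on_def by blast
    obtain d2 where d2: "0 < d2" "\<forall>s\<in>{T..T + S}. \<forall>s'\<in>{T..T + S}. dist s' s < d2 \<longrightarrow> dist (D s') (D s) < \<theta> / 2"
      using uc(2) \<theta>2 unfolding uniformly_continuous_on_def by blast
    have d: "0 < d1" "0 < d2"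
      "\<And>s s'. s \<in> {T..T + S} \<Longrightarrow> s' \<in> {T..T + S} \<Longrightarrow> dist s' s < d1 \<Longrightarrow> dist (P.X s') (P.X s) < \<theta> / 2"
      "\<And>s s'. s \<in> {T..T + S} \<Longrightarrow> s' \<in> {T..T + S} \<Longrightarrow> dist s' s < d2 \<Longrightarrow> dist (D s') (D s) < \<theta> / 2"
      using d1 d2 by blast+
    obtain n0 where n0: "\<And>n. n0 \<le> n \<Longrightarrow> S / real (Suc n) < min d1 d2"
      using LIMSEQ_D[OF h0, of "min d1 d2"] d(1,2) S by auto
    have "\<bar>grid_reflection r T S b D n - \<rho> n\<bar> \<le> \<eta> * Dt" if n: "n0 \<le> n" for n
    proof -
      have "\<bar>grid_reflection r T S b D n - \<rho> n\<bar> \<le> (\<Sum>i<Suc n. \<eta> * (D (t n (Suc i)) - D (t n i)))"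
        unfolding grid_reflection_def Let_def t_def[symmetric] \<rho>_def sum_subtractf[symmetric]
      proof (intro order_trans[OF sum_abs] sum_mono)
        fix i assume "i \<in> {..<Suc n}"
        then have i: "t n (Suc i) \<in> {T..T + S}" "t n i \<in> {T..T + S}" by (intro g(5); simp)+
        let ?d = "D (t n (Suc i)) - D (t n i)" and ?x = "P.X (t n (Suc i))"
        have 1: "\<bar>v 0 r (?x + ?d) - v 0 r ?x - ?d\<bar> \<le> \<eta> * ?d"
        proof (cases "?d = 0")
          case False
          then have "D (t n i) < D (t n (Suc i))" using dD[of n i] by simp
          then obtain w where w: "t n i < w" "w \<le> t n (Suc i)" "P.X w = k"
            using P.growth[OF g(6) g(3)] by blast
          have dt: "t n (Suc i) - t n i < min d1 d2" using n0[OF n] g(4)[of n i] by simp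
          have dx: "dist ?x (P.X w) < \<theta> / 2"
            using w i dt by (intro d(3)) (auto simp: dist_real_def)
          have dd: "dist (D (t n (Suc i))) (D (t n i)) < \<theta> / 2"
            using i dt less_imp_le[OF g(3)[of n i]] by (intro d(4)) (auto simp: dist_real_def)
          have near: "\<bar>?x - k\<bar> < \<theta> / 2" using dx unfolding dist_real_def w(3) .
          have near2: "?d < \<theta> / 2" using dd unfolding dist_real_def by linarith
          obtain \<zeta> where z: "?x \<le> \<zeta>" "\<zeta> \<le> ?x + ?d" "v 0 r (?x + ?d) - v 0 r ?x = ?d * v (Suc 0) r \<zeta>"
            using value_increment[OF dD] by blast
          have "\<bar>v (Suc 0) r \<zeta> - 1\<bar> < \<eta>" using z(1,2) near near2 by (intro \<theta>(2)) linarith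
          then have "\<bar>?d * (v (Suc 0) r \<zeta> - 1)\<bar> \<le> ?d * \<eta>"
            unfolding abs_mult using dD[of n i] by (intro mult_mono) auto
          then show ?thesis unfolding z(3) by (simp add: algebra_simps)
        qed simp
        have 2: "\<bar>exp (- (r * (t n (Suc i) - T))) * (v 0 r (?x + ?d) - v 0 r ?x - ?d)\<bar> \<le> 1 * \<bar>v 0 r (?x + ?d) - v 0 r ?x - ?d\<bar>"
          unfolding abs_mult using r g(6)[of n "Suc i"] by (intro mult_right_mono) auto
        have 3: "exp (- (r * (t n (Suc i) - T))) * (v 0 r (?x + ?d) - v 0 r ?x) - exp (- r * (t n (Suc i) - T)) * ?d
            = exp (- (r * (t n (Suc i) - T))) * (v 0 r (?x + ?d) - v 0 r ?x - ?d)" by (simp add: algebra_simps)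
        show "\<bar>exp (- (r * (t n (Suc i) - T))) * (v 0 r (?x + ?d) - v 0 r ?x) - exp (- r * (t n (Suc i) - T)) * ?d\<bar>
            \<le> \<eta> * ?d" unfolding 3 by (rule order_trans[OF 2[unfolded mult_1] 1])
      qed
      also have "\<dots> = \<eta> * Dt" unfolding sum_distrib_left[symmetric] Dsum ..
      finally show ?thesis .
    qed
    then show "\<exists>no. \<forall>n\<ge>no. norm (grid_reflection r T S b D n - \<rho> n - 0) < e"
      using \<eta>(2) by (intro exI[of _ n0]) (auto intro: le_less_trans)
  qed
  from tendsto_add[OF this \<rho>lim] show "grid_reflection r T S b D \<longlonglongrightarrow> enn2real P" by simp
qed

text \<open>
  The boundary term disappears after ruin because \<open>v(0) = 0\<close>.
\<close>

lemma grid_martingale_limit: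
  assumes r: "0 < r" and path: "reflected_path k T b D \<tau>" and S: "0 < S"
  defines "P \<equiv> \<integral>\<^sup>+ s \<in> {T<..T + S}. ennreal (exp (- r * (s - T))) \<partial>interval_measure D"
  shows "grid_martingale r T S b D \<tau> \<longlonglongrightarrow>
    (if \<tau> \<le> ereal (T + S) then 0 else exp (- (r * S)) * v 0 r (b (T + S) - D (T + S))) + enn2real P"
proof -
  interpret P: reflected_path k T b D \<tau> by fact
  define t where "t n i = T + real i * (S / real (Suc n))" for n i
  note g = grid_points[OF S, where T = T, folded t_def]
  define Q where "Q n j \<longleftrightarrow> j \<le> Suc n \<and> (\<forall>i<j. ereal (t n i) < \<tau>) \<and> (j < Suc n \<longrightarrow> \<tau> \<le> ereal (t n j)) \<and>
     grid_martingale r T S b D \<tau> n = exp (- (r * (t n j - T))) * v 0 r (P.X (t n j)) + grid_reflection r T S b D n" for n j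
  have "\<exists>j. Q n j" for n
  proof (rule grid_decomposition[OF path S, where n = n and r = r, folded t_def])
    fix j
    assume "j \<le> Suc n" "\<And>i. i < j \<Longrightarrow> ereal (t n i) < \<tau>" "j < Suc n \<Longrightarrow> \<tau> \<le> ereal (t n j)"
      "grid_martingale r T S b D \<tau> n = exp (- (r * (t n j - T))) * v 0 r (P.X (t n j)) + grid_reflection r T S b D n"
    then have "Q n j" unfolding Q_def by (intro conjI allI impI)
    then show "\<exists>j. Q n j" by (rule exI)
  qed
  then obtain j where "\<And>n. Q n (j n)" using choice[of Q] by blast
  then have j: "\<And>n. j n \<le> Suc n" "\<And>n i. i < j n \<Longrightarrow> ereal (t n i) < \<tau>"
     "\<And>n. j n < Suc n \<Longrightarrow> \<tau> \<le> ereal (t n (j n))"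
     "\<And>n. grid_martingale r T S b D \<tau> n = exp (- (r * (t n (j n) - T))) * v 0 r (P.X (t n (j n))) + grid_reflection r T S b D n"
    unfolding Q_def by blast+
  have "(\<lambda>n. exp (- (r * (t n (j n) - T))) * v 0 r (P.X (t n (j n)))) \<longlonglongrightarrow>
    (if \<tau> \<le> ereal (T + S) then 0 else exp (- (r * S)) * v 0 r (P.X (T + S)))"
  proof (cases "\<tau> \<le> ereal (T + S)")
    case False
    have "j n = Suc n" for n
    proof (rule ccontr)
      assume "j n \<noteq> Suc n"
      then have "\<tau> \<le> ereal (t n (j n))" using j(1,3)[of n] by auto
      also have "\<dots> \<le> ereal (T + S)" using g(5)[OF j(1)] by simp
      finally show False using False by simp
    qed
    then show ?thesis using False g(2) by simp
  next
    case True
    then obtain u where u: "\<tau> = ereal u" "T \<le> u" "u \<le> T + S" using P.T_le by (cases \<tau>) auto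
    have b1: "u \<le> t n (j n)" for n
    proof (cases "j n = Suc n")
      case True then show ?thesis using g(2)[of n] u by simp
    next
      case False then show ?thesis using j(1,3)[of n] u by simp
    qed
    have b2: "t n (j n) \<le> u + S / real (Suc n)" for n
    proof (cases "j n")
      case 0
      have "0 \<le> S / real (Suc n)" using S by simp
      then show ?thesis unfolding 0 g(1) using u by linarith
    next
      case (Suc i)
      then have "t n i < u" using j(2)[of i n] u by simp
      then show ?thesis using g(4)[of n i] Suc by simp
    qed
    have h0: "(\<lambda>n. S / real (Suc n)) \<longlonglongrightarrow> 0" by (rule LIMSEQ_Suc[OF lim_const_over_n])
    have "(\<lambda>n. t n (j n)) \<longlonglongrightarrow> u"
    proof (rule tendsto_sandwich[of "\<lambda>_. u" _ _ "\<lambda>n. u + S / real (Suc n)"])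
      show "(\<lambda>n. u + S / real (Suc n)) \<longlonglongrightarrow> u" using tendsto_add[OF tendsto_const h0, of u] by simp
      show "\<forall>\<^sub>F n in sequentially. u \<le> t n (j n)" by (rule always_eventually, rule allI, rule b1)
      show "\<forall>\<^sub>F n in sequentially. t n (j n) \<le> u + S / real (Suc n)" by (rule always_eventually, rule allI, rule b2)
    qed simp
    then have "(\<lambda>n. P.X (t n (j n))) \<longlonglongrightarrow> P.X u"
      using u g(6) by (intro continuous_on_tendsto_compose[OF P.X_cont]) auto
    moreover have "isCont (v 0 r) 0" using v_deriv_numerals(1) by (rule DERIV_isCont)
    ultimately have vlim: "(\<lambda>n. v 0 r (P.X (t n (j n)))) \<longlonglongrightarrow> 0"
      using isCont_tendsto_compose[of 0 "v 0 r" "\<lambda>n. P.X (t n (j n))" sequentially] unfolding P.ruin[OF u(1)] v_0_0 by blast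
    have le: "norm (exp (- (r * (t n (j n) - T))) * v 0 r (P.X (t n (j n)))) \<le> norm (v 0 r (P.X (t n (j n))))" for n
    proof -
      have "exp (- (r * (t n (j n) - T))) \<le> 1" using r g(6)[of n "j n"] by simp
      then show ?thesis by (simp add: abs_mult mult_left_le_one_le)
    qed
    have "(\<lambda>n. exp (- (r * (t n (j n) - T))) * v 0 r (P.X (t n (j n)))) \<longlonglongrightarrow> 0"
      by (rule Lim_null_comparison[OF always_eventually[OF allI[OF le]] tendsto_norm_zero[OF vlim]])
    then show ?thesis using True by simp
  qed
  note lim = tendsto_add[OF this grid_reflection_limit(1)[OF r path S]]
  show ?thesis unfolding P_def
    by (rule Lim_transform_eventually[OF lim]) (rule always_eventually, rule allI, rule j(4)[symmetric])
qed

end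

section \<open>Expected dividends of a reflected path\<close>

context brownian_barrier begin

text \<open>
  On \<open>[T, T + S]\<close> the discrete martingale has a constant expectation, and dominated convergence
  transfers it to the limit, the discounted value at \<open>T + S\<close> plus the dividends paid so far.  As \<open>S\<close>
  grows the first part vanishes, because the value is bounded on \<open>[0, k]\<close>.  The second
  conclusion provides the measurability of the dividend integral that nested expectations need.
\<close>

lemma expected_reflection_dividends:
  fixes Y :: "'a \<Rightarrow> real" and D :: "real \<Rightarrow> 'a \<Rightarrow> real" and \<tau> :: "'a \<Rightarrow> ereal"
  assumes T: "0 \<le> T" and r: "0 < r"
    and Y: "Y \<in> borel_measurable (F T)" and D: "\<And>s. T \<le> s \<Longrightarrow> D s \<in> borel_measurable (F s)"
    and path: "AE \<omega> in M. reflected_path k T (\<lambda>s. Y \<omega> + \<mu> * (s - T) + \<sigma> * (W s \<omega> - W T \<omega>)) (\<lambda>s. D s \<omega>) (\<tau> \<omega>)"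
  shows "(\<integral>\<^sup>+ \<omega>. (\<integral>\<^sup>+ s \<in> {T<..}. ennreal (exp (- r * (s - T))) \<partial>interval_measure (\<lambda>s. D s \<omega>)) \<partial>M)
    = (\<integral>\<^sup>+ \<omega>. ennreal (v 0 r (Y \<omega> - D T \<omega>)) \<partial>M)"
    and "\<exists>g\<in>borel_measurable M. AE \<omega> in M. g \<omega> =
      (\<integral>\<^sup>+ s \<in> {T<..}. ennreal (exp (- r * (s - T))) \<partial>interval_measure (\<lambda>s. D s \<omega>))"
proof -
  define b where "b s \<omega> = Y \<omega> + \<mu> * (s - T) + \<sigma> * (W s \<omega> - W T \<omega>)" for s \<omega>
  define X where "X s \<omega> = b s \<omega> - D s \<omega>" for s \<omega>
  have path': "AE \<omega> in M. reflected_path k T (\<lambda>s. b s \<omega>) (\<lambda>s. D s \<omega>) (\<tau> \<omega>)"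
    using path by (simp only: b_def)
  have YF: "Y \<in> borel_measurable (F s)" if "T \<le> s" for s using measurable_F_mono[OF that Y] .
  have WF: "W s \<in> borel_measurable (F u)" if "T \<le> s" "s \<le> u" for s u
    using measurable_F_mono[OF that(2) W_adapted] that T by auto
  have bF: "b s \<in> borel_measurable (F u)" if "T \<le> s" "s \<le> u" for s u
  proof -
    note [measurable] = WF[OF that] WF[OF order_refl, of u] YF[of u]
    have "T \<le> u" using that by linarith
    then show ?thesis unfolding b_def[abs_def] by measurable
  qed
  have XF: "X s \<in> borel_measurable (F u)" if "T \<le> s" "s \<le> u" for s u
    unfolding X_def[abs_def] using bF[OF that] measurable_F_mono[OF that(2) D[OF that(1)]] by measurable
  have XM: "X s \<in> borel_measurable M" if "T \<le> s" for s
    using measurable_F_M[OF _ XF[OF that order_refl]] T that by auto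
  have bM: "b s \<in> borel_measurable M" if "T \<le> s" for s
    using measurable_F_M[OF _ bF[OF that order_refl]] T that by auto
  \<comment> \<open>The event that the surplus is alive at time \<open>s\<close>; the bounds keep the values of \<open>v 0 r\<close> bounded on it everywhere, also off the almost sure set of good paths.\<close>
  define al where "al s = {\<omega> \<in> space M. 0 < X s \<omega> \<and> X s \<omega> \<le> k \<and>
     (s = T \<or> (\<exists>m. \<forall>n. \<forall>i\<in>{..Suc n}. 1 / real (Suc m) \<le> X (T + real i * ((s - T) / real (Suc n))) \<omega>))}" for s
  have alF: "al s \<in> sets (F s)" if s: "T \<le> s" for s
  proof -
    have [measurable]: "X s \<in> borel_measurable (F s)" by (rule XF[OF s order_refl])
    have m: "X (T + real i * ((s - T) / real (Suc n))) \<in> borel_measurable (F s)" if "i \<in> {..Suc n}" for i n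
    proof (rule XF)
      have "real i * ((s - T) / real (Suc n)) \<le> real (Suc n) * ((s - T) / real (Suc n))"
        using that s by (intro mult_right_mono) auto
      also have "\<dots> = s - T" by simp
      finally show "T + real i * ((s - T) / real (Suc n)) \<le> s" by linarith
      have "0 \<le> real i * ((s - T) / real (Suc n))" using s by (intro mult_nonneg_nonneg) auto
      then show "T \<le> T + real i * ((s - T) / real (Suc n))" by linarith
    qed
    have p[measurable]: "Measurable.pred (F s) (\<lambda>\<omega>. \<forall>i\<in>{..Suc n}. c \<le> X (T + real i * ((s - T) / real (Suc n))) \<omega>)" for n c
    proof (rule pred_intros_finite(3))
      fix i assume "i \<in> {..Suc n}"
      note [measurable] = m[OF this]
      show "Measurable.pred (F s) (\<lambda>\<omega>. c \<le> X (T + real i * ((s - T) / real (Suc n))) \<omega>)" by measurable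
    qed simp
    have "{\<omega> \<in> space (F s). 0 < X s \<omega> \<and> X s \<omega> \<le> k \<and>
     (s = T \<or> (\<exists>m. \<forall>n. \<forall>i\<in>{..Suc n}. 1 / real (Suc m) \<le> X (T + real i * ((s - T) / real (Suc n))) \<omega>))} \<in> sets (F s)"
      by measurable
    then show ?thesis unfolding al_def space_F .
  qed
  have al: "\<omega> \<in> al s \<longleftrightarrow> ereal s < \<tau> \<omega>"
    if "reflected_path k T (\<lambda>s. b s \<omega>) (\<lambda>s. D s \<omega>) (\<tau> \<omega>)" "\<omega> \<in> space M" "T \<le> s" for s \<omega>
  proof -
    interpret P: reflected_path k T "\<lambda>s. b s \<omega>" "\<lambda>s. D s \<omega>" "\<tau> \<omega>" by fact
    have 1: "0 < X s \<omega> \<and> X s \<omega> \<le> k" if "ereal s < \<tau> \<omega>"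
      using P.above_zero[OF \<open>T \<le> s\<close> that] P.below_barrier[OF \<open>T \<le> s\<close> that] by (simp add: X_def)
    show ?thesis
    proof (cases "s = T")
      case True
      have "ereal T < \<tau> \<omega>" if "0 < X T \<omega>"
      proof (rule ccontr)
        assume "\<not> ereal T < \<tau> \<omega>"
        then have "\<tau> \<omega> = ereal T" using P.T_le by (auto simp: not_less)
        from P.ruin[OF this] show False using that by (simp add: X_def)
      qed
      then show ?thesis using True 1 that(2) by (auto simp: al_def)
    next
      case False
      then have "T < s" using that(3) by simp
      have "ereal s < \<tau> \<omega> \<longleftrightarrow>
        (\<exists>m. \<forall>n. \<forall>i\<in>{..Suc n}. 1 / real (Suc m) \<le> X (T + real i * ((s - T) / real (Suc n))) \<omega>)"
        unfolding P.alive_iff[OF that(3)] X_def Ball_def[of "{.._}"] atMost_iff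
        by (rule positive_on_grid_iff[OF \<open>T < s\<close>]) (rule continuous_on_subset[OF P.X_cont], auto)
      then show ?thesis using 1 that(2) False unfolding al_def by blast
    qed
  qed
  define C where "C = v 0 r k"
  have C0: "0 \<le> C" unfolding C_def using v_0_nonneg[OF r, of k] k_pos by simp
  have vC: "0 \<le> v 0 r z \<and> v 0 r z \<le> C" if "0 \<le> z" "z \<le> k" for z
    unfolding C_def using v_0_nonneg[OF r that(1)] v_0_mono[OF r that(2)] by simp
  have v0m: "(\<lambda>\<omega>. v 0 r (f \<omega>)) \<in> borel_measurable N" if "f \<in> borel_measurable N" for f and N :: "'a measure"
    using that by measurable
  have start: "AE \<omega> in M. 0 \<le> v 0 r (X T \<omega>) \<and> v 0 r (X T \<omega>) \<le> C"
    using path' by eventually_elim (use vC in \<open>auto simp: X_def dest: reflected_path.start\<close>)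
  define E0 where "E0 = expectation (\<lambda>\<omega>. v 0 r (X T \<omega>))"
  have i0: "integrable M (\<lambda>\<omega>. v 0 r (X T \<omega>))"
    by (rule integrable_const_bound[of _ C]) (use start in \<open>auto intro!: v0m XM\<close>)
  have main: "\<exists>f. integrable M f \<and> expectation f = E0 \<and> (AE \<omega> in M.
      f \<omega> = indicator (al (T + S)) \<omega> * (exp (- (r * S)) * v 0 r (X (T + S) \<omega>)) +
       enn2real (\<integral>\<^sup>+ s \<in> {T<..T + S}. ennreal (exp (- r * (s - T))) \<partial>interval_measure (\<lambda>s. D s \<omega>)))"
    if S: "0 < S" for S
  proof -
    define t where "t n i = T + real i * (S / real (Suc n))" for n i
    note g = grid_points[OF S, where T = T, folded t_def]
    have t0: "0 \<le> t n i" for n i using g(6)[of n i] T by linarith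
    define m where "m n i \<omega> = indicator (al (t n i)) \<omega> * (exp (- (r * (t n (Suc i) - t n i))) *
       v 0 r (X (t n i) \<omega> + \<mu> * (t n (Suc i) - t n i) + \<sigma> * (W (t n (Suc i)) \<omega> - W (t n i) \<omega>)) - v 0 r (X (t n i) \<omega>))" for n i \<omega>
    have hm: "integrable M (m n i)" "expectation (m n i) = 0" for n i
    proof -
      have bd: "\<bar>X (t n i) \<omega>\<bar> \<le> k" if "\<omega> \<in> al (t n i)" for \<omega> using that by (auto simp: al_def)
      show "integrable M (m n i)" "expectation (m n i) = 0"
        using harmonic_increment[OF t0 g(3) r alF[OF g(6)] XF[OF g(6) order_refl] bd] unfolding m_def by blast+
    qed
    define A where "A n \<omega> = v 0 r (X T \<omega>) + (\<Sum>i<Suc n. exp (- (r * (t n i - T))) * m n i \<omega>)" for n \<omega>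
    have Ai: "integrable M (A n)" for n
      unfolding A_def by (intro Bochner_Integration.integrable_add i0 Bochner_Integration.integrable_sum integrable_mult_right hm)
    have AE0: "expectation (A n) = E0" for n
      unfolding A_def E0_def using i0 hm
      by (subst Bochner_Integration.integral_add)
         (auto intro!: Bochner_Integration.integrable_sum simp: Bochner_Integration.integral_sum simp del: sum.lessThan_Suc)
    have Agrid: "A n \<omega> = grid_martingale r T S (\<lambda>s. b s \<omega>) (\<lambda>s. D s \<omega>) (\<tau> \<omega>) n"
      if "reflected_path k T (\<lambda>s. b s \<omega>) (\<lambda>s. D s \<omega>) (\<tau> \<omega>)" "\<omega> \<in> space M" for n \<omega>
    proof -
      have distrib: "e1 * (e2 * x - y) = e3 * x - e1 * y" if "e1 * e2 = e3" for e1 e2 e3 x y :: real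
        unfolding that[symmetric] by (simp only: right_diff_distrib mult.assoc)
      have "exp (- (r * (t n i - T))) * m n i \<omega> = (if ereal (t n i) < \<tau> \<omega> then
         exp (- (r * (t n (Suc i) - T))) * v 0 r (b (t n i) \<omega> - D (t n i) \<omega> + (b (t n (Suc i)) \<omega> - b (t n i) \<omega>))
         - exp (- (r * (t n i - T))) * v 0 r (b (t n i) \<omega> - D (t n i) \<omega>) else 0)" for i
      proof (cases "ereal (t n i) < \<tau> \<omega>")
        case True
        have x: "X (t n i) \<omega> + \<mu> * (t n (Suc i) - t n i) + \<sigma> * (W (t n (Suc i)) \<omega> - W (t n i) \<omega>)
          = b (t n i) \<omega> - D (t n i) \<omega> + (b (t n (Suc i)) \<omega> - b (t n i) \<omega>)"
          by (simp only: X_def b_def) (simp add: algebra_simps)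
        have e: "exp (- (r * (t n i - T))) * exp (- (r * (t n (Suc i) - t n i))) = exp (- (r * (t n (Suc i) - T)))"
          unfolding mult_exp_exp by (simp only: algebra_simps) simp
        have "indicator (al (t n i)) \<omega> = (1::real)" using True al[OF that g(6)] by simp
        then have "exp (- (r * (t n i - T))) * m n i \<omega> =
          exp (- (r * (t n i - T))) * (exp (- (r * (t n (Suc i) - t n i))) *
            v 0 r (b (t n i) \<omega> - D (t n i) \<omega> + (b (t n (Suc i)) \<omega> - b (t n i) \<omega>)) - v 0 r (X (t n i) \<omega>))"
          unfolding m_def x by (simp only: mult_1)
        also have "\<dots> = exp (- (r * (t n (Suc i) - T))) * v 0 r (b (t n i) \<omega> - D (t n i) \<omega> + (b (t n (Suc i)) \<omega> - b (t n i) \<omega>))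
           - exp (- (r * (t n i - T))) * v 0 r (b (t n i) \<omega> - D (t n i) \<omega>)"
          by (simp only: X_def) (rule distrib[OF e])
        finally show ?thesis using True by (simp only: if_True)
      next
        case False
        then have "indicator (al (t n i)) \<omega> = (0::real)" using al[OF that g(6)] by simp
        then show ?thesis using False by (simp only: m_def mult_zero_left mult_zero_right if_False)
      qed
      then show ?thesis unfolding A_def grid_martingale_def Let_def t_def[symmetric] X_def by (simp only:)
    qed
    obtain c where c: "1 \<le> c" and cb: "\<And>T S b D \<tau> Z n. reflected_path k T b D \<tau> \<Longrightarrow> 0 < S \<Longrightarrow>
       (\<And>s. s \<in> {T..T + S} \<Longrightarrow> \<bar>b s - b T\<bar> \<le> Z) \<Longrightarrow> \<bar>grid_martingale r T S b D \<tau> n\<bar> \<le> c * exp (c * Z)"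
      using grid_martingale_bound[OF r] by blast
    have c\<sigma>: "0 < c * \<sigma>" using c sigma_pos by simp
    obtain H where Hi: "integrable M H" and Hb: "AE \<omega> in M. \<forall>u\<in>{T..T + S}. exp (c * \<sigma> * \<bar>W u \<omega> - W T \<omega>\<bar>) \<le> H \<omega>"
      using sup_increment_exp[OF T S, of "c * \<sigma>"] by blast
    have dom: "AE \<omega> in M. norm (A n \<omega>) \<le> c * exp (c * \<mu> * S) * H \<omega>" for n
      using path' Hb AE_space
    proof eventually_elim
      case (elim \<omega>)
      have H1: "1 \<le> H \<omega>" using bspec[OF elim(2), of T] S by simp
      \<comment> \<open>\<open>H\<close> dominates the exponential of \<open>c \<sigma>\<close> times the oscillation of \<open>W\<close>, so its logarithm bounds the oscillation itself.\<close>
      define y where "y = ln (H \<omega>) / (c * \<sigma>)"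
      define Z where "Z = \<mu> * S + \<sigma> * y"
      have W: "\<bar>W u \<omega> - W T \<omega>\<bar> \<le> y" if "u \<in> {T..T + S}" for u
      proof -
        have "c * \<sigma> * \<bar>W u \<omega> - W T \<omega>\<bar> \<le> ln (H \<omega>)"
          using bspec[OF elim(2) that] H1 by (subst ln_ge_iff) auto
        then show ?thesis unfolding y_def using c\<sigma> by (simp add: pos_le_divide_eq mult_ac)
      qed
      have bZ: "\<bar>b u \<omega> - b T \<omega>\<bar> \<le> Z" if u: "u \<in> {T..T + S}" for u
      proof -
        have "b u \<omega> - b T \<omega> = \<mu> * (u - T) + \<sigma> * (W u \<omega> - W T \<omega>)" by (simp add: b_def)
        then have "\<bar>b u \<omega> - b T \<omega>\<bar> \<le> \<bar>\<mu> * (u - T)\<bar> + \<bar>\<sigma> * (W u \<omega> - W T \<omega>)\<bar>" by simp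
        also have "\<dots> = \<mu> * (u - T) + \<sigma> * \<bar>W u \<omega> - W T \<omega>\<bar>" using mu_pos sigma_pos u by (simp add: abs_mult)
        also have "\<dots> \<le> Z" unfolding Z_def using mu_pos sigma_pos u W[OF u] by (intro add_mono mult_left_mono) auto
        finally show ?thesis .
      qed
      have "\<bar>A n \<omega>\<bar> \<le> c * exp (c * Z)"
        unfolding Agrid[OF elim(1,3)] by (rule cb[OF elim(1) S]) (rule bZ)
      also have "c * Z = c * \<mu> * S + ln (H \<omega>)"
        using c sigma_pos by (simp add: Z_def y_def distrib_left)
      also have "c * exp (c * \<mu> * S + ln (H \<omega>)) = c * exp (c * \<mu> * S) * H \<omega>" using H1 by (simp add: exp_add)
      finally show ?case by simp
    qed
    have lim: "AE \<omega> in M. (\<lambda>n. A n \<omega>) \<longlonglongrightarrow> indicator (al (T + S)) \<omega> * (exp (- (r * S)) * v 0 r (X (T + S) \<omega>)) +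
       enn2real (\<integral>\<^sup>+ s \<in> {T<..T + S}. ennreal (exp (- r * (s - T))) \<partial>interval_measure (\<lambda>s. D s \<omega>))"
      using path' AE_space
    proof eventually_elim
      case (elim \<omega>)
      have "indicator (al (T + S)) \<omega> * (exp (- (r * S)) * v 0 r (X (T + S) \<omega>))
        = (if \<tau> \<omega> \<le> ereal (T + S) then 0 else exp (- (r * S)) * v 0 r (b (T + S) \<omega> - D (T + S) \<omega>))"
        using al[OF elim, of "T + S"] S by (auto simp: X_def not_le indicator_def)
      then show ?case using grid_martingale_limit[OF r elim(1) S] unfolding Agrid[OF elim] by (simp only:)
    qed
    define f where "f \<omega> = lim (\<lambda>n. A n \<omega>)" for \<omega>
    have [measurable]: "A n \<in> borel_measurable M" for n using Ai by (rule borel_measurable_integrable)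
    have fm: "f \<in> borel_measurable M" unfolding f_def[abs_def] by (rule borel_measurable_lim_metric) measurable
    have flim: "AE \<omega> in M. (\<lambda>n. A n \<omega>) \<longlonglongrightarrow> f \<omega>"
      using lim unfolding f_def by eventually_elim (simp add: limI)
    have Hi': "integrable M (\<lambda>\<omega>. c * exp (c * \<mu> * S) * H \<omega>)" using Hi by simp
    have Am: "A n \<in> borel_measurable M" for n by measurable
    have fi: "integrable M f"
      by (rule integrable_dominated_convergence[OF fm Am Hi' flim dom])
    have "(\<lambda>n. expectation (A n)) \<longlonglongrightarrow> expectation f"
      by (rule integral_dominated_convergence[OF fm Am Hi' flim dom])
    then have "expectation f = E0" unfolding AE0 using LIMSEQ_unique tendsto_const by blast
    moreover have "AE \<omega> in M. f \<omega> = indicator (al (T + S)) \<omega> * (exp (- (r * S)) * v 0 r (X (T + S) \<omega>)) +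
       enn2real (\<integral>\<^sup>+ s \<in> {T<..T + S}. ennreal (exp (- r * (s - T))) \<partial>interval_measure (\<lambda>s. D s \<omega>))"
      using lim unfolding f_def by eventually_elim (rule limI)
    ultimately show ?thesis using fi by blast
  qed
  define p where "p n \<omega> = (\<integral>\<^sup>+ s \<in> {T<..T + real (Suc n)}. ennreal (exp (- r * (s - T))) \<partial>interval_measure (\<lambda>s. D s \<omega>))" for n \<omega>
  define q where "q n \<omega> = indicator (al (T + real (Suc n))) \<omega> * (exp (- (r * real (Suc n))) * v 0 r (X (T + real (Suc n)) \<omega>))" for n \<omega>
  have "\<forall>n. \<exists>f. integrable M f \<and> expectation f = E0 \<and> (AE \<omega> in M. f \<omega> = q n \<omega> + enn2real (p n \<omega>))"
    using main unfolding p_def q_def by simp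
  then obtain f where f: "\<And>n. integrable M (f n)" "\<And>n. expectation (f n) = E0"
     "\<And>n. AE \<omega> in M. f n \<omega> = q n \<omega> + enn2real (p n \<omega>)"
    using choice[of "\<lambda>n f. integrable M f \<and> expectation f = E0 \<and> (AE \<omega> in M. f \<omega> = q n \<omega> + enn2real (p n \<omega>))"] by blast
  have q0: "0 \<le> q n \<omega> \<and> q n \<omega> \<le> exp (- (r * real (Suc n))) * C" for n \<omega>
  proof (cases "\<omega> \<in> al (T + real (Suc n))")
    case True
    then have "0 \<le> v 0 r (X (T + real (Suc n)) \<omega>) \<and> v 0 r (X (T + real (Suc n)) \<omega>) \<le> C" by (intro vC) (auto simp: al_def)
    then show ?thesis using True by (simp add: q_def mult_left_mono)
  qed (use C0 in \<open>simp add: q_def\<close>)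
  have qm: "q n \<in> borel_measurable M" for n
  proof -
    have TS: "T \<le> T + real (Suc n)" "0 \<le> T + real (Suc n)" using T by simp_all
    note [measurable] = sets_F_M[OF TS(2) alF[OF TS(1)]] XM[OF TS(1)]
    show ?thesis unfolding q_def[abs_def] by measurable
  qed
  have qi: "integrable M (q n)" for n
    by (rule integrable_const_bound[OF _ qm, of _ "exp (- (r * real (Suc n))) * C"]) (use q0 in auto)
  define G where "G n \<omega> = f n \<omega> - q n \<omega>" for n \<omega>
  have Gi: "integrable M (G n)" for n unfolding G_def by (intro Bochner_Integration.integrable_diff f qi)
  have GP: "AE \<omega> in M. G n \<omega> = enn2real (p n \<omega>)" for n
    using f(3)[of n] by eventually_elim (simp add: G_def)
  have pfin: "AE \<omega> in M. p n \<omega> < \<infinity>" for n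
    using path' unfolding p_def by eventually_elim (rule grid_reflection_limit(2)[OF r], assumption, simp)
  have Gp: "AE \<omega> in M. ennreal (G n \<omega>) = p n \<omega>" for n
    using GP[of n] pfin[of n] by eventually_elim (simp add: less_top)
  have pmono: "p n \<omega> \<le> p (Suc n) \<omega>" for n \<omega>
    unfolding p_def by (intro nn_integral_mono) (auto simp: indicator_def)
  have psup: "(SUP n. p n \<omega>) = (\<integral>\<^sup>+ s \<in> {T<..}. ennreal (exp (- r * (s - T))) \<partial>interval_measure (\<lambda>s. D s \<omega>))" for \<omega>
  proof -
    let ?f = "\<lambda>n s. ennreal (exp (- r * (s - T))) * indicator {T<..T + real (Suc n)} s"
    have "(SUP n. p n \<omega>) = (\<integral>\<^sup>+ s. (SUP n. ?f n s) \<partial>interval_measure (\<lambda>s. D s \<omega>))"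
      unfolding p_def
      by (rule nn_integral_monotone_convergence_SUP[symmetric])
         (auto simp: incseq_def le_fun_def indicator_def)
    also have "(\<lambda>s. SUP n. ?f n s) = (\<lambda>s. ennreal (exp (- r * (s - T))) * indicator {T<..} s)"
    proof
      fix s
      show "(SUP n. ?f n s) = ennreal (exp (- r * (s - T))) * indicator {T<..} s"
      proof (cases "T < s")
        case True
        obtain n where "s - T < real n" using reals_Archimedean2 by blast
        then have "s \<in> {T<..T + real (Suc n)}" using True by simp
        then have "?f n s = ennreal (exp (- r * (s - T)))" by simp
        moreover have "?f n' s \<le> ennreal (exp (- r * (s - T)))" for n' by (auto simp: indicator_def)
        ultimately have "(SUP n. ?f n s) = ennreal (exp (- r * (s - T)))"
          by (intro antisym SUP_least) (auto intro: SUP_upper2[of n])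
        then show ?thesis using True by simp
      qed simp
    qed
    finally show ?thesis .
  qed
  have Gm[measurable]: "(\<lambda>\<omega>. ennreal (G n \<omega>)) \<in> borel_measurable M" for n
    using borel_measurable_integrable[OF Gi[of n]] by measurable
  have "AE \<omega> in M. \<forall>n. ennreal (G n \<omega>) = p n \<omega>" using Gp by (simp add: AE_all_countable)
  then have supAE: "AE \<omega> in M. (SUP n. ennreal (G n \<omega>)) = (SUP n. p n \<omega>)" by eventually_elim simp
  show "\<exists>g\<in>borel_measurable M. AE \<omega> in M. g \<omega> =
      (\<integral>\<^sup>+ s \<in> {T<..}. ennreal (exp (- r * (s - T))) \<partial>interval_measure (\<lambda>s. D s \<omega>))"
    using supAE unfolding psup by (intro bexI[of _ "\<lambda>\<omega>. SUP n. ennreal (G n \<omega>)"]) measurable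
  have "(\<integral>\<^sup>+ \<omega>. (SUP n. p n \<omega>) \<partial>M) = (\<integral>\<^sup>+ \<omega>. (SUP n. ennreal (G n \<omega>)) \<partial>M)"
    using supAE by (intro nn_integral_cong_AE) (auto elim!: eventually_mono)
  also have "\<dots> = (SUP n. \<integral>\<^sup>+ \<omega>. ennreal (G n \<omega>) \<partial>M)"
  proof (rule nn_integral_monotone_convergence_SUP_AE)
    show "AE \<omega> in M. ennreal (G n \<omega>) \<le> ennreal (G (Suc n) \<omega>)" for n
      using Gp[of n] Gp[of "Suc n"] by eventually_elim (simp add: pmono)
  qed measurable
  also have "(\<lambda>n. \<integral>\<^sup>+ \<omega>. ennreal (G n \<omega>) \<partial>M) = (\<lambda>n. ennreal (E0 - expectation (q n)))"
  proof
    fix n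
    have "(\<integral>\<^sup>+ \<omega>. ennreal (G n \<omega>) \<partial>M) = ennreal (expectation (G n))"
      using GP[of n] by (intro nn_integral_eq_integral Gi) (auto elim!: eventually_mono)
    also have "expectation (G n) = E0 - expectation (q n)"
      unfolding G_def using f qi by (simp add: Bochner_Integration.integral_diff)
    finally show "(\<integral>\<^sup>+ \<omega>. ennreal (G n \<omega>) \<partial>M) = ennreal (E0 - expectation (q n))" .
  qed
  also have "(SUP n. ennreal (E0 - expectation (q n))) = ennreal E0"
  proof (rule antisym)
    have Eq: "0 \<le> expectation (q n)" "expectation (q n) \<le> exp (- (r * real (Suc n))) * C" for n
    proof -
      show "0 \<le> expectation (q n)" using q0 by (intro Bochner_Integration.integral_nonneg) auto
      have "expectation (q n) \<le> expectation (\<lambda>_. exp (- (r * real (Suc n))) * C)"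
        using q0 qi by (intro integral_mono) auto
      then show "expectation (q n) \<le> exp (- (r * real (Suc n))) * C" by (simp add: prob_space)
    qed
    show "(SUP n. ennreal (E0 - expectation (q n))) \<le> ennreal E0"
      using Eq(1) by (intro SUP_least ennreal_leI) simp
    have "(\<lambda>n. exp (- r) ^ Suc n * C) \<longlonglongrightarrow> 0 * C"
      using r by (intro tendsto_mult tendsto_const LIMSEQ_Suc LIMSEQ_power_zero) auto
    moreover have "exp (- r) ^ Suc n = exp (- (r * real (Suc n)))" for n
      unfolding exp_of_nat_mult[symmetric] by (simp add: algebra_simps)
    ultimately have "(\<lambda>n. exp (- (r * real (Suc n))) * C) \<longlonglongrightarrow> 0" by simp
    then have "(\<lambda>n. expectation (q n)) \<longlonglongrightarrow> 0"
      by (intro tendsto_sandwich[of "\<lambda>_. 0" "\<lambda>n. expectation (q n)" sequentially "\<lambda>n. exp (- (r * real (Suc n))) * C"])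
         (use Eq in auto)
    from tendsto_diff[OF tendsto_const this, of E0]
    have lim: "(\<lambda>n. ennreal (E0 - expectation (q n))) \<longlonglongrightarrow> ennreal (E0 - 0)" by (rule tendsto_ennrealI)
    show "ennreal E0 \<le> (SUP n. ennreal (E0 - expectation (q n)))"
    proof -
      have "\<forall>n\<ge>0. ennreal (E0 - expectation (q n)) \<le> (SUP n. ennreal (E0 - expectation (q n)))"
        by (intro allI impI SUP_upper UNIV_I)
      then show ?thesis using LIMSEQ_le_const2[OF lim] unfolding diff_0_right by blast
    qed
  qed
  also have "ennreal E0 = (\<integral>\<^sup>+ \<omega>. ennreal (v 0 r (X T \<omega>)) \<partial>M)"
    unfolding E0_def using start by (intro nn_integral_eq_integral[symmetric] i0) (auto elim!: eventually_mono)
  also have "X T = (\<lambda>\<omega>. Y \<omega> - D T \<omega>)" by (rule ext) (simp add: X_def b_def)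
  finally show "(\<integral>\<^sup>+ \<omega>. (\<integral>\<^sup>+ s \<in> {T<..}. ennreal (exp (- r * (s - T))) \<partial>interval_measure (\<lambda>s. D s \<omega>)) \<partial>M)
    = (\<integral>\<^sup>+ \<omega>. ennreal (v 0 r (Y \<omega> - D T \<omega>)) \<partial>M)" unfolding psup .
qed

end

section \<open>From the reflection problem to reflected paths\<close>

lemma emeasure_Ioc_mono:
  assumes "mono D" "\<And>s. continuous (at_right s) D" "a \<le> b"
  shows "emeasure (interval_measure D) {a<..b} = ennreal (D b - D a)"
  using assms by (intro emeasure_interval_measure_Ioc) (auto dest: monoD)

lemma emeasure_atom_ge:
  assumes D: "mono D" "\<And>s. continuous (at_right s) D" and e: "\<And>s. s < u \<Longrightarrow> e \<le> D u - D s"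
  shows "ennreal e \<le> emeasure (interval_measure D) {u}"
proof -
  define A where "A n = {u - 1 / real (Suc n)<..u}" for n
  have em: "emeasure (interval_measure D) (A n) = ennreal (D u - D (u - 1 / real (Suc n)))" for n
    unfolding A_def by (rule emeasure_Ioc_mono[OF D]) simp
  have "(\<Inter>n. A n) = {u}"
  proof (rule set_eqI)
    fix x show "x \<in> (\<Inter>n. A n) \<longleftrightarrow> x \<in> {u}"
    proof
      assume x: "x \<in> (\<Inter>n. A n)"
      have "x \<le> u" using x by (auto simp: A_def)
      moreover have "\<not> x < u"
      proof
        assume "x < u"
        then obtain n where "1 / real (Suc n) < u - x" using nat_approx_posE[of "u - x"] by auto
        then show False using x by (auto simp: A_def dest!: spec[of _ n])
      qed
      ultimately show "x \<in> {u}" by simp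
    qed (auto simp: A_def)
  qed
  moreover have "(INF n. emeasure (interval_measure D) (A n)) = emeasure (interval_measure D) (\<Inter>n. A n)"
  proof (rule INF_emeasure_decseq)
    show "range A \<subseteq> sets (interval_measure D)" by (auto simp: A_def)
    show "decseq A"
    proof (rule decseq_SucI)
      fix n
      have "1 / real (Suc (Suc n)) \<le> 1 / real (Suc n)" by (intro divide_left_mono) auto
      then show "A (Suc n) \<subseteq> A n" unfolding A_def by auto
    qed
    show "emeasure (interval_measure D) (A n) \<noteq> \<infinity>" for n unfolding em by simp
  qed
  moreover have "ennreal e \<le> (INF n. emeasure (interval_measure D) (A n))"
    unfolding em by (intro INF_greatest ennreal_leI e) simp
  ultimately show ?thesis by simp
qed

text \<open>
  Right-continuity makes the set of times with \<open>f \<le> 0\<close> closed under decreasing limits.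
\<close>

lemma first_time_attained:
  fixes f :: "real \<Rightarrow> real"
  assumes f: "\<And>s. T \<le> s \<Longrightarrow> continuous (at_right s) f" and \<tau>: "Inf (ereal ` {s. T \<le> s \<and> f s \<le> 0}) = ereal u"
  shows "T \<le> u" "f u \<le> 0"
proof -
  define A where "A = {s. T \<le> s \<and> f s \<le> 0}"
  have lb: "u \<le> s" if "s \<in> A" for s
    using Inf_lower[of "ereal s" "ereal ` A"] that \<tau> by (simp add: A_def)
  have "ereal T \<le> Inf (ereal ` A)" by (intro Inf_greatest) (auto simp: A_def)
  then show Tu: "T \<le> u" using \<tau> by (simp add: A_def)
  show "f u \<le> 0"
  proof (rule ccontr)
    assume "\<not> f u \<le> 0"
    then have "0 < f u" by simp
    moreover have "(f \<longlongrightarrow> f u) (at_right u)" using f[OF Tu] by (simp add: continuous_within)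
    ultimately have "eventually (\<lambda>s. 0 < f s) (at_right u)" by (rule order_tendstoD(1)[rotated])
    then obtain d where d: "u < d" "\<And>s. u < s \<Longrightarrow> s < d \<Longrightarrow> 0 < f s"
      unfolding eventually_at_right_field by blast
    have "d \<le> s" if "s \<in> A" for s
    proof (rule ccontr)
      assume "\<not> d \<le> s"
      then have "s = u \<or> (u < s \<and> s < d)" using lb[OF that] by linarith
      then have "0 < f s" using d(2) \<open>0 < f u\<close> by auto
      then show False using that by (simp add: A_def)
    qed
    then have "ereal d \<le> Inf (ereal ` A)" by (intro Inf_greatest) auto
    then show False using \<tau> d(1) by (simp add: A_def)
  qed
qed

lemma before_first_time:
  fixes f :: "real \<Rightarrow> real"
  assumes "T \<le> s" "ereal s < Inf (ereal ` {s. T \<le> s \<and> f s \<le> 0})"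
  shows "0 < f s"
proof (rule ccontr)
  assume "\<not> 0 < f s"
  then have "Inf (ereal ` {s. T \<le> s \<and> f s \<le> 0}) \<le> ereal s" using assms(1) by (intro Inf_lower) auto
  then show False using assms(2) by simp
qed

lemma continuous_on_halfline:
  fixes D :: "real \<Rightarrow> real"
  assumes "continuous (at_right T) D" "\<And>u. T < u \<Longrightarrow> continuous (at u) D"
  shows "continuous_on {T..} D"
  unfolding continuous_on_eq_continuous_within
proof
  fix u assume "u \<in> {T..}"
  show "continuous (at u within {T..}) D"
  proof (cases "u = T")
    case True
    have "at T within {T..} = at_right T" by (rule at_within_Ici_at_right)
    then show ?thesis using assms(1) True by simp
  next
    case False
    then have "T < u" using \<open>u \<in> {T..}\<close> by simp
    then show ?thesis by (rule continuous_at_imp_continuous_at_within[OF assms(2)])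
  qed
qed

text \<open>
  The integral condition says that the measure \<open>dD\<close> gives no mass to times at which the surplus is
  below the barrier; this is the minimality of \<open>D\<close>.  It also excludes jumps after \<open>T\<close>: a jump at
  \<open>u\<close> would end at the barrier, so the surplus would have been above it just before \<open>u\<close>.  A
  starting point \<open>\<xi> \<le> 0\<close> is ruined at once and gives the same path as \<open>\<xi> = 0\<close>.
\<close>

lemma reflected_path_of_skorokhod:
  fixes k T \<xi> :: real and X D c :: "real \<Rightarrow> real"
  defines "\<tau> \<equiv> Inf (ereal ` {s. T \<le> s \<and> X s \<le> 0})"
  assumes k: "0 < k" and c: "continuous_on {T..} c" "c T = 0"
    and D: "\<And>s. s < T \<Longrightarrow> D s = 0" "mono D" "\<And>s. continuous (at_right s) D"
    and X: "\<And>s. T \<le> s \<Longrightarrow> X s = \<xi> + c s - D s"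
    and range: "\<And>s. T \<le> s \<Longrightarrow> ereal s < \<tau> \<Longrightarrow> X s \<le> k"
    and int: "\<And>s. T \<le> s \<Longrightarrow> ennreal (D s) =
       (\<integral>\<^sup>+ u \<in> {u. T \<le> u \<and> u \<le> s \<and> ereal u \<le> \<tau>}. indicator {k..} (X u) \<partial>interval_measure D)"
  shows "reflected_path k T (\<lambda>s. max \<xi> 0 + c s) D \<tau>" "D T = max 0 (max \<xi> 0 - k)"
    "\<And>s. T \<le> s \<Longrightarrow> \<tau> \<le> ereal s \<Longrightarrow> D s = D (real_of_ereal \<tau>)"
proof -
  let ?M = "interval_measure D"
  have D0: "0 \<le> D s" for s
  proof -
    have "D (min s (T - 1)) \<le> D s" by (intro monoD[OF D(2)]) simp
    then show ?thesis using D(1)[of "min s (T - 1)"] by simp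
  qed
  have c_right: "continuous (at_right s) c" if "T \<le> s" for s
    using c(1) that unfolding continuous_on_eq_continuous_within
    by (auto intro: continuous_within_subset[of s "{T..}" c])
  have X_right: "continuous (at_right s) X" if "T \<le> s" for s
  proof -
    have "continuous (at_right s) (\<lambda>s. \<xi> + c s - D s)"
      by (intro continuous_intros c_right[OF that] D(3))
    then have "((\<lambda>s. \<xi> + c s - D s) \<longlongrightarrow> X s) (at_right s)" using X[OF that] by (simp add: continuous_within)
    moreover have "eventually (\<lambda>u. \<xi> + c u - D u = X u) (at_right s)"
      using that by (auto simp: eventually_at_right_field X intro!: exI[of _ "s + 1"])
    ultimately show ?thesis unfolding continuous_within by (rule Lim_transform_eventually)
  qed
  have T\<tau>: "ereal T \<le> \<tau>" unfolding \<tau>_def by (intro Inf_greatest) auto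
  note att = first_time_attained[OF X_right, of T, folded \<tau>_def, simplified]
  have pos: "0 < X s" if "T \<le> s" "ereal s < \<tau>" for s
    using before_first_time[of T s X] that unfolding \<tau>_def by blast
  \<comment> \<open>By the integral condition, \<open>dD\<close> restricted to \<open>[T, s]\<close> is carried by this set.\<close>
  define G where "G s = {u \<in> {T..s}. k \<le> \<xi> + c u - D u \<and> ereal u \<le> \<tau>}" for s
  have Gm: "G s \<in> sets ?M" for s
  proof -
    have [measurable]: "D \<in> borel_measurable borel" by (rule borel_measurable_mono[OF D(2)])
    have [measurable]: "(\<lambda>u. indicator {T..} u * c u) \<in> borel_measurable borel"
      using borel_measurable_continuous_on_indicator[OF _ c(1)] by simp
    have [measurable]: "Measurable.pred borel (\<lambda>u. ereal u \<le> \<tau>)" by measurable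
    have "G s = {u \<in> space borel. u \<in> {T..s} \<and> k \<le> \<xi> + indicator {T..} u * c u - D u \<and> ereal u \<le> \<tau>}"
      unfolding G_def by (auto simp: indicator_def)
    also have "\<dots> \<in> sets borel" by measurable
    finally show ?thesis by simp
  qed
  have good: "T \<le> u \<and> u \<le> s \<and> X u = k \<and> ereal u < \<tau>" if "u \<in> G s" for u s
  proof -
    have u: "T \<le> u" "u \<le> s" "k \<le> X u" "ereal u \<le> \<tau>" using that X[of u] by (auto simp: G_def)
    have "ereal u \<noteq> \<tau>" using att(2)[of u] u k by auto
    then have "ereal u < \<tau>" using u by simp
    then show ?thesis using range[OF u(1)] u by auto
  qed
  have DG: "ennreal (D s) = emeasure ?M (G s)" if "T \<le> s" for s
  proof -
    have "(\<integral>\<^sup>+ u \<in> {u. T \<le> u \<and> u \<le> s \<and> ereal u \<le> \<tau>}. indicator {k..} (X u) \<partial>?M) = (\<integral>\<^sup>+ u. indicator (G s) u \<partial>?M)"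
      by (intro nn_integral_cong) (auto simp: G_def indicator_def X)
    then show ?thesis using int[OF that] Gm by simp
  qed
  have null: "emeasure ?M ({T - 1<..s} - G s) = 0" if s: "T \<le> s" for s
  proof -
    have "G s \<subseteq> {T - 1<..s}" by (auto simp: G_def)
    moreover have e: "emeasure ?M {T - 1<..s} = ennreal (D s)"
      using emeasure_Ioc_mono[OF D(2,3), of "T - 1" s] s D(1)[of "T - 1"] by simp
    ultimately have "emeasure ?M ({T - 1<..s} - G s) = ennreal (D s) - ennreal (D s)"
      using Gm DG[OF s] by (subst emeasure_Diff) auto
    then show ?thesis by simp
  qed
  have charge: "\<exists>v\<in>A. T \<le> v \<and> X v = k \<and> ereal v < \<tau>"
    if A: "A \<in> sets ?M" "A \<subseteq> {T - 1<..s}" "emeasure ?M A \<noteq> 0" "T \<le> s" for A s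
  proof (rule ccontr)
    assume "\<not> ?thesis"
    then have "u \<notin> G s" if "u \<in> A" for u using good[of u s] that by blast
    then have "A \<subseteq> {T - 1<..s} - G s" using A(2) by auto
    then have "emeasure ?M A \<le> emeasure ?M ({T - 1<..s} - G s)" using Gm by (intro emeasure_mono) auto
    then show False using null[OF A(4)] A(3) by simp
  qed
  have growth: "\<exists>v. s < v \<and> v \<le> u \<and> X v = k \<and> ereal v < \<tau>" if "T \<le> s" "s < u" "D s < D u" for s u
  proof -
    have "emeasure ?M {s<..u} \<noteq> 0"
      using that emeasure_Ioc_mono[OF D(2,3), of s u] by (simp add: ennreal_eq_0_iff)
    moreover have "{s<..u} \<subseteq> {T - 1<..u}" using that by auto
    ultimately obtain v where "v \<in> {s<..u}" "X v = k" "ereal v < \<tau>"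
      using charge[of "{s<..u}" u] \<open>T \<le> s\<close> \<open>s < u\<close> by auto
    then show ?thesis by auto
  qed
  have DT: "0 < D T \<Longrightarrow> X T = k"
  proof -
    assume "0 < D T"
    then have "emeasure ?M {T - 1<..T} \<noteq> 0"
      using emeasure_Ioc_mono[OF D(2,3), of "T - 1" T] D(1)[of "T - 1"] by (simp add: ennreal_eq_0_iff)
    then have "emeasure ?M (G T) \<noteq> 0" using \<open>0 < D T\<close> by (simp add: DG[symmetric] ennreal_eq_0_iff)
    then have "G T \<noteq> {}" by (intro notI) simp
    then obtain v where "v \<in> G T" by blast
    then show "X T = k" using good[of v T] by auto
  qed
  have frozen: "D u = D s" if su: "T \<le> s" "\<tau> \<le> ereal s" "s \<le> u" for s u
  proof (rule ccontr)
    assume "D u \<noteq> D s"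
    then have "s < u" "D s < D u" using su(3) monoD[OF D(2) su(3)] by (auto simp: less_le)
    then obtain v where "s < v" "ereal v < \<tau>" using growth[OF su(1)] by blast
    then have "ereal v < ereal s" using less_le_trans[OF _ su(2)] by blast
    then show False using \<open>s < v\<close> by simp
  qed
  have cont: "continuous (at u) D" if u: "T < u" for u
  proof -
    have "continuous (at_left u) D"
    proof (rule ccontr)
      assume nc: "\<not> continuous (at_left u) D"
      obtain e where e: "0 < e" "\<And>s. s < u \<Longrightarrow> e \<le> D u - D s"
      proof -
        have "\<exists>e>0. \<forall>s<u. e \<le> D u - D s"
        proof (rule ccontr)
          assume ne: "\<not> ?thesis"
          have "continuous (at_left u) D"
            unfolding continuous_within tendsto_iff eventually_at_left_field
          proof (intro allI impI)
            fix e :: real assume "0 < e"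
            then obtain s where s: "s < u" "D u - D s < e" using ne by (auto simp: not_le)
            show "\<exists>b<u. \<forall>y>b. y < u \<longrightarrow> dist (D y) (D u) < e"
            proof (intro exI[of _ s] conjI allI impI)
              fix y assume "s < y" "y < u"
              then have "D s \<le> D y" "D y \<le> D u" by (auto intro: monoD[OF D(2)])
              then show "dist (D y) (D u) < e" using s(2) by (simp add: dist_real_def)
            qed (rule s(1))
          qed
          then show False using nc by simp
        qed
        then show thesis using that by blast
      qed
      have "ennreal e \<le> emeasure ?M {u}" by (rule emeasure_atom_ge[OF D(2,3) e(2)])
      then have "emeasure ?M {u} \<noteq> 0" using e(1) by (intro notI) (simp add: ennreal_eq_0_iff)
      then have u1: "X u = k" "ereal u < \<tau>" using charge[of "{u}" u] u by auto
      have "isCont c u" using c(1) u by (intro continuous_on_interior[OF c(1)]) simp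
      then obtain d where d: "0 < d" "\<And>s. \<bar>s - u\<bar> < d \<Longrightarrow> \<bar>c s - c u\<bar> < e"
        using e(1) unfolding continuous_at_eps_delta dist_real_def by blast
      define s where "s = max T (u - d / 2)"
      have s: "T \<le> s" "s < u" "\<bar>s - u\<bar> < d" using u d(1) by (auto simp: s_def)
      have "ereal s < \<tau>" using le_less_trans[of "ereal s" "ereal u" \<tau>] s(2) u1(2) by simp
      then have "X s \<le> k" using range s by blast
      then have "\<xi> + c s - D s \<le> \<xi> + c u - D u" using X[of s] X[of u] s u u1 by simp
      then show False using e(2)[OF s(2)] d(2)[OF s(3)] by linarith
    qed
    then show ?thesis using D(3) by (simp add: continuous_at_split)
  qed
  have Dc: "continuous_on {T..} D" by (rule continuous_on_halfline[OF D(3) cont])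
  show "D s = D (real_of_ereal \<tau>)" if "T \<le> s" "\<tau> \<le> ereal s" for s
    using T\<tau> that frozen[of "real_of_ereal \<tau>" s] by (cases \<tau>) auto
  have both: "reflected_path k T (\<lambda>s. max \<xi> 0 + c s) D \<tau> \<and> D T = max 0 (max \<xi> 0 - k)"
  proof (cases "0 < \<xi>")
    case True
    have XT: "X T = \<xi> - D T" using X[of T] c(2) by simp
    have XTpos: "0 < X T"
    proof (cases "0 < D T")
      case True then show ?thesis using DT k by simp
    next
      case False then show ?thesis using XT D0[of T] \<open>0 < \<xi>\<close> by linarith
    qed
    have T\<tau>': "ereal T < \<tau>"
    proof (rule ccontr)
      assume "\<not> ereal T < \<tau>"
      then have "\<tau> = ereal T" using T\<tau> by auto
      then show False using att(2)[of T] XTpos by simp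
    qed
    have XTk: "X T \<le> k" using range T\<tau>' by simp
    have X': "max \<xi> 0 + c s - D s = X s" if "T \<le> s" for s using X[OF that] True by simp
    have Xc: "continuous_on {T..} X"
    proof -
      have "continuous_on {T..} (\<lambda>s. \<xi> + c s - D s)" by (intro continuous_intros c(1) Dc)
      then show ?thesis by (rule continuous_on_eq) (simp add: X)
    qed
    have ruin: "X u = 0" if "\<tau> = ereal u" for u
    proof -
      have u: "T < u" "X u \<le> 0" using att[OF that] T\<tau>' that by auto
      have "\<not> X u < 0"
      proof
        assume "X u < 0"
        then have "\<exists>s\<ge>T. s \<le> u \<and> X s = 0"
          using XTpos u continuous_on_subset[OF Xc, of "{T..u}"] by (intro IVT2') auto
        then obtain s where "T \<le> s" "s \<le> u" "X s = 0" by blast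
        moreover have "s \<noteq> u" using \<open>X u < 0\<close> \<open>X s = 0\<close> by auto
        ultimately have "s < u" by simp
        then show False using pos[OF \<open>T \<le> s\<close>] \<open>X s = 0\<close> unfolding that by simp
      qed
      then show ?thesis using u by simp
    qed
    have "reflected_path k T (\<lambda>s. max \<xi> 0 + c s) D \<tau>"
    proof
      show "continuous_on {T..} (\<lambda>s. max \<xi> 0 + c s)" by (intro continuous_intros c(1))
      show "0 \<le> max \<xi> 0 + c T - D T" "max \<xi> 0 + c T - D T \<le> k" using X'[OF order_refl] XTpos XTk by linarith+
      show "0 < max \<xi> 0 + c s - D s" "max \<xi> 0 + c s - D s \<le> k" if "T \<le> s" "ereal s < \<tau>" for s
        using X'[OF that(1)] pos[OF that] range[OF that] by linarith+
      show "max \<xi> 0 + c u - D u = 0" if "\<tau> = ereal u" for u using X'[of u] ruin[OF that] att(1)[OF that] by simp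
      show "D u = D s" if "T \<le> s" "\<tau> \<le> ereal s" "s \<le> u" for s u using frozen[OF that] .
      show "\<exists>v. s < v \<and> v \<le> u \<and> max \<xi> 0 + c v - D v = k" if su: "T \<le> s" "s < u" "D s < D u" for s u
      proof -
        obtain v where v: "s < v" "v \<le> u" "X v = k" using growth[OF su] by blast
        then show ?thesis using X'[of v] \<open>T \<le> s\<close> by (intro exI[of _ v]) simp
      qed
      show "0 < k" "mono D" "continuous (at_right s) D" "continuous_on {T..} D" "ereal T \<le> \<tau>" for s
        by (fact k D(2) D(3) Dc T\<tau>)+
    qed
    moreover have "D T = max 0 (max \<xi> 0 - k)"
    proof (cases "0 < D T")
      case True
      then have "D T = \<xi> - k" using DT[OF True] XT by linarith
      then show ?thesis using True \<open>0 < \<xi>\<close> by (simp only: max_def) simp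
    next
      case False
      then have "D T = 0" using D0[of T] by simp
      moreover have "\<xi> \<le> k" using XT XTk \<open>D T = 0\<close> by linarith
      ultimately show ?thesis using \<open>0 < \<xi>\<close> by simp
    qed
    ultimately show ?thesis by blast
  next
    case False
    have "X T \<le> 0" using X[of T] c(2) D0[of T] False by simp
    then have "\<tau> \<le> ereal T" unfolding \<tau>_def by (intro Inf_lower) auto
    then have \<tau>: "\<tau> = ereal T" using T\<tau> by auto
    have G0: "G s = {}" for s
    proof (rule equals0I)
      fix u assume "u \<in> G s"
      then have "T \<le> u" "ereal u < \<tau>" using good[of u s] by blast+
      then show False unfolding \<tau> by simp
    qed
    have Ds: "D s = 0" for s
    proof (cases "T \<le> s")
      case True
      then have "ennreal (D s) = 0" using DG[OF True] unfolding G0 by simp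
      then show ?thesis using D0[of s] by (simp add: ennreal_eq_0_iff)
    next
      case False then show ?thesis by (intro D(1)) simp
    qed
    have m: "max \<xi> 0 = 0" using False by simp
    have "reflected_path k T (\<lambda>s. max \<xi> 0 + c s) D \<tau>"
      unfolding m
    proof
      show "continuous_on {T..} (\<lambda>s. 0 + c s)" by (intro continuous_intros c(1))
      show "0 < k" "mono D" "continuous (at_right s) D" "continuous_on {T..} D" "ereal T \<le> \<tau>" for s
        by (fact k D(2) D(3) Dc T\<tau>)+
      show "0 \<le> 0 + c T - D T" "0 + c T - D T \<le> k" using c(2) Ds[of T] k by simp_all
      have vacuous: False if "T \<le> s" "ereal s < \<tau>" for s
      proof -
        have "ereal s < ereal T" using that(2) by (simp only: \<tau>)
        then show False using that(1) by simp
      qed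
      show "0 < 0 + c s - D s" "0 + c s - D s \<le> k" if "T \<le> s" "ereal s < \<tau>" for s
        using vacuous[OF that] by blast+
      show "0 + c u - D u = 0" if "\<tau> = ereal u" for u
      proof -
        have "u = T" using that by (simp only: \<tau>) simp
        then show ?thesis using c(2) Ds[of T] by simp
      qed
      show "D u = D s" for s u unfolding Ds ..
      show "\<exists>v. s < v \<and> v \<le> u \<and> 0 + c v - D v = k" if "D s < D u" for s u
      proof -
        have False using that Ds[of s] Ds[of u] by linarith
        then show ?thesis ..
      qed
    qed
    moreover have "D T = max 0 (max \<xi> 0 - k)" unfolding m Ds using k by simp
    ultimately show ?thesis by blast
  qed
  then show "reflected_path k T (\<lambda>s. max \<xi> 0 + c s) D \<tau>" "D T = max 0 (max \<xi> 0 - k)" by blast+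
qed

section \<open>From reflected paths to the reflection problem\<close>

text \<open>
  The converse direction.  A time after \<open>T\<close> at which the surplus is not at the barrier, or at which it is already
  ruined, has a neighbourhood on which \<open>D\<close> is constant.  Countably many such intervals with rational end points
  cover these times, so \<open>dD\<close> is carried by the visits to the barrier.
\<close>

lemma (in reflected_path) skorokhod_integral:
  assumes before: "\<And>s. s < T \<Longrightarrow> D s = 0" and DT: "D T = max 0 (b T - k)" and s: "T \<le> s"
  shows "ennreal (D s) = (\<integral>\<^sup>+ u \<in> {u. T \<le> u \<and> u \<le> s \<and> ereal u \<le> \<tau>}. indicator {k..} (X u) \<partial>interval_measure D)"
proof -
  let ?M = "interval_measure D"
  define I where "I = {(p, q). p \<in> \<rat> \<and> q \<in> \<rat> \<and> p \<le> q \<and> D p = D q}"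
  define N where "N = (\<Union>(p, q)\<in>I. {p<..q}) \<union> (if D T = 0 then {T - 1<..T} else {})"
  have "countable I" by (rule countable_subset[of _ "\<rat> \<times> \<rat>"]) (auto simp: I_def countable_rat)
  then have "(\<Union>i\<in>I. case i of (p, q) \<Rightarrow> {p<..q}) \<in> null_sets ?M"
    by (rule null_sets_UN') (auto simp: I_def null_sets_def emeasure_Ioc_mono[OF D_mono D_right_cont])
  moreover have "(if D T = 0 then {T - 1<..T} else {}) \<in> null_sets ?M"
    using before[of "T - 1"] by (auto simp: null_sets_def emeasure_Ioc_mono[OF D_mono D_right_cont])
  ultimately have N: "N \<in> null_sets ?M" unfolding N_def by (rule null_sets.Un)
  have inI: "u \<in> N" if pq: "p' < u" "u < q'" "\<And>p q. p' < p \<Longrightarrow> p < u \<Longrightarrow> u < q \<Longrightarrow> q < q' \<Longrightarrow> D p = D q" for u p' q'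
  proof -
    obtain p where p: "p \<in> \<rat>" "p' < p" "p < u" using Rats_dense_in_real[OF pq(1)] by blast
    obtain q where q: "q \<in> \<rat>" "u < q" "q < q'" using Rats_dense_in_real[OF pq(2)] by blast
    have "(p, q) \<in> I" using p q pq(3)[OF p(2,3) q(2,3)] by (auto simp: I_def)
    moreover have "u \<in> {p<..q}" using p q by auto
    ultimately show ?thesis unfolding N_def by (intro UnI1 UN_I[of "(p, q)"]) simp_all
  qed
  define G where "G = {u \<in> {T..s}. k \<le> X u \<and> ereal u \<le> \<tau>}"
  have Gm[measurable]: "G \<in> sets ?M"
  proof -
    have [measurable]: "D \<in> borel_measurable borel" by (rule borel_measurable_mono[OF D_mono])
    have [measurable]: "(\<lambda>u. indicator {T..} u * b u) \<in> borel_measurable borel"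
      using borel_measurable_continuous_on_indicator[OF _ b_cont] by simp
    have [measurable]: "Measurable.pred borel (\<lambda>u. ereal u \<le> \<tau>)" by measurable
    have "G = {u \<in> space borel. u \<in> {T..s} \<and> k \<le> indicator {T..} u * b u - D u \<and> ereal u \<le> \<tau>}"
      unfolding G_def by (auto simp: indicator_def)
    also have "\<dots> \<in> sets borel" by measurable
    finally show ?thesis by simp
  qed
  have cover: "u \<in> G \<union> N" if u: "u \<in> {T - 1<..s}" for u
  proof -
    consider "u < T" | "u = T" | "T < u" by linarith
    then show ?thesis
    proof cases
      case 1
      then have "u \<in> N" by (intro inI[of "u - 1" u T]) (auto simp: before)
      then show ?thesis by blast
    next
      case 2
      show ?thesis
      proof (cases "D T = 0")
        case True then show ?thesis using 2 by (simp add: N_def)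
      next
        case False
        then have "X T = k" using DT by (simp add: max_def split: if_splits)
        then show ?thesis using 2 s T_le by (simp add: G_def)
      qed
    next
      case 3
      show ?thesis
      proof (cases "X u = k \<and> ereal u \<le> \<tau>")
        case True then show ?thesis using 3 u by (simp add: G_def)
      next
        case False
        have "u \<in> N"
        proof (cases "ereal u \<le> \<tau>")
          case True
          then have ne: "X u \<noteq> k" using False by blast
          have "isCont X u" using 3 by (intro continuous_on_interior[OF X_cont]) simp
          then obtain d where d: "0 < d" "\<And>w. dist w u < d \<Longrightarrow> dist (X w) (X u) < \<bar>X u - k\<bar>"
          proof -
            have "0 < \<bar>X u - k\<bar>" using ne by simp
            then show thesis using that \<open>isCont X u\<close> unfolding continuous_at_eps_delta by blast
          qed
          have "D p = D q" if pq: "max T (u - d) < p" "p < u" "u < q" "q < u + d" for p q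
          proof (rule ccontr)
            assume "D p \<noteq> D q"
            then have "D p < D q" using monoD[OF D_mono, of p q] pq by simp
            then obtain w where w: "p < w" "w \<le> q" "X w = k" using growth[of p q] pq by auto
            have "dist (X w) (X u) < \<bar>X u - k\<bar>" using w pq by (intro d(2)) (simp add: dist_real_def abs_less_iff)
            then show False using w(3) by (simp add: dist_real_def abs_minus_commute)
          qed
          then show ?thesis using 3 d(1) by (intro inI[of "max T (u - d)" u "u + d"]) auto
        next
          case False
          then obtain w where w: "\<tau> = ereal w" "T \<le> w" "w < u" using T_le by (cases \<tau>) auto
          have "D p = D q" if "w < p" "p < u" "u < q" for p q
            using frozen[of p q] w that by simp
          then show ?thesis using w(3) by (intro inI[of w u "u + 1"]) auto
        qed
        then show ?thesis by blast
      qed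
    qed
  qed
  have e: "emeasure ?M {T - 1<..s} = ennreal (D s)"
    using emeasure_Ioc_mono[OF D_mono D_right_cont, of "T - 1" s] s before[of "T - 1"] by simp
  have "ennreal (D s) \<le> emeasure ?M (G \<union> N)"
    unfolding e[symmetric] by (intro emeasure_mono subsetI cover sets.Un Gm null_setsD2[OF N])
  also have "\<dots> = emeasure ?M G" using N by (rule emeasure_Un_null_set[OF Gm])
  finally have 1: "ennreal (D s) \<le> emeasure ?M G" .
  have 2: "emeasure ?M G \<le> ennreal (D s)"
    unfolding e[symmetric] by (intro emeasure_mono) (auto simp: G_def)
  have "(\<integral>\<^sup>+ u \<in> {u. T \<le> u \<and> u \<le> s \<and> ereal u \<le> \<tau>}. indicator {k..} (X u) \<partial>?M) = (\<integral>\<^sup>+ u. indicator G u \<partial>?M)"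
    by (intro nn_integral_cong) (auto simp: G_def indicator_def)
  then show ?thesis using antisym[OF 1 2] nn_integral_indicator[OF Gm] by simp
qed

lemma alive_iff_positive:
  fixes f :: "real \<Rightarrow> real"
  assumes f: "continuous_on {T..} f" and s: "T \<le> s"
  shows "ereal s < Inf (ereal ` {s. T \<le> s \<and> f s \<le> 0}) \<longleftrightarrow> (\<forall>u\<in>{T..s}. 0 < f u)"
proof
  assume a: "ereal s < Inf (ereal ` {s. T \<le> s \<and> f s \<le> 0})"
  show "\<forall>u\<in>{T..s}. 0 < f u"
  proof
    fix u assume "u \<in> {T..s}"
    then show "0 < f u" using a le_less_trans[of "ereal u" "ereal s"] by (intro before_first_time[of T u f]) auto
  qed
next
  assume a: "\<forall>u\<in>{T..s}. 0 < f u"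
  show "ereal s < Inf (ereal ` {s. T \<le> s \<and> f s \<le> 0})"
  proof (rule ccontr)
    assume n: "\<not> ?thesis"
    have "ereal T \<le> Inf (ereal ` {s. T \<le> s \<and> f s \<le> 0})" by (intro Inf_greatest) auto
    then obtain u where u: "Inf (ereal ` {s. T \<le> s \<and> f s \<le> 0}) = ereal u" "u \<le> s"
      using n by (cases "Inf (ereal ` {s. T \<le> s \<and> f s \<le> 0})") auto
    have "continuous (at_right v) f" if "T \<le> v" for v
      using f that unfolding continuous_on_eq_continuous_within
      by (auto intro: continuous_within_subset[of v "{T..}" f])
    from first_time_attained[OF this u(1)] show False using bspec[OF a, of u] u(2) by simp
  qed
qed

definition running_reflection :: "real \<Rightarrow> real \<Rightarrow> (real \<Rightarrow> real) \<Rightarrow> real \<Rightarrow> real" where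
  "running_reflection k T b s = max 0 (Sup ((\<lambda>v. b v - k) ` {T..s}))"

definition reflection_ruin :: "real \<Rightarrow> real \<Rightarrow> (real \<Rightarrow> real) \<Rightarrow> ereal" where
  "reflection_ruin k T b = Inf (ereal ` {s. T \<le> s \<and> b s - running_reflection k T b s \<le> 0})"

definition stopped_reflection :: "real \<Rightarrow> real \<Rightarrow> (real \<Rightarrow> real) \<Rightarrow> real \<Rightarrow> real" where
  "stopped_reflection k T b s =
    (if s < T then 0 else running_reflection k T b (real_of_ereal (min (ereal s) (reflection_ruin k T b))))"

context
  fixes k T :: real and b :: "real \<Rightarrow> real"
  assumes k: "0 < k" and b: "continuous_on {T..} b" and bT: "0 < b T"
begin

private lemma sup_attained:
  assumes "T \<le> s"
  obtains w where "w \<in> {T..s}" "Sup ((\<lambda>v. b v - k) ` {T..s}) = b w - k" "\<And>v. v \<in> {T..s} \<Longrightarrow> b v \<le> b w"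
proof -
  obtain w where w: "w \<in> {T..s}" "\<And>v. v \<in> {T..s} \<Longrightarrow> b v \<le> b w"
    using continuous_attains_sup[of "{T..s}" b] continuous_on_subset[OF b] assms by auto
  have "Sup ((\<lambda>v. b v - k) ` {T..s}) = b w - k"
    by (rule cSup_eq_maximum) (use w in auto)
  then show thesis using that w by blast
qed

private abbreviation "R \<equiv> running_reflection k T b"

private lemma R_ge: "v \<in> {T..s} \<Longrightarrow> b v - k \<le> R s"
  by (rule sup_attained[of s]) (auto simp: running_reflection_def le_max_iff_disj)

private lemma R_nonneg: "0 \<le> R s" by (simp add: running_reflection_def)

private lemma R_cases:
  assumes "T \<le> s" obtains "R s = 0" | w where "w \<in> {T..s}" "R s = b w - k"
  using sup_attained[OF assms] unfolding running_reflection_def by (metis max_def)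

private lemma R_mono: "T \<le> s \<Longrightarrow> s \<le> u \<Longrightarrow> R s \<le> R u"
  by (rule R_cases[of s]) (use R_nonneg R_ge[of _ u] in auto)

private lemma R_T: "R T = max 0 (b T - k)" by (simp add: running_reflection_def)

private lemma R_cont: "continuous_on {T..} R"
  unfolding continuous_on_iff
proof (intro ballI allI impI)
  fix u and e :: real assume u: "u \<in> {T..}" and e: "0 < e"
  have e3: "0 < e / 3" using e by simp
  obtain d where d: "0 < d" "\<And>w. w \<in> {T..} \<Longrightarrow> dist w u < d \<Longrightarrow> dist (b w) (b u) < e / 3"
    using bspec[OF b[unfolded continuous_on_iff] u] e3 by blast
  have le: "R y \<le> R x + 2 * e / 3" if xy: "T \<le> x" "x \<le> y" "dist x u < d" "dist y u < d" for x y
  proof (rule R_cases[of y])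
    show "T \<le> y" using xy by linarith
    show ?thesis if "R y = 0" using that R_nonneg[of x] e by simp
    show ?thesis if w: "w \<in> {T..y}" "R y = b w - k" for w
    proof (cases "w \<le> x")
      case True then show ?thesis using R_ge[of w x] w e by simp
    next
      case False
      then have "dist w u < d" using w xy by (auto simp: dist_real_def)
      then have "dist (b w) (b u) < e / 3" using d(2)[of w] w by simp
      moreover have "dist (b x) (b u) < e / 3" using d(2)[of x] xy by simp
      moreover have "b x - k \<le> R x" using R_ge[of x x] xy by simp
      ultimately show ?thesis unfolding w(2) dist_real_def by linarith
    qed
  qed
  have "dist (R w) (R u) < e" if w: "w \<in> {T..}" "dist w u < d" for w
  proof (cases "w \<le> u")
    case True
    then show ?thesis using le[of w u] R_mono[of w u] w d(1) e by (simp add: dist_real_def)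
  next
    case False
    then show ?thesis using le[of u w] R_mono[of u w] w u d(1) e by (simp add: dist_real_def)
  qed
  then show "\<exists>d>0. \<forall>x'\<in>{T..}. dist x' u < d \<longrightarrow> dist (R x') (R u) < e" using d(1) by blast
qed

private lemma X_cont: "continuous_on {T..} (\<lambda>s. b s - R s)"
  by (intro continuous_intros b R_cont)

private abbreviation "\<tau> \<equiv> reflection_ruin k T b"
private abbreviation "D \<equiv> stopped_reflection k T b"

lemma reflection_alive_iff: "T \<le> s \<Longrightarrow> ereal s < reflection_ruin k T b \<longleftrightarrow> (\<forall>u\<in>{T..s}. 0 < b u - running_reflection k T b u)"
  unfolding reflection_ruin_def by (rule alive_iff_positive[OF X_cont])

private lemma T_less: "ereal T < \<tau>"
proof -
  have "0 < b T - R T" using bT k by (auto simp: R_T)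
  then show ?thesis using reflection_alive_iff[of T] by simp
qed

private lemma D_alive: "T \<le> s \<Longrightarrow> ereal s \<le> \<tau> \<Longrightarrow> D s = R s"
  by (simp add: stopped_reflection_def min_absorb1)

private lemma D_frozen: "T \<le> s \<Longrightarrow> \<tau> \<le> ereal s \<Longrightarrow> D s = R (real_of_ereal \<tau>)"
  by (simp add: stopped_reflection_def min_absorb2)

private lemma D_eq: "T \<le> s \<Longrightarrow> \<exists>u. T \<le> u \<and> u \<le> s \<and> ereal u \<le> \<tau> \<and> D s = R u \<and> (u = s \<or> \<tau> = ereal u)"
proof (cases "ereal s \<le> \<tau>")
  case True
  assume "T \<le> s" then show ?thesis using D_alive[OF _ True] True by (intro exI[of _ s]) auto
next
  case False
  assume s: "T \<le> s"
  obtain u where u: "\<tau> = ereal u" "T \<le> u" "u < s" using False T_less by (cases \<tau>) auto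
  then show ?thesis using D_frozen[OF s] by (intro exI[of _ u]) auto
qed

lemma stopped_reflection_before: "s < T \<Longrightarrow> stopped_reflection k T b s = 0"
  by (simp add: stopped_reflection_def)

lemma stopped_reflection_start: "stopped_reflection k T b T = max 0 (b T - k)"
  using D_alive[of T] T_less by (simp add: R_T)

lemma stopped_reflection_limit: "T \<le> s \<Longrightarrow> stopped_reflection k T b s = running_reflection k T b (real_of_ereal (min (ereal s) \<tau>))"
  by (simp add: stopped_reflection_def)

lemma running_reflection_cont: "continuous_on {T..} (running_reflection k T b)"
  by (rule R_cont)

lemma reflected_path_exists: "reflected_path k T b (stopped_reflection k T b) (reflection_ruin k T b)"
proof
  show "0 < k" "continuous_on {T..} b" by (fact k b)+
  have Dmono: "D s \<le> D u" if su: "s \<le> u" for s u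
  proof (cases "T \<le> s")
    case True
    obtain s' where s': "T \<le> s'" "s' \<le> s" "ereal s' \<le> \<tau>" "D s = R s'" "s' = s \<or> \<tau> = ereal s'" using D_eq[OF True] by blast
    obtain u' where u': "T \<le> u'" "u' \<le> u" "ereal u' \<le> \<tau>" "D u = R u'" "u' = u \<or> \<tau> = ereal u'"
      using D_eq[of u] order_trans[OF True su] by blast
    have "s' \<le> u'"
    proof (cases "u' = u")
      case True then show ?thesis using s'(2) su by linarith
    next
      case False then show ?thesis using u'(5) s'(3) by simp
    qed
    then show ?thesis using R_mono[OF s'(1)] s' u' by simp
  next
    case False
    then have "D s = 0" by (simp add: stopped_reflection_before)
    moreover have "0 \<le> D u" using R_nonneg by (simp add: stopped_reflection_def)
    ultimately show ?thesis by simp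
  qed
  then show "mono D" by (rule monoI)
  show Dc: "continuous_on {T..} D"
  proof -
    have "continuous_on {T..} (\<lambda>s. R (if ereal s \<le> \<tau> then s else real_of_ereal \<tau>))"
    proof (cases \<tau>)
      case (real u)
      have "continuous_on {T..} (\<lambda>s. min s u)" by (intro continuous_intros)
      moreover have "(\<lambda>s. min s u) ` {T..} \<subseteq> {T..}" using T_less real by auto
      ultimately have "continuous_on {T..} (\<lambda>s. R (min s u))" by (rule continuous_on_compose2[OF R_cont])
      then show ?thesis by (rule continuous_on_eq) (simp add: real min_def)
    qed (use R_cont T_less in auto)
    then show ?thesis by (rule continuous_on_eq) (auto simp: D_alive D_frozen not_le less_imp_le)
  qed
  show "continuous (at_right s) D" for s
  proof (cases "T \<le> s")
    case True
    then show ?thesis using Dc unfolding continuous_on_eq_continuous_within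
      by (auto intro: continuous_within_subset[of s "{T..}" D])
  next
    case False
    have "eventually (\<lambda>u. 0 = D u) (at_right s)"
      using False by (auto simp: eventually_at_right_field stopped_reflection_before intro!: exI[of _ T])
    then show ?thesis unfolding continuous_within
      using False by (intro Lim_transform_eventually[OF tendsto_const]) (auto simp: stopped_reflection_before)
  qed
  show "0 \<le> b T - D T" "b T - D T \<le> k" using bT k by (auto simp: stopped_reflection_start)
  show "ereal T \<le> \<tau>" using T_less by simp
  show "0 < b s - D s" "b s - D s \<le> k" if "T \<le> s" "ereal s < \<tau>" for s
    using reflection_alive_iff[OF that(1)] that D_alive[of s] R_ge[of s s] by auto
  show "b u - D u = 0" if u: "\<tau> = ereal u" for u
  proof -
    have Tu: "T < u" using T_less u by simp
    have Du: "D u = R u" using D_alive[of u] Tu u by simp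
    have rc: "continuous (at_right v) (\<lambda>s. b s - R s)" if "T \<le> v" for v
      using X_cont that unfolding continuous_on_eq_continuous_within
      by (auto intro: continuous_within_subset[of v "{T..}" "\<lambda>s. b s - R s"])
    have le: "b u - R u \<le> 0"
      by (rule first_time_attained(2)[OF rc]) (use u in \<open>auto simp: reflection_ruin_def\<close>)
    have "isCont (\<lambda>s. b s - R s) u" using Tu by (intro continuous_on_interior[OF X_cont]) simp
    then have "((\<lambda>s. b s - R s) \<longlongrightarrow> b u - R u) (at_left u)"
      by (auto simp: isCont_def intro: tendsto_mono[OF at_le])
    moreover have "eventually (\<lambda>s. 0 \<le> b s - R s) (at_left u)"
      unfolding eventually_at_left_field
    proof (intro exI[of _ T] conjI allI impI)
      fix s assume "T < s" "s < u"
      then show "0 \<le> b s - R s" using reflection_alive_iff[of s] u by (auto intro: less_imp_le)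
    qed (rule Tu)
    ultimately have "0 \<le> b u - R u" by (intro tendsto_lowerbound[of _ _ "at_left u"]) auto
    then show ?thesis using le Du by simp
  qed
  show "D u = D s" if "T \<le> s" "\<tau> \<le> ereal s" "s \<le> u" for s u
    using D_frozen[of s] D_frozen[of u] that order_trans[OF that(2), of "ereal u"] by simp
  show "\<exists>v. s < v \<and> v \<le> u \<and> b v - D v = k" if su: "T \<le> s" "s < u" "D s < D u" for s u
  proof -
    obtain s' where s': "T \<le> s'" "s' \<le> s" "D s = R s'" "s' = s \<or> \<tau> = ereal s'" using D_eq[OF su(1)] by blast
    obtain u' where u': "T \<le> u'" "u' \<le> u" "ereal u' \<le> \<tau>" "D u = R u'" using D_eq[of u] su by fastforce
    have ss: "s' = s"
    proof (rule ccontr)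
      assume "s' \<noteq> s"
      then have "u' \<le> s'" using s'(4) u'(3) by simp
      then show False using R_mono[OF u'(1), of s'] s' u' su(3) by simp
    qed
    show ?thesis
    proof (rule R_cases[OF u'(1)])
      assume "R u' = 0" then show ?thesis using su(3) s' u' R_nonneg[of s'] by simp
    next
      fix w assume w: "w \<in> {T..u'}" "R u' = b w - k"
      have "s < w"
      proof (rule ccontr)
        assume "\<not> s < w"
        then have "b w - k \<le> R s" using w by (intro R_ge) auto
        then show False using w su(3) s' u' ss by simp
      qed
      moreover have "ereal w \<le> \<tau>" using order_trans[OF _ u'(3), of "ereal w"] w by simp
      then have "D w = R w" using D_alive w by simp
      moreover have "R w = b w - k" using R_ge[of w w] R_mono[of w u'] w by auto
      ultimately show ?thesis using w u' by (intro exI[of _ w]) auto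
    qed
  qed
qed

end

text \<open>
  Only the first interval that meets \<open>\<tau>\<close> contributes beyond the stopping time, and its length tends to
  \<open>0\<close>.  This writes a stopped process as a limit of adapted sums.
\<close>

lemma stopped_grid_limit:
  fixes q :: "real \<Rightarrow> real"
  assumes T: "ereal T \<le> \<tau>" and S: "0 < S" and q: "continuous_on {T..} q"
  defines "t \<equiv> \<lambda>n i. T + real i * (S / real (Suc n))"
  shows "(\<lambda>n. q T + (\<Sum>i<Suc n. if ereal (t n i) < \<tau> then q (t n (Suc i)) - q (t n i) else 0))
    \<longlonglongrightarrow> q (real_of_ereal (min (ereal (T + S)) \<tau>))"
proof -
  have g: "t n 0 = T" "t n (Suc n) = T + S" "t n (Suc i) = t n i + S / real (Suc n)" "T \<le> t n i" "t n i < t n (Suc i)" for n i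
  proof -
    have h: "0 < S / real (Suc n)" using S by simp
    show "t n 0 = T" "t n (Suc n) = T + S" by (simp_all add: t_def del: of_nat_Suc)
    show d: "t n (Suc i) = t n i + S / real (Suc n)" by (simp add: t_def distrib_right add_divide_distrib)
    show "t n i < t n (Suc i)" unfolding d using h by simp
    show "T \<le> t n i" using h mult_nonneg_nonneg[of "real i" "S / real (Suc n)"] unfolding t_def by linarith
  qed
  define Q where "Q n j \<longleftrightarrow> j \<le> Suc n \<and> q T + (\<Sum>i<Suc n. if ereal (t n i) < \<tau> then q (t n (Suc i)) - q (t n i) else 0) = q (t n j)
      \<and> (\<forall>i<j. ereal (t n i) < \<tau>) \<and> (j < Suc n \<longrightarrow> \<not> ereal (t n j) < \<tau>)" for n j
  have "\<exists>j. Q n j" for n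
  proof -
    have "ereal (t n (Suc i)) < \<tau> \<Longrightarrow> ereal (t n i) < \<tau>" for i
      using g(5)[of n i] by (intro less_trans[of "ereal (t n i)" "ereal (t n (Suc i))" \<tau>]) simp_all
    from stopped_telescope[where p = "\<lambda>i. ereal (t n i) < \<tau>" and q = "\<lambda>i. q (t n i)" and N = "Suc n", OF this]
    show ?thesis unfolding Q_def g(1) by blast
  qed
  then obtain j where j: "\<And>n. Q n (j n)" using choice[of Q] by blast
  define w where "w = real_of_ereal (min (ereal (T + S)) \<tau>)"
  have w: "ereal w \<le> \<tau>" "w \<le> T + S" "T \<le> w" "w = T + S \<or> \<tau> = ereal w"
    using T S unfolding w_def by (cases \<tau>; auto simp: min_def)+
  have close: "\<bar>t n (j n) - w\<bar> \<le> S / real (Suc n)" for n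
  proof -
    note jn = j[of n, unfolded Q_def]
    have S0: "0 \<le> S / real (Suc n)" using S by simp
    have up: "t n (j n) \<le> w + S / real (Suc n)"
    proof (cases "j n")
      case 0 then show ?thesis unfolding 0 g(1) using w S0 by linarith
    next
      case (Suc i)
      then have "ereal (t n i) < \<tau>" using jn by auto
      moreover have "t n i \<le> T + S"
      proof -
        have "real i * (S / real (Suc n)) \<le> real (Suc n) * (S / real (Suc n))"
          using Suc jn S0 by (intro mult_right_mono) auto
        then show ?thesis unfolding t_def by simp
      qed
      ultimately have "t n i \<le> w" using w(4) by auto
      then show ?thesis using g(3)[of n i] Suc by simp
    qed
    have low: "w \<le> t n (j n)"
    proof (cases "j n = Suc n")
      case True then show ?thesis using g(2)[of n] w by simp
    next
      case False
      then have "\<tau> \<le> ereal (t n (j n))" using jn by auto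
      then show ?thesis using w(1) order_trans by fastforce
    qed
    show ?thesis using up low S0 by linarith
  qed
  have "(\<lambda>n. S / real (Suc n)) \<longlonglongrightarrow> 0" by (rule LIMSEQ_Suc[OF lim_const_over_n])
  then have "(\<lambda>n. t n (j n) - w) \<longlonglongrightarrow> 0"
    by (rule Lim_null_comparison[rotated]) (use close in simp)
  then have "(\<lambda>n. t n (j n)) \<longlonglongrightarrow> w" by (simp add: LIM_zero_iff)
  then have "(\<lambda>n. q (t n (j n))) \<longlonglongrightarrow> q w"
    using w g(4) by (intro continuous_on_tendsto_compose[OF q]) auto
  moreover have "q (t n (j n)) = q T + (\<Sum>i<Suc n. if ereal (t n i) < \<tau> then q (t n (Suc i)) - q (t n i) else 0)" for n
    using j[of n] unfolding Q_def by simp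
  ultimately show ?thesis unfolding w_def by simp
qed

section \<open>The strategy generated by the barrier\<close>

lemma left_limit_eq:
  assumes "(f \<longlongrightarrow> l) (at_left s)" shows "left_limit f s = l"
  unfolding left_limit_def using assms by (intro tendsto_Lim) auto

lemma left_limit_const:
  assumes "\<And>u. u < s \<Longrightarrow> f u = l" shows "left_limit f s = l"
proof (rule left_limit_eq)
  have "eventually (\<lambda>u. l = f u) (at_left s)"
    unfolding eventually_at_left_field using assms by (intro exI[of _ "s - 1"]) auto
  then show "(f \<longlongrightarrow> l) (at_left s)" by (rule Lim_transform_eventually[OF tendsto_const])
qed

text \<open>
  The running maximum of a continuous path is a supremum over a countable set of times, and is
  therefore adapted.
\<close>

lemma Sup_grid:
  fixes f :: "real \<Rightarrow> real"
  assumes s: "T < s" and f: "continuous_on {T..s} f"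
  defines "g \<equiv> \<lambda>p. T + real (min (snd p) (Suc (fst p))) * ((s - T) / real (Suc (fst p)))"
  shows "Sup (f ` {T..s}) = (SUP p. f (g p))" "bdd_above (range (\<lambda>p. f (g p)))" "g p \<in> {T..s}"
proof -
  show sub: "g p \<in> {T..s}" for p
  proof -
    have "real (min (snd p) (Suc (fst p))) * ((s - T) / real (Suc (fst p))) \<le> real (Suc (fst p)) * ((s - T) / real (Suc (fst p)))"
      using s by (intro mult_right_mono) auto
    moreover have "0 \<le> real (min (snd p) (Suc (fst p))) * ((s - T) / real (Suc (fst p)))"
      using s by (intro mult_nonneg_nonneg) auto
    ultimately show ?thesis by (simp add: g_def)
  qed
  obtain w where w: "w \<in> {T..s}" "\<And>v. v \<in> {T..s} \<Longrightarrow> f v \<le> f w"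
    using continuous_attains_sup[of "{T..s}" f] f s by auto
  show bdd: "bdd_above (range (\<lambda>p. f (g p)))" using w(2)[OF sub] by (intro bdd_aboveI[of _ "f w"]) auto
  have "Sup (f ` {T..s}) = f w" using w by (intro cSup_eq_maximum) auto
  moreover have "(SUP p. f (g p)) = f w"
  proof (rule antisym)
    show "(SUP p. f (g p)) \<le> f w" using w(2)[OF sub] by (intro cSUP_least) auto
    have sw: "w \<in> {T..T + (s - T)}" "0 < s - T" using w s by auto
    obtain i where i: "\<And>n. i n \<le> Suc n" "\<And>n. T + real (i n) * ((s - T) / real (Suc n)) \<in> {T..T + (s - T)}"
      and l: "(\<lambda>n. T + real (i n) * ((s - T) / real (Suc n))) \<longlonglongrightarrow> w"
      using grid_approximation[OF sw(2,1)] by blast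
    have "(\<lambda>n. f (T + real (i n) * ((s - T) / real (Suc n)))) \<longlonglongrightarrow> f w"
      using i w by (intro continuous_on_tendsto_compose[OF f l]) auto
    moreover have "f (T + real (i n) * ((s - T) / real (Suc n))) \<le> (SUP p. f (g p))" for n
      using cSUP_upper[OF UNIV_I bdd, of "(n, i n)"] i(1)[of n] by (simp add: g_def min_absorb1)
    ultimately show "f w \<le> (SUP p. f (g p))" by (intro LIMSEQ_le_const2) auto
  qed
  ultimately show "Sup (f ` {T..s}) = (SUP p. f (g p))" by simp
qed

locale dividend_barrier = dividend_model M F W R \<mu> \<sigma> \<phi> + barrier \<mu> \<sigma> k
  for M :: "'a measure" and F :: "real \<Rightarrow> 'a measure" and W :: "real \<Rightarrow> 'a \<Rightarrow> real"
    and R :: "real measure" and \<mu> \<sigma> :: real and \<phi> :: "real \<Rightarrow> real" and k :: real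
begin

sublocale brownian_barrier M F W \<mu> \<sigma> k ..

abbreviation free_path :: "real \<Rightarrow> ('a \<Rightarrow> real) \<Rightarrow> 'a \<Rightarrow> real \<Rightarrow> real" where
  "free_path T Y \<omega> s \<equiv> Y \<omega> + \<mu> * (s - T) + \<sigma> * (W s \<omega> - W T \<omega>)"

lemma skorokhod_solution_path:
  assumes T: "0 \<le> T" and sol: "skorokhod_solution T \<xi> {0<..<k} {k..} X D"
  shows "AE \<omega> in M. reflected_path k T (free_path T (\<lambda>\<omega>. max (\<xi> \<omega>) 0) \<omega>) (\<lambda>s. D s \<omega>) (ruin_time T X \<omega>)
    \<and> D T \<omega> = max 0 (max (\<xi> \<omega>) 0 - k)
    \<and> (\<forall>s<T. D s \<omega> = 0)
    \<and> (\<forall>s\<ge>T. ruin_time T X \<omega> \<le> ereal s \<longrightarrow> D s \<omega> = D (real_of_ereal (ruin_time T X \<omega>)) \<omega>)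
    \<and> (\<forall>s\<ge>T. X s \<omega> = \<xi> \<omega> + \<mu> * (s - T) + \<sigma> * (W s \<omega> - W T \<omega>) - D s \<omega>)
    \<and> (\<forall>s. X s \<omega> = surplus T \<xi> D s \<omega>)"
proof -
  have cl: "closure {0<..<k} = {0..k}" using k_pos by (rule closure_greaterThanLessThan)
  have "AE \<omega> in M. (\<forall>s<T. D s \<omega> = 0) \<and> mono (\<lambda>s. D s \<omega>) \<and> right_continuous (\<lambda>s. D s \<omega>)"
    using sol by (simp add: skorokhod_solution_def dividend_process_def)
  moreover have "AE \<omega> in M. right_continuous (\<lambda>s. X s \<omega>) \<and>
      (\<forall>s. X s \<omega> = surplus T \<xi> D s \<omega>) \<and>
      (\<forall>s\<ge>T. ereal s < ruin_time T X \<omega> \<longrightarrow> X s \<omega> \<in> {0..k}) \<and>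
      (\<forall>s\<ge>T. ennreal (D s \<omega>) =
        (\<integral>\<^sup>+ u \<in> {u. T \<le> u \<and> u \<le> s \<and> ereal u \<le> ruin_time T X \<omega>}.
           indicator {k..} (X u \<omega>) \<partial>stieltjes D \<omega>))"
    using sol by (simp add: skorokhod_solution_def cl)
  ultimately show ?thesis using W_continuous
  proof eventually_elim
    case (elim \<omega>)
    define c where "c s = \<mu> * (s - T) + \<sigma> * (W s \<omega> - W T \<omega>)" for s
    have "left_limit (\<lambda>u. D u \<omega>) T = 0" using elim(1) by (intro left_limit_const) auto
    then have X: "X s \<omega> = \<xi> \<omega> + c s - D s \<omega>" if "T \<le> s" for s
      using elim(2) that by (simp add: surplus_def c_def)
    have "continuous_on {T..} (\<lambda>s. W s \<omega>)" using continuous_on_subset[OF elim(3)] T by auto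
    then have c: "continuous_on {T..} c" unfolding c_def by (intro continuous_intros)
    have rt: "Inf (ereal ` {s. T \<le> s \<and> X s \<omega> \<le> 0}) = ruin_time T X \<omega>" by (simp add: ruin_time_def)
    have D: "\<And>s. s < T \<Longrightarrow> D s \<omega> = 0" "mono (\<lambda>s. D s \<omega>)" "\<And>s. continuous (at_right s) (\<lambda>s. D s \<omega>)"
      using elim(1) by (auto simp: right_continuous_def)
    have range: "X s \<omega> \<le> k" if "T \<le> s" "ereal s < ruin_time T X \<omega>" for s using elim(2) that by auto
    have int: "ennreal (D s \<omega>) = (\<integral>\<^sup>+ u \<in> {u. T \<le> u \<and> u \<le> s \<and> ereal u \<le> ruin_time T X \<omega>}.
           indicator {k..} (X u \<omega>) \<partial>interval_measure (\<lambda>s. D s \<omega>))" if "T \<le> s" for s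
      using elim(2) that by (simp add: stieltjes_def)
    have cT: "c T = 0" by (simp add: c_def)
    note rp = reflected_path_of_skorokhod[where T = T and X = "\<lambda>s. X s \<omega>", unfolded rt, OF k_pos c cT D X range int]
    have fp: "free_path T (\<lambda>\<omega>. max (\<xi> \<omega>) 0) \<omega> = (\<lambda>s. max (\<xi> \<omega>) 0 + c s)"
      by (rule ext) (simp add: c_def)
    show ?case unfolding fp
      using rp elim(1,2) X by (auto simp: c_def)
  qed
qed

lemma skorokhod_solution_unique:
  assumes T: "0 \<le> T" and x: "0 < x"
    and s1: "skorokhod_solution T (\<lambda>_. x) {0<..<k} {k..} X D"
    and s2: "skorokhod_solution T (\<lambda>_. x) {0<..<k} {k..} X' D'"
  shows "AE \<omega> in M. \<forall>s\<ge>T. X s \<omega> = X' s \<omega> \<and> D s \<omega> = D' s \<omega>"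
  using skorokhod_solution_path[OF T s1] skorokhod_solution_path[OF T s2]
proof eventually_elim
  case (elim \<omega>)
  have "D s \<omega> = D' s \<omega>" if "T \<le> s" for s
    using reflected_path_unique[of k T _ "\<lambda>s. D s \<omega>" _ "\<lambda>s. D' s \<omega>", OF _ _ _ that] elim by auto
  then show ?case using elim by auto
qed

text \<open>
  The solution is the stopped reflection of the free path.  Off the event of continuous paths the
  free path is replaced by a constant; this keeps it adapted because the filtration contains the null
  sets.
\<close>

lemma skorokhod_solution_exists:
  assumes T: "0 \<le> T" and x: "0 < x"
  shows "\<exists>X D. skorokhod_solution T (\<lambda>_. x) {0<..<k} {k..} X D"
proof -
  obtain N where N: "N \<in> null_sets M" "{\<omega> \<in> space M. \<not> continuous_on {0..} (\<lambda>t. W t \<omega>)} \<subseteq> N"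
    using W_continuous by (elim AE_E) (auto simp: null_sets_def)
  define g where "g = space M - N"
  define b where "b s \<omega> = x + (if \<omega> \<in> g then \<mu> * (s - T) + \<sigma> * (W s \<omega> - W T \<omega>) else 0)" for s \<omega>
  have bc: "continuous_on {T..} (\<lambda>s. b s \<omega>)" for \<omega>
  proof (cases "\<omega> \<in> g")
    case True
    then have "continuous_on {0..} (\<lambda>t. W t \<omega>)" using N(2) by (auto simp: g_def)
    then have "continuous_on {T..} (\<lambda>s. W s \<omega>)" by (rule continuous_on_subset) (use T in auto)
    then show ?thesis using True unfolding b_def by (simp only: if_True) (intro continuous_intros)
  next
    case False then show ?thesis unfolding b_def by simp
  qed
  have bT: "0 < b T \<omega>" for \<omega> using x by (simp add: b_def)
  have gF: "g \<in> sets (F s)" if "0 \<le> s" for s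
    using sets.compl_sets[OF null_sets_sets_F[OF that N(1)]] unfolding g_def space_F .
  have bF: "b s \<in> borel_measurable (F u)" if "T \<le> s" "s \<le> u" for s u
  proof -
    have u: "0 \<le> u" "0 \<le> s" "T \<le> u" using that T by auto
    have [measurable]: "W s \<in> borel_measurable (F u)" "W T \<in> borel_measurable (F u)"
      using measurable_F_mono[OF that(2) W_adapted[OF u(2)]] measurable_F_mono[OF u(3) W_adapted[OF T]] by auto
    note [measurable] = gF[OF u(1)]
    show ?thesis unfolding b_def[abs_def] by measurable
  qed
  define Rn where "Rn s \<omega> = running_reflection k T (\<lambda>s. b s \<omega>) s" for s \<omega>
  have RF: "Rn s \<in> borel_measurable (F u)" if su: "T \<le> s" "s \<le> u" for s u
  proof (cases "T = s")
    case True
    have [measurable]: "b T \<in> borel_measurable (F u)" using bF[of T u] su by auto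
    have "Rn s = (\<lambda>\<omega>. max 0 (b T \<omega> - k))" by (rule ext) (simp add: Rn_def running_reflection_def True[symmetric])
    then show ?thesis by simp
  next
    case False
    then have Ts: "T < s" using su by simp
    define G where "G p = T + real (min (snd p) (Suc (fst p))) * ((s - T) / real (Suc (fst p)))" for p :: "nat \<times> nat"
    have cont: "continuous_on {T..s} (\<lambda>v. b v \<omega> - k)" for \<omega>
      by (intro continuous_intros continuous_on_subset[OF bc]) auto
    note sg = Sup_grid[OF Ts cont, folded G_def]
    have [measurable]: "b (G p) \<in> borel_measurable (F u)" for p
      using sg(3)[of p] su by (intro bF) auto
    have "(\<lambda>\<omega>. SUP p. b (G p) \<omega> - k) \<in> borel_measurable (F u)"
      by (rule borel_measurable_cSUP) (use sg(2) in auto)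
    then show ?thesis unfolding Rn_def[abs_def] running_reflection_def sg(1) by measurable
  qed
  define D where "D s \<omega> = stopped_reflection k T (\<lambda>s. b s \<omega>) s" for s \<omega>
  define \<tau> where "\<tau> \<omega> = reflection_ruin k T (\<lambda>s. b s \<omega>)" for \<omega>
  have path: "reflected_path k T (\<lambda>s. b s \<omega>) (\<lambda>s. D s \<omega>) (\<tau> \<omega>)" for \<omega>
    using reflected_path_exists[OF k_pos bc bT] unfolding D_def \<tau>_def .
  have XcF: "continuous_on {T..s} (\<lambda>u. b u \<omega> - Rn u \<omega>)" for s \<omega>
    unfolding Rn_def
    by (intro continuous_intros continuous_on_subset[OF bc] continuous_on_subset[OF running_reflection_cont[OF k_pos bc bT]]) auto
  have alive: "{\<omega> \<in> space M. ereal u < \<tau> \<omega>} \<in> sets (F s)" if u: "T \<le> u" "u \<le> s" for u s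
  proof (cases "u = T")
    case True
    have "ereal T < \<tau> \<omega>" for \<omega>
      using reflection_alive_iff[OF k_pos bc bT order_refl, of \<omega>] bT[of \<omega>] k_pos
      unfolding \<tau>_def by (simp add: running_reflection_def)
    then show ?thesis using sets.top[of "F s"] True unfolding space_F by simp
  next
    case False
    then have Tu: "T < u" using u by simp
    define X0 where "X0 w \<omega> = b w \<omega> - Rn w \<omega>" for w \<omega>
    have X0F: "X0 (T + real i * ((u - T) / real (Suc n))) \<in> borel_measurable (F s)" if "i \<in> {..Suc n}" for i n
    proof -
      have "real i * ((u - T) / real (Suc n)) \<le> real (Suc n) * ((u - T) / real (Suc n))"
        using that Tu by (intro mult_right_mono) auto
      also have "\<dots> = u - T" by simp
      finally have 1: "T + real i * ((u - T) / real (Suc n)) \<le> s" using u by linarith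
      have "0 \<le> real i * ((u - T) / real (Suc n))" using Tu by (intro mult_nonneg_nonneg) auto
      then have 2: "T \<le> T + real i * ((u - T) / real (Suc n))" by linarith
      note [measurable] = bF[OF 2 1] RF[OF 2 1]
      show ?thesis unfolding X0_def[abs_def] by measurable
    qed
    have p[measurable]: "Measurable.pred (F s) (\<lambda>\<omega>. \<forall>i\<in>{..Suc n}. c \<le> X0 (T + real i * ((u - T) / real (Suc n))) \<omega>)" for n c
    proof (rule pred_intros_finite(3))
      fix i assume "i \<in> {..Suc n}"
      note [measurable] = X0F[OF this]
      show "Measurable.pred (F s) (\<lambda>\<omega>. c \<le> X0 (T + real i * ((u - T) / real (Suc n))) \<omega>)" by measurable
    qed simp
    have "ereal u < \<tau> \<omega> \<longleftrightarrow> (\<exists>m. \<forall>n. \<forall>i\<in>{..Suc n}. 1 / real (Suc m) \<le> X0 (T + real i * ((u - T) / real (Suc n))) \<omega>)" for \<omega>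
      unfolding \<tau>_def reflection_alive_iff[OF k_pos bc bT u(1)] Ball_def[of "{.._}"] atMost_iff X0_def Rn_def[symmetric]
      by (rule positive_on_grid_iff[OF Tu XcF])
    then have "{\<omega> \<in> space M. ereal u < \<tau> \<omega>} = {\<omega> \<in> space (F s). \<exists>m. \<forall>n. \<forall>i\<in>{..Suc n}.
        1 / real (Suc m) \<le> X0 (T + real i * ((u - T) / real (Suc n))) \<omega>}" unfolding space_F by simp
    also have "\<dots> \<in> sets (F s)" by measurable
    finally show ?thesis .
  qed
  have DF: "D s \<in> borel_measurable (F s)" if s: "T \<le> s" for s
  proof (cases "s = T")
    case True
    have "D T = (\<lambda>\<omega>. max 0 (b T \<omega> - k))"
      by (rule ext) (simp only: D_def stopped_reflection_start[OF k_pos bc bT])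
    moreover have [measurable]: "b T \<in> borel_measurable (F T)" by (rule bF) auto
    ultimately show ?thesis using True by simp
  next
    case False
    then have S: "0 < s - T" using s by simp
    define t where "t n i = T + real i * ((s - T) / real (Suc n))" for n i
    note g = grid_points[OF S, where T = T, folded t_def]
    define A where "A n \<omega> = Rn T \<omega> + (\<Sum>i<Suc n. if ereal (t n i) < \<tau> \<omega> then Rn (t n (Suc i)) \<omega> - Rn (t n i) \<omega> else 0)" for n \<omega>
    have AF: "A n \<in> borel_measurable (F s)" for n
    proof -
      have "(\<lambda>\<omega>. if ereal (t n i) < \<tau> \<omega> then Rn (t n (Suc i)) \<omega> - Rn (t n i) \<omega> else 0) \<in> borel_measurable (F s)"
        if "i \<in> {..<Suc n}" for i
      proof -
        have ti: "T \<le> t n i" "t n i \<le> s" "T \<le> t n (Suc i)" "t n (Suc i) \<le> s"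
          using g(5)[of i n] g(5)[of "Suc i" n] that by auto
        note [measurable] = RF[OF ti(1,2)] RF[OF ti(3,4)] alive[OF ti(1,2)]
        have "(\<lambda>\<omega>. indicator {\<omega> \<in> space M. ereal (t n i) < \<tau> \<omega>} \<omega> * (Rn (t n (Suc i)) \<omega> - Rn (t n i) \<omega>)) \<in> borel_measurable (F s)"
          by measurable
        then show ?thesis by (rule measurable_cong[THEN iffD1, rotated]) (simp add: space_F)
      qed
      note [measurable] = this
      have [measurable]: "Rn T \<in> borel_measurable (F s)" by (rule RF) (use s in auto)
      show ?thesis unfolding A_def[abs_def] by (intro borel_measurable_add borel_measurable_sum) measurable
    qed
    have lim: "(\<lambda>n. A n \<omega>) \<longlonglongrightarrow> D s \<omega>" for \<omega>
    proof -
      have "ereal T \<le> \<tau> \<omega>" using path[of \<omega>] by (rule reflected_path.T_le)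
      from stopped_grid_limit[OF this S running_reflection_cont[OF k_pos bc bT, of \<omega>]]
      show ?thesis unfolding A_def t_def Rn_def D_def stopped_reflection_limit[OF k_pos bc bT s] \<tau>_def by simp
    qed
    show ?thesis by (rule borel_measurable_LIMSEQ_real[OF lim AF])
  qed
  have D0: "D s \<omega> = 0" if "s < T" for s \<omega>
    unfolding D_def by (rule stopped_reflection_before[OF k_pos bc bT that])
  have ll: "left_limit (\<lambda>u. D u \<omega>) T = 0" for \<omega> by (intro left_limit_const D0)
  define X where "X s \<omega> = surplus T (\<lambda>_. x) D s \<omega>" for s \<omega>
  have Xs: "X s \<omega> = x + \<mu> * (s - T) + \<sigma> * (W s \<omega> - W T \<omega>) - D s \<omega>" if "T \<le> s" for s \<omega>
    using that by (simp add: X_def surplus_def ll)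
  have cl: "closure {0<..<k} = {0..k}" using k_pos by (rule closure_greaterThanLessThan)
  have "skorokhod_solution T (\<lambda>_. x) {0<..<k} {k..} X D"
    unfolding skorokhod_solution_def dividend_process_def cl
  proof (intro conjI allI impI)
    show "D s \<in> borel_measurable (F s)" if "T \<le> s" for s by (rule DF[OF that])
    show "AE \<omega> in M. (\<forall>s<T. D s \<omega> = 0) \<and> mono (\<lambda>s. D s \<omega>) \<and> right_continuous (\<lambda>s. D s \<omega>)"
      unfolding right_continuous_def
      using D0 reflected_path.D_mono[OF path] reflected_path.D_right_cont[OF path] by (intro AE_I2) blast
    show "X s \<in> borel_measurable (F s)" if "T \<le> s" for s
    proof -
      have [measurable]: "W s \<in> borel_measurable (F s)" "W T \<in> borel_measurable (F s)"
        using W_adapted[of s] measurable_F_mono[OF that W_adapted[OF T]] T that by auto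
      note [measurable] = DF[OF that]
      have "X s = (\<lambda>\<omega>. x + \<mu> * (s - T) + \<sigma> * (W s \<omega> - W T \<omega>) - D s \<omega>)" by (rule ext) (rule Xs[OF that])
      then show ?thesis by simp
    qed
    have "AE \<omega> in M. \<omega> \<in> g" using AE_not_in[OF N(1)] AE_space by eventually_elim (simp add: g_def)
    then show "AE \<omega> in M. right_continuous (\<lambda>s. X s \<omega>) \<and> (\<forall>s. X s \<omega> = surplus T (\<lambda>_. x) D s \<omega>) \<and>
      (\<forall>s\<ge>T. ereal s < ruin_time T X \<omega> \<longrightarrow> X s \<omega> \<in> {0..k}) \<and>
      (\<forall>s\<ge>T. ennreal (D s \<omega>) = (\<integral>\<^sup>+ u \<in> {u. T \<le> u \<and> u \<le> s \<and> ereal u \<le> ruin_time T X \<omega>}.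
           indicator {k..} (X u \<omega>) \<partial>stieltjes D \<omega>))"
    proof eventually_elim
      case (elim \<omega>)
      interpret P: reflected_path k T "\<lambda>s. b s \<omega>" "\<lambda>s. D s \<omega>" "\<tau> \<omega>" by (rule path)
      have XP: "X s \<omega> = P.X s" if "T \<le> s" for s using elim that by (simp add: Xs b_def)
      have Xc: "continuous_on {T..} (\<lambda>s. X s \<omega>)"
        by (rule continuous_on_eq[OF P.X_cont]) (simp add: XP)
      have rc: "continuous (at_right s) (\<lambda>s. X s \<omega>)" for s
      proof (cases "T \<le> s")
        case True
        then show ?thesis using Xc unfolding continuous_on_eq_continuous_within
          by (auto intro: continuous_within_subset[of s "{T..}"])
      next
        case False
        have "eventually (\<lambda>u. x = X u \<omega>) (at_right s)"
          using False by (auto simp: eventually_at_right_field X_def surplus_def intro!: exI[of _ T])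
        then show ?thesis unfolding continuous_within
          using False by (intro Lim_transform_eventually[OF tendsto_const]) (auto simp: X_def surplus_def)
      qed
      have ruin: "ruin_time T X \<omega> = \<tau> \<omega>"
      proof (rule antisym)
        show "ruin_time T X \<omega> \<le> \<tau> \<omega>"
        proof (cases "\<tau> \<omega>")
          case (real u)
          then have "T \<le> u" "X u \<omega> = 0" using P.T_le XP[of u] P.ruin[OF real] by auto
          then show ?thesis unfolding ruin_time_def real by (intro Inf_lower) auto
        qed (use P.T_le in auto)
        show "\<tau> \<omega> \<le> ruin_time T X \<omega>"
          unfolding ruin_time_def
        proof (intro Inf_greatest)
          fix y assume "y \<in> ereal ` {s. T \<le> s \<and> X s \<omega> \<le> 0}"
          then obtain s where s: "y = ereal s" "T \<le> s" "X s \<omega> \<le> 0" by auto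
          then show "\<tau> \<omega> \<le> y" using P.above_zero[of s] XP[of s] by (auto simp: not_less[symmetric])
        qed
      qed
      have DT: "D T \<omega> = max 0 (b T \<omega> - k)" unfolding D_def by (rule stopped_reflection_start[OF k_pos bc bT])
      have "ennreal (D s \<omega>) = (\<integral>\<^sup>+ u \<in> {u. T \<le> u \<and> u \<le> s \<and> ereal u \<le> \<tau> \<omega>}.
           indicator {k..} (X u \<omega>) \<partial>interval_measure (\<lambda>s. D s \<omega>))" if "T \<le> s" for s
      proof -
        have "ennreal (D s \<omega>) = (\<integral>\<^sup>+ u \<in> {u. T \<le> u \<and> u \<le> s \<and> ereal u \<le> \<tau> \<omega>}.
           indicator {k..} (P.X u) \<partial>interval_measure (\<lambda>s. D s \<omega>))"
          by (rule P.skorokhod_integral[OF D0 DT that])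
        also have "\<dots> = (\<integral>\<^sup>+ u \<in> {u. T \<le> u \<and> u \<le> s \<and> ereal u \<le> \<tau> \<omega>}.
           indicator {k..} (X u \<omega>) \<partial>interval_measure (\<lambda>s. D s \<omega>))"
          by (intro nn_integral_cong) (auto simp: XP indicator_def)
        finally show ?thesis .
      qed
      moreover have "X s \<omega> \<in> {0..k}" if "T \<le> s" "ereal s < \<tau> \<omega>" for s
        using P.above_zero[OF that] P.below_barrier[OF that] XP[OF that(1)] by simp
      ultimately show ?case using rc unfolding ruin right_continuous_def stieltjes_def X_def by blast
    qed
  qed
  then show ?thesis by blast
qed

end

section \<open>Payoffs of the law and of its perturbations\<close>

lemma nn_integral_interval_measure_cong:
  assumes F: "mono F" "\<And>s. continuous (at_right s) F" and G: "mono G" "\<And>s. continuous (at_right s) G"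
    and eq: "\<And>s. T \<le> s \<Longrightarrow> G s = c + F s" and f: "f \<in> borel_measurable borel"
  shows "(\<integral>\<^sup>+ s \<in> {T<..}. f s \<partial>interval_measure F) = (\<integral>\<^sup>+ s \<in> {T<..}. f s \<partial>interval_measure G)"
proof -
  let ?d = "\<lambda>H. density (interval_measure H) (indicator {T<..})"
  have val: "emeasure (?d H) {a<..b} = ennreal (H (max T b) - H (max T a))"
    if "mono H" "\<And>s. continuous (at_right s) H" "a \<le> b" for H :: "real \<Rightarrow> real" and a b
  proof -
    have "emeasure (?d H) {a<..b} = emeasure (interval_measure H) ({T<..} \<inter> {a<..b})"
      by (subst emeasure_density) (auto simp: nn_integral_indicator indicator_inter_arith[symmetric])
    also have "{T<..} \<inter> {a<..b} = {max T a<..max T b}" using that(3) by auto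
    also have "emeasure (interval_measure H) \<dots> = ennreal (H (max T b) - H (max T a))"
      using that by (intro emeasure_Ioc_mono) auto
    finally show ?thesis .
  qed
  have same: "G (max T b) - G (max T a) = F (max T b) - F (max T a)" for a b by (simp add: eq)
  have "?d F = ?d G"
  proof (rule measure_eqI_generator_eq[where E = "range (\<lambda>(a, b). {a<..b::real})" and \<Omega> = UNIV and A = "\<lambda>n. {- real n<..real n}"])
    show "Int_stable (range (\<lambda>(a, b). {a<..b::real}))"
      by (auto simp: Int_stable_def)
    show "emeasure (?d F) X = emeasure (?d G) X" if Xr: "X \<in> range (\<lambda>(a, b). {a<..b::real})" for X
    proof -
      obtain a b where X: "X = {a<..b}" using Xr by auto
      show ?thesis
      proof (cases "a \<le> b")
        case True then show ?thesis by (simp add: X val[OF F True] val[OF G True] same)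
      qed (simp add: X)
    qed
    show "sets (?d F) = sigma_sets UNIV (range (\<lambda>(a, b). {a<..b::real}))"
      "sets (?d G) = sigma_sets UNIV (range (\<lambda>(a, b). {a<..b::real}))"
      by (simp_all add: borel_sigma_sets_Ioc)
    show "(\<Union>i. {- real i<..real i}) = UNIV"
    proof -
      have "\<exists>i. - real i < y \<and> y \<le> real i" for y
      proof -
        obtain i where "\<bar>y\<bar> < real i" using reals_Archimedean2 by blast
        then show ?thesis by (intro exI[of _ i]) auto
      qed
      then show ?thesis by auto
    qed
    show "emeasure (?d F) {- real i<..real i} \<noteq> \<infinity>" for i by (subst val[OF F]) auto
  qed auto
  then have "(\<integral>\<^sup>+ s. f s \<partial>?d F) = (\<integral>\<^sup>+ s. f s \<partial>?d G)" by simp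
  then show ?thesis using f by (simp add: nn_integral_density mult.commute)
qed

context dividend_barrier begin

text \<open>
  The initial lump sum, which brings the surplus down to \<open>k\<close>, is the atom of \<open>dD\<close> at \<open>T\<close>; the rest
  is the dividends of a reflected path.  The starting point may be random.
\<close>

lemma expected_total_dividends:
  assumes T: "0 \<le> T" and r: "0 < r" and sol: "skorokhod_solution T \<xi> {0<..<k} {k..} X D"
  defines "I \<equiv> \<lambda>\<omega>. (\<integral>\<^sup>+ s \<in> {T..}. ennreal (exp (- r * (s - T))) \<partial>stieltjes D \<omega>)"
  shows "(\<integral>\<^sup>+ \<omega>. I \<omega> \<partial>M) = (\<integral>\<^sup>+ \<omega>. ennreal (V r (\<xi> \<omega>)) \<partial>M)"
    "\<exists>g\<in>borel_measurable M. AE \<omega> in M. g \<omega> = I \<omega>"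
    "AE \<omega> in M. I \<omega> = ennreal (D T \<omega>) + (\<integral>\<^sup>+ s \<in> {T<..}. ennreal (exp (- r * (s - T))) \<partial>stieltjes D \<omega>)"
proof -
  note path = skorokhod_solution_path[OF T sol]
  have DF: "D s \<in> borel_measurable (F s)" if "T \<le> s" for s
    using sol that by (simp add: skorokhod_solution_def dividend_process_def)
  have XF: "X T \<in> borel_measurable (F T)" using sol by (simp add: skorokhod_solution_def)
  define Y where "Y \<omega> = max (X T \<omega> + D T \<omega>) 0" for \<omega>
  have YF: "Y \<in> borel_measurable (F T)" unfolding Y_def[abs_def] using XF DF[of T] by measurable
  have Y\<xi>: "AE \<omega> in M. Y \<omega> = max (\<xi> \<omega>) 0"
    using path
  proof eventually_elim
    case (elim \<omega>)
    then have "X T \<omega> = \<xi> \<omega> + \<mu> * (T - T) + \<sigma> * (W T \<omega> - W T \<omega>) - D T \<omega>" by blast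
    then show ?case by (simp add: Y_def)
  qed
  have path': "AE \<omega> in M. reflected_path k T (free_path T Y \<omega>) (\<lambda>s. D s \<omega>) (ruin_time T X \<omega>)"
    using path Y\<xi> by eventually_elim simp
  define J where "J \<omega> = (\<integral>\<^sup>+ s \<in> {T<..}. ennreal (exp (- r * (s - T))) \<partial>interval_measure (\<lambda>s. D s \<omega>))" for \<omega>
  note core = expected_reflection_dividends[OF T r YF DF path', folded J_def]
  obtain g where g: "g \<in> borel_measurable M" "AE \<omega> in M. g \<omega> = J \<omega>" using core(2) by blast
  have IJ: "AE \<omega> in M. I \<omega> = ennreal (D T \<omega>) + J \<omega>"
    using path
  proof eventually_elim
    case (elim \<omega>)
    interpret P: reflected_path k T "free_path T (\<lambda>\<omega>. max (\<xi> \<omega>) 0) \<omega>" "\<lambda>s. D s \<omega>" "ruin_time T X \<omega>"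
      using elim by blast
    have D0: "D s \<omega> = 0" if "s < T" for s using elim that by blast
    have "ennreal (D T \<omega>) \<le> emeasure (interval_measure (\<lambda>s. D s \<omega>)) {T}"
      by (rule emeasure_atom_ge[OF P.D_mono P.D_right_cont]) (simp add: D0)
    moreover have "emeasure (interval_measure (\<lambda>s. D s \<omega>)) {T} \<le> emeasure (interval_measure (\<lambda>s. D s \<omega>)) {T - 1<..T}"
      by (intro emeasure_mono) auto
    moreover have "\<dots> = ennreal (D T \<omega>)"
      using emeasure_Ioc_mono[OF P.D_mono P.D_right_cont, of "T - 1" T] by (simp add: D0)
    ultimately have atom: "emeasure (interval_measure (\<lambda>s. D s \<omega>)) {T} = ennreal (D T \<omega>)" by (intro antisym) simp_all
    have "{T..} = {T} \<union> {T<..}" by auto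
    then have "I \<omega> = (\<integral>\<^sup>+ s \<in> {T}. ennreal (exp (- r * (s - T))) \<partial>interval_measure (\<lambda>s. D s \<omega>)) + J \<omega>"
      unfolding I_def J_def stieltjes_def by (subst nn_integral_disjoint_pair[symmetric]) auto
    also have "(\<integral>\<^sup>+ s \<in> {T}. ennreal (exp (- r * (s - T))) \<partial>interval_measure (\<lambda>s. D s \<omega>))
       = (\<integral>\<^sup>+ s. indicator {T} s \<partial>interval_measure (\<lambda>s. D s \<omega>))"
      by (intro nn_integral_cong) (auto simp: indicator_def)
    also have "\<dots> = ennreal (D T \<omega>)" by (simp add: atom)
    finally show ?case .
  qed
  then show "AE \<omega> in M. I \<omega> = ennreal (D T \<omega>) + (\<integral>\<^sup>+ s \<in> {T<..}. ennreal (exp (- r * (s - T))) \<partial>stieltjes D \<omega>)"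
    unfolding J_def stieltjes_def .
  have [measurable]: "D T \<in> borel_measurable M" "Y \<in> borel_measurable M"
    using measurable_F_M[OF T DF[OF order_refl]] measurable_F_M[OF T YF] by auto
  note [measurable] = g(1)
  show "\<exists>g\<in>borel_measurable M. AE \<omega> in M. g \<omega> = I \<omega>"
  proof (rule bexI)
    show "AE \<omega> in M. ennreal (D T \<omega>) + g \<omega> = I \<omega>" using IJ g(2) by eventually_elim simp
  qed measurable
  have "(\<integral>\<^sup>+ \<omega>. I \<omega> \<partial>M) = (\<integral>\<^sup>+ \<omega>. ennreal (D T \<omega>) + g \<omega> \<partial>M)"
    using IJ g(2) by (intro nn_integral_cong_AE) (auto elim!: eventually_elim2)
  also have "\<dots> = (\<integral>\<^sup>+ \<omega>. ennreal (D T \<omega>) \<partial>M) + (\<integral>\<^sup>+ \<omega>. g \<omega> \<partial>M)" by (intro nn_integral_add) measurable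
  also have "(\<integral>\<^sup>+ \<omega>. g \<omega> \<partial>M) = (\<integral>\<^sup>+ \<omega>. J \<omega> \<partial>M)" using g(2) by (intro nn_integral_cong_AE)
  also have "\<dots> = (\<integral>\<^sup>+ \<omega>. ennreal (v 0 r (Y \<omega> - D T \<omega>)) \<partial>M)" by (rule core(1))
  also have "(\<integral>\<^sup>+ \<omega>. ennreal (D T \<omega>) \<partial>M) + \<dots> = (\<integral>\<^sup>+ \<omega>. ennreal (D T \<omega>) + ennreal (v 0 r (Y \<omega> - D T \<omega>)) \<partial>M)"
    by (intro nn_integral_add[symmetric]) measurable
  also have "\<dots> = (\<integral>\<^sup>+ \<omega>. ennreal (V r (\<xi> \<omega>)) \<partial>M)"
  proof (rule nn_integral_cong_AE)
    show "AE \<omega> in M. ennreal (D T \<omega>) + ennreal (v 0 r (Y \<omega> - D T \<omega>)) = ennreal (V r (\<xi> \<omega>))"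
      using path Y\<xi>
    proof eventually_elim
      case (elim \<omega>)
      have DT: "D T \<omega> = max 0 (max (\<xi> \<omega>) 0 - k)" using elim by blast
      have nn: "0 \<le> D T \<omega>" "0 \<le> v 0 r (Y \<omega> - D T \<omega>)" using DT elim(2) k_pos by (auto intro!: v_0_nonneg[OF r])
      consider "\<xi> \<omega> \<le> 0" | "0 < \<xi> \<omega>" "\<xi> \<omega> \<le> k" | "k < \<xi> \<omega>" by linarith
      then have "D T \<omega> + v 0 r (Y \<omega> - D T \<omega>) = V r (\<xi> \<omega>)"
        by cases (use DT elim(2) k_pos v_0_0[of r] in \<open>simp_all add: V_def\<close>)
      then show ?case using nn by (simp add: ennreal_plus[symmetric] del: ennreal_plus)
    qed
  qed
  finally show "(\<integral>\<^sup>+ \<omega>. I \<omega> \<partial>M) = (\<integral>\<^sup>+ \<omega>. ennreal (V r (\<xi> \<omega>)) \<partial>M)" .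
qed

text \<open>
  After ruin \<open>D\<close> is constant, so the truncation at ruin in the payoff removes a null set.
\<close>

lemma expected_payoff_of_law:
  assumes T: "0 \<le> T" and r: "0 < r" and x: "0 < x" and sol: "skorokhod_solution T (\<lambda>_. x) {0<..<k} {k..} X D"
  shows "expected_payoff T x D r = ennreal (V r x)"
proof -
  have "expected_payoff T x D r = (\<integral>\<^sup>+ \<omega>. (\<integral>\<^sup>+ s \<in> {T..}. ennreal (exp (- r * (s - T))) \<partial>stieltjes D \<omega>) \<partial>M)"
    unfolding expected_payoff_def
  proof (rule nn_integral_cong_AE)
    show "AE \<omega> in M. payoff T x D r \<omega> = (\<integral>\<^sup>+ s \<in> {T..}. ennreal (exp (- r * (s - T))) \<partial>stieltjes D \<omega>)"
      using skorokhod_solution_path[OF T sol]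
    proof eventually_elim
      case (elim \<omega>)
      interpret P: reflected_path k T "free_path T (\<lambda>\<omega>. max x 0) \<omega>" "\<lambda>s. D s \<omega>" "ruin_time T X \<omega>"
        using elim by blast
      have ruin: "ruin_time T (surplus T (\<lambda>_. x) D) \<omega> = ruin_time T X \<omega>"
        unfolding ruin_time_def using elim by simp
      define N where "N = {s. ruin_time T X \<omega> < ereal s}"
      have "N \<in> null_sets (interval_measure (\<lambda>s. D s \<omega>))"
      proof (cases "ruin_time T X \<omega>")
        case (real u)
        then have Tu: "T \<le> u" using P.T_le by simp
        have "N = (\<Union>n. {u<..u + real n})"
        proof (rule set_eqI)
          fix s
          obtain n where "s - u < real n" using reals_Archimedean2 by blast
          then show "s \<in> N \<longleftrightarrow> s \<in> (\<Union>n. {u<..u + real n})"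
            by (auto simp: N_def real intro!: exI[of _ n])
        qed
        moreover have "{u<..u + real n} \<in> null_sets (interval_measure (\<lambda>s. D s \<omega>))" for n
          using P.frozen[of u "u + real n"] real Tu
          by (simp add: null_sets_def emeasure_Ioc_mono[OF P.D_mono P.D_right_cont])
        ultimately show ?thesis by (simp add: null_sets_UN)
      qed (use P.T_le in \<open>auto simp: N_def\<close>)
      then have "AE s in interval_measure (\<lambda>s. D s \<omega>). s \<notin> N" by (rule AE_not_in)
      then show ?case
        unfolding payoff_def ruin stieltjes_def
        by (intro nn_integral_cong_AE) (auto elim!: eventually_mono simp: N_def indicator_def not_less)
    qed
  qed
  also have "\<dots> = (\<integral>\<^sup>+ \<omega>. ennreal (V r x) \<partial>M)" by (rule expected_total_dividends(1)[OF T r sol])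
  also have "\<dots> = ennreal (V r x)" by (simp add: emeasure_space_1)
  finally show ?thesis .
qed

lemma law_strategy_solution:
  assumes "0 \<le> T" "0 < x"
  shows "\<exists>X. skorokhod_solution T (\<lambda>_. x) {0<..<k} {k..} X (law_strategy T x {0<..<k} {k..})"
  unfolding law_strategy_def
  using skorokhod_solution_exists[OF assms] by (intro someI_ex[of "\<lambda>D. \<exists>X. skorokhod_solution T (\<lambda>_. x) {0<..<k} {k..} X D"]) blast

text \<open>
  The expected payoff is decreasing in the rate, so its sublevel sets are intervals.
\<close>

lemma expected_payoff_measurable: "(\<lambda>r. expected_payoff t x D r) \<in> borel_measurable borel"
proof -
  have anti: "expected_payoff t x D r' \<le> expected_payoff t x D r" if "r \<le> r'" for r r'
    unfolding expected_payoff_def payoff_def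
    using that by (intro nn_integral_mono) (auto simp: indicator_def intro!: ennreal_leI mult_right_mono)
  show ?thesis
  proof (rule borel_measurableI_le)
    fix y
    have "is_interval {r. expected_payoff t x D r \<le> y}"
      unfolding is_interval_1 using anti by (auto intro: order_trans)
    then have "{r. expected_payoff t x D r \<le> y} \<in> sets borel"
      by (rule real_interval_borel_measurable)
    then show "{r \<in> space borel. expected_payoff t x D r \<le> y} \<in> sets borel" by simp
  qed
qed

text \<open>
  Before \<open>T = t + \<epsilon>\<close> the strategy pays at most \<open>l\<close>, the left limit of \<open>\<delta>\<close> at \<open>T\<close>; from then on it is
  the barrier strategy, whose payoff from a random state is \<open>V\<close>.  If ruin occurs before \<open>T\<close>, the
  restarted strategy starts from a nonpositive surplus and is worth \<open>0\<close>; otherwise it starts from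
  the state at which \<open>V\<close> is evaluated in the bound.
\<close>

lemma perturbed_payoff_bound:
  assumes t: "0 \<le> t" and x: "0 < x" and \<epsilon>: "0 < \<epsilon>" and r: "0 < r"
    and \<delta>: "dividend_process t \<delta>"
    and ps: "perturbed_strategy t x d {0<..<k} {k..} \<delta> \<epsilon> D"
    and l: "l \<in> borel_measurable M" "AE \<omega> in M. ((\<lambda>u. \<delta> u \<omega>) \<longlongrightarrow> l \<omega>) (at_left (t + \<epsilon>))"
  shows "expected_payoff t x D r \<le> (\<integral>\<^sup>+ \<omega>. ennreal (l \<omega> +
     exp (- (r * \<epsilon>)) * V r (x + \<mu> * \<epsilon> + \<sigma> * (W (t + \<epsilon>) \<omega> - W t \<omega>) - l \<omega>)) \<partial>M)"
proof -
  define T where "T = t + \<epsilon>"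
  have T: "0 \<le> T" "t < T" "T - t = \<epsilon>" using t \<epsilon> by (auto simp: T_def)
  define X where "X = surplus t (\<lambda>_. x) D"
  define \<tau> where "\<tau> = ruin_time t X"
  define \<xi> where "\<xi> \<omega> = (if \<tau> \<omega> < ereal T then X (real_of_ereal (\<tau> \<omega>)) \<omega> else left_limit (\<lambda>u. X u \<omega>) T)" for \<omega>
  have "\<exists>X' D'. skorokhod_solution T \<xi> {0<..<k} {k..} X' D' \<and> (AE \<omega> in M.
         (\<forall>s<t. D s \<omega> = d \<omega>) \<and>
         (\<forall>s. t \<le> s \<and> s < T \<longrightarrow> D s \<omega> = d \<omega> + \<delta> (real_of_ereal (min (ereal s) (\<tau> \<omega>))) \<omega>) \<and>
         (\<forall>s\<ge>T. D s \<omega> = left_limit (\<lambda>u. D u \<omega>) T + D' s \<omega>))"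
    using ps unfolding perturbed_strategy_def Let_def T_def[symmetric] X_def[symmetric] \<tau>_def[symmetric] \<xi>_def[abs_def] .
  then obtain X' D' where sol: "skorokhod_solution T \<xi> {0<..<k} {k..} X' D'" and DAE: "AE \<omega> in M.
         (\<forall>s<t. D s \<omega> = d \<omega>) \<and>
         (\<forall>s. t \<le> s \<and> s < T \<longrightarrow> D s \<omega> = d \<omega> + \<delta> (real_of_ereal (min (ereal s) (\<tau> \<omega>))) \<omega>) \<and>
         (\<forall>s\<ge>T. D s \<omega> = left_limit (\<lambda>u. D u \<omega>) T + D' s \<omega>)" by blast
  define I where "I \<omega> = (\<integral>\<^sup>+ s \<in> {T..}. ennreal (exp (- r * (s - T))) \<partial>stieltjes D' \<omega>)" for \<omega>
  note tot = expected_total_dividends[OF T(1) r sol, folded I_def]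
  obtain g where g: "g \<in> borel_measurable M" "AE \<omega> in M. g \<omega> = I \<omega>" using tot(2) by blast
  define z where "z \<omega> = x + \<mu> * \<epsilon> + \<sigma> * (W T \<omega> - W t \<omega>) - l \<omega>" for \<omega>
  have \<delta>AE: "AE \<omega> in M. (\<forall>s<t. \<delta> s \<omega> = 0) \<and> mono (\<lambda>s. \<delta> s \<omega>) \<and> right_continuous (\<lambda>s. \<delta> s \<omega>)"
    using \<delta> by (simp add: dividend_process_def)
  have key: "AE \<omega> in M. payoff t x D r \<omega> \<le> ennreal (l \<omega>) + ennreal (exp (- (r * \<epsilon>))) * I \<omega> \<and> V r (\<xi> \<omega>) \<le> V r (z \<omega>) \<and> 0 \<le> l \<omega>"
    using DAE \<delta>AE l(2) W_continuous skorokhod_solution_path[OF T(1) sol] tot(3)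
  proof eventually_elim
    case (elim \<omega>)
    interpret P: reflected_path k T "free_path T (\<lambda>\<omega>. max (\<xi> \<omega>) 0) \<omega>" "\<lambda>s. D' s \<omega>" "ruin_time T X' \<omega>"
      using elim by blast
    have \<delta>0: "\<delta> s \<omega> = 0" if "s < t" for s using elim(2) that by blast
    have \<delta>m: "\<delta> s \<omega> \<le> \<delta> u \<omega>" if "s \<le> u" for s u using elim(2) monoD[of "\<lambda>s. \<delta> s \<omega>"] that by blast
    have \<delta>rc: "continuous (at_right s) (\<lambda>s. \<delta> s \<omega>)" for s using elim(2) by (simp add: right_continuous_def)
    have \<delta>nn: "0 \<le> \<delta> s \<omega>" for s using \<delta>m[of "min s (t - 1)" s] \<delta>0[of "min s (t - 1)"] by simp
    have ll: "((\<lambda>u. \<delta> u \<omega>) \<longlongrightarrow> l \<omega>) (at_left T)" using elim(3) by (simp add: T_def)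
    have \<delta>l: "\<delta> s \<omega> \<le> l \<omega>" if "s < T" for s
    proof (rule tendsto_lowerbound[OF ll])
      show "\<forall>\<^sub>F u in at_left T. \<delta> s \<omega> \<le> \<delta> u \<omega>"
        unfolding eventually_at_left_field using that \<delta>m by (intro exI[of _ s]) auto
    qed simp
    have l0: "0 \<le> l \<omega>" using \<delta>l[of t] \<delta>nn[of t] T by linarith
    have \<tau>t: "ereal t \<le> \<tau> \<omega>" unfolding \<tau>_def ruin_time_def by (intro Inf_greatest) auto
    define m where "m s = real_of_ereal (min (ereal s) (\<tau> \<omega>))" for s
    have m: "m s = (if ereal s \<le> \<tau> \<omega> then s else real_of_ereal (\<tau> \<omega>))" for s
      unfolding m_def by (auto simp: min_def)
    have m_le: "m s \<le> s" "m s \<le> m u" if "t \<le> s" "s \<le> u" for s u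
      using \<tau>t that unfolding m by (cases "\<tau> \<omega>"; auto)+
    have \<delta>ml: "\<delta> (m s) \<omega> \<le> l \<omega>" if "t \<le> s" "s < T" for s
      using \<delta>l[of "m s"] m_le(1)[OF that(1) order_refl] that(2) by simp
    have D1: "D s \<omega> = d \<omega>" if "s < t" for s using elim(1) that by blast
    have D2: "D s \<omega> = d \<omega> + \<delta> (m s) \<omega>" if "t \<le> s" "s < T" for s using elim(1) that by (simp add: m_def)
    define L where "L = left_limit (\<lambda>u. D u \<omega>) T"
    have D3: "D s \<omega> = L + D' s \<omega>" if "T \<le> s" for s using elim(1) that by (simp add: L_def)
    have D'0: "D' s \<omega> = 0" if "s < T" for s using elim(5) that by blast
    have D'nn: "0 \<le> D' s \<omega>" for s
      using monoD[OF P.D_mono, of "min s (T - 1)" s] D'0[of "min s (T - 1)"] by simp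
    define S where "S = Sup ((\<lambda>s. d \<omega> + \<delta> (m s) \<omega>) ` {t..<T})"
    have bdd: "bdd_above ((\<lambda>s. d \<omega> + \<delta> (m s) \<omega>) ` {t..<T})"
      using \<delta>ml by (intro bdd_aboveI[of _ "d \<omega> + l \<omega>"]) auto
    have DS: "D s \<omega> \<le> S" if "s < T" for s
    proof (cases "t \<le> s")
      case True then show ?thesis unfolding D2[OF True that] S_def using that bdd by (intro cSup_upper) auto
    next
      case False
      have "d \<omega> + \<delta> (m t) \<omega> \<le> S" unfolding S_def using T bdd by (intro cSup_upper) auto
      then show ?thesis using D1 False \<delta>nn[of "m t"] by simp
    qed
    have Sl: "S \<le> d \<omega> + l \<omega>" unfolding S_def
      using \<delta>ml T by (intro cSup_least) auto
    have D12: "D s \<omega> \<le> D u \<omega>" if "s \<le> u" "u < T" for s u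
    proof (cases "t \<le> s")
      case True then show ?thesis using D2[of s] D2[of u] that \<delta>m[OF m_le(2)] by simp
    next
      case False
      then show ?thesis using D1[of s] D1[of u] D2[of u] that \<delta>nn[of "m u"] by (cases "t \<le> u") simp_all
    qed
    have Dlim: "((\<lambda>u. D u \<omega>) \<longlongrightarrow> S) (at_left T)"
    proof (rule order_tendstoI)
      fix a assume "a < S"
      then obtain s where s: "t \<le> s" "s < T" "a < d \<omega> + \<delta> (m s) \<omega>"
        unfolding S_def using T by (subst (asm) less_cSup_iff[OF _ bdd]) auto
      then show "\<forall>\<^sub>F u in at_left T. a < D u \<omega>"
        unfolding eventually_at_left_field using D12[OF less_imp_le, of s] D2[OF s(1,2)] s
        by (intro exI[of _ s]) (auto intro: less_le_trans[of a "D s \<omega>"])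
    next
      fix a assume "S < a"
      then show "\<forall>\<^sub>F u in at_left T. D u \<omega> < a"
        unfolding eventually_at_left_field using DS by (intro exI[of _ t]) (auto intro: le_less_trans simp: T)
    qed
    have LS: "L = S" unfolding L_def by (rule left_limit_eq[OF Dlim])
    have Dmono: "mono (\<lambda>s. D s \<omega>)"
    proof (rule monoI)
      fix s u :: real assume su: "s \<le> u"
      show "D s \<omega> \<le> D u \<omega>"
      proof (cases "u < T")
        case True then show ?thesis using D12 su by blast
      next
        case False
        then have u: "T \<le> u" by simp
        show ?thesis
        proof (cases "s < T")
          case True then show ?thesis using DS[OF True] D3[OF u] LS D'nn[of u] by simp
        next
          case False then show ?thesis using D3[of s] D3[OF u] monoD[OF P.D_mono su] by simp
        qed
      qed
    qed
    have Drc: "continuous (at_right s) (\<lambda>s. D s \<omega>)" for s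
    proof -
      consider "s < t" | "t \<le> s" "s < T" | "T \<le> s" by linarith
      then show ?thesis
      proof cases
        case 1
        have "eventually (\<lambda>u. d \<omega> = D u \<omega>) (at_right s)"
          using 1 by (auto simp: eventually_at_right_field D1 intro!: exI[of _ t])
        then show ?thesis unfolding continuous_within D1[OF 1]
          by (rule Lim_transform_eventually[OF tendsto_const])
      next
        case 2
        have "((\<lambda>u. \<delta> (m u) \<omega>) \<longlongrightarrow> \<delta> (m s) \<omega>) (at_right s)"
        proof (cases "ereal s < \<tau> \<omega>")
          case True
          from ereal_dense2[OF True] obtain q where q0: "ereal s < ereal q" "ereal q < \<tau> \<omega>" by (elim exE conjE)
          have q: "s < q" "ereal q \<le> \<tau> \<omega>" using q0(1) less_imp_le[OF q0(2)] by simp_all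
          have "eventually (\<lambda>u. \<delta> u \<omega> = \<delta> (m u) \<omega>) (at_right s)"
            unfolding eventually_at_right_field
          proof (rule exI[of _ q], rule conjI)
            have "\<delta> u \<omega> = \<delta> (m u) \<omega>" if "s < u" "u < q" for u
            proof -
              have "ereal u \<le> ereal q" using that by simp
              then have "ereal u \<le> \<tau> \<omega>" using q(2) by (rule order_trans)
              then show ?thesis by (simp add: m)
            qed
            then show "\<forall>u>s. u < q \<longrightarrow> \<delta> u \<omega> = \<delta> (m u) \<omega>" by blast
          qed (rule q(1))
          moreover have "m s = s" using less_imp_le[OF True] by (simp add: m)
          ultimately show ?thesis
            using Lim_transform_eventually[OF \<delta>rc[of s, unfolded continuous_within]] by simp
        next
          case False
          then obtain w where w: "\<tau> \<omega> = ereal w" "w \<le> s" using \<tau>t by (cases "\<tau> \<omega>") auto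
          have "m u = w" if "s \<le> u" for u using w that by (auto simp: m)
          then have "eventually (\<lambda>u. \<delta> (m s) \<omega> = \<delta> (m u) \<omega>) (at_right s)"
            unfolding eventually_at_right_field by (intro exI[of _ "s + 1"]) auto
          then show ?thesis by (rule Lim_transform_eventually[OF tendsto_const])
        qed
        then have "((\<lambda>u. d \<omega> + \<delta> (m u) \<omega>) \<longlongrightarrow> D s \<omega>) (at_right s)"
          unfolding D2[OF 2] by (intro tendsto_intros)
        moreover have "eventually (\<lambda>u. d \<omega> + \<delta> (m u) \<omega> = D u \<omega>) (at_right s)"
          unfolding eventually_at_right_field using 2 D2 by (intro exI[of _ T]) auto
        ultimately show ?thesis unfolding continuous_within by (rule Lim_transform_eventually)
      next
        case 3
        have "((\<lambda>u. L + D' u \<omega>) \<longlongrightarrow> D s \<omega>) (at_right s)"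
          unfolding D3[OF 3] using P.D_right_cont[of s] unfolding continuous_within by (intro tendsto_intros)
        moreover have "eventually (\<lambda>u. L + D' u \<omega> = D u \<omega>) (at_right s)"
          unfolding eventually_at_right_field using 3 D3 by (intro exI[of _ "s + 1"]) auto
        ultimately show ?thesis unfolding continuous_within by (rule Lim_transform_eventually)
      qed
    qed
    let ?\<nu> = "interval_measure (\<lambda>s. D s \<omega>)"
    have early: "emeasure ?\<nu> {t..<T} \<le> ennreal (l \<omega>)"
    proof -
      have "{t..<T} \<subseteq> (\<Union>n. {t - 1<..T - \<epsilon> / real (Suc n)})"
      proof
        fix s assume s: "s \<in> {t..<T}"
        then have "0 < (T - s) / \<epsilon>" using \<epsilon> by simp
        then obtain n where "1 / real (Suc n) < (T - s) / \<epsilon>" by (rule nat_approx_posE)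
        then have "\<epsilon> / real (Suc n) < T - s" using \<epsilon> by (simp add: field_simps)
        then show "s \<in> (\<Union>n. {t - 1<..T - \<epsilon> / real (Suc n)})" using s by (intro UN_I[of n]) auto
      qed
      then have "emeasure ?\<nu> {t..<T} \<le> emeasure ?\<nu> (\<Union>n. {t - 1<..T - \<epsilon> / real (Suc n)})"
        by (intro emeasure_mono) auto
      also have "\<dots> = (SUP n. emeasure ?\<nu> {t - 1<..T - \<epsilon> / real (Suc n)})"
      proof (rule SUP_emeasure_incseq[symmetric])
        show "incseq (\<lambda>n. {t - 1<..T - \<epsilon> / real (Suc n)})"
        proof (rule incseq_SucI)
          fix n
          have "\<epsilon> / real (Suc (Suc n)) \<le> \<epsilon> / real (Suc n)" using \<epsilon> by (intro divide_left_mono) auto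
          then show "{t - 1<..T - \<epsilon> / real (Suc n)} \<subseteq> {t - 1<..T - \<epsilon> / real (Suc (Suc n))}" by auto
        qed
      qed auto
      also have "\<dots> \<le> ennreal (l \<omega>)"
      proof (rule SUP_least)
        fix n
        have h: "0 < \<epsilon> / real (Suc n)" "\<epsilon> / real (Suc n) \<le> \<epsilon>" using \<epsilon> by (auto simp: divide_le_eq)
        have "emeasure ?\<nu> {t - 1<..T - \<epsilon> / real (Suc n)} = ennreal (D (T - \<epsilon> / real (Suc n)) \<omega> - d \<omega>)"
          using emeasure_Ioc_mono[OF Dmono Drc, of "t - 1" "T - \<epsilon> / real (Suc n)"] D1[of "t - 1"] T h by simp
        also have "\<dots> \<le> ennreal (l \<omega>)"
          using DS[of "T - \<epsilon> / real (Suc n)"] Sl h by (intro ennreal_leI) linarith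
        finally show "emeasure ?\<nu> {t - 1<..T - \<epsilon> / real (Suc n)} \<le> ennreal (l \<omega>)" .
      qed
      finally show ?thesis .
    qed
    have atom: "emeasure ?\<nu> {T} \<le> ennreal (D' T \<omega>)"
    proof -
      have "emeasure ?\<nu> {T} \<le> ennreal (D T \<omega> - D s \<omega>)" if "s < T" for s
      proof -
        have "emeasure ?\<nu> {T} \<le> emeasure ?\<nu> {s<..T}" using that by (intro emeasure_mono) auto
        then show ?thesis using emeasure_Ioc_mono[OF Dmono Drc, of s T] that by simp
      qed
      then have "\<forall>\<^sub>F s in at_left T. emeasure ?\<nu> {T} \<le> ennreal (D T \<omega> - D s \<omega>)"
        unfolding eventually_at_left_field by (intro exI[of _ t]) (auto simp: T)
      moreover have "((\<lambda>s. ennreal (D T \<omega> - D s \<omega>)) \<longlongrightarrow> ennreal (D T \<omega> - S)) (at_left T)"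
        by (intro tendsto_ennrealI tendsto_intros Dlim)
      ultimately have "emeasure ?\<nu> {T} \<le> ennreal (D T \<omega> - S)" by (intro tendsto_lowerbound[of _ _ "at_left T"]) auto
      then show ?thesis using D3[of T] LS by simp
    qed
    let ?e = "ennreal (exp (- (r * \<epsilon>)))"
    have split: "exp (- r * (s - t)) = exp (- (r * \<epsilon>)) * exp (- r * (s - T))" for s
      unfolding mult_exp_exp T_def by (simp add: algebra_simps)
    have late: "(\<integral>\<^sup>+ s \<in> {T..}. ennreal (exp (- r * (s - t))) \<partial>?\<nu>) \<le> ?e * I \<omega>"
    proof -
      have "{T..} = {T} \<union> {T<..}" by auto
      then have "(\<integral>\<^sup>+ s \<in> {T..}. ennreal (exp (- r * (s - T))) \<partial>?\<nu>)
         = (\<integral>\<^sup>+ s \<in> {T}. ennreal (exp (- r * (s - T))) \<partial>?\<nu>) + (\<integral>\<^sup>+ s \<in> {T<..}. ennreal (exp (- r * (s - T))) \<partial>?\<nu>)"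
        by (subst nn_integral_disjoint_pair[symmetric]) auto
      also have "(\<integral>\<^sup>+ s \<in> {T}. ennreal (exp (- r * (s - T))) \<partial>?\<nu>) = (\<integral>\<^sup>+ s. indicator {T} s \<partial>?\<nu>)"
        by (intro nn_integral_cong) (auto simp: indicator_def)
      also have "\<dots> = emeasure ?\<nu> {T}" by simp
      also have "(\<integral>\<^sup>+ s \<in> {T<..}. ennreal (exp (- r * (s - T))) \<partial>?\<nu>)
         = (\<integral>\<^sup>+ s \<in> {T<..}. ennreal (exp (- r * (s - T))) \<partial>interval_measure (\<lambda>s. D' s \<omega>))"
        by (rule nn_integral_interval_measure_cong[symmetric, OF P.D_mono P.D_right_cont Dmono Drc D3]) measurable
      also have "emeasure ?\<nu> {T} + \<dots> \<le> I \<omega>"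
        using elim(6) atom unfolding stieltjes_def by (simp add: add_right_mono)
      finally have "(\<integral>\<^sup>+ s \<in> {T..}. ennreal (exp (- r * (s - T))) \<partial>?\<nu>) \<le> I \<omega>" .
      moreover have "(\<integral>\<^sup>+ s \<in> {T..}. ennreal (exp (- r * (s - t))) \<partial>?\<nu>)
         = ?e * (\<integral>\<^sup>+ s \<in> {T..}. ennreal (exp (- r * (s - T))) \<partial>?\<nu>)"
        unfolding split by (subst nn_integral_cmult[symmetric]) (auto simp: ennreal_mult mult.assoc)
      ultimately show ?thesis by (simp add: mult_left_mono)
    qed
    have low: "(\<integral>\<^sup>+ s \<in> {t..<T}. ennreal (exp (- r * (s - t))) \<partial>?\<nu>) \<le> emeasure ?\<nu> {t..<T}"
    proof -
      have "(\<integral>\<^sup>+ s \<in> {t..<T}. ennreal (exp (- r * (s - t))) \<partial>?\<nu>) \<le> (\<integral>\<^sup>+ s. indicator {t..<T} s \<partial>?\<nu>)"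
        using r by (intro nn_integral_mono) (auto simp: indicator_def)
      then show ?thesis by simp
    qed
    have "payoff t x D r \<omega> \<le> (\<integral>\<^sup>+ s. ennreal (exp (- r * (s - t))) * indicator {t..<T} s + ennreal (exp (- r * (s - t))) * indicator {T..} s \<partial>?\<nu>)"
      unfolding payoff_def stieltjes_def by (intro nn_integral_mono) (auto simp: indicator_def)
    also have "\<dots> = (\<integral>\<^sup>+ s \<in> {t..<T}. ennreal (exp (- r * (s - t))) \<partial>?\<nu>) + (\<integral>\<^sup>+ s \<in> {T..}. ennreal (exp (- r * (s - t))) \<partial>?\<nu>)"
      by (intro nn_integral_add) auto
    also have "\<dots> \<le> ennreal (l \<omega>) + ?e * I \<omega>"
      by (rule add_mono[OF order_trans[OF low early] late])
    finally have pay: "payoff t x D r \<omega> \<le> ennreal (l \<omega>) + ?e * I \<omega>" .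
    have ll_t: "left_limit (\<lambda>u. D u \<omega>) t = d \<omega>" using D1 by (intro left_limit_const)
    have X: "X s \<omega> = x + \<mu> * (s - t) + \<sigma> * (W s \<omega> - W t \<omega>) - (D s \<omega> - d \<omega>)" if "t \<le> s" for s
      using that by (simp add: X_def surplus_def ll_t)
    have Wt: "continuous_on {t..} (\<lambda>s. W s \<omega>)" using continuous_on_subset[OF elim(4)] t by auto
    have "V r (\<xi> \<omega>) \<le> V r (z \<omega>)"
    proof (cases "\<tau> \<omega> < ereal T")
      case True
      then obtain u where u: "\<tau> \<omega> = ereal u" using \<tau>t by (cases "\<tau> \<omega>") auto
      have rcX: "continuous (at_right s) (\<lambda>s. X s \<omega>)" if "t \<le> s" for s
      proof -
        have "continuous (at_right s) (\<lambda>s. W s \<omega>)"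
          by (rule continuous_within_subset[of s "{t..}"])
            (use Wt that in \<open>auto simp: continuous_on_eq_continuous_within\<close>)
        then have "continuous (at_right s) (\<lambda>s. x + \<mu> * (s - t) + \<sigma> * (W s \<omega> - W t \<omega>) - (D s \<omega> - d \<omega>))"
          by (intro continuous_intros Drc)
        then have "((\<lambda>s. x + \<mu> * (s - t) + \<sigma> * (W s \<omega> - W t \<omega>) - (D s \<omega> - d \<omega>)) \<longlongrightarrow> X s \<omega>) (at_right s)"
          using X[OF that] by (simp add: continuous_within)
        moreover have "eventually (\<lambda>s. x + \<mu> * (s - t) + \<sigma> * (W s \<omega> - W t \<omega>) - (D s \<omega> - d \<omega>) = X s \<omega>) (at_right s)"
          unfolding eventually_at_right_field using that X by (intro exI[of _ "s + 1"]) auto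
        ultimately show ?thesis unfolding continuous_within by (rule Lim_transform_eventually)
      qed
      have "X u \<omega> \<le> 0"
        by (rule first_time_attained(2)[of t "\<lambda>s. X s \<omega>" u]) (use rcX u in \<open>auto simp: \<tau>_def ruin_time_def\<close>)
      then have "\<xi> \<omega> \<le> 0" using True u by (simp add: \<xi>_def)
      then have "V r (\<xi> \<omega>) = 0" by (simp add: V_def)
      then show ?thesis using V_nonneg[OF r, of "z \<omega>"] by simp
    next
      case False
      have ms: "m s = s" if "s < T" for s
      proof -
        have "ereal s \<le> \<tau> \<omega>" using False that by (simp add: not_less order_trans[of "ereal s" "ereal T"])
        then show ?thesis by (simp add: m)
      qed
      have "((\<lambda>s. W s \<omega>) \<longlongrightarrow> W T \<omega>) (at_left T)"
      proof -
        have "isCont (\<lambda>s. W s \<omega>) T" using T by (intro continuous_on_interior[OF Wt]) simp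
        then show ?thesis unfolding isCont_def by (rule tendsto_mono[OF at_le, rotated]) simp
      qed
      then have "((\<lambda>s. x + \<mu> * (s - t) + \<sigma> * (W s \<omega> - W t \<omega>) - \<delta> s \<omega>) \<longlongrightarrow> x + \<mu> * (T - t) + \<sigma> * (W T \<omega> - W t \<omega>) - l \<omega>) (at_left T)"
        by (intro tendsto_intros ll)
      moreover have "eventually (\<lambda>s. x + \<mu> * (s - t) + \<sigma> * (W s \<omega> - W t \<omega>) - \<delta> s \<omega> = X s \<omega>) (at_left T)"
        unfolding eventually_at_left_field using X D2 ms T by (intro exI[of _ t]) auto
      ultimately have "((\<lambda>s. X s \<omega>) \<longlongrightarrow> z \<omega>) (at_left T)"
        unfolding z_def T(3) by (rule Lim_transform_eventually)
      then have "\<xi> \<omega> = z \<omega>" using False by (simp add: \<xi>_def left_limit_eq)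
      then show ?thesis by simp
    qed
    then show ?case using pay l0 by blast
  qed
  have [measurable]: "z \<in> borel_measurable M"
  proof -
    note [measurable] = W_measurable[OF T(1)] W_measurable[OF t] l(1)
    show ?thesis unfolding z_def[abs_def] by measurable
  qed
  note [measurable] = l(1) g(1)
  have "expected_payoff t x D r \<le> (\<integral>\<^sup>+ \<omega>. ennreal (l \<omega>) + ennreal (exp (- (r * \<epsilon>))) * g \<omega> \<partial>M)"
    unfolding expected_payoff_def
  proof (rule nn_integral_mono_AE)
    show "AE \<omega> in M. payoff t x D r \<omega> \<le> ennreal (l \<omega>) + ennreal (exp (- (r * \<epsilon>))) * g \<omega>"
      using key g(2) by eventually_elim simp
  qed
  also have "\<dots> = (\<integral>\<^sup>+ \<omega>. ennreal (l \<omega>) \<partial>M) + ennreal (exp (- (r * \<epsilon>))) * (\<integral>\<^sup>+ \<omega>. g \<omega> \<partial>M)"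
    by (subst nn_integral_add) (auto simp: nn_integral_cmult)
  also have "(\<integral>\<^sup>+ \<omega>. g \<omega> \<partial>M) = (\<integral>\<^sup>+ \<omega>. ennreal (V r (\<xi> \<omega>)) \<partial>M)"
    unfolding tot(1)[symmetric] using g(2) by (intro nn_integral_cong_AE)
  also have "\<dots> \<le> (\<integral>\<^sup>+ \<omega>. ennreal (V r (z \<omega>)) \<partial>M)"
  proof (rule nn_integral_mono_AE)
    show "AE \<omega> in M. ennreal (V r (\<xi> \<omega>)) \<le> ennreal (V r (z \<omega>))"
      using key by eventually_elim (simp add: ennreal_leI)
  qed
  also have "(\<integral>\<^sup>+ \<omega>. ennreal (l \<omega>) \<partial>M) + ennreal (exp (- (r * \<epsilon>))) * \<dots>
      = (\<integral>\<^sup>+ \<omega>. ennreal (l \<omega>) + ennreal (exp (- (r * \<epsilon>))) * ennreal (V r (z \<omega>)) \<partial>M)"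
    by (subst nn_integral_add) (auto simp: nn_integral_cmult)
  also have "\<dots> = (\<integral>\<^sup>+ \<omega>. ennreal (l \<omega> + exp (- (r * \<epsilon>)) * V r (z \<omega>)) \<partial>M)"
  proof (rule nn_integral_cong_AE)
    show "AE \<omega> in M. ennreal (l \<omega>) + ennreal (exp (- (r * \<epsilon>))) * ennreal (V r (z \<omega>)) = ennreal (l \<omega> + exp (- (r * \<epsilon>)) * V r (z \<omega>))"
      using key by eventually_elim (simp add: V_nonneg[OF r] ennreal_mult[symmetric])
  qed
  finally show ?thesis
    unfolding z_def T_def by (simp add: add_left_mono mult_left_mono)
qed

end

section \<open>The equilibrium property\<close>

text \<open>
  The complement of the support is covered by countably many null intervals with rational end
  points.
\<close>

lemma AE_measure_support:
  assumes "real_distribution R"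
  shows "AE r in R. r \<in> measure_support R"
proof -
  interpret real_distribution R by fact
  define N where "N = (\<Union>(p, q) \<in> {(p, q) \<in> \<rat> \<times> \<rat>. measure R {p<..<q} = 0}. {p<..<q})"
  have "N \<in> null_sets R"
    unfolding N_def
  proof (rule null_sets_UN')
    show "countable {(p, q) \<in> \<rat> \<times> \<rat>. measure R {p<..<q} = (0::real)}"
      by (rule countable_subset[of _ "\<rat> \<times> \<rat>"]) (auto intro: countable_rat)
  qed (auto simp: null_sets_def emeasure_eq_measure)
  then have "AE r in R. r \<notin> N" by (rule AE_not_in)
  then show ?thesis
  proof eventually_elim
    case (elim r)
    show ?case
      unfolding measure_support_def
    proof (rule CollectI, intro allI impI)
      fix e :: real assume e: "0 < e"
      obtain p where p: "p \<in> \<rat>" "r - e < p" "p < r" using Rats_dense_in_real[of "r - e" r] e by auto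
      obtain q where q: "q \<in> \<rat>" "r < q" "q < r + e" using Rats_dense_in_real[of r "r + e"] e by auto
      have "measure R {p<..<q} \<noteq> 0"
      proof
        assume "measure R {p<..<q} = 0"
        then have "(p, q) \<in> {(p, q) \<in> \<rat> \<times> \<rat>. measure R {p<..<q} = 0}" using p(1) q(1) by simp
        moreover have "r \<in> (case (p, q) of (p, q) \<Rightarrow> {p<..<q})" using p(3) q(2) by simp
        ultimately show False using elim unfolding N_def by (meson UN_I)
      qed
      then have "0 < measure R {p<..<q}" using measure_nonneg[of R "{p<..<q}"] by linarith
      also have "\<dots> \<le> measure R {r - e<..<r + e}" using p q by (intro finite_measure_mono) auto
      finally show "0 < measure R {r - e<..<r + e}" .
    qed
  qed
qed

lemma mono_left_limit:
  fixes f :: "real \<Rightarrow> real"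
  assumes f: "mono f"
  obtains L where "(f \<longlongrightarrow> L) (at_left T)" "\<And>s. s < T \<Longrightarrow> f s \<le> L" "L \<le> f T"
proof -
  define L where "L = Sup (f ` {..<T})"
  have bdd: "bdd_above (f ` {..<T})" using monoD[OF f] by (intro bdd_aboveI2[of _ _ "f T"]) simp
  have ne: "f ` {..<T} \<noteq> {}" by simp
  have up: "f s \<le> L" if "s < T" for s unfolding L_def using that bdd by (intro cSup_upper) auto
  have le: "L \<le> f T" unfolding L_def using monoD[OF f, of _ T] by (intro cSup_least) auto
  have lim: "(f \<longlongrightarrow> L) (at_left T)"
  proof (rule order_tendstoI)
    fix a assume "a < L"
    then obtain s where s: "s < T" "a < f s" unfolding L_def using less_cSup_iff[OF ne bdd] by auto
    have "a < f u" if "s < u" for u using s(2) monoD[OF f less_imp_le[OF that]] by linarith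
    then show "\<forall>\<^sub>F u in at_left T. a < f u" unfolding eventually_at_left_field using s(1) by blast
  next
    fix a assume "L < a"
    then have "f u < a" if "u < T" for u using up[OF that] by linarith
    then show "\<forall>\<^sub>F u in at_left T. f u < a" unfolding eventually_at_left_field by (intro exI[of _ "T - 1"]) auto
  qed
  from lim up le show thesis by (rule that)
qed

locale entropic_barrier =
  dividend_barrier M F W R \<mu> \<sigma> "\<lambda>y. - (1 / \<alpha>) * exp (- \<alpha> * y)" k + barrier_bounds \<mu> \<sigma> k rl rh B m
  for M :: "'a measure" and F :: "real \<Rightarrow> 'a measure" and W :: "real \<Rightarrow> 'a \<Rightarrow> real"
    and R :: "real measure" and \<mu> \<sigma> k \<alpha> rl rh B m :: real +
  assumes alpha_pos: "0 < \<alpha>" and support_R: "measure_support R \<subseteq> {rl..rh}"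
    and root_G: "G_fun \<mu> \<sigma> \<alpha> R k = 0"
begin

lemma rate_bounds: "AE r in R. rl \<le> r \<and> r \<le> rh"
  using AE_measure_support[OF rate.real_distribution_axioms] support_R by (auto elim!: eventually_mono)

lemma R_measurable: "(f \<in> borel_measurable R) = (f \<in> borel_measurable borel)"
  by (simp only: measurable_cong_sets[OF rate.events_eq_borel refl])

lemma R_integrable_bounded:
  fixes f :: "real \<Rightarrow> real"
  assumes "f \<in> borel_measurable borel" "\<And>r. rl \<le> r \<Longrightarrow> r \<le> rh \<Longrightarrow> \<bar>f r\<bar> \<le> c"
  shows "integrable R f"
proof (rule rate.integrable_const_bound[where B = c])
  show "AE r in R. norm (f r) \<le> c" using rate_bounds by eventually_elim (simp add: assms(2))
qed (simp add: R_measurable assms(1))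

text \<open>
  The marginal utility of the payoff of the barrier strategy.
\<close>

definition weight :: "real \<Rightarrow> real \<Rightarrow> real" where
  "weight x r = exp (- \<alpha> * V r x)"

lemma weight_measurable[measurable]: "weight x \<in> borel_measurable borel"
  unfolding weight_def[abs_def] by measurable

lemma weight_bounds: "0 < weight x r" "rl \<le> r \<Longrightarrow> weight x r \<le> 1"
  using V_nonneg[of r x] rl_pos alpha_pos by (auto simp: weight_def)

lemma weighted_curvature_integrable: "integrable R (\<lambda>r. weight x r * v 2 r k)"
proof (rule R_integrable_bounded)
  fix r assume r: "rl \<le> r" "r \<le> rh"
  have "\<bar>weight x r * v 2 r k\<bar> \<le> 1 * B"
    unfolding abs_mult using weight_bounds(1)[of x r] weight_bounds(2)[of r x] r v_2_abs[OF r] by (intro mult_mono) auto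
  then show "\<bar>weight x r * v 2 r k\<bar> \<le> B" by simp
qed measurable

text \<open>
  Since \<open>V r k = h(k, r)\<close>, this is \<open>G(k) = 0\<close> up to the factor \<open>- \<sigma>\<^sup>2/2\<close>.
\<close>

lemma weighted_curvature_at_barrier: "(\<integral>r. weight k r * v 2 r k \<partial>R) = 0"
proof -
  have "0 = (\<integral>r. indicator {0..} r *\<^sub>R (exp (- \<alpha> * v 0 r k) * (\<mu> - r * v 0 r k)) \<partial>R)"
    using root_G unfolding G_fun_def set_lebesgue_integral_def v_0_k by simp
  also have "\<dots> = (\<integral>r. - (\<sigma>\<^sup>2 / 2) * (weight k r * v 2 r k) \<partial>R)"
  proof (rule integral_cong_AE)
    show "AE r in R. indicator {0..} r *\<^sub>R (exp (- \<alpha> * v 0 r k) * (\<mu> - r * v 0 r k)) = - (\<sigma>\<^sup>2 / 2) * (weight k r * v 2 r k)"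
      using rate_bounds
    proof eventually_elim
      case (elim r)
      then have r: "0 < r" using rl_pos by linarith
      have "\<mu> - r * v 0 r k = - (\<sigma>\<^sup>2 / 2) * v 2 r k" using v_2_k[OF r] unfolding v_0_k by linarith
      moreover have "V r k = v 0 r k" using k_pos by (simp add: V_def)
      ultimately show ?case using r by (simp add: weight_def)
    qed
  qed (simp_all add: R_measurable)
  also have "\<dots> = - (\<sigma>\<^sup>2 / 2) * (\<integral>r. weight k r * v 2 r k \<partial>R)" by (rule integral_mult_right_zero)
  finally show ?thesis using sigma_pos by simp
qed

text \<open>
  Above the barrier all payoffs exceed those at the barrier by the same amount \<open>x - k\<close>.
\<close>

lemma weighted_curvature_above:
  assumes "k \<le> x"
  shows "(\<integral>r. weight x r * v 2 r k \<partial>R) = 0"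
proof -
  have "- \<alpha> * V r x = - \<alpha> * (x - k) + - \<alpha> * V r k" for r
    using assms k_pos by (simp add: V_def algebra_simps)
  then have "weight x r * v 2 r k = exp (- \<alpha> * (x - k)) * (weight k r * v 2 r k)" for r
    by (simp only: weight_def exp_add mult.assoc)
  then have "(\<integral>r. weight x r * v 2 r k \<partial>R) = exp (- \<alpha> * (x - k)) * (\<integral>r. weight k r * v 2 r k \<partial>R)"
    by (simp only: integral_mult_right_zero)
  then show ?thesis by (simp add: weighted_curvature_at_barrier)
qed

text \<open>
  The quotient of the weights at \<open>x\<close> and at \<open>k\<close> is decreasing in the rate, and \<open>v 2 r k\<close> is
  increasing.
\<close>

lemma weighted_curvature_below:
  assumes x: "0 < x" "x < k"
  shows "(\<integral>r. weight x r * v 2 r k \<partial>R) \<le> 0"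
proof -
  let ?g = "\<lambda>r. exp (\<alpha> * (v 0 r k - v 0 r x))"
  have Vk: "V r k = v 0 r k" and Vx: "V r x = v 0 r x" for r using x k_pos by (auto simp: V_def)
  have eq: "weight k r * ?g r * v 2 r k = weight x r * v 2 r k" for r
    by (simp add: weight_def Vk Vx exp_add[symmetric] algebra_simps)
  have "(\<integral>r. weight k r * ?g r * v 2 r k \<partial>R) \<le> 0"
  proof (rule integral_association_nonpos[where I = "{rl..rh}" and B = "exp (\<alpha> * B)"])
    show "AE r in R. r \<in> {rl..rh}" using rate_bounds by simp
    show "v 2 r k \<le> v 2 s k" if "r \<in> {rl..rh}" "s \<in> {rl..rh}" "r \<le> s" for r s
      using that rl_pos by (intro v_2_k_mono) auto
    show "?g s \<le> ?g r" if "r \<in> {rl..rh}" "s \<in> {rl..rh}" "r \<le> s" for r s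
      using that rl_pos alpha_pos x v_0_increment_antimono[of r s x] by auto
    show "0 \<le> ?g r \<and> ?g r \<le> exp (\<alpha> * B)" if "r \<in> {rl..rh}" for r
    proof -
      have "v 0 r k - v 0 r x \<le> B" using that rl_pos x v_0_nonneg[of r x] v_0_k_le[of r] by auto
      then show ?thesis using alpha_pos by simp
    qed
    show "0 \<le> weight k r" for r using weight_bounds(1)[of k r] by simp
    show "integrable R (\<lambda>r. weight k r * v 2 r k)" by (rule weighted_curvature_integrable)
    show "integrable R (\<lambda>r. weight k r * ?g r * v 2 r k)" unfolding eq by (rule weighted_curvature_integrable)
    show "(\<integral>r. weight k r * v 2 r k \<partial>R) \<le> 0" by (simp add: weighted_curvature_at_barrier)
  qed
  then show ?thesis unfolding eq .
qed

abbreviation \<phi> :: "real \<Rightarrow> real" where "\<phi> y \<equiv> - (1 / \<alpha>) * exp (- \<alpha> * y)"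

lemma utility_integrable:
  assumes "p \<in> borel_measurable borel" "\<And>r. rl \<le> r \<Longrightarrow> r \<le> rh \<Longrightarrow> 0 \<le> p r"
  shows "integrable R (\<lambda>r. \<phi> (p r))"
proof (rule R_integrable_bounded)
  show "(\<lambda>r. \<phi> (p r)) \<in> borel_measurable borel" using assms(1) by measurable
  show "\<bar>\<phi> (p r)\<bar> \<le> 1 / \<alpha>" if "rl \<le> r" "r \<le> rh" for r
    using assms(2)[OF that] alpha_pos by (simp add: abs_mult divide_right_mono)
qed

lemma payoff_measurable: "(\<lambda>r. enn2real (expected_payoff t x D r)) \<in> borel_measurable borel"
  using expected_payoff_measurable[of t x D] by measurable

lemma J_eq: "J t x D = (\<integral>r. \<phi> (enn2real (expected_payoff t x D r)) \<partial>R)"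
  unfolding J_def set_lebesgue_integral_def
proof (rule integral_cong_AE)
  note [measurable] = payoff_measurable[of t x D]
  show "(\<lambda>r. indicator {0..} r *\<^sub>R \<phi> (enn2real (expected_payoff t x D r))) \<in> borel_measurable R"
    "(\<lambda>r. \<phi> (enn2real (expected_payoff t x D r))) \<in> borel_measurable R"
    unfolding R_measurable by measurable
  show "AE r in R. indicator {0..} r *\<^sub>R \<phi> (enn2real (expected_payoff t x D r)) = \<phi> (enn2real (expected_payoff t x D r))"
    using rate_bounds
  proof eventually_elim
    case (elim r)
    then have "r \<in> {0..}" using rl_pos by simp
    then show ?case by simp
  qed
qed

lemma law_payoff:
  assumes "0 \<le> t" "0 < x" "0 < r"
  shows "expected_payoff t x (law_strategy t x {0<..<k} {k..}) r = ennreal (V r x)"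
  using law_strategy_solution[OF assms(1,2)] expected_payoff_of_law[OF assms(1,3,2)] by blast

lemma J_law:
  assumes "0 \<le> t" "0 < x"
  shows "J t x (law_strategy t x {0<..<k} {k..}) = (\<integral>r. \<phi> (V r x) \<partial>R)"
  unfolding J_eq
proof (rule integral_cong_AE)
  note [measurable] = payoff_measurable[of t x]
  show "(\<lambda>r. \<phi> (enn2real (expected_payoff t x (law_strategy t x {0<..<k} {k..}) r))) \<in> borel_measurable R"
    "(\<lambda>r. \<phi> (V r x)) \<in> borel_measurable R"
    unfolding R_measurable by measurable
  show "AE r in R. \<phi> (enn2real (expected_payoff t x (law_strategy t x {0<..<k} {k..}) r)) = \<phi> (V r x)"
    using rate_bounds
  proof eventually_elim
    case (elim r)
    then have "0 < r" using rl_pos by linarith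
    then show ?case using law_payoff[OF assms] V_nonneg[of r x] by simp
  qed
qed

lemma barrier_law_admissible: "admissible_law {0<..<k} {k..}"
  unfolding admissible_law_def
proof (intro conjI allI impI)
  show "{0<..<k} \<union> {k..} = {0<..}" using k_pos by auto
  show "{0<..<k} \<inter> {k..} = {}" by auto
  have "{0<..<k} = {0<..} \<inter> {..<k}" by auto
  then show "openin (top_of_set {0<..}) {0<..<k}" using openin_open_Int[of "{..<k}" "{0<..}"] by simp
  have "{k..} = {0<..} \<inter> {k..}" using k_pos by auto
  then show "closedin (top_of_set {0<..}) {k..}" using closedin_closed_Int[of "{k..}" "{0<..}"] by simp
  fix t x :: real assume t: "0 \<le> t" and x: "0 < x"
  show "uniquely_solvable t x {0<..<k} {k..}"
    unfolding uniquely_solvable_def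
    using skorokhod_solution_exists[OF t x] skorokhod_solution_unique[OF t x] by blast
  let ?D = "law_strategy t x {0<..<k} {k..}"
  have "AE r in R. 0 < r \<longrightarrow> expected_payoff t x ?D r < \<infinity>"
    by (simp add: law_payoff[OF t x])
  moreover have "set_integrable R {0..} (\<lambda>r. \<phi> (enn2real (expected_payoff t x ?D r)))"
    unfolding set_integrable_def
    by (intro integrable_mult_indicator utility_integrable payoff_measurable) auto
  ultimately show "finite_reward t x ?D" unfolding finite_reward_def by (rule conjI)
qed

text \<open>
  Subtracting the mean zero part does not change the expectation of the gain at any rate.  After
  exchanging the order of integration, the pathwise estimate can be integrated over the rates with
  the coefficient \<open>c\<close> held fixed.
\<close>

lemma deviation_gain_bound:
  assumes t: "0 \<le> t" and x: "0 < x" and \<epsilon>: "0 < \<epsilon>" "\<epsilon> \<le> 1" and K: "0 < K"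
    and a: "a \<in> borel_measurable (F t)" "\<And>\<omega>. 0 \<le> a \<omega> \<and> a \<omega> \<le> x"
    and \<Delta>: "\<Delta> \<in> borel_measurable M" "\<And>\<omega>. 0 \<le> \<Delta> \<omega> \<and> \<Delta> \<omega> \<le> K * \<epsilon>"
  defines "g \<equiv> \<lambda>\<omega>. \<mu> * \<epsilon> + \<sigma> * (W (t + \<epsilon>) \<omega> - W t \<omega>)"
  defines "U \<equiv> \<lambda>r \<omega>. a \<omega> + \<Delta> \<omega> + exp (- (r * \<epsilon>)) * V r (x - a \<omega> + g \<omega> - \<Delta> \<omega>)"
  assumes est: "\<And>\<omega>. \<exists>c. (x < k \<longrightarrow> 0 \<le> c) \<and> (\<forall>r\<in>{rl..rh}.
      U r \<omega> - V r x - one_step_martingale x r \<epsilon> (x - a \<omega>) (g \<omega>) \<le> c * v 2 r k + Z \<omega>)"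
    and Z: "integrable M Z" "\<And>\<omega>. 0 \<le> Z \<omega>"
  shows "\<And>r. rl \<le> r \<Longrightarrow> r \<le> rh \<Longrightarrow> integrable M (U r)"
    "(\<lambda>r. expectation (U r)) \<in> borel_measurable borel"
    "integrable R (\<lambda>r. weight x r * (expectation (U r) - V r x))"
    "(\<integral>r. weight x r * (expectation (U r) - V r x) \<partial>R) \<le> expectation Z"
proof -
  let ?m = "\<lambda>r \<omega>. one_step_martingale x r \<epsilon> (x - a \<omega>) (g \<omega>)"
  define q where "q r \<omega> = weight x r * (U r \<omega> - V r x - ?m r \<omega>)" for r \<omega>
  \<comment> \<open>An integrable bound for the gain that is uniform over the rates, as needed for Fubini's theorem.\<close>
  define H where "H \<omega> = (x + K + 2 * B * x + \<mu>) + (B + 1) * \<bar>g \<omega>\<bar> + 2 * B * exp (B * x) * (exp (B * g \<omega>) + exp (- B * g \<omega>))" for \<omega>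
  have B0: "0 \<le> B" using B_ge by linarith
  have te: "0 \<le> t + \<epsilon>" "t < t + \<epsilon>" using t \<epsilon> by auto
  have [measurable]: "a \<in> borel_measurable M" by (rule measurable_F_M[OF t a(1)])
  note [measurable] = \<Delta>(1)
  have gm[measurable]: "g \<in> borel_measurable M"
  proof -
    note [measurable] = W_measurable[OF te(1)] W_measurable[OF t]
    show ?thesis unfolding g_def by measurable
  qed
  have Hint: "integrable M H"
  proof -
    have 1: "integrable M g"
      unfolding g_def by (intro Bochner_Integration.integrable_add integrable_mult_right increment_moments(1)[OF t te(2)]) simp
    have 2: "integrable M (\<lambda>\<omega>. exp (c * g \<omega>))" for c
    proof -
      have "integrable M (\<lambda>\<omega>. exp (c * \<mu> * \<epsilon>) * exp (c * \<sigma> * (W (t + \<epsilon>) \<omega> - W t \<omega>)))"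
        by (intro integrable_mult_right increment_exp(1)[OF t less_imp_le[OF te(2)]])
      then show ?thesis by (simp add: g_def exp_add[symmetric] algebra_simps)
    qed
    show ?thesis unfolding H_def
      by (intro Bochner_Integration.integrable_add integrable_mult_right Bochner_Integration.integrable_abs 1 2) simp_all
  qed
  have UB: "\<bar>U r \<omega>\<bar> \<le> x + K + B * (x + \<bar>g \<omega>\<bar>)" "0 \<le> U r \<omega>" if r: "rl \<le> r" "r \<le> rh" for r \<omega>
  proof -
    have r0: "0 < r" using r rl_pos by linarith
    have "x - a \<omega> + g \<omega> - \<Delta> \<omega> \<le> x + \<bar>g \<omega>\<bar>" using a(2)[of \<omega>] \<Delta>(2)[of \<omega>] by linarith
    then have "V r (x - a \<omega> + g \<omega> - \<Delta> \<omega>) \<le> V r (x + \<bar>g \<omega>\<bar>)" by (rule V_mono[OF r0])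
    also have "\<dots> \<le> V r 0 + B * (x + \<bar>g \<omega>\<bar> - 0)" using x by (intro V_lipschitz[OF r]) auto
    also have "V r 0 = 0" by (simp add: V_def)
    finally have 1: "V r (x - a \<omega> + g \<omega> - \<Delta> \<omega>) \<le> B * (x + \<bar>g \<omega>\<bar>)" by simp
    have "exp (- (r * \<epsilon>)) * V r (x - a \<omega> + g \<omega> - \<Delta> \<omega>) \<le> 1 * V r (x - a \<omega> + g \<omega> - \<Delta> \<omega>)"
      using r0 \<epsilon> V_nonneg[OF r0] by (intro mult_right_mono) auto
    moreover have "0 \<le> exp (- (r * \<epsilon>)) * V r (x - a \<omega> + g \<omega> - \<Delta> \<omega>)" using V_nonneg[OF r0] by simp
    moreover have "K * \<epsilon> \<le> K" using K \<epsilon> by simp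
    ultimately show "\<bar>U r \<omega>\<bar> \<le> x + K + B * (x + \<bar>g \<omega>\<bar>)" "0 \<le> U r \<omega>"
      unfolding U_def using 1 a(2)[of \<omega>] \<Delta>(2)[of \<omega>] by linarith+
  qed
  have mB: "\<bar>?m r \<omega>\<bar> \<le> 2 * B * exp (B * (x + \<bar>g \<omega>\<bar>)) + \<bar>g \<omega>\<bar> + \<mu>" if r: "rl \<le> r" "r \<le> rh" for r \<omega>
  proof -
    have r0: "0 < r" using r rl_pos by linarith
    have e: "0 \<le> exp (- (r * \<epsilon>))" "exp (- (r * \<epsilon>)) \<le> 1" using r0 \<epsilon> by auto
    have vb: "\<bar>v 0 r y\<bar> \<le> B * exp (B * (x + \<bar>g \<omega>\<bar>))" if "\<bar>y\<bar> \<le> x + \<bar>g \<omega>\<bar>" for y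
    proof -
      have "B * exp (B * \<bar>y\<bar>) \<le> B * exp (B * (x + \<bar>g \<omega>\<bar>))" using that B0 by (intro mult_left_mono) (auto intro: mult_left_mono)
      then show ?thesis using v_0_exp[OF r, of y] by linarith
    qed
    have scale: "\<bar>exp (- (r * \<epsilon>)) * y\<bar> \<le> \<bar>y\<bar>" for y
      unfolding abs_mult using e by (intro mult_left_le_one_le) auto
    have v1: "\<bar>v 0 r (x - a \<omega> + g \<omega>)\<bar> \<le> B * exp (B * (x + \<bar>g \<omega>\<bar>))" "\<bar>v 0 r (x - a \<omega>)\<bar> \<le> B * exp (B * (x + \<bar>g \<omega>\<bar>))"
      using a(2)[of \<omega>] by (auto intro!: vb)
    have P: "0 \<le> B * exp (B * (x + \<bar>g \<omega>\<bar>))" using B0 by simp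
    have "\<mu> * \<epsilon> \<le> \<mu>" "0 \<le> \<mu> * \<epsilon>" using mu_pos \<epsilon> by auto
    then show ?thesis
      using scale[of "v 0 r (x - a \<omega> + g \<omega>)"] scale[of "g \<omega> - \<mu> * \<epsilon>"] v1 P mu_pos
      unfolding one_step_martingale_def
      by (cases "x - a \<omega> < min x k / 2"; cases "x - a \<omega> < k"; simp only: if_True if_False; linarith)
  qed
  have qB: "\<bar>q r \<omega>\<bar> \<le> H \<omega>" if r: "rl \<le> r" "r \<le> rh" for r \<omega>
  proof -
    have r0: "0 < r" using r rl_pos by linarith
    have "V r x \<le> V r 0 + B * (x - 0)" using x by (intro V_lipschitz[OF r]) auto
    then have Vx: "\<bar>V r x\<bar> \<le> B * x" using V_nonneg[OF r0, of x] by (simp add: V_def)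
    have "exp (B * \<bar>g \<omega>\<bar>) \<le> exp (B * g \<omega>) + exp (- B * g \<omega>)"
      by (cases "0 \<le> g \<omega>") (auto simp: add_increasing)
    then have "2 * B * exp (B * x) * exp (B * \<bar>g \<omega>\<bar>) \<le> 2 * B * exp (B * x) * (exp (B * g \<omega>) + exp (- B * g \<omega>))"
      using B0 by (intro mult_left_mono) auto
    then have E: "2 * B * exp (B * (x + \<bar>g \<omega>\<bar>)) \<le> 2 * B * exp (B * x) * (exp (B * g \<omega>) + exp (- B * g \<omega>))"
      by (simp add: distrib_left exp_add mult.assoc)
    have "\<bar>q r \<omega>\<bar> \<le> 1 * \<bar>U r \<omega> - V r x - ?m r \<omega>\<bar>"
      unfolding q_def abs_mult using weight_bounds(1)[of x r] weight_bounds(2)[of r x] r by (intro mult_right_mono) auto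
    also have "\<dots> \<le> \<bar>U r \<omega>\<bar> + \<bar>V r x\<bar> + \<bar>?m r \<omega>\<bar>" unfolding mult_1 by linarith
    also have "\<dots> \<le> (x + K + B * (x + \<bar>g \<omega>\<bar>)) + B * x + (2 * B * exp (B * (x + \<bar>g \<omega>\<bar>)) + \<bar>g \<omega>\<bar> + \<mu>)"
      by (intro add_mono UB(1)[OF r] Vx mB[OF r])
    also have "\<dots> \<le> H \<omega>" unfolding H_def using E by (simp add: algebra_simps)
    finally show ?thesis .
  qed
  have Upair[measurable]: "(\<lambda>(r, \<omega>). U r \<omega>) \<in> borel_measurable (borel \<Otimes>\<^sub>M M)"
    unfolding U_def split_beta' by measurable
  show Uint: "integrable M (U r)" if r: "rl \<le> r" "r \<le> rh" for r
  proof (rule Bochner_Integration.integrable_bound)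
    show "integrable M (\<lambda>\<omega>. x + K + B * (x + \<bar>g \<omega>\<bar>))"
    proof -
      have "integrable M g"
        unfolding g_def by (intro Bochner_Integration.integrable_add integrable_mult_right increment_moments(1)[OF t te(2)]) simp
      then show ?thesis by (intro Bochner_Integration.integrable_add integrable_mult_right Bochner_Integration.integrable_abs) auto
    qed
    show "U r \<in> borel_measurable M" unfolding U_def by measurable
    show "AE \<omega> in M. norm (U r \<omega>) \<le> norm (x + K + B * (x + \<bar>g \<omega>\<bar>))"
      using UB(1)[OF r] by (intro AE_I2) (force intro: order_trans[OF _ abs_ge_self])
  qed
  show Emeas: "(\<lambda>r. expectation (U r)) \<in> borel_measurable borel"
    by (rule borel_measurable_lebesgue_integral) (use Upair in \<open>simp add: split_beta'\<close>)
  note m0 = one_step_martingale_expectation[OF t \<epsilon>(1) _ x, where y = "\<lambda>\<omega>. x - a \<omega>", folded g_def]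
  have y: "(\<lambda>\<omega>. x - a \<omega>) \<in> borel_measurable (F t)" "AE \<omega> in M. 0 \<le> x - a \<omega> \<and> x - a \<omega> \<le> x"
    using a by auto
  have Eq: "expectation (q r) = weight x r * (expectation (U r) - V r x)" if r: "rl \<le> r" "r \<le> rh" for r
  proof -
    have r0: "0 < r" using r rl_pos by linarith
    have "expectation (q r) = weight x r * expectation (\<lambda>\<omega>. U r \<omega> - V r x - ?m r \<omega>)"
      unfolding q_def by (rule integral_mult_right_zero)
    also have "expectation (\<lambda>\<omega>. U r \<omega> - V r x - ?m r \<omega>) = expectation (U r) - V r x - 0"
      using Uint[OF r] m0[OF r0 y] by (simp add: prob_space g_def)
    finally show ?thesis by simp
  qed
  interpret P: pair_sigma_finite R M ..
  have qpair: "(\<lambda>(r, \<omega>). q r \<omega>) \<in> borel_measurable (R \<Otimes>\<^sub>M M)"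
  proof -
    have "(\<lambda>(r, \<omega>). q r \<omega>) \<in> borel_measurable (borel \<Otimes>\<^sub>M M)"
      unfolding q_def one_step_martingale_def U_def split_beta' by measurable
    moreover have "sets (R \<Otimes>\<^sub>M M) = sets (borel \<Otimes>\<^sub>M M)" by (intro sets_pair_measure_cong) auto
    ultimately show ?thesis by (simp cong: measurable_cong_sets)
  qed
  have qM: "q r \<in> borel_measurable M" for r
    unfolding q_def one_step_martingale_def U_def by measurable
  have qint: "integrable M (q r)" if r: "rl \<le> r" "r \<le> rh" for r
    by (rule Bochner_Integration.integrable_bound[OF Hint qM])
      (use qB[OF r] in \<open>force intro: order_trans[OF _ abs_ge_self]\<close>)
  have qR: "integrable R (\<lambda>r. q r \<omega>)" for \<omega>
    by (rule R_integrable_bounded[OF _ qB]) (unfold q_def one_step_martingale_def U_def, measurable)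
  have qprod: "integrable (R \<Otimes>\<^sub>M M) (\<lambda>(r, \<omega>). q r \<omega>)"
  proof (rule P.Fubini_integrable[OF qpair])
    show "AE r in R. integrable M (\<lambda>\<omega>. case (r, \<omega>) of (r, \<omega>) \<Rightarrow> q r \<omega>)"
      using rate_bounds by eventually_elim (simp add: qint)
    show "integrable R (\<lambda>r. \<integral>\<omega>. norm (case (r, \<omega>) of (r, \<omega>) \<Rightarrow> q r \<omega>) \<partial>M)"
    proof (rule R_integrable_bounded)
      have "(\<lambda>(r, \<omega>). norm (q r \<omega>)) \<in> borel_measurable (borel \<Otimes>\<^sub>M M)"
        unfolding q_def one_step_martingale_def U_def split_beta' by measurable
      then show "(\<lambda>r. \<integral>\<omega>. norm (case (r, \<omega>) of (r, \<omega>) \<Rightarrow> q r \<omega>) \<partial>M) \<in> borel_measurable borel"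
        by (intro borel_measurable_lebesgue_integral) simp
      fix r assume r: "rl \<le> r" "r \<le> rh"
      have "(\<integral>\<omega>. \<bar>q r \<omega>\<bar> \<partial>M) \<le> expectation H"
        using qint[OF r] Hint qB[OF r] by (intro integral_mono) auto
      then show "\<bar>\<integral>\<omega>. norm (case (r, \<omega>) of (r, \<omega>) \<Rightarrow> q r \<omega>) \<partial>M\<bar> \<le> expectation H" by simp
    qed
  qed
  have wE: "(\<lambda>r. weight x r * (expectation (U r) - V r x)) \<in> borel_measurable borel" using Emeas by measurable
  show "integrable R (\<lambda>r. weight x r * (expectation (U r) - V r x))"
  proof (rule R_integrable_bounded[OF wE])
    fix r assume r: "rl \<le> r" "r \<le> rh"
    have "\<bar>expectation (q r)\<bar> \<le> expectation (\<lambda>\<omega>. \<bar>q r \<omega>\<bar>)" by (rule integral_abs_bound)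
    also have "\<dots> \<le> expectation H" using qint[OF r] Hint qB[OF r] by (intro integral_mono) auto
    finally show "\<bar>weight x r * (expectation (U r) - V r x)\<bar> \<le> expectation H" unfolding Eq[OF r] .
  qed
  have "(\<integral>r. weight x r * (expectation (U r) - V r x) \<partial>R) = (\<integral>r. expectation (q r) \<partial>R)"
  proof (rule integral_cong_AE)
    show "AE r in R. weight x r * (expectation (U r) - V r x) = expectation (q r)"
      using rate_bounds by eventually_elim (simp add: Eq)
    show "(\<lambda>r. expectation (q r)) \<in> borel_measurable R"
      using qpair by (intro borel_measurable_lebesgue_integral) simp
  qed (use wE in \<open>simp add: R_measurable\<close>)
  also have "\<dots> = (\<integral>\<omega>. (\<integral>r. q r \<omega> \<partial>R) \<partial>M)"
    by (rule P.Fubini_integral[OF qprod, symmetric])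
  also have "\<dots> \<le> expectation Z"
  proof (rule integral_mono[OF _ Z(1)])
    show "integrable M (\<lambda>\<omega>. \<integral>r. q r \<omega> \<partial>R)" using P.integrable_snd[OF qprod] by simp
    fix \<omega>
    obtain c where c: "x < k \<longrightarrow> 0 \<le> c" "\<forall>r\<in>{rl..rh}. U r \<omega> - V r x - ?m r \<omega> \<le> c * v 2 r k + Z \<omega>"
      using est by blast
    have "(\<integral>r. q r \<omega> \<partial>R) \<le> (\<integral>r. c * (weight x r * v 2 r k) + Z \<omega> \<partial>R)"
    proof (rule integral_mono_AE[OF qR])
      show "integrable R (\<lambda>r. c * (weight x r * v 2 r k) + Z \<omega>)"
        by (intro Bochner_Integration.integrable_add integrable_mult_right weighted_curvature_integrable) simp
      show "AE r in R. q r \<omega> \<le> c * (weight x r * v 2 r k) + Z \<omega>"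
        using rate_bounds
      proof eventually_elim
        case (elim r)
        have "q r \<omega> \<le> weight x r * (c * v 2 r k + Z \<omega>)"
          unfolding q_def using c(2) elim weight_bounds(1)[of x r] by (intro mult_left_mono) auto
        also have "\<dots> \<le> c * (weight x r * v 2 r k) + 1 * Z \<omega>"
          unfolding distrib_left using weight_bounds(2)[of r x] elim Z(2)[of \<omega>]
          by (intro add_mono mult_right_mono) auto
        finally show ?case by simp
      qed
    qed
    also have "\<dots> = c * (\<integral>r. weight x r * v 2 r k \<partial>R) + Z \<omega>"
      using weighted_curvature_integrable[of x] rate.prob_space by simp
    also have "\<dots> \<le> Z \<omega>"
    proof (cases "x < k")
      case True
      then have "c * (\<integral>r. weight x r * v 2 r k \<partial>R) \<le> 0"
        using c(1) weighted_curvature_below[OF x] by (intro mult_nonneg_nonpos) auto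
      then show ?thesis by simp
    qed (simp add: weighted_curvature_above)
    finally show "(\<integral>r. q r \<omega> \<partial>R) \<le> Z \<omega>" .
  qed
  finally show "(\<integral>r. weight x r * (expectation (U r) - V r x) \<partial>R) \<le> expectation Z" .
qed

text \<open>
  By concavity, \<open>\<phi> p - \<phi> v \<le> exp (- \<alpha> v) (p - v)\<close>: the gain in utility is at most the weighted linear
  gain, which was bounded above.
\<close>

lemma deviation_loss:
  assumes t: "0 \<le> t" and x: "0 < x" and \<delta>: "perturbation t x \<delta>"
  obtains C \<epsilon>0 where "0 < C" "0 < \<epsilon>0"
    "\<And>\<epsilon> d D. 0 < \<epsilon> \<Longrightarrow> \<epsilon> \<le> \<epsilon>0 \<Longrightarrow> perturbed_strategy t x d {0<..<k} {k..} \<delta> \<epsilon> D \<Longrightarrow>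
      - C * (\<epsilon> * sqrt \<epsilon>) \<le> J t x (law_strategy t x {0<..<k} {k..}) - J t x D"
proof -
  have dp: "dividend_process t \<delta>" using \<delta> unfolding perturbation_def admissible_def by blast
  obtain \<epsilon>2 K where \<epsilon>2: "0 < \<epsilon>2" and K: "0 < K" and \<delta>K: "AE \<omega> in M. 0 \<le> \<delta> t \<omega> \<and> \<delta> t \<omega> \<le> x \<and>
      (\<forall>\<epsilon>. 0 < \<epsilon> \<and> \<epsilon> \<le> \<epsilon>2 \<longrightarrow> \<delta> (t + \<epsilon>) \<omega> - \<delta> t \<omega> \<le> K * \<epsilon>)"
    using \<delta> unfolding perturbation_def by blast
  have \<delta>F: "\<delta> s \<in> borel_measurable (F s)" if "t \<le> s" for s
    using dp that by (simp add: dividend_process_def)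
  have \<delta>m: "AE \<omega> in M. mono (\<lambda>s. \<delta> s \<omega>)"
    using dp unfolding dividend_process_def by (auto elim!: eventually_mono)
  obtain C \<epsilon>1 where C: "0 < C" and \<epsilon>1: "0 < \<epsilon>1" "\<epsilon>1 \<le> 1" and est:
    "\<And>\<epsilon> a \<Delta> g. 0 < \<epsilon> \<Longrightarrow> \<epsilon> \<le> \<epsilon>1 \<Longrightarrow> 0 \<le> a \<Longrightarrow> a \<le> x \<Longrightarrow> 0 \<le> \<Delta> \<Longrightarrow> \<Delta> \<le> K * \<epsilon> \<Longrightarrow>
      \<exists>c. (x < k \<longrightarrow> 0 \<le> c) \<and> (\<forall>r\<in>{rl..rh}.
        a + \<Delta> + exp (- (r * \<epsilon>)) * V r (x - a + g - \<Delta>) - V r x - one_step_martingale x r \<epsilon> (x - a) g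
          \<le> c * v 2 r k + C * (\<epsilon>\<^sup>2 + \<epsilon> * \<bar>g\<bar> + \<epsilon> * g\<^sup>2 + g ^ 4) * exp (C * \<bar>g\<bar>))"
    using one_step_estimate[OF x K] by metis
  obtain C' where C': "0 < C'" and err:
    "\<And>t \<epsilon>. 0 \<le> t \<Longrightarrow> 0 < \<epsilon> \<Longrightarrow> \<epsilon> \<le> 1 \<Longrightarrow> \<exists>Z. integrable M Z \<and> expectation Z \<le> C' * (\<epsilon> * sqrt \<epsilon>) \<and>
      (\<forall>\<omega> g. g = \<mu> * \<epsilon> + \<sigma> * (W (t + \<epsilon>) \<omega> - W t \<omega>) \<longrightarrow>
        (\<epsilon>\<^sup>2 + \<epsilon> * \<bar>g\<bar> + \<epsilon> * g\<^sup>2 + g ^ 4) * exp (C * \<bar>g\<bar>) \<le> Z \<omega>)"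
    using small_increment_error[OF mu_pos sigma_pos C] by metis
  show thesis
  proof (rule that[of "C * C'" "min \<epsilon>1 \<epsilon>2"])
    show "0 < C * C'" using C C' by simp
    show "0 < min \<epsilon>1 \<epsilon>2" using \<epsilon>1 \<epsilon>2 by simp
    fix \<epsilon> d D assume \<epsilon>0: "0 < \<epsilon>" and \<epsilon>le: "\<epsilon> \<le> min \<epsilon>1 \<epsilon>2"
      and ps: "perturbed_strategy t x d {0<..<k} {k..} \<delta> \<epsilon> D"
    have \<epsilon>: "0 < \<epsilon>" "\<epsilon> \<le> 1" "\<epsilon> \<le> \<epsilon>1" "\<epsilon> \<le> \<epsilon>2" using \<epsilon>0 \<epsilon>le \<epsilon>1 by auto
    obtain Z where Z: "integrable M Z" "expectation Z \<le> C' * (\<epsilon> * sqrt \<epsilon>)"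
      "\<forall>\<omega> g. g = \<mu> * \<epsilon> + \<sigma> * (W (t + \<epsilon>) \<omega> - W t \<omega>) \<longrightarrow>
        (\<epsilon>\<^sup>2 + \<epsilon> * \<bar>g\<bar> + \<epsilon> * g\<^sup>2 + g ^ 4) * exp (C * \<bar>g\<bar>) \<le> Z \<omega>"
      using err[OF t \<epsilon>(1,2)] by blast
    define T where "T = t + \<epsilon>"
    define sq where "sq n = T - \<epsilon> / real (Suc n)" for n
    have sq: "t \<le> sq n" "sq n < T" for n
      using \<epsilon>(1) by (auto simp: sq_def T_def divide_le_eq)
    have sqlim: "filterlim sq (at_left T) sequentially"
      unfolding filterlim_at
    proof
      have "(\<lambda>n. T - \<epsilon> * (1 / real (Suc n))) \<longlonglongrightarrow> T - \<epsilon> * 0"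
        by (intro tendsto_intros LIMSEQ_Suc lim_1_over_n)
      then show "sq \<longlonglongrightarrow> T" by (simp add: sq_def[abs_def])
      show "\<forall>\<^sub>F n in sequentially. sq n \<in> {..<T} \<and> sq n \<noteq> T" using sq(2) by (auto simp: less_imp_neq)
    qed
    \<comment> \<open>The perturbation satisfies its bounds only almost surely, and \<open>\<delta>\<close> need not have left limits everywhere; clamping makes the bounds hold on every path, and the limit along a sequence keeps the variable measurable.\<close>
    define a where "a \<omega> = max 0 (min x (\<delta> t \<omega>))" for \<omega>
    define \<Delta> where "\<Delta> \<omega> = max 0 (min (K * \<epsilon>) (lim (\<lambda>n. \<delta> (sq n) \<omega>) - \<delta> t \<omega>))" for \<omega>
    define g where "g \<omega> = \<mu> * \<epsilon> + \<sigma> * (W (t + \<epsilon>) \<omega> - W t \<omega>)" for \<omega>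
    define U where "U r \<omega> = a \<omega> + \<Delta> \<omega> + exp (- (r * \<epsilon>)) * V r (x - a \<omega> + g \<omega> - \<Delta> \<omega>)" for r \<omega>
    have aF: "a \<in> borel_measurable (F t)"
    proof -
      note [measurable] = \<delta>F[OF order_refl]
      show ?thesis unfolding a_def[abs_def] by measurable
    qed
    have a: "0 \<le> a \<omega> \<and> a \<omega> \<le> x" for \<omega> using x by (auto simp: a_def)
    have \<Delta>M: "\<Delta> \<in> borel_measurable M"
    proof -
      have [measurable]: "\<delta> s \<in> borel_measurable M" if "t \<le> s" for s
        using measurable_F_M[OF _ \<delta>F[OF that]] t that by simp
      have [measurable]: "\<And>n. \<delta> (sq n) \<in> borel_measurable M" "\<delta> t \<in> borel_measurable M"
        using sq by auto
      show ?thesis unfolding \<Delta>_def[abs_def] by measurable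
    qed
    have \<Delta>: "0 \<le> \<Delta> \<omega> \<and> \<Delta> \<omega> \<le> K * \<epsilon>" for \<omega> using K \<epsilon> by (auto simp: \<Delta>_def)
    have lAE: "AE \<omega> in M. ((\<lambda>u. \<delta> u \<omega>) \<longlongrightarrow> a \<omega> + \<Delta> \<omega>) (at_left (t + \<epsilon>))"
      using \<delta>m \<delta>K
    proof eventually_elim
      case (elim \<omega>)
      obtain L where L: "((\<lambda>s. \<delta> s \<omega>) \<longlongrightarrow> L) (at_left T)" "\<And>s. s < T \<Longrightarrow> \<delta> s \<omega> \<le> L"
        "L \<le> \<delta> T \<omega>" using mono_left_limit[OF elim(1), of T] by blast
      have "lim (\<lambda>n. \<delta> (sq n) \<omega>) = L"
        by (rule limI) (rule filterlim_compose[OF L(1) sqlim])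
      moreover have "\<delta> t \<omega> \<le> L" using \<epsilon> by (intro L(2)) (simp add: T_def)
      moreover have "\<delta> T \<omega> - \<delta> t \<omega> \<le> K * \<epsilon>" unfolding T_def using elim(2) \<epsilon> by blast
      then have "L \<le> \<delta> t \<omega> + K * \<epsilon>" using L(3) by linarith
      ultimately have "a \<omega> + \<Delta> \<omega> = L" using elim(2) by (simp add: a_def \<Delta>_def)
      then show ?case using L(1) by (simp add: T_def)
    qed
    have E0: "0 \<le> (\<epsilon>\<^sup>2 + \<epsilon> * \<bar>y\<bar> + \<epsilon> * y\<^sup>2 + y ^ 4) * exp (C * \<bar>y\<bar>)" for y
      using \<epsilon> by (intro mult_nonneg_nonneg add_nonneg_nonneg) auto
    have Zg: "(\<epsilon>\<^sup>2 + \<epsilon> * \<bar>g \<omega>\<bar> + \<epsilon> * (g \<omega>)\<^sup>2 + g \<omega> ^ 4) * exp (C * \<bar>g \<omega>\<bar>) \<le> Z \<omega>" for \<omega>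
      using Z(3) by (simp add: g_def)
    have CZ: "integrable M (\<lambda>\<omega>. C * Z \<omega>)" "0 \<le> C * Z \<omega>" for \<omega>
      using Z(1) C order_trans[OF E0 Zg] by auto
    have est': "\<exists>c. (x < k \<longrightarrow> 0 \<le> c) \<and> (\<forall>r\<in>{rl..rh}.
        U r \<omega> - V r x - one_step_martingale x r \<epsilon> (x - a \<omega>) (g \<omega>) \<le> c * v 2 r k + C * Z \<omega>)" for \<omega>
    proof -
      obtain c where c: "x < k \<longrightarrow> 0 \<le> c" "\<forall>r\<in>{rl..rh}. U r \<omega> - V r x - one_step_martingale x r \<epsilon> (x - a \<omega>) (g \<omega>)
          \<le> c * v 2 r k + C * (\<epsilon>\<^sup>2 + \<epsilon> * \<bar>g \<omega>\<bar> + \<epsilon> * (g \<omega>)\<^sup>2 + g \<omega> ^ 4) * exp (C * \<bar>g \<omega>\<bar>)"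
        using est[OF \<epsilon>(1,3), of "a \<omega>" "\<Delta> \<omega>" "g \<omega>"] a \<Delta> unfolding U_def by blast
      have "C * (\<epsilon>\<^sup>2 + \<epsilon> * \<bar>g \<omega>\<bar> + \<epsilon> * (g \<omega>)\<^sup>2 + g \<omega> ^ 4) * exp (C * \<bar>g \<omega>\<bar>) \<le> C * Z \<omega>"
        using Zg[of \<omega>] C by (simp add: mult.assoc)
      then show ?thesis using c by (intro exI[of _ c]) fastforce
    qed
    note gain = deviation_gain_bound[OF t x \<epsilon>(1,2) K aF a \<Delta>M \<Delta>, folded g_def, folded U_def, OF est' CZ]
    let ?u = "\<lambda>r. expectation (U r)"
    let ?p = "\<lambda>r. enn2real (expected_payoff t x D r)"
    have payoff_le: "?p r \<le> ?u r" if r: "rl \<le> r" "r \<le> rh" for r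
    proof -
      have r0: "0 < r" using r rl_pos by linarith
      have U0: "0 \<le> U r \<omega>" for \<omega>
        using a[of \<omega>] \<Delta>[of \<omega>] V_nonneg[OF r0] by (simp add: U_def)
      have lM: "(\<lambda>\<omega>. a \<omega> + \<Delta> \<omega>) \<in> borel_measurable M"
        using measurable_F_M[OF t aF] \<Delta>M by measurable
      have "x + \<mu> * \<epsilon> + \<sigma> * (W (t + \<epsilon>) \<omega> - W t \<omega>) - (a \<omega> + \<Delta> \<omega>) = x - a \<omega> + g \<omega> - \<Delta> \<omega>" for \<omega>
        by (simp add: g_def)
      then have "expected_payoff t x D r \<le> (\<integral>\<^sup>+ \<omega>. ennreal (U r \<omega>) \<partial>M)"
        using perturbed_payoff_bound[OF t x \<epsilon>(1) r0 dp ps lM lAE] by (simp only: U_def)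
      also have "\<dots> = ennreal (?u r)" using gain(1)[OF r] U0 by (intro nn_integral_eq_integral) auto
      finally have "?p r \<le> enn2real (ennreal (?u r))" by (intro enn2real_mono) auto
      then show ?thesis using U0 by (simp add: integral_nonneg_AE)
    qed
    have concave: "- (weight x r * (?u r - V r x)) \<le> \<phi> (V r x) - \<phi> (?p r)" if r: "rl \<le> r" "r \<le> rh" for r
    proof -
      have "weight x r * (1 - \<alpha> * (?u r - V r x)) \<le> weight x r * exp (- \<alpha> * (?u r - V r x))"
        using exp_ge_add_one_self[of "- \<alpha> * (?u r - V r x)"] weight_bounds(1)[of x r] by (intro mult_left_mono) auto
      also have "\<dots> = exp (- \<alpha> * ?u r)" by (simp add: weight_def exp_add[symmetric] algebra_simps)
      also have "\<dots> \<le> exp (- \<alpha> * ?p r)" using payoff_le[OF r] alpha_pos by simp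
      finally have "1 / \<alpha> * (weight x r * (1 - \<alpha> * (?u r - V r x))) \<le> 1 / \<alpha> * exp (- \<alpha> * ?p r)"
        using alpha_pos by (intro mult_left_mono) auto
      moreover have "1 / \<alpha> * (weight x r * (1 - \<alpha> * (?u r - V r x))) = 1 / \<alpha> * weight x r - weight x r * (?u r - V r x)"
        using alpha_pos by (simp add: field_simps)
      ultimately show ?thesis by (simp add: weight_def)
    qed
    have Vint: "integrable R (\<lambda>r. \<phi> (V r x))"
      using V_nonneg rl_pos by (intro utility_integrable) auto
    have pint: "integrable R (\<lambda>r. \<phi> (?p r))" by (intro utility_integrable payoff_measurable) simp
    have "- C * (C' * (\<epsilon> * sqrt \<epsilon>)) \<le> - expectation (\<lambda>\<omega>. C * Z \<omega>)" using Z(2) C by simp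
    also have "\<dots> \<le> - (\<integral>r. weight x r * (?u r - V r x) \<partial>R)" using gain(4) by simp
    also have "\<dots> = (\<integral>r. - (weight x r * (?u r - V r x)) \<partial>R)" by simp
    also have "\<dots> \<le> (\<integral>r. \<phi> (V r x) - \<phi> (?p r) \<partial>R)"
    proof (rule integral_mono_AE)
      show "integrable R (\<lambda>r. - (weight x r * (?u r - V r x)))" using gain(3) by simp
      show "integrable R (\<lambda>r. \<phi> (V r x) - \<phi> (?p r))" by (rule Bochner_Integration.integrable_diff[OF Vint pint])
      show "AE r in R. - (weight x r * (?u r - V r x)) \<le> \<phi> (V r x) - \<phi> (?p r)"
        using rate_bounds by eventually_elim (rule concave; simp)
    qed
    also have "\<dots> = J t x (law_strategy t x {0<..<k} {k..}) - J t x D"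
      unfolding J_law[OF t x] J_eq[of t x D] by (rule Bochner_Integration.integral_diff[OF Vint pint])
    finally show "- (C * C') * (\<epsilon> * sqrt \<epsilon>) \<le> J t x (law_strategy t x {0<..<k} {k..}) - J t x D" by simp
  qed
qed

lemma barrier_law_equilibrium: "equilibrium_law {0<..<k} {k..}"
  unfolding equilibrium_law_def
proof (intro conjI allI impI)
  show "admissible_law {0<..<k} {k..}" by (rule barrier_law_admissible)
  fix t x \<delta> d D\<epsilon>
  assume t: "0 \<le> t" and x: "0 < x" and \<delta>: "perturbation t x \<delta>"
    and D: "\<forall>\<epsilon>>0. perturbed_strategy t x d {0<..<k} {k..} \<delta> \<epsilon> (D\<epsilon> \<epsilon>)"
  let ?q = "\<lambda>\<epsilon>. (J t x (law_strategy t x {0<..<k} {k..}) - J t x (D\<epsilon> \<epsilon>)) / \<epsilon>"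
  obtain C \<epsilon>0 where C: "0 < \<epsilon>0" and loss: "\<And>\<epsilon> d D. 0 < \<epsilon> \<Longrightarrow> \<epsilon> \<le> \<epsilon>0 \<Longrightarrow> perturbed_strategy t x d {0<..<k} {k..} \<delta> \<epsilon> D \<Longrightarrow>
      - C * (\<epsilon> * sqrt \<epsilon>) \<le> J t x (law_strategy t x {0<..<k} {k..}) - J t x D"
    using deviation_loss[OF t x \<delta>] by metis
  have ev: "- C * sqrt \<epsilon> \<le> ?q \<epsilon>" if "0 < \<epsilon>" "\<epsilon> < \<epsilon>0" for \<epsilon>
    using loss[of \<epsilon> d "D\<epsilon> \<epsilon>"] D that by (simp add: pos_le_divide_eq mult_ac)
  have "((\<lambda>\<epsilon>. - C * sqrt \<epsilon>) \<longlongrightarrow> - C * sqrt 0) (at_right 0)" by (intro tendsto_intros)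
  then have "((\<lambda>\<epsilon>. ereal (- C * sqrt \<epsilon>)) \<longlongrightarrow> 0) (at_right 0)" by (simp add: zero_ereal_def)
  then have "Liminf (at_right 0) (\<lambda>\<epsilon>. ereal (- C * sqrt \<epsilon>)) = 0" by (rule lim_imp_Liminf[rotated]) simp
  moreover have "Liminf (at_right 0) (\<lambda>\<epsilon>. ereal (- C * sqrt \<epsilon>)) \<le> Liminf (at_right 0) (\<lambda>\<epsilon>. ereal (?q \<epsilon>))"
  proof (rule Liminf_mono)
    show "\<forall>\<^sub>F \<epsilon> in at_right 0. ereal (- C * sqrt \<epsilon>) \<le> ereal (?q \<epsilon>)"
      unfolding eventually_at_right_field using ev C by (intro exI[of _ \<epsilon>0]) simp
  qed
  ultimately show "0 \<le> Liminf (at_right 0) (\<lambda>\<epsilon>. ereal (?q \<epsilon>))" by simp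
qed

end

theorem theorem5p13:
  fixes M :: "'a measure" and F :: "real \<Rightarrow> 'a measure" and W :: "real \<Rightarrow> 'a \<Rightarrow> real"
    and R :: "real measure" and \<mu> \<sigma> \<alpha> r_low r_high k :: real
  assumes "dividend_model M F W R"
    and "0 < \<mu>" and "0 < \<sigma>"
    and "0 < r_low" and "r_low \<le> r_high"
    and "measure_support R \<subseteq> {r_low..r_high}"
    and "0 < \<alpha>" and "\<alpha> < (\<mu> + sqrt (\<mu>\<^sup>2 + 2 * \<sigma>\<^sup>2 * r_low)) / \<sigma>\<^sup>2"
    and "0 < k" and "G_fun \<mu> \<sigma> \<alpha> R k = 0"
  shows "dividend_model.equilibrium_law M F W R \<mu> \<sigma> (\<lambda>y. - (1 / \<alpha>) * exp (- \<alpha> * y))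
           {0<..<k} {k..}"
proof -
  interpret dividend_model M F W R \<mu> \<sigma> "\<lambda>y. - (1 / \<alpha>) * exp (- \<alpha> * y)" by fact
  interpret barrier \<mu> \<sigma> k using assms by unfold_locales
  obtain B m where "barrier_bounds \<mu> \<sigma> k r_low r_high B m"
    using barrier_bounds_exist[OF assms(4,5)] by blast
  then interpret barrier_bounds \<mu> \<sigma> k r_low r_high B m .
  interpret entropic_barrier M F W R \<mu> \<sigma> k \<alpha> r_low r_high B m
    using assms(6,7,10) by unfold_locales
  show ?thesis by (rule barrier_law_equilibrium)
qed

end
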